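(* Let $n\ge1$. For any $\lambda>2n-1$, the $C^*$-algebra $\mathcal{T}^{(\lambda)}(L^\infty(\mathrm{D}^{\mathrm{I}}_{n\times n})^{\mathrm{U}(n)\times\mathrm{U}(n)})$ acting on $\mathcal{A}^2_\lambda(\mathrm{D}^{\mathrm{I}}_{n\times n})$ is commutative. Furthermore, every operator belonging to $\mathcal{T}^{(\lambda)}(L^\infty(\mathrm{D}^{\mathrm{I}}_{n\times n})^{\mathrm{U}(n)\times\mathrm{U}(n)})$ preserves the Hilbert direct sum $$\mathcal{A}^2_\lambda(\mathrm{D}^{\mathrm{I}}_{n\times n})=\bigoplus_{\mu\in P(n)}\mathcal{P}^\mu(M_{n\times n}(\mathbb{C}))$$ and acts by a constant multiple of the identity on each of its summands.
   Context: $\mathrm{D}^{\mathrm{I}}_{n\times n}=\{Z\in M_{n\times n}(\mathbb{C}): Z^*Z<I_n\}$. For $\lambda>2n-1$, $dv_\lambda(Z)=c_\lambda\det(I_n-ZZ^* )^{\lambda-2n}dv(Z)$, with $dv$ Lebesgue measure and $c_\lambda>0$ such that $v_\lambda(\mathrm{D}^{\mathrm{I}}_{n\times n})=1$. $\mathcal{A}^2_\lambda(\mathrm{D}^{\mathrm{I}}_{n\times n})$ is the weighted Bergman space of holomorphic functions in $L^2(\mathrm{D}^{\mathrm{I}}_{n\times n},v_\lambda)$, with orthogonal projection $B_\lambda$ from $L^2(\mathrm{D}^{\mathrm{I}}_{n\times n},v_\lambda)$. For $a\in L^\infty(\mathrm{D}^{\mathrm{I}}_{n\times n})$ (a symbol;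 functions equal a.e. are identified), $T^{(\lambda)}_a(f)=B_\lambda(af)$. For a set $\mathcal{S}$ of symbols, $\mathcal{T}^{(\lambda)}(\mathcal{S})$ is the unital Banach algebra (norm-closed algebra of operators on $\mathcal{A}^2_\lambda(\mathrm{D}^{\mathrm{I}}_{n\times n})$) generated by the $T^{(\lambda)}_a$, $a\in\mathcal{S}$. $L^\infty(\mathrm{D}^{\mathrm{I}}_{n\times n})^{\mathrm{U}(n)\times\mathrm{U}(n)}$ is the space of symbols with $a(A^{-1}ZB)=a(Z)$ for every $A,B\in\mathrm{U}(n)$; being conjugation invariant it yields a $C^*$-algebra. $P(n)$ is the set of $\mu=(m_1,\dots,m_n)\in\mathbb{Z}^n$ with $m_1\ge\dots\ge m_n\ge0$. $W^\mu$ is the irreducible rational $\mathrm{GL}(n,\mathbb{C})$-module with highest weight $\mu$, and $W^{\mu*}$ its dual. $\mathrm{GL}(n,\mathbb{C})\times\mathrm{GL}(n,\mathbb{C})$ acts on holomorphic polynomials on $M_{n\times n}(\mathbb{C})$ by $((A,B)\cdot p)(Z)=p(A^{-1}ZB)$, and $\mathcal{P}^\mu(M_{n\times n}(\mathbb{C}))$ is the unique submodule of the space of polynomials isomorphic to $W^{\mu*}\otimes W^\mu$ (first group factor acting on $W^{\mu*}$, second on $W^\mu$). *)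

theory Defs
  imports "HOL-Analysis.Analysis" "Jordan_Normal_Form.Matrix"
begin

hide_const (open) Matrix.mat Matrix.vec Matrix.row Matrix.col
hide_type (open) Matrix.vec
no_notation Matrix.vec_index (infixl "$" 100)

text \<open>
  Matrices over the index set \<open>{1,...,n}\<close> have type \<^typ>\<open>complex^'n^'n\<close>, with
  \<open>n = CARD('n)\<close>. The linear order on \<open>'n\<close> is used for dominant weights and for
  triangular matrices. The matrices of Jordan Normal Form (\<^typ>\<open>complex mat\<close>) are used for
  representation spaces, whose dimension has to be quantified over.
\<close>

section \<open>The domain, its measures and the Bergman space\<close>

definition conj_transpose :: "complex^'n^'m \<Rightarrow> complex^'m^'n" where
  "conj_transpose Z = (\<chi> i j. cnj (Z $ j $ i))"

definition positive_definite :: "complex^'n^'n \<Rightarrow> bool" where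
  "positive_definite A \<longleftrightarrow>
     (\<forall>v. v \<noteq> 0 \<longrightarrow>
        (\<Sum>i\<in>UNIV. cnj (v $ i) * (A *v v) $ i) \<in> \<real> \<and>
        0 < Re (\<Sum>i\<in>UNIV. cnj (v $ i) * (A *v v) $ i))"

definition cartan_domain :: "(complex^'n^'n) set" where
  "cartan_domain = {Z. positive_definite (mat 1 - conj_transpose Z ** Z)}"

definition unitary_group :: "(complex^'n^'n) set" where
  "unitary_group = {A. conj_transpose A ** A = mat 1}"

abbreviation domain_lebesgue :: "(complex^'n^'n) measure" where
  "domain_lebesgue \<equiv> restrict_space lborel cartan_domain"

text \<open>The determinant below is a positive real on the domain, so \<^const>\<open>Re\<close> loses nothing.\<close>

definition weight_density :: "real \<Rightarrow> complex^'n^'n \<Rightarrow> real" where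
  "weight_density lam Z =
     Re (det (mat 1 - Z ** conj_transpose Z)) powr (lam - 2 * real CARD('n))"

definition norm_const :: "'n::finite itself \<Rightarrow> real \<Rightarrow> real" where
  "norm_const _ lam =
     1 / (LINT Z|(domain_lebesgue :: (complex^'n^'n) measure). weight_density lam Z)"

definition bergman_measure :: "real \<Rightarrow> (complex^'n^'n) measure" where
  "bergman_measure lam =
     density domain_lebesgue (\<lambda>Z. ennreal (norm_const TYPE('n) lam * weight_density lam Z))"

text \<open>
  Elements of \<open>L\<^sup>2\<close> and \<open>L\<^sup>\<infinity>\<close> are represented by (Borel measurable) functions; only their
  values on the domain matter, and these only almost everywhere.
\<close>

definition L2_fun :: "real \<Rightarrow> (complex^'n^'n \<Rightarrow> complex) set" where
  "L2_fun lam = {f \<in> borel_measurable (bergman_measure lam).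
     integrable (bergman_measure lam) (\<lambda>Z. (cmod (f Z))\<^sup>2)}"

definition L2_inner :: "real \<Rightarrow> (complex^'n^'n \<Rightarrow> complex) \<Rightarrow> (complex^'n^'n \<Rightarrow> complex) \<Rightarrow> complex" where
  "L2_inner lam f g = (LINT Z|bergman_measure lam. f Z * cnj (g Z))"

definition L2_nrm :: "real \<Rightarrow> (complex^'n^'n \<Rightarrow> complex) \<Rightarrow> real" where
  "L2_nrm lam f = sqrt (LINT Z|bergman_measure lam. (cmod (f Z))\<^sup>2)"

text \<open>Several-variable holomorphy: complex Frechet differentiability (\<open>mat c ** W\<close> is \<open>c W\<close>).\<close>

definition mat_holomorphic_on :: "(complex^'n^'n \<Rightarrow> complex) \<Rightarrow> (complex^'n^'n) set \<Rightarrow> bool" where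
  "mat_holomorphic_on f S \<longleftrightarrow>
     (\<forall>Z\<in>S. \<exists>f'. (f has_derivative f') (at Z) \<and> (\<forall>c W. f' (mat c ** W) = c * f' W))"

text \<open>
  A holomorphic function on the domain is determined by its almost everywhere class; it is
  extended by 0 to all matrices, so that elements of the Bergman space are equal iff they are
  equal as functions.
\<close>

definition zero_ext :: "(complex^'n^'n \<Rightarrow> complex) \<Rightarrow> complex^'n^'n \<Rightarrow> complex" where
  "zero_ext f Z = (if Z \<in> cartan_domain then f Z else 0)"

definition bergman_space :: "real \<Rightarrow> (complex^'n^'n \<Rightarrow> complex) set" where
  "bergman_space lam =
     {f \<in> L2_fun lam. mat_holomorphic_on f cartan_domain \<and> (\<forall>Z. Z \<notin> cartan_domain \<longrightarrow> f Z = 0)}"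

definition bergman_proj ::
  "real \<Rightarrow> (complex^'n^'n \<Rightarrow> complex) \<Rightarrow> complex^'n^'n \<Rightarrow> complex" where
  "bergman_proj lam f =
     (THE g. g \<in> bergman_space lam \<and>
        (\<forall>h\<in>bergman_space lam. L2_inner lam (\<lambda>Z. f Z - g Z) h = 0))"

section \<open>Toeplitz operators and the algebras they generate\<close>

definition Linf_fun :: "(complex^'n^'n \<Rightarrow> complex) set" where
  "Linf_fun = {a \<in> borel_measurable domain_lebesgue.
     \<exists>C. AE Z in domain_lebesgue. cmod (a Z) \<le> C}"

text \<open>
  As symbols equal a.e. are identified, invariance means that for each \<open>A\<close> and \<open>B\<close> the two symbols
  \<open>Z \<mapsto> a (A\<^sup>-\<^sup>1 Z B)\<close> and \<open>a\<close> agree almost everywhere.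
\<close>

definition invariant_symbols :: "(complex^'n^'n \<Rightarrow> complex) set" where
  "invariant_symbols = {a \<in> Linf_fun.
     \<forall>A\<in>unitary_group. \<forall>B\<in>unitary_group.
       AE Z in domain_lebesgue. a (matrix_inv A ** Z ** B) = a Z}"

definition toeplitz :: "real \<Rightarrow> (complex^'n^'n \<Rightarrow> complex) \<Rightarrow>
    (complex^'n^'n \<Rightarrow> complex) \<Rightarrow> complex^'n^'n \<Rightarrow> complex" where
  "toeplitz lam a f = bergman_proj lam (\<lambda>Z. a Z * f Z)"

text \<open>
  An operator on the Bergman space is represented by any total function with the right
  restriction to the Bergman space; its values elsewhere are irrelevant. All sets of operators
  formed below are saturated under changing these values (take \<open>X\<close> and \<open>Y\<close> equal on the
  Bergman space in the last clause of \<open>closed_unital_algebra\<close>).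
\<close>

type_synonym 'n fun_op =
  "(complex^'n^'n \<Rightarrow> complex) \<Rightarrow> (complex^'n^'n \<Rightarrow> complex)"

definition bounded_op :: "real \<Rightarrow> 'n::finite fun_op \<Rightarrow> bool" where
  "bounded_op lam X \<longleftrightarrow>
     (\<forall>f\<in>bergman_space lam. X f \<in> bergman_space lam) \<and>
     (\<forall>f\<in>bergman_space lam. \<forall>g\<in>bergman_space lam. X (\<lambda>Z. f Z + g Z) = (\<lambda>Z. X f Z + X g Z)) \<and>
     (\<forall>c. \<forall>f\<in>bergman_space lam. X (\<lambda>Z. c * f Z) = (\<lambda>Z. c * X f Z)) \<and>
     (\<exists>C. \<forall>f\<in>bergman_space lam. L2_nrm lam (X f) \<le> C * L2_nrm lam f)"

definition closed_unital_algebra :: "real \<Rightarrow> 'n::finite fun_op set \<Rightarrow> bool" where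
  "closed_unital_algebra lam \<A> \<longleftrightarrow>
     (\<forall>X\<in>\<A>. bounded_op lam X) \<and>
     id \<in> \<A> \<and>
     (\<forall>X\<in>\<A>. \<forall>Y\<in>\<A>. (\<lambda>f Z. X f Z + Y f Z) \<in> \<A>) \<and>
     (\<forall>c. \<forall>X\<in>\<A>. (\<lambda>f Z. c * X f Z) \<in> \<A>) \<and>
     (\<forall>X\<in>\<A>. \<forall>Y\<in>\<A>. X \<circ> Y \<in> \<A>) \<and>
     (\<forall>X. bounded_op lam X \<and>
        (\<forall>e>0. \<exists>Y\<in>\<A>. \<forall>f\<in>bergman_space lam.
           L2_nrm lam (\<lambda>Z. X f Z - Y f Z) \<le> e * L2_nrm lam f) \<longrightarrow> X \<in> \<A>)"

definition toeplitz_algebra ::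
  "real \<Rightarrow> (complex^'n^'n \<Rightarrow> complex) set \<Rightarrow> 'n::finite fun_op set" where
  "toeplitz_algebra lam S = \<Inter> {\<A>. closed_unital_algebra lam \<A> \<and> toeplitz lam ` S \<subseteq> \<A>}"

section \<open>Polynomials and rational representations\<close>

inductive polynomial_fun :: "(complex^'n^'n \<Rightarrow> complex) \<Rightarrow> bool" where
  entry: "polynomial_fun (\<lambda>Z. Z $ i $ j)"
| const: "polynomial_fun (\<lambda>Z. c)"
| add: "polynomial_fun p \<Longrightarrow> polynomial_fun q \<Longrightarrow> polynomial_fun (\<lambda>Z. p Z + q Z)"
| mult: "polynomial_fun p \<Longrightarrow> polynomial_fun q \<Longrightarrow> polynomial_fun (\<lambda>Z. p Z * q Z)"

definition fun_subspace :: "('x \<Rightarrow> complex) set \<Rightarrow> bool" where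
  "fun_subspace S \<longleftrightarrow>
     (\<lambda>_. 0) \<in> S \<and>
     (\<forall>f\<in>S. \<forall>g\<in>S. (\<lambda>x. f x + g x) \<in> S) \<and>
     (\<forall>c. \<forall>f\<in>S. (\<lambda>x. c * f x) \<in> S)"

definition poly_act :: "complex^'n^'n \<Rightarrow> complex^'n^'n \<Rightarrow>
    (complex^'n^'n \<Rightarrow> complex) \<Rightarrow> complex^'n^'n \<Rightarrow> complex" where
  "poly_act A B p Z = p (matrix_inv A ** Z ** B)"

definition poly_submodule :: "(complex^'n^'n \<Rightarrow> complex) set \<Rightarrow> bool" where
  "poly_submodule S \<longleftrightarrow>
     S \<subseteq> Collect polynomial_fun \<and> fun_subspace S \<and>
     (\<forall>A B. invertible A \<and> invertible B \<longrightarrow> (\<forall>p\<in>S. poly_act A B p \<in> S))"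

text \<open>
  A rational representation of \<open>GL(n, \<complex>)\<close> on \<open>\<complex>\<^sup>d\<close>: the matrix entries are regular functions on the
  group, i.e. polynomials divided by powers of the determinant.
\<close>

definition rational_rep :: "nat \<Rightarrow> (complex^'n^'n \<Rightarrow> complex mat) \<Rightarrow> bool" where
  "rational_rep d \<rho> \<longleftrightarrow>
     (\<forall>A. invertible A \<longrightarrow> \<rho> A \<in> carrier_mat d d) \<and>
     \<rho> (mat 1) = 1\<^sub>m d \<and>
     (\<forall>A B. invertible A \<and> invertible B \<longrightarrow> \<rho> (A ** B) = \<rho> A * \<rho> B) \<and>
     (\<forall>i<d. \<forall>j<d. \<exists>p k. polynomial_fun p \<and>
        (\<forall>A. invertible A \<longrightarrow> \<rho> A $$ (i, j) = p A / det A ^ k))"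

definition irreducible_rep :: "nat \<Rightarrow> (complex^'n^'n \<Rightarrow> complex mat) \<Rightarrow> bool" where
  "irreducible_rep d \<rho> \<longleftrightarrow>
     d > 0 \<and>
     (\<forall>U. U \<subseteq> carrier_vec d \<and> 0\<^sub>v d \<in> U \<and>
          (\<forall>u\<in>U. \<forall>w\<in>U. u + w \<in> U) \<and> (\<forall>c. \<forall>u\<in>U. c \<cdot>\<^sub>v u \<in> U) \<and>
          (\<forall>A. invertible A \<longrightarrow> (\<forall>u\<in>U. \<rho> A *\<^sub>v u \<in> U))
        \<longrightarrow> U = {0\<^sub>v d} \<or> U = carrier_vec d)"

text \<open>
  A highest weight vector of weight \<open>\<mu>\<close> is a nonzero eigenvector of the Borel subgroup of upper
  triangular matrices with character \<open>A \<mapsto> \<Prod>i. A\<^sub>i\<^sub>i^\<mu>\<^sub>i\<close> (trivial on the unipotent radical).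
\<close>

definition has_highest_weight ::
  "nat \<Rightarrow> (complex^('n::{finite,linorder})^('n::{finite,linorder}) \<Rightarrow> complex mat) \<Rightarrow> int^('n::{finite,linorder}) \<Rightarrow> bool" where
  "has_highest_weight d \<rho> \<mu> \<longleftrightarrow>
     (\<exists>v\<in>carrier_vec d. v \<noteq> 0\<^sub>v d \<and>
        (\<forall>A. invertible A \<and> (\<forall>i j. j < i \<longrightarrow> A $ i $ j = 0) \<longrightarrow>
           \<rho> A *\<^sub>v v = (\<Prod>i\<in>UNIV. A $ i $ i powi \<mu> $ i) \<cdot>\<^sub>v v))"

definition dominant_weights :: "(int^('n::{finite,linorder})) set" where
  "dominant_weights = {\<mu>. (\<forall>i j. i \<le> j \<longrightarrow> \<mu> $ j \<le> \<mu> $ i) \<and> (\<forall>i. 0 \<le> \<mu> $ i)}"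

text \<open>
  For the representation \<open>\<rho>\<close> on \<open>W = \<complex>\<^sup>d\<close>, the dual \<open>W\<^sup>*\<close> is \<open>\<complex>\<^sup>d\<close> with \<open>A\<close> acting by the transpose
  of \<open>\<rho> (A\<^sup>-\<^sup>1)\<close>. The space \<open>W\<^sup>* \<otimes> W\<close> is identified with the \<open>d\<times>d\<close> matrices by sending
  \<open>\<xi> \<otimes> w\<close> to the product of the column \<open>\<xi>\<close> and the row \<open>w\<close>, so that \<open>(A, B)\<close> sends \<open>X\<close> to
  \<open>\<rho>\<^sup>*(A) X \<rho>(B)\<^sup>T\<close>.
\<close>

definition dual_rep :: "(complex^'n^'n \<Rightarrow> complex mat) \<Rightarrow> complex^'n^'n \<Rightarrow> complex mat" where
  "dual_rep \<rho> A = transpose_mat (\<rho> (matrix_inv A))"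

definition iso_dual_tensor ::
  "nat \<Rightarrow> (complex^'n^'n \<Rightarrow> complex mat) \<Rightarrow> (complex^'n^'n \<Rightarrow> complex) set \<Rightarrow> bool" where
  "iso_dual_tensor d \<rho> S \<longleftrightarrow>
     (\<exists>\<phi>. bij_betw \<phi> (carrier_mat d d) S \<and>
        (\<forall>X\<in>carrier_mat d d. \<forall>Y\<in>carrier_mat d d. \<phi> (X + Y) = (\<lambda>Z. \<phi> X Z + \<phi> Y Z)) \<and>
        (\<forall>c. \<forall>X\<in>carrier_mat d d. \<phi> (c \<cdot>\<^sub>m X) = (\<lambda>Z. c * \<phi> X Z)) \<and>
        (\<forall>A B. invertible A \<and> invertible B \<longrightarrow>
           (\<forall>X\<in>carrier_mat d d.
              \<phi> (dual_rep \<rho> A * X * transpose_mat (\<rho> B)) = poly_act A B (\<phi> X))))"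

definition poly_component ::
  "int^('n::{finite,linorder}) \<Rightarrow> (complex^('n::{finite,linorder})^('n::{finite,linorder}) \<Rightarrow> complex) set" where
  "poly_component \<mu> =
     (THE S. poly_submodule S \<and>
        (\<exists>d \<rho>. rational_rep d \<rho> \<and> irreducible_rep d \<rho> \<and> has_highest_weight d \<rho> \<mu> \<and>
               iso_dual_tensor d \<rho> S))"

definition bergman_component ::
  "int^('n::{finite,linorder}) \<Rightarrow> (complex^('n::{finite,linorder})^('n::{finite,linorder}) \<Rightarrow> complex) set" where
  "bergman_component \<mu> = zero_ext ` poly_component \<mu>"

section \<open>Hilbert direct sums in the Bergman space\<close>

text \<open>
  Closedness of the summands is not listed since it follows: the components in the other summands
  of an element of the closure of \<open>V \<mu>\<close> vanish by orthogonality.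
\<close>

definition hilbert_direct_sum ::
  "real \<Rightarrow> 'i set \<Rightarrow> ('i \<Rightarrow> (complex^'n^'n \<Rightarrow> complex) set) \<Rightarrow> bool" where
  "hilbert_direct_sum lam I V \<longleftrightarrow>
     (\<forall>\<mu>\<in>I. fun_subspace (V \<mu>) \<and> V \<mu> \<subseteq> bergman_space lam) \<and>
     (\<forall>\<mu>\<in>I. \<forall>\<nu>\<in>I. \<mu> \<noteq> \<nu> \<longrightarrow> (\<forall>f\<in>V \<mu>. \<forall>g\<in>V \<nu>. L2_inner lam f g = 0)) \<and>
     (\<forall>f\<in>bergman_space lam. \<exists>g. (\<forall>\<mu>\<in>I. g \<mu> \<in> V \<mu>) \<and>
        ((\<lambda>F. L2_nrm lam (\<lambda>Z. f Z - (\<Sum>\<mu>\<in>F. g \<mu> Z))) \<longlongrightarrow> 0) (finite_subsets_at_top I))"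

end

theory Submission
 imports Defs "HOL-Complex_Analysis.Complex_Analysis" "HOL-Library.Function_Algebras"
begin

text \<open>
  Toeplitz operators with bi-unitarily invariant symbols commute because the Bergman space is a
  multiplicity-free representation of \<open>U(n) \<times> U(n)\<close>. For an invariant symbol \<open>a\<close>, the sesquilinear form
  \<open>(p, q) \<mapsto> \<integral> a p cnj q\<close> on polynomials satisfies \<open>(p(A Z), q) = (p, q(A\<^sup>* Z))\<close> for unitary \<open>A\<close>.
  Both sides are polynomial in \<open>A\<close>, and unitary matrices are Zariski dense, so the identity holds
  for every matrix (\<open>form_left\<close>, \<open>form_right\<close>). It is then possible to move triangular matrices from one
  argument to the other: the form on the module generated by a highest weight polynomial
  \<open>\<Delta>\<close> is determined by the single number \<open>(\<Delta>, \<Delta>)\<close>, and modules of different weights are orthogonal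
  (\<open>form_bi_module\<close>, \<open>form_highest_weight_zero\<close>). Compared with the symbol 1 this says that the Toeplitz
  operator is a scalar on each module (\<open>toeplitz_component\<close>).

  On the algebraic side, the component of weight \<open>\<mu>\<close>, described abstractly as a copy of
  \<open>W\<^sup>* \<otimes> W\<close>, has to be identified with the span of the translates of \<open>\<Delta>\<close> (\<open>poly_component_eq\<close>). The
  representation \<open>W\<close> is the span of the right translates, and the matrix coefficients give the
  isomorphism. Uniqueness, and later density, rest on one fact: a nonzero bi-invariant space of
  polynomials contains a highest weight polynomial (\<open>biinvariant_subspace_contains_hw_poly\<close>).

  On the analytic side, the density is integrable up to the boundary exactly because the exponent
  exceeds \<open>-1\<close> (\<open>partial_gram_integrable\<close>), and the Bergman space is complete since point evaluations
  are bounded by the mean value property (\<open>bergman_complete\<close>). The homogeneous Taylor components of a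
  function in the space are polynomials (\<open>taylor_part_polynomial\<close>), and averaging over rotations
  shows that they inherit orthogonality to all components. Hence a function orthogonal to all components is zero
  (\<open>orthogonal_to_components_imp_zero\<close>), which gives the Hilbert direct sum.

  The bounded operators that are scalar on every component form a closed unital algebra
  (\<open>diagonal_ops_algebra\<close>). It is commutative by density and contains the generators, hence the Toeplitz
  algebra. Adjoints of generators are generators with conjugate symbols, and adjoints of a
  norm convergent sequence converge (\<open>adjoint_limit\<close>), so the algebra is self-adjoint.
\<close>

no_notation fps_nth (infixl "$" 75)

type_synonym 'n cmat = "complex^'n^'n"

lemmas cvec_eq_iff = Finite_Cartesian_Product.vec_eq_iff
lemmas caxis_def = Finite_Cartesian_Product.axis_def
lemmas cmat_def = Finite_Cartesian_Product.mat_def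

section \<open>Polynomial functions of a matrix\<close>

lemma polynomial_fun_cmult: "polynomial_fun p ==> polynomial_fun (%Z. c * p Z)"
 using polynomial_fun.mult[OF polynomial_fun.const] by blast

lemma polynomial_fun_uminus: "polynomial_fun p ==> polynomial_fun (%Z. - p Z)"
 using polynomial_fun_cmult[of p "-1"] by simp

lemma polynomial_fun_diff:
 "polynomial_fun p ==> polynomial_fun q ==> polynomial_fun (%Z. p Z - q Z)"
 using polynomial_fun.add[OF _ polynomial_fun_uminus] by fastforce

lemma polynomial_fun_sum:
 "(!!i. i : I ==> polynomial_fun (p i)) ==> polynomial_fun (%Z. \<Sum>i\<in>I. p i Z)"
 by (induction I rule: infinite_finite_induct)
  (auto intro: polynomial_fun.const polynomial_fun.add)

lemma polynomial_fun_prod: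
 "(!!i. i : I ==> polynomial_fun (p i)) ==> polynomial_fun (%Z. \<Prod>i\<in>I. p i Z)"
 by (induction I rule: infinite_finite_induct)
  (auto intro: polynomial_fun.const polynomial_fun.mult)

lemma polynomial_fun_power: "polynomial_fun p ==> polynomial_fun (%Z. p Z ^ k)"
 by (induction k) (auto intro: polynomial_fun.const polynomial_fun.mult)

lemma polynomial_fun_compose:
 assumes "polynomial_fun p" and M: "!!i j. polynomial_fun (%Z. M Z $ i $ j)"
 shows "polynomial_fun (%Z. p (M Z))"
 using assms(1) by induction (auto intro: M polynomial_fun.intros)

lemma polynomial_fun_det:
 fixes M :: "complex^'n^'n => complex^'n^'n"
 assumes "!!i j. polynomial_fun (%Z. M Z $ i $ j)"
 shows "polynomial_fun (%Z. det (M Z))"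
 unfolding det_def
 by (intro polynomial_fun_sum polynomial_fun_prod polynomial_fun.mult polynomial_fun.const assms)

lemma polynomial_fun_mult_left: "polynomial_fun (%Z. (A ** Z) $ i $ j)"
 by (simp add: matrix_matrix_mult_def)
  (intro polynomial_fun_sum polynomial_fun_cmult polynomial_fun.entry)

lemma polynomial_fun_mult_right: "polynomial_fun (%Z. (Z ** B) $ i $ j)"
 by (simp add: matrix_matrix_mult_def)
  (intro polynomial_fun_sum polynomial_fun.mult polynomial_fun.entry polynomial_fun.const)

lemma polynomial_fun_translate:
 fixes A B :: "complex^'n^'n"
 shows "polynomial_fun p ==> polynomial_fun (%Z. p (A ** Z ** B))"
proof -
 assume p: "polynomial_fun p"
 have "polynomial_fun (%Z. p (Z ** B))"
  by (rule polynomial_fun_compose[OF p polynomial_fun_mult_right])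
 from polynomial_fun_compose[OF this polynomial_fun_mult_left] show ?thesis .
qed

definition cpoly_fun :: "(complex => complex) => bool" where
 "cpoly_fun f \<longleftrightarrow> (EX Q. ALL s. f s = poly Q s)"

lemma cpoly_fun_const: "cpoly_fun (%s. c)"
 unfolding cpoly_fun_def by (rule exI[of _ "[:c:]"]) simp

lemma cpoly_fun_id: "cpoly_fun (%s. s)"
 unfolding cpoly_fun_def by (rule exI[of _ "[:0,1:]"]) simp

lemma cpoly_fun_add: "cpoly_fun f ==> cpoly_fun g ==> cpoly_fun (%s. f s + g s)"
 unfolding cpoly_fun_def by (metis poly_add)

lemma cpoly_fun_mult: "cpoly_fun f ==> cpoly_fun g ==> cpoly_fun (%s. f s * g s)"
 unfolding cpoly_fun_def by (metis poly_mult)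

lemma cpoly_fun_power: "cpoly_fun f ==> cpoly_fun (%s. f s ^ k)"
 unfolding cpoly_fun_def by (metis poly_power)

lemma cpoly_fun_sum: "(!!i. i : I ==> cpoly_fun (f i)) ==> cpoly_fun (%s. \<Sum>i\<in>I. f i s)"
 by (induction I rule: infinite_finite_induct) (auto intro: cpoly_fun_const cpoly_fun_add)

lemmas cpoly_intros = cpoly_fun_const cpoly_fun_id cpoly_fun_add cpoly_fun_mult cpoly_fun_power
 cpoly_fun_sum

lemma cpoly_fun_curve:
 assumes "polynomial_fun p" and M: "!!i j. cpoly_fun (%s. M s $ i $ j)"
 shows "cpoly_fun (%s. p (M s))"
 using assms(1) by induction (auto intro: M cpoly_intros)

lemma cpoly_fun_matmult:
 assumes "!!i j. cpoly_fun (%s. M s $ i $ j)" "!!i j. cpoly_fun (%s. N s $ i $ j)"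
 shows "cpoly_fun (%s. (M s ** N s) $ i $ j)"
 unfolding matrix_matrix_mult_def by (simp, intro cpoly_intros assms)

lemma cpoly_fun_eq:
 assumes "cpoly_fun f" "cpoly_fun g" "infinite {s. f s = g s}"
 shows "f = g"
proof -
 obtain P Q where P: "!!s. f s = poly P s" and Q: "!!s. g s = poly Q s"
  using assms(1,2) by (auto simp: cpoly_fun_def)
 have "{s. f s = g s} = {s. poly (P - Q) s = 0}" by (auto simp: P Q)
 then have "P - Q = 0" using assms(3) poly_roots_finite by metis
 then show ?thesis by (auto simp: P Q)
qed

lemma cpoly_fun_eq_0_cofinite:
 assumes "cpoly_fun f" "finite S" "!!s. s \<notin> S ==> f s = 0"
 shows "f s = 0"
proof -
 have "- S <= {s. f s = 0}" using assms(3) by auto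
 moreover have "infinite (- S)"
  using assms(2) by (simp add: finite_compl infinite_UNIV_char_0)
 ultimately have "infinite {s. f s = 0}" using finite_subset by blast
 from cpoly_fun_eq[OF assms(1) cpoly_fun_const this] show ?thesis by (simp add: fun_eq_iff)
qed

lemma cpoly_fun_mult_eq_0:
 assumes "cpoly_fun f" "cpoly_fun g" "!!s. f s * g s = 0" "g a ~= 0"
 shows "f s = 0"
proof -
 obtain P Q where P: "!!s. f s = poly P s" and Q: "!!s. g s = poly Q s"
  using assms(1,2) by (auto simp: cpoly_fun_def)
 have "poly (P * Q) s = 0" for s using assms(3) by (simp add: P Q)
 then have "P * Q = 0" using poly_all_0_iff_0 by blast
 moreover have "Q ~= 0" using assms(4) Q by auto
 ultimately show ?thesis by (simp add: P)
qed

lemma polynomial_fun_mult_eq_0: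
 assumes p: "polynomial_fun p" and q: "polynomial_fun q" and "!!Z. p Z * q Z = 0" "q A ~= 0"
 shows "p Z = 0"
proof -
 define M where "M s = (\<chi> i j. A $ i $ j + s * (Z $ i $ j - A $ i $ j))" for s
 have M: "cpoly_fun (%s. M s $ i $ j)" for i j
  unfolding M_def by (simp, intro cpoly_intros)
 have M0: "M 0 = A" and M1: "M 1 = Z" by (simp_all add: M_def cvec_eq_iff)
 from cpoly_fun_mult_eq_0[OF cpoly_fun_curve[OF p M] cpoly_fun_curve[OF q M], of 0 1]
 show ?thesis using assms(3,4) by (simp add: M0 M1)
qed

lemma polynomial_fun_0_on_invertible:
 fixes p :: "complex^'n^'n => complex"
 assumes "polynomial_fun p" "!!A. invertible A ==> p A = 0"
 shows "p Z = 0"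
proof (rule polynomial_fun_mult_eq_0[OF assms(1), of det "mat 1"])
 show "polynomial_fun (det :: complex^'n^'n => complex)"
  using polynomial_fun_det[of "%Z. Z"] polynomial_fun.entry by auto
 show "p A * det A = 0" for A
  using assms(2)[of A] by (cases "det A = 0") (auto simp: invertible_det_nz)
qed simp

text \<open>
  Every matrix is \<open>X + \<i> Y\<close> with \<open>X\<close> and \<open>Y\<close> skew-Hermitian, and a polynomial in one variable that
  vanishes at all real parameters also vanishes at \<open>\<i>\<close>.
\<close>

lemma polynomial_fun_0_on_skew_hermitian:
 assumes p: "polynomial_fun p" and 0: "!!K. conj_transpose K = - K ==> p K = 0"
 shows "p Z = 0"
proof -
 define X where "X = (\<chi> i j. (Z $ i $ j - cnj (Z $ j $ i)) / 2)"
 define Y where "Y = (\<chi> i j. (Z $ i $ j + cnj (Z $ j $ i)) / (2 * \<i>))"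
 define M where "M s = (\<chi> i j. X $ i $ j + s * Y $ i $ j)" for s
 have M: "cpoly_fun (%s. M s $ i $ j)" for i j
  unfolding M_def by (simp, intro cpoly_intros)
 have "p (M (of_real t)) = 0" for t
  by (rule 0) (simp add: M_def X_def Y_def conj_transpose_def cvec_eq_iff field_simps)
 then have "range of_real <= {s. p (M s) = 0}" by auto
 moreover have "infinite (range (of_real :: real => complex))"
  using finite_imageD[OF _ inj_of_real] infinite_UNIV_char_0 by blast
 ultimately have "infinite {s. p (M s) = 0}" using finite_subset by blast
 from cpoly_fun_eq[OF cpoly_fun_curve[OF p M] cpoly_fun_const this]
 have "p (M \<i>) = 0" by (simp add: fun_eq_iff)
 moreover have "M \<i> = Z" by (simp add: M_def X_def Y_def cvec_eq_iff field_simps)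
 ultimately show ?thesis by simp
qed

lemma conj_transpose_mult: "conj_transpose (A ** B) = conj_transpose B ** conj_transpose A"
 by (simp add: conj_transpose_def matrix_matrix_mult_def cvec_eq_iff mult.commute)

lemma conj_transpose_conj_transpose [simp]: "conj_transpose (conj_transpose A) = A"
 by (simp add: conj_transpose_def cvec_eq_iff)

lemma conj_transpose_one [simp]: "conj_transpose (mat 1) = mat 1"
 by (auto simp: conj_transpose_def cmat_def cvec_eq_iff)

lemma conj_transpose_diff: "conj_transpose (A - B) = conj_transpose A - conj_transpose B"
 by (simp add: conj_transpose_def cvec_eq_iff)

lemma conj_transpose_add: "conj_transpose (A + B) = conj_transpose A + conj_transpose B"
 by (simp add: conj_transpose_def cvec_eq_iff)

lemma matrix_sub_ldistrib: "(A::complex^'n^'m) ** (B - C) = A ** B - A ** C"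
 by (simp add: cvec_eq_iff matrix_matrix_mult_def algebra_simps sum_subtractf)

lemma matrix_sub_rdistrib: "(B - C) ** (A::complex^'n^'m) = B ** A - C ** A"
 by (simp add: cvec_eq_iff matrix_matrix_mult_def algebra_simps sum_subtractf)

lemma matrix_add_rdistr: "(B + C) ** (A::complex^'n^'m) = B ** A + C ** A"
 by (simp add: cvec_eq_iff matrix_matrix_mult_def algebra_simps sum.distrib)

lemma det_conj_transpose: "det (conj_transpose A) = cnj (det A)"
proof -
 have "det (conj_transpose A) = det (transpose (\<chi> i j. cnj (A $ i $ j)))"
  by (simp add: conj_transpose_def transpose_def)
 also have "... = cnj (det A)"
  by (simp add: det_transpose) (simp add: det_def)
 finally show ?thesis .
qed

lemma invertible_conj_transpose:
 fixes A :: "complex^'n^'n"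
 shows "invertible A ==> invertible (conj_transpose A)"
 by (simp add: invertible_det_nz det_conj_transpose)

text \<open>
  The two conjugations cancel, so adjoints do not leave the class of polynomial functions.
\<close>

lemma cnj_polynomial_fun_conj_transpose:
 "polynomial_fun p ==> polynomial_fun (%Z. cnj (p (conj_transpose Z)))"
proof (induction rule: polynomial_fun.induct)
 case (entry i j)
 show ?case by (simp add: conj_transpose_def) (rule polynomial_fun.entry)
qed (auto intro: polynomial_fun.intros)

lemma matrix_inv_left: "invertible A ==> matrix_inv A ** A = mat 1"
 and matrix_inv_right: "invertible A ==> A ** matrix_inv A = mat 1"
proof -
 assume "invertible A"
 then have "A ** matrix_inv A = mat 1 & matrix_inv A ** A = mat 1"
  unfolding invertible_def matrix_inv_def by (rule someI_ex)
 then show "matrix_inv A ** A = mat 1" "A ** matrix_inv A = mat 1" by auto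
qed

lemma invertible_iff_kernel:
 fixes A :: "complex^'n^'n"
 shows "invertible A \<longleftrightarrow> (ALL v. A *v v = 0 --> v = 0)"
 using matrix_left_invertible_ker[of A] invertible_left_inverse[of A] by auto

lemma matrix_inv_cramer:
 fixes A :: "complex^'n^'n"
 assumes "invertible A"
 shows "matrix_inv A $ i $ j =
  det (\<chi> k l. if l = i then (if k = j then 1 else 0) else A $ k $ l) / det A"
proof -
 have A: "A ** matrix_inv A = mat 1" using assms by (rule matrix_inv_right)
 define x where "x = (\<chi> i. matrix_inv A $ i $ j)"
 have "A *v x = axis j 1"
  using A by (simp add: cvec_eq_iff matrix_vector_mult_def matrix_matrix_mult_def x_def cmat_def caxis_def)
 moreover have "det A ~= 0" using assms by (simp add: invertible_det_nz)
 ultimately have "x = (\<chi> k. det (\<chi> i j'. if j' = k then axis j 1 $ i else A $ i $ j') / det A)"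
  using cramer by blast
 then have "x $ i = det (\<chi> i' j'. if j' = i then axis j 1 $ i' else A $ i' $ j') / det A"
  by simp
 then show ?thesis by (simp add: x_def caxis_def cong: if_cong)
qed

text \<open>
  The Cayley transform parametrises unitary matrices by skew-Hermitian ones; its denominator
  can be cleared. This is the unitarian trick: polynomial identities in the group element
  pass from the unitary group to all matrices.
\<close>

lemma polynomial_fun_0_on_unitary:
 fixes p :: "complex^'n^'n => complex"
 assumes p: "polynomial_fun p" and 0: "!!A. A : unitary_group ==> p A = 0"
 shows "p Z = 0"
proof -
 let ?d = "%K::complex^'n^'n. det (mat 1 + K)"
 let ?C = "%K::complex^'n^'n. (mat 1 - K) ** matrix_inv (mat 1 + K)"
 have poly_1pK: "polynomial_fun (%K::complex^'n^'n. (mat 1 + K) $ i $ j)" for i j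
  by (simp, intro polynomial_fun.intros)
 have poly_1mK: "polynomial_fun (%K::complex^'n^'n. (mat 1 - K) $ i $ j)" for i j
  by (simp, intro polynomial_fun_diff polynomial_fun.intros)
 have poly_d: "polynomial_fun ?d" by (intro polynomial_fun_det poly_1pK)
 have inv_iff: "invertible (mat 1 + K) \<longleftrightarrow> ?d K ~= 0" for K :: "complex^'n^'n"
  by (simp add: invertible_det_nz)
 have rat: "EX m q. polynomial_fun q & (ALL K. ?d K ~= 0 --> p (?C K) * ?d K ^ m = q K)"
  if "polynomial_fun p" for p
  using that
 proof (induction rule: polynomial_fun.induct)
  case (entry i j)
  let ?q = "%K::complex^'n^'n. \<Sum>k\<in>UNIV. (mat 1 - K) $ i $ k *
    det (\<chi> k' l. if l = k then (if k' = j then 1 else 0) else (mat 1 + K) $ k' $ l)"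
  have "polynomial_fun ?q"
  proof (intro polynomial_fun_sum polynomial_fun.mult poly_1mK polynomial_fun_det)
   fix k i' j'
   show "polynomial_fun (%Z. (\<chi> k' l. if l = k then if k' = j then 1 else 0 else (mat 1 + Z) $ k' $ l) $ i' $ j')"
    using poly_1pK[of i' j'] by (cases "j' = k") (auto intro: polynomial_fun.const)
  qed
  moreover have "?C K $ i $ j * ?d K ^ 1 = ?q K" if "?d K ~= 0" for K
   using that
   by (simp add: matrix_matrix_mult_def matrix_inv_cramer[OF inv_iff[THEN iffD2, OF that]]
     sum_distrib_right)
  ultimately show ?case by blast
 next
  case (const c)
  show ?case by (intro exI[of _ 0] exI[of _ "%_. c"]) (simp add: polynomial_fun.const)
 next
  case (add p1 p2)
  then obtain m1 q1 m2 q2 where q: "polynomial_fun q1" "polynomial_fun q2"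
   and e: "!!K. ?d K ~= 0 ==> p1 (?C K) * ?d K ^ m1 = q1 K"
    "!!K. ?d K ~= 0 ==> p2 (?C K) * ?d K ^ m2 = q2 K" by metis
  have "(p1 (?C K) + p2 (?C K)) * ?d K ^ (m1 + m2) = q1 K * ?d K ^ m2 + q2 K * ?d K ^ m1"
   if "?d K ~= 0" for K
   using e[OF that, symmetric] by (simp add: algebra_simps power_add)
  moreover have "polynomial_fun (%K. q1 K * ?d K ^ m2 + q2 K * ?d K ^ m1)"
   by (intro polynomial_fun.intros q polynomial_fun_power poly_d)
  ultimately show ?case by blast
 next
  case (mult p1 p2)
  then obtain m1 q1 m2 q2 where q: "polynomial_fun q1" "polynomial_fun q2"
   and e: "!!K. ?d K ~= 0 ==> p1 (?C K) * ?d K ^ m1 = q1 K"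
    "!!K. ?d K ~= 0 ==> p2 (?C K) * ?d K ^ m2 = q2 K" by metis
  have "(p1 (?C K) * p2 (?C K)) * ?d K ^ (m1 + m2) = q1 K * q2 K"
   if "?d K ~= 0" for K
   using e[OF that, symmetric] by (simp add: algebra_simps power_add)
  moreover have "polynomial_fun (%K. q1 K * q2 K)" by (intro polynomial_fun.intros q)
  ultimately show ?case by blast
 qed
 from rat[OF p] obtain m q where q: "polynomial_fun q"
  and pq: "!!K. ?d K ~= 0 ==> p (?C K) * ?d K ^ m = q K" by blast
 have "q K = 0" if K: "conj_transpose K = - K" for K
 proof -
  have nz: "?d K ~= 0"
  proof
   assume "?d K = 0"
   then obtain v where v: "v ~= 0" "(mat 1 + K) *v v = 0"
    using inv_iff[of K] invertible_iff_kernel by auto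
   have Kv: "K *v v = - v"
    using v(2) by (simp add: matrix_vector_mult_add_rdistrib add_eq_0_iff)
   define N where "N = (\<Sum>i\<in>UNIV. cnj (v $ i) * v $ i)"
   have "cnj (K $ i $ j) = - K $ j $ i" for i j
    using K by (simp add: conj_transpose_def cvec_eq_iff)
   then have "(\<Sum>i\<in>UNIV. cnj ((K *v v) $ i) * v $ i) = - (\<Sum>i\<in>UNIV. cnj (v $ i) * (K *v v) $ i)"
    apply (simp add: matrix_vector_mult_def sum_distrib_left sum_distrib_right sum_negf)
    apply (subst sum.swap)
    apply (simp add: algebra_simps)
    done
   then have "N = 0" by (simp add: Kv N_def sum_negf)
   moreover have "N = of_real (\<Sum>i\<in>UNIV. (cmod (v $ i))^2)"
    by (simp add: N_def complex_norm_square of_real_sum mult.commute del: of_real_power)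
   ultimately have "(\<Sum>i\<in>UNIV. (cmod (v $ i))^2) = 0" by (metis of_real_eq_0_iff)
   then have "ALL i. v $ i = 0" by (subst (asm) sum_nonneg_eq_0_iff) auto
   with v(1) show False by (simp add: cvec_eq_iff)
  qed
  let ?I = "matrix_inv (mat 1 + K)"
  have I: "?I ** (mat 1 + K) = mat 1" "(mat 1 + K) ** ?I = mat 1"
   using nz inv_iff matrix_inv_left matrix_inv_right by blast+
  have cI: "conj_transpose ?I ** (mat 1 - K) = mat 1"
   using arg_cong[OF I(2), of conj_transpose]
   by (simp add: conj_transpose_mult conj_transpose_add K)
  have comm: "(mat 1 + K) ** (mat 1 - K) = (mat 1 - K) ** (mat 1 + K)"
   by (simp add: matrix_add_ldistrib matrix_add_rdistr matrix_sub_ldistrib matrix_sub_rdistrib)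
  have "conj_transpose (?C K) ** ?C K
    = conj_transpose ?I ** ((mat 1 + K) ** (mat 1 - K)) ** ?I"
   by (simp add: conj_transpose_mult conj_transpose_diff K matrix_mul_assoc)
  also have "... = (conj_transpose ?I ** (mat 1 - K)) ** ((mat 1 + K) ** ?I)"
   by (simp add: comm matrix_mul_assoc)
  also have "... = mat 1" by (simp add: cI I)
  finally have "?C K : unitary_group" by (simp add: unitary_group_def)
  from 0[OF this] pq[OF nz] show ?thesis by simp
 qed
 then have q0: "q K = 0" for K by (rule polynomial_fun_0_on_skew_hermitian[OF q])
 have "p A = 0" if nz: "?d A ~= 0" for A
 proof -
  let ?I = "matrix_inv (mat 1 + A)"
  have I: "?I ** (mat 1 + A) = mat 1" "(mat 1 + A) ** ?I = mat 1"
   using nz inv_iff matrix_inv_left matrix_inv_right by blast+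
  let ?K = "?C A"
  have "mat 1 + ?K = (mat 1 + A) ** ?I + (mat 1 - A) ** ?I" by (simp add: I)
  also have "... = ((mat 1 + A) + (mat 1 - A)) ** ?I" by (rule matrix_add_rdistr[symmetric])
  also have "(mat 1 + A) + (mat 1 - A) = mat 1 + mat 1" by simp
  also have "(mat 1 + mat 1) ** ?I = ?I + ?I" by (simp only: matrix_add_rdistr matrix_mul_lid)
  finally have plus: "mat 1 + ?K = ?I + ?I" .
  have "mat 1 - ?K = (mat 1 + A) ** ?I - (mat 1 - A) ** ?I" by (simp add: I)
  also have "... = ((mat 1 + A) - (mat 1 - A)) ** ?I" by (rule matrix_sub_rdistrib[symmetric])
  also have "(mat 1 + A) - (mat 1 - A) = A + A" by simp
  also have "(A + A) ** ?I = A ** (mat 1 + ?K)"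
   by (simp only: plus matrix_add_ldistrib matrix_add_rdistr)
  finally have minus: "mat 1 - ?K = A ** (mat 1 + ?K)" .
  have inv: "invertible (mat 1 + ?K)"
   unfolding invertible_iff_kernel
  proof (intro allI impI)
   fix v assume "(mat 1 + ?K) *v v = 0"
   then have "?I *v v + ?I *v v = 0"
    by (simp only: plus matrix_vector_mult_add_rdistrib)
   then have "(2::real) *\<^sub>R (?I *v v) = 0" by (simp only: scaleR_2)
   then have "(mat 1 + A) *v (?I *v v) = 0" by simp
   then show "v = 0" by (simp add: matrix_vector_mul_assoc I)
  qed
  have "?C ?K = A ** ((mat 1 + ?K) ** matrix_inv (mat 1 + ?K))"
   by (simp add: minus matrix_mul_assoc)
  then have "?C ?K = A" by (simp add: matrix_inv_right[OF inv])
  with pq[of ?K] q0[of ?K] inv show ?thesis by (simp add: inv_iff)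
 qed
 then have "p A * ?d A = 0" for A by (cases "?d A = 0") auto
 from polynomial_fun_mult_eq_0[OF p poly_d this, of 0] show ?thesis by simp
qed

section \<open>Polynomials in a product of matrices\<close>

text \<open>
  Finite sums of products of a polynomial in the first and one in the second matrix.
\<close>

inductive separable :: "(complex^'n^'n => complex^'n^'n => complex) => bool" where
 base: "polynomial_fun a ==> polynomial_fun r ==> separable (%A Z. a A * r Z)"
| sum: "separable F ==> separable G ==> separable (%A Z. F A Z + G A Z)"

lemma separable_mult_base:
 "separable F ==> polynomial_fun a ==> polynomial_fun r ==> separable (%A Z. F A Z * (a A * r Z))"
proof (induction rule: separable.induct)
 case (base a' r')
 then have "separable (%A Z. (a' A * a A) * (r' Z * r Z))"
  by (intro separable.base polynomial_fun.mult)
 then show ?case by (simp add: mult_ac)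
next
 case (sum F G)
 then show ?case using separable.sum by (simp add: distrib_right)
qed

lemma separable_mult: "separable G ==> separable F ==> separable (%A Z. F A Z * G A Z)"
proof (induction G rule: separable.induct)
 case (base a r)
 then show ?case using separable_mult_base by blast
next
 case (sum F' G')
 then show ?case using separable.sum by (simp add: distrib_left)
qed

lemma separable_const: "separable (%A Z. c)"
 using separable.base[OF polynomial_fun.const[of c] polynomial_fun.const[of 1]] by simp

lemma separable_sum: "(!!i. i : I ==> separable (F i)) ==> separable (%A Z. \<Sum>i\<in>I. F i A Z)"
 by (induction I rule: infinite_finite_induct) (auto intro: separable_const separable.sum)

lemma separable_mult_left:
 fixes p :: "complex^'n^'n => complex"
 shows "polynomial_fun p ==> separable (%A Z. p (A ** Z))"
proof (induction rule: polynomial_fun.induct)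
 case (entry i j)
 show ?case
  by (simp add: matrix_matrix_mult_def) (intro separable_sum separable.base polynomial_fun.entry)
qed (auto intro: separable_const separable_mult separable.sum)

lemma separable_mult_right:
 fixes p :: "complex^'n^'n => complex"
 shows "polynomial_fun p ==> separable (%B Z. p (Z ** B))"
proof (induction rule: polynomial_fun.induct)
 case (entry i j)
 show ?case
  by (simp add: matrix_matrix_mult_def mult.commute[of "_ $ i $ _"])
   (intro separable_sum separable.base polynomial_fun.entry)
qed (auto intro: separable_const separable_mult separable.sum)

lemma separable_sections_polynomial: "separable F ==> polynomial_fun (F A)"
 by (induction rule: separable.induct)
  (auto intro: polynomial_fun.add polynomial_fun_cmult)

text \<open>
  A functional sends a sum of products \<open>a\<^sub>j(A) r\<^sub>j(Z)\<close> to \<open>\<Sum> a\<^sub>j(A) \<Phi>(r\<^sub>j)\<close>. So pairings of translates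
  are polynomial in the translating matrix.
\<close>

lemma separable_functional:
 assumes "separable F"
  and add: "!!p q. polynomial_fun p ==> polynomial_fun q ==> \<Phi> (%Z. p Z + q Z) = \<Phi> p + \<Phi> q"
  and scale: "!!c p. polynomial_fun p ==> \<Phi> (%Z. c * p Z) = c * \<Phi> p"
 shows "polynomial_fun (%A. \<Phi> (F A))"
 using assms(1)
proof (induction rule: separable.induct)
 case (base a r)
 then show ?case
  by (simp add: scale) (intro polynomial_fun.mult polynomial_fun.const)
next
 case (sum F G)
 then show ?case
  by (simp add: add separable_sections_polynomial) (intro polynomial_fun.add)
qed

section \<open>Triangular matrices\<close>

definition upper_tri :: "('n::{finite,linorder}) cmat => bool" where
 "upper_tri A \<longleftrightarrow> (ALL i j. j < i --> A $ i $ j = 0)"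

definition lower_tri :: "('n::{finite,linorder}) cmat => bool" where
 "lower_tri A \<longleftrightarrow> (ALL i j. i < j --> A $ i $ j = 0)"

definition dmat :: "('n => complex) => complex^'n^'n" where
 "dmat d = (\<chi> i j. if i = j then d i else 0)"

lemma permutation_increasing_id:
 fixes p :: "'n::{finite,linorder} => 'n"
 assumes "inj p" "!!i. i <= p i"
 shows "p = id"
proof (rule ccontr)
 assume "p ~= id"
 then have ne: "{i. p i ~= i} ~= {}" by (auto simp: fun_eq_iff)
 define i where "i = Max {i. p i ~= i}"
 have i: "p i ~= i" using Max_in[OF _ ne] by (simp add: i_def)
 then have "i < p i" using assms(2)[of i] by simp
 then have "p (p i) = p i"
  using Max_ge[of "{i. p i ~= i}" "p i"] by (fastforce simp: i_def)
 then show False using assms(1) i by (auto dest: injD)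
qed

lemma det_upper_tri:
 fixes A :: "('n::{finite,linorder}) cmat"
 assumes "upper_tri A"
 shows "det A = (\<Prod>i\<in>UNIV. A $ i $ i)"
proof -
 have "det A = (\<Sum>p\<in>{id}. of_int (sign p) * (\<Prod>i\<in>UNIV. A $ i $ p i))"
  unfolding det_def
 proof (rule sum.mono_neutral_right)
  show "ALL p:{p. p permutes UNIV} - {id}. of_int (sign p) * (\<Prod>i\<in>UNIV. A $ i $ p i) = 0"
  proof
   fix p :: "'n => 'n"
   assume "p : {p. p permutes UNIV} - {id}"
   then have "inj p" "p ~= id" by (auto simp: permutes_inj)
   then obtain i where "p i < i" using permutation_increasing_id not_le by metis
   then have "(\<Prod>i\<in>UNIV. A $ i $ p i) = 0"
    using assms by (intro prod_zero) (auto simp: upper_tri_def)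
   then show "of_int (sign p) * (\<Prod>i\<in>UNIV. A $ i $ p i) = 0" by simp
  qed
 qed (auto simp: permutes_id)
 then show ?thesis by (simp add: sign_id)
qed

lemma lower_tri_transpose: "lower_tri (transpose A) \<longleftrightarrow> upper_tri A"
 by (auto simp: lower_tri_def upper_tri_def transpose_def)

lemma upper_tri_transpose: "upper_tri (transpose A) \<longleftrightarrow> lower_tri A"
 by (auto simp: lower_tri_def upper_tri_def transpose_def)

lemma det_lower_tri: "lower_tri A ==> det A = (\<Prod>i\<in>UNIV. A $ i $ i)"
 using det_upper_tri[of "transpose A"] by (simp add: upper_tri_transpose det_transpose) (simp add: transpose_def)

lemma invertible_upper_tri: "upper_tri A ==> invertible A \<longleftrightarrow> (ALL i. A $ i $ i ~= 0)"
 by (simp add: invertible_det_nz det_upper_tri)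

lemma lower_tri_mult:
 assumes "lower_tri A" "lower_tri B"
 shows "lower_tri (A ** B)" "(A ** B) $ i $ i = A $ i $ i * B $ i $ i"
proof -
 show "lower_tri (A ** B)"
  unfolding lower_tri_def
 proof (intro allI impI)
  fix i j :: 'a assume "i < j"
  then have "A $ i $ k * B $ k $ j = 0" for k
   using assms by (cases "i < k") (auto simp: lower_tri_def)
  then show "(A ** B) $ i $ j = 0"
   by (simp only: matrix_matrix_mult_def vec_lambda_beta sum.neutral_const)
 qed
 have "(A ** B) $ i $ i = (\<Sum>k\<in>UNIV. A $ i $ k * B $ k $ i)"
  by (simp add: matrix_matrix_mult_def)
 also have "... = (\<Sum>k\<in>{i}. A $ i $ k * B $ k $ i)"
 proof (rule sum.mono_neutral_right; clarsimp)
  fix k assume "k ~= i" "B $ k $ i ~= 0"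
  then have "i < k" using assms(2) by (metis lower_tri_def neqE)
  then show "A $ i $ k = 0" using assms(1) by (simp add: lower_tri_def)
 qed
 finally show "(A ** B) $ i $ i = A $ i $ i * B $ i $ i" by simp
qed

lemma upper_tri_mult:
 assumes "upper_tri A" "upper_tri B"
 shows "upper_tri (A ** B)" "(A ** B) $ i $ i = A $ i $ i * B $ i $ i"
proof -
 have "lower_tri (transpose B ** transpose A)"
  using assms by (intro lower_tri_mult) (auto simp: lower_tri_transpose)
 then show "upper_tri (A ** B)" by (metis matrix_transpose_mul lower_tri_transpose)
 have "(transpose B ** transpose A) $ i $ i = transpose B $ i $ i * transpose A $ i $ i"
  using assms by (intro lower_tri_mult(2)) (auto simp: lower_tri_transpose)
 then show "(A ** B) $ i $ i = A $ i $ i * B $ i $ i"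
  by (simp add: matrix_transpose_mul[symmetric]) (simp add: transpose_def mult.commute)
qed

lemma lower_tri_one: "lower_tri (mat 1)" and upper_tri_one: "upper_tri (mat 1)"
 by (auto simp: lower_tri_def upper_tri_def cmat_def)

lemma polynomial_fun_0_on_LU_partial:
 fixes p :: "('n::{finite,linorder}) cmat => complex"
 assumes p: "polynomial_fun p"
  and "!!L U. lower_tri L ==> (ALL i. L $ i $ i = 1) ==>
   (ALL k:J. U $ k $ k ~= 0 & (ALL i>k. U $ i $ k = 0)) ==> p (L ** U) = 0"
 shows "p Z = 0"
proof -
 have "finite J" by simp
 then show ?thesis using assms(2)
 proof (induction J rule: finite_linorder_max_induct)
  case empty
  from empty[of "mat 1" Z] show ?case by (simp add: lower_tri_one) (simp add: cmat_def)
 next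
  case (insert b J)
  show ?case
  proof (rule insert.IH)
   fix L Y :: "'n cmat"
   assume L: "lower_tri L" "ALL i. L $ i $ i = 1"
    and Y: "ALL k:J. Y $ k $ k ~= 0 & (ALL i>k. Y $ i $ k = 0)"
   define Ys where "Ys s = (\<chi> i k. Y $ i $ k + (if i = b & k = b then s else 0))" for s
   have poly: "cpoly_fun (%s. p (L ** Ys s))"
   proof (intro cpoly_fun_curve[OF p] cpoly_fun_matmult cpoly_intros)
    show "cpoly_fun (%s. Ys s $ i $ j)" for i j
     by (cases "i = b & j = b") (auto simp: Ys_def intro!: cpoly_intros)
   qed
   have "p (L ** Ys s) = 0" if s: "s \<notin> {- Y $ b $ b}" for s
   proof -
    let ?Y = "Ys s"
    have nz: "?Y $ b $ b ~= 0" using s by (auto simp: Ys_def add_eq_0_iff)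
    define M where "M = (\<chi> i k. if i = k then 1 else if k = b & b < i then ?Y $ i $ b / ?Y $ b $ b else 0)"
    define U where "U = (\<chi> i k. if b < i then ?Y $ i $ k - ?Y $ i $ b / ?Y $ b $ b * ?Y $ b $ k else ?Y $ i $ k)"
    have M: "lower_tri M" "ALL i. M $ i $ i = 1" by (auto simp: M_def lower_tri_def)
    have YJ: "?Y $ k $ k ~= 0 & (ALL i>k. ?Y $ i $ k = 0)" if "k : J" for k
     using Y insert.hyps(2) that by (auto simp: Ys_def)
    have "(M ** U) $ i $ k = ?Y $ i $ k" for i k
    proof -
     have "(M ** U) $ i $ k = (\<Sum>l\<in>UNIV. M $ i $ l * U $ l $ k)"
      by (simp add: matrix_matrix_mult_def)
     also have "... = (\<Sum>l\<in>UNIV. (if l = i then U $ i $ k else 0) +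
       (if l = b then (if b < i then ?Y $ i $ b / ?Y $ b $ b * U $ b $ k else 0) else 0))"
      by (rule sum.cong) (auto simp: M_def)
     also have "... = ?Y $ i $ k" by (simp add: sum.distrib) (simp add: U_def)
     finally show ?thesis .
    qed
    then have MU: "M ** U = ?Y" by (simp add: cvec_eq_iff)
    have "U $ k $ k ~= 0 & (ALL i>k. U $ i $ k = 0)" if "k : insert b J" for k
    proof (cases "k = b")
     case True
     then show ?thesis using nz by (simp add: U_def)
    next
     case False
     then have "k : J" "k < b" using that insert.hyps(2) by auto
     then show ?thesis using YJ[of k] by (auto simp: U_def)
    qed
    then have "p ((L ** M) ** U) = 0"
     using L M by (intro insert.prems) (auto simp: lower_tri_mult)
    then show ?thesis by (simp add: MU flip: matrix_mul_assoc)
   qed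
   from cpoly_fun_eq_0_cofinite[OF poly finite.insertI[OF finite.emptyI] this]
   have "p (L ** Ys 0) = 0" .
   moreover have "Ys 0 = Y" by (simp add: Ys_def cvec_eq_iff)
   ultimately show "p (L ** Y) = 0" by simp
  qed
 qed
qed

lemma polynomial_fun_0_on_LU:
 fixes p :: "('n::{finite,linorder}) cmat => complex"
 assumes p: "polynomial_fun p"
  and 0: "!!L U. lower_tri L ==> (ALL i. L $ i $ i = 1) ==> upper_tri U ==> (ALL i. U $ i $ i ~= 0)
   ==> p (L ** U) = 0"
 shows "p Z = 0"
 by (rule polynomial_fun_0_on_LU_partial[OF p, of UNIV], rule 0) (auto simp: upper_tri_def)

text \<open>
  Gaussian elimination, column by column: matrices with an LU decomposition are Zariski dense.
  This is what makes a function on the group computable from its behaviour under both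
  triangular subgroups.
\<close>

lemma polynomial_fun_eq_on_LU:
 fixes p q :: "('n::{finite,linorder}) cmat => complex"
 assumes "polynomial_fun p" "polynomial_fun q"
  and "!!L U. lower_tri L ==> (ALL i. L $ i $ i = 1) ==> upper_tri U ==> (ALL i. U $ i $ i ~= 0)
   ==> p (L ** U) = q (L ** U)"
 shows "p = q"
proof
 show "p Z = q Z" for Z
  using polynomial_fun_0_on_LU[OF polynomial_fun_diff[OF assms(1,2)], of Z] assms(3) by simp
qed

text \<open>
  Comparing the parameter \<open>s\<close> with \<open>2 s\<close> eliminates one power of \<open>s\<close> at a time.
\<close>

lemma subspace_coefficient_extraction:
 fixes V :: "('x => complex) set"
 assumes V: "fun_subspace V"
  and "!!s. s ~= 0 ==> (%x. \<Sum>k\<le>K. s ^ k * f k x) : V" "k <= K"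
 shows "f k : V"
 using assms(2,3)
proof (induction K arbitrary: f k)
 case 0
 from 0(1)[of 1] 0(2) show ?case by simp
next
 case (Suc K)
 have scale: "!!c f. f : V ==> (%x. c * f x) : V"
  and add: "!!f g. f : V ==> g : V ==> (%x. f x + g x) : V"
  and zero: "(%x. 0) : V"
  using V by (auto simp: fun_subspace_def)
 have low: "f k : V" if "k <= K" for k
 proof -
  let ?g = "%k x. (2 ^ k - 2 ^ Suc K :: complex) * f k x"
  have "?g k : V"
  proof (rule Suc.IH[OF _ that])
   fix s :: complex assume "s ~= 0"
   then have "(%x. (\<Sum>k\<le>Suc K. (2 * s) ^ k * f k x) + (- (2 ^ Suc K)) * (\<Sum>k\<le>Suc K. s ^ k * f k x)) : V"
    by (intro add scale Suc.prems) auto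
   moreover have "(%x. (\<Sum>k\<le>Suc K. (2 * s) ^ k * f k x) + (- (2 ^ Suc K)) * (\<Sum>k\<le>Suc K. s ^ k * f k x))
     = (%x. \<Sum>k\<le>K. s ^ k * ?g k x)"
    by (rule ext) (simp add: sum_distrib_left algebra_simps sum.distrib sum_subtractf
      sum_negf power_mult_distrib)
   ultimately show "(%x. \<Sum>k\<le>K. s ^ k * ?g k x) : V" by simp
  qed
  moreover have "(2 ^ k :: complex) ~= 2 ^ Suc K"
  proof
   assume "(2 ^ k :: complex) = 2 ^ Suc K"
   then have "(of_nat (2 ^ k) :: complex) = of_nat (2 ^ Suc K)" by simp
   then have "(2::nat) ^ k = 2 ^ Suc K" by (rule of_nat_eq_iff[THEN iffD1])
   then show False using that by (simp del: power_Suc)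
  qed
  ultimately show ?thesis
   using scale[of "?g k" "inverse (2 ^ k - 2 ^ Suc K)"] by (simp add: mult.assoc[symmetric] del: power_Suc)
 qed
 have sums: "(%x. \<Sum>k\<in>I. f k x) : V" if "!!k. k : I ==> f k : V" for I :: "nat set"
  using that by (induction I rule: infinite_finite_induct) (auto intro: zero add)
 show ?case
 proof (cases "k <= K")
  case True
  then show ?thesis by (rule low)
 next
  case False
  then have k: "k = Suc K" using Suc.prems by simp
  have "(%x. (\<Sum>k\<le>Suc K. 1 ^ k * f k x) + (-1) * (\<Sum>k\<le>K. f k x)) : V"
   by (intro add scale Suc.prems sums low) auto
  then show ?thesis by (simp add: k)
 qed
qed

lemma ctranspose_transpose: "Finite_Cartesian_Product.transpose (Finite_Cartesian_Product.transpose A) = A"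
 by (simp add: Finite_Cartesian_Product.transpose_def cvec_eq_iff)

lemma fun_subspaceD:
 assumes "fun_subspace V"
 shows "(%_. 0) : V" "f : V ==> g : V ==> (%x. f x + g x) : V"
  "f : V ==> (%x. c * f x) : V"
 using assms by (auto simp: fun_subspace_def)

lemma dmat_mult: "dmat d ** dmat e = dmat (%i. d i * e i)"
proof -
 have "(dmat d ** dmat e) $ i $ j = (if i = j then d i * e i else 0)" for i j
 proof -
  have "(dmat d ** dmat e) $ i $ j = (\<Sum>k\<in>UNIV. if k = i then (if i = j then d i * e i else 0) else 0)"
   unfolding matrix_matrix_mult_def dmat_def vec_lambda_beta by (rule sum.cong) auto
  then show ?thesis by simp
 qed
 then show ?thesis by (simp add: cvec_eq_iff dmat_def)
qed

lemma dmat_mult_left_entry: "(dmat d ** A) $ i $ j = d i * A $ i $ j"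
proof -
 have "(dmat d ** A) $ i $ j = (\<Sum>k\<in>UNIV. if k = i then d i * A $ i $ j else 0)"
  unfolding matrix_matrix_mult_def dmat_def vec_lambda_beta by (rule sum.cong) auto
 then show ?thesis by simp
qed

lemma dmat_mult_right_entry: "(A ** dmat d) $ i $ j = A $ i $ j * d j"
proof -
 have "(A ** dmat d) $ i $ j = (\<Sum>k\<in>UNIV. if k = j then A $ i $ j * d j else 0)"
  unfolding matrix_matrix_mult_def dmat_def vec_lambda_beta by (rule sum.cong) auto
 then show ?thesis by simp
qed

lemma dmat_one: "dmat (%_. 1) = mat 1"
 by (auto simp: dmat_def cmat_def cvec_eq_iff)

lemma invertible_dmat:
 assumes "!!i. d i ~= 0" shows "invertible (dmat d)"
 unfolding invertible_def
 by (rule exI[of _ "dmat (%i. inverse (d i))"]) (simp add: dmat_mult assms dmat_one)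

lemma upper_tri_dmat: "upper_tri (dmat d)" and lower_tri_dmat: "lower_tri (dmat d)"
 by (auto simp: upper_tri_def lower_tri_def dmat_def)

lemma dmat_entry_same [simp]: "dmat d $ i $ i = d i"
 by (simp add: dmat_def)

section \<open>Highest weight polynomials\<close>

definition tri_char :: "('n::finite => nat) => 'n cmat => complex" where
 "tri_char \<mu> A = (\<Prod>i\<in>UNIV. A $ i $ i ^ \<mu> i)"

text \<open>
  For decreasing exponents this is a product of powers of leading principal minors. Lower triangular matrices act on the left and upper
  triangular ones on the right, so that LU products fix the function.
\<close>

definition hw_poly :: "('n::{finite,linorder} => nat) => ('n cmat => complex) => bool" where
 "hw_poly \<mu> p \<longleftrightarrow> polynomial_fun p & p (mat 1) = 1 \<and>
  (ALL L Z U. lower_tri L --> upper_tri U --> p (L ** Z ** U) = tri_char \<mu> L * tri_char \<mu> U * p Z)"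

definition corner_minor :: "'n set => ('n::finite) cmat => 'n cmat" where
 "corner_minor S Z = (\<chi> i j. if i : S & j : S then Z $ i $ j else if i = j then 1 else 0)"

lemma corner_minor_mult_lower:
 fixes L :: "('n::{finite,linorder}) cmat"
 assumes S: "!!i j. i : S ==> j <= i ==> j : S" and L: "lower_tri L"
 shows "corner_minor S (L ** Z) = corner_minor S L ** corner_minor S Z"
proof -
 have "corner_minor S (L ** Z) $ i $ j = (corner_minor S L ** corner_minor S Z) $ i $ j" for i j
 proof (cases "i : S & j : S")
  case True
  have "L $ i $ k * Z $ k $ j = corner_minor S L $ i $ k * corner_minor S Z $ k $ j" for k
  proof (cases "k : S")
   case False
   then have "i < k" using S[of i k] True by force
   then show ?thesis using L True False by (auto simp: corner_minor_def lower_tri_def)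
  qed (use True in \<open>auto simp: corner_minor_def\<close>)
  then show ?thesis using True by (simp add: corner_minor_def matrix_matrix_mult_def)
 next
  case False
  have "(corner_minor S L ** corner_minor S Z) $ i $ j =
   (\<Sum>k\<in>UNIV. if k = i then (if i = j then 1 else 0) else 0)"
   unfolding matrix_matrix_mult_def vec_lambda_beta
  proof (rule sum.cong)
   fix k
   show "corner_minor S L $ i $ k * corner_minor S Z $ k $ j = (if k = i then if i = j then 1 else 0 else 0)"
    using False
    by (cases "i : S"; cases "j : S"; cases "k : S"; cases "k = i"; cases "i = j"; cases "k = j")
     (simp_all add: corner_minor_def)
  qed simp
  moreover have "corner_minor S (L ** Z) $ i $ j = (if i = j then 1 else 0)"
   using False by (cases "i = j") (auto simp: corner_minor_def)
  ultimately show ?thesis by simp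
 qed
 then show ?thesis by (simp add: cvec_eq_iff)
qed

lemma corner_minor_transpose: "corner_minor S (transpose Z) = transpose (corner_minor S Z)"
 by (auto simp: corner_minor_def transpose_def cvec_eq_iff)

lemma corner_minor_mult_upper:
 fixes U :: "('n::{finite,linorder}) cmat"
 assumes S: "!!i j. i : S ==> j <= i ==> j : S" and U: "upper_tri U"
 shows "corner_minor S (Z ** U) = corner_minor S Z ** corner_minor S U"
proof -
 have "corner_minor S (transpose U ** transpose Z)
   = corner_minor S (transpose U) ** corner_minor S (transpose Z)"
  using S U by (intro corner_minor_mult_lower) (simp_all add: lower_tri_transpose)
 then have "transpose (corner_minor S (Z ** U)) = transpose (corner_minor S Z ** corner_minor S U)"
  by (simp only: matrix_transpose_mul[symmetric] corner_minor_transpose)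
 from arg_cong[OF this, of transpose] show ?thesis by (simp only: ctranspose_transpose)
qed

lemma det_corner_minor_tri:
 fixes A :: "('n::{finite,linorder}) cmat"
 assumes "lower_tri A \<or> upper_tri A"
 shows "det (corner_minor S A) = (\<Prod>i\<in>UNIV. if i : S then A $ i $ i else 1)"
proof -
 have "det (corner_minor S A) = (\<Prod>i\<in>UNIV. corner_minor S A $ i $ i)"
  using assms
 proof
  assume "lower_tri A" then show ?thesis
   by (intro det_lower_tri) (auto simp: corner_minor_def lower_tri_def)
 next
  assume "upper_tri A" then show ?thesis
   by (intro det_upper_tri) (auto simp: corner_minor_def upper_tri_def)
 qed
 then show ?thesis by (simp add: corner_minor_def cong: if_cong)
qed

lemma polynomial_fun_corner_minor: "polynomial_fun (%Z. det (corner_minor S Z))"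
proof (rule polynomial_fun_det)
 show "polynomial_fun (%Z. corner_minor S Z $ i $ j)" for i j
  by (cases "i : S"; cases "j : S"; cases "i = j")
   (simp_all add: corner_minor_def polynomial_fun.intros)
qed

lemma hw_poly_exists:
 fixes \<mu> :: "'n::{finite,linorder} => nat"
 assumes "antimono \<mu>"
 shows "EX p. hw_poly \<mu> p"
 using assms
proof (induction "\<Sum>i\<in>UNIV. \<mu> i" arbitrary: \<mu> rule: less_induct)
 case (less \<mu>)
 show ?case
 proof (cases "ALL i. \<mu> i = 0")
  case True
  then have "hw_poly \<mu> (%_. 1)"
   by (simp add: hw_poly_def tri_char_def polynomial_fun.const)
  then show ?thesis by blast
 next
  case False
  then obtain i0 where i0: "\<mu> i0 ~= 0" by blast
  define \<mu>' where "\<mu>' i = \<mu> i - 1" for i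
  define S where "S = {i. 0 < \<mu> i}"
  have "(\<Sum>i\<in>UNIV. \<mu>' i) < (\<Sum>i\<in>UNIV. \<mu> i)"
   using i0 by (intro sum_strict_mono_ex1) (auto simp: \<mu>'_def intro!: exI[of _ i0])
  moreover have "antimono \<mu>'"
   using less.prems by (auto simp: antimono_def \<mu>'_def intro: diff_le_mono)
  ultimately obtain p where p: "hw_poly \<mu>' p" using less.hyps by blast
  have S: "j : S" if "i : S" "j <= i" for i j
   using less.prems that by (auto simp: S_def antimono_def dest: less_le_trans)
  have char: "tri_char \<mu> A = (\<Prod>i\<in>UNIV. if i : S then A $ i $ i else 1) * tri_char \<mu>' A" for A
   unfolding tri_char_def prod.distrib[symmetric]
   by (rule prod.cong) (auto simp: S_def \<mu>'_def power_eq_if)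
  have "hw_poly \<mu> (%Z. det (corner_minor S Z) * p Z)"
   unfolding hw_poly_def
  proof (intro conjI allI impI)
   show "polynomial_fun (%Z. det (corner_minor S Z) * p Z)"
    using p by (intro polynomial_fun.mult polynomial_fun_corner_minor) (simp add: hw_poly_def)
   show "det (corner_minor S (mat 1)) * p (mat 1) = 1"
    using p by (simp add: hw_poly_def det_corner_minor_tri lower_tri_one) (simp add: cmat_def cong: if_cong)
   fix L Z U :: "'n cmat" assume L: "lower_tri L" and U: "upper_tri U"
   have "p (L ** Z ** U) = tri_char \<mu>' L * tri_char \<mu>' U * p Z"
    using p L U by (simp add: hw_poly_def)
   moreover have "det (corner_minor S (L ** Z ** U))
     = det (corner_minor S L) * det (corner_minor S Z) * det (corner_minor S U)"
    by (simp add: corner_minor_mult_lower[OF S L] corner_minor_mult_upper[OF S U] det_mul)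
   ultimately show "det (corner_minor S (L ** Z ** U)) * p (L ** Z ** U)
     = tri_char \<mu> L * tri_char \<mu> U * (det (corner_minor S Z) * p Z)"
    using L U by (simp add: char det_corner_minor_tri)
  qed
  then show ?thesis by blast
 qed
qed

lemma tri_char_unipotent: "(ALL i. A $ i $ i = 1) ==> tri_char \<mu> A = 1"
 by (simp add: tri_char_def)

lemma tri_char_one [simp]: "tri_char \<mu> (mat 1) = 1"
 by (rule tri_char_unipotent) (simp add: cmat_def)

lemma hw_polyD:
 assumes "hw_poly \<mu> p"
 shows "polynomial_fun p" "p (mat 1) = 1"
  "lower_tri L ==> p (L ** Z) = tri_char \<mu> L * p Z"
  "upper_tri U ==> p (Z ** U) = tri_char \<mu> U * p Z"
proof -
 have *: "lower_tri L ==> upper_tri U ==> p (L ** Z ** U) = tri_char \<mu> L * tri_char \<mu> U * p Z" for L Z U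
  using assms by (simp add: hw_poly_def)
 show "polynomial_fun p" "p (mat 1) = 1" using assms by (auto simp: hw_poly_def)
 show "lower_tri L ==> p (L ** Z) = tri_char \<mu> L * p Z" using *[of L "mat 1" Z] upper_tri_one by simp
 show "upper_tri U ==> p (Z ** U) = tri_char \<mu> U * p Z" using *[of "mat 1" U Z] lower_tri_one by simp
qed

lemma hw_poly_unique:
 assumes \<Delta>: "hw_poly \<mu> \<Delta>" and p: "polynomial_fun p"
  and "!!L U. lower_tri L ==> (ALL i. L $ i $ i = 1) ==> upper_tri U ==> (ALL i. U $ i $ i ~= 0)
   ==> p (L ** U) = tri_char \<mu> U * c"
 shows "p = (%Z. c * \<Delta> Z)"
proof (rule polynomial_fun_eq_on_LU[OF p])
 show "polynomial_fun (%Z. c * \<Delta> Z)" using hw_polyD(1)[OF \<Delta>] by (rule polynomial_fun_cmult)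
 fix L U :: "'a cmat"
 assume L: "lower_tri L" "ALL i. L $ i $ i = 1" and U: "upper_tri U" "ALL i. U $ i $ i ~= 0"
 have "\<Delta> (L ** U) = tri_char \<mu> U * \<Delta> (mat 1)"
  using hw_polyD(3)[OF \<Delta> L(1), of U] hw_polyD(4)[OF \<Delta> U(1), of "mat 1"] L(2)
  by (simp add: tri_char_unipotent)
 then show "p (L ** U) = c * \<Delta> (L ** U)"
  using assms(3)[OF L U] hw_polyD(2)[OF \<Delta>] by simp
qed

section \<open>Weight vectors in invariant spaces\<close>

definition torus :: "('n => nat) => complex => ('n::finite) cmat" where
 "torus w s = dmat (%i. s ^ w i)"

lemma torus_mult: "torus w s ** torus w t = torus w (s * t)"
 by (simp add: torus_def dmat_mult power_mult_distrib)

lemma torus_1 [simp]: "torus w 1 = mat 1"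
 by (simp add: torus_def dmat_one)

lemma invertible_torus: "s ~= 0 ==> invertible (torus w s)"
 by (simp add: torus_def invertible_dmat)

lemma cpoly_fun_torus: "cpoly_fun (%s. torus w s $ i $ j)"
 by (cases "i = j") (simp_all add: torus_def dmat_def cpoly_intros)

lemma cpoly_fun_torus_translate: "polynomial_fun p ==> cpoly_fun (%s. p (Z ** torus w s))"
 by (erule cpoly_fun_curve) (rule cpoly_fun_matmult[OF cpoly_fun_const cpoly_fun_torus])

definition wcoeff :: "('n => nat) => (('n::finite) cmat => complex) => nat => 'n cmat => complex" where
 "wcoeff w p k Z = coeff (SOME Q. ALL s. p (Z ** torus w s) = poly Q s) k"

lemma wcoeff_eqI:
 assumes "!!s. p (Z ** torus w s) = poly Q s"
 shows "wcoeff w p k Z = coeff Q k"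
proof -
 define Q' where "Q' = (SOME Q. ALL s. p (Z ** torus w s) = poly Q s)"
 have Q': "ALL s. p (Z ** torus w s) = poly Q' s"
  unfolding Q'_def by (rule someI[of _ Q]) (use assms in blast)
 have "poly Q' = poly Q"
 proof
  show "poly Q' s = poly Q s" for s using Q'[rule_format, of s] assms[of s] by simp
 qed
 then have "Q' = Q" by (rule poly_eq_poly_eq_iff[THEN iffD1])
 then show ?thesis by (simp add: wcoeff_def Q'_def)
qed

lemma wcoeff_poly:
 assumes "polynomial_fun p"
 shows "EX Q. (ALL s. p (Z ** torus w s) = poly Q s) & (ALL k. wcoeff w p k Z = coeff Q k)"
proof -
 obtain Q where "!!s. p (Z ** torus w s) = poly Q s"
  using cpoly_fun_torus_translate[OF assms, of Z w] by (auto simp: cpoly_fun_def)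
 then show ?thesis using wcoeff_eqI[of p Z w Q] by blast
qed

lemma wcoeff_expansion:
 fixes p :: "('n::finite) cmat => complex"
 assumes p: "polynomial_fun p"
 shows "EX N. (ALL Z s. p (Z ** torus w s) = (\<Sum>k\<le>N. s ^ k * wcoeff w p k Z)) \<and>
  (ALL Z k. N < k --> wcoeff w p k Z = 0)"
proof -
 have "EX N c. (ALL k>N. ALL Z. c k Z = 0) & (ALL Z s. F (torus w s) Z = (\<Sum>k\<le>N. s ^ k * c k Z))"
  if "separable F" for F :: "'n cmat => 'n cmat => complex"
  using that
 proof (induction rule: separable.induct)
  case (base a r)
  have "cpoly_fun (%s. a (torus w s))"
   by (rule cpoly_fun_curve[OF base(1) cpoly_fun_torus])
  then obtain Q where Q: "!!s. a (torus w s) = poly Q s" by (auto simp: cpoly_fun_def)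
  have "coeff Q k * r Z = 0" if "degree Q < k" for k Z using that by (simp add: coeff_eq_0)
  moreover have "a (torus w s) * r Z = (\<Sum>k\<le>degree Q. s ^ k * (coeff Q k * r Z))" for Z s
   by (simp add: Q poly_altdef sum_distrib_left sum_distrib_right mult_ac)
  ultimately show ?case
   by (intro exI[of _ "degree Q"] exI[of _ "%k Z. coeff Q k * r Z"]) blast
 next
  case (sum F G)
  from sum.IH(1) obtain N c where
   N: "!!k Z. k > N ==> c k Z = 0" "!!Z s. F (torus w s) Z = (\<Sum>k\<le>N. s ^ k * c k Z)"
   by blast
  from sum.IH(2) obtain M d where
   M: "!!k Z. k > M ==> d k Z = 0" "!!Z s. G (torus w s) Z = (\<Sum>k\<le>M. s ^ k * d k Z)"
   by blast
  have "(\<Sum>k\<le>N. s ^ k * c k Z) = (\<Sum>k\<le>max N M. s ^ k * c k Z)" for s Z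
   using N(1) by (intro sum.mono_neutral_left) auto
  moreover have "(\<Sum>k\<le>M. s ^ k * d k Z) = (\<Sum>k\<le>max N M. s ^ k * d k Z)" for s Z
   using M(1) by (intro sum.mono_neutral_left) auto
  ultimately show ?case
   using N M
   by (intro exI[of _ "max N M"] exI[of _ "%k Z. c k Z + d k Z"])
    (simp add: sum.distrib distrib_left)
 qed
 from this[OF separable_mult_right[OF p]] obtain N c
  where c: "!!k Z. k > N ==> c k Z = 0" "!!Z s. p (Z ** torus w s) = (\<Sum>k\<le>N. s ^ k * c k Z)"
  by blast
 have "wcoeff w p k Z = c k Z" for k Z
 proof -
  have "p (Z ** torus w s) = poly (\<Sum>k\<le>N. monom (c k Z) k) s" for s
   by (simp add: c(2) poly_sum poly_monom mult.commute)
  from wcoeff_eqI[of p, OF this] have "wcoeff w p k Z = (\<Sum>k'\<le>N. if k' = k then c k' Z else 0)"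
   by (simp add: coeff_sum)
  then show ?thesis using c(1)[of k Z] by (auto simp: not_le)
 qed
 then have "wcoeff w p = c" by (simp add: fun_eq_iff)
 with c show ?thesis by blast
qed

lemma wcoeff_weight:
 assumes "polynomial_fun p"
 shows "wcoeff w p k (Z ** torus w s) = s ^ k * wcoeff w p k Z"
proof -
 obtain Q where Q: "!!s. p (Z ** torus w s) = poly Q s" "!!k. wcoeff w p k Z = coeff Q k"
  using wcoeff_poly[OF assms, where Z=Z and w=w] by blast
 have "p ((Z ** torus w s) ** torus w t) = poly (pcompose Q [:0, s:]) t" for t
  by (simp add: torus_mult Q poly_pcompose mult.commute flip: matrix_mul_assoc)
 from wcoeff_eqI[of p, OF this] show ?thesis by (simp add: coeff_pcompose_linear Q)
qed

lemma wcoeff_in_subspace: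
 assumes V: "fun_subspace V" and poly: "!!p. p : V ==> polynomial_fun p"
  and inv: "!!p s. p : V ==> s ~= 0 ==> (%Z. p (Z ** torus w s)) : V" and p: "p : V"
 shows "wcoeff w p k : V"
proof -
 obtain N where N: "!!Z s. p (Z ** torus w s) = (\<Sum>k\<le>N. s ^ k * wcoeff w p k Z)"
  "!!Z k. N < k ==> wcoeff w p k Z = 0" using wcoeff_expansion[OF poly[OF p], where w=w] by blast
 show ?thesis
 proof (cases "k <= N")
  case True
  show ?thesis
   by (rule subspace_coefficient_extraction[OF V _ True]) (use inv[OF p] in \<open>simp add: N(1)[symmetric]\<close>)
 next
  case False
  then have "wcoeff w p k = (%_. 0)" using N(2) by (simp add: fun_eq_iff)
  then show ?thesis using fun_subspaceD(1)[OF V] by simp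
 qed
qed

lemma wcoeff_nonzero:
 assumes p: "polynomial_fun p" and "p Z ~= 0"
 shows "EX k. wcoeff w p k Z ~= 0"
proof (rule ccontr)
 assume *: "\<nexists>k. wcoeff w p k Z ~= 0"
 obtain N where N: "!!Z s. p (Z ** torus w s) = (\<Sum>k\<le>N. s ^ k * wcoeff w p k Z)"
  using wcoeff_expansion[OF p, where w=w] by blast
 from N[of Z 1] * have "p Z = 0" by simp
 with assms(2) show False by simp
qed

lemma poly_inverse_variable_const:
 fixes P R :: "complex poly"
 assumes "!!s. s ~= 0 ==> poly R s = poly P (inverse s)"
 shows "poly P t = poly P 0"
proof (cases "P = 0")
 case False
 have "poly (monom 1 (degree P) * R) s = poly (reflect_poly P) s" if "s ~= 0" for s
  using assms[OF that] that by (simp add: poly_monom poly_reflect_poly_nz)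
 then have "UNIV - {0} <= {s. poly (monom 1 (degree P) * R - reflect_poly P) s = 0}" by auto
 moreover have "infinite (UNIV - {0 :: complex})" by (simp add: infinite_UNIV_char_0)
 ultimately have "monom 1 (degree P) * R - reflect_poly P = 0"
  using finite_subset poly_roots_finite by metis
 then have eq: "monom 1 (degree P) * R = reflect_poly P" by simp
 have "degree R = 0"
 proof (cases "R = 0")
  case False
  then have "degree (monom 1 (degree P) * R) = degree P + degree R"
   by (simp add: degree_mult_eq degree_monom_eq)
  then show ?thesis using degree_reflect_poly_le[of P] by (simp add: eq)
 qed simp
 then obtain c where c: "R = [:c:]" by (metis degree_0_id)
 have A: "poly P u - c = 0" if "u \<notin> {0}" for u
  using assms[of "inverse u"] that by (simp add: c)
 have B: "cpoly_fun (%u. poly P u - c)"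
  unfolding cpoly_fun_def by (rule exI[of _ "P - [:c:]"]) simp
 have "poly P u - c = 0" for u
  by (rule cpoly_fun_eq_0_cofinite[OF B finite.insertI[OF finite.emptyI] A])
 then show ?thesis by (metis eq_iff_diff_eq_0)
qed simp

definition height :: "'n::{finite,linorder} => nat" where
 "height i = card {j. j < i}"

lemma height_strict_mono: "i < j ==> height i < height j"
 unfolding height_def by (rule psubset_card_mono) auto

lemma lowest_coefficient_unipotent_invariant:
 fixes V :: "(('n::{finite,linorder}) cmat => complex) set"
 assumes V: "fun_subspace V" and poly: "!!p. p : V ==> polynomial_fun p"
  and inv: "!!p B. p : V ==> invertible B ==> (%Z. p (Z ** B)) : V"
  and low: "!!p k Z. p : V ==> k < K ==> wcoeff height p k Z = 0"
  and p: "p : V" and u: "upper_tri u" "ALL i. u $ i $ i = 1"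
 shows "wcoeff height p K (Z ** u) = wcoeff height p K Z"
proof -
 define q where "q = wcoeff height p K"
 have qV: "q : V"
  unfolding q_def by (rule wcoeff_in_subspace[OF V poly _ p]) (auto intro: inv invertible_torus)
 have q_weight: "q (Y ** torus height s) = s ^ K * q Y" for Y s
  unfolding q_def by (rule wcoeff_weight[OF poly[OF p]])
 define v :: "complex => 'n cmat" where "v t = (\<chi> i j. if i = j then 1 else if i < j then t ^ (height j - height i) * u $ i $ j else 0)" for t
 have cv: "cpoly_fun (%t. v t $ i $ j)" for i j
  by (cases "i = j"; cases "i < j") (simp_all add: v_def cpoly_intros)
 have "cpoly_fun (%t. q (Z ** v t))"
  by (rule cpoly_fun_curve[OF poly[OF qV]], rule cpoly_fun_matmult[OF cpoly_fun_const cv])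
 then obtain P where P: "!!t. q (Z ** v t) = poly P t" by (auto simp: cpoly_fun_def)
 have v0: "v 0 = mat 1"
  by (auto simp: v_def cmat_def cvec_eq_iff zero_power height_strict_mono)
 have v1: "v 1 = u" using u by (auto simp: v_def cvec_eq_iff upper_tri_def not_less)
 have "invertible u" using u by (simp add: invertible_upper_tri)
 then have rV: "(%Z. q (Z ** u)) : V" by (rule inv[OF qV])
 obtain R where R: "!!s. q (Z ** torus height s ** u) = poly R s"
  "!!k. wcoeff height (%Z. q (Z ** u)) k Z = coeff R k"
  using wcoeff_poly[OF poly[OF rV], where Z=Z and w=height] by blast
 have "coeff R k = 0" if "k < K" for k
  using low[OF rV that, of Z] R(2)[of k] by simp
 then obtain R' where R': "R = monom 1 K * R'"
  by (metis monom_1_dvd_iff' dvd_def)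
 have comm: "torus height s ** u = v (inverse s) ** torus height s" if "s ~= 0" for s
 proof -
  have "s ^ height i * u $ i $ j = v (inverse s) $ i $ j * s ^ height j" for i j
  proof (rule linorder_cases[of i j])
   assume "i < j"
   then have "height j = height i + (height j - height i)" using height_strict_mono[of i j] by simp
   then have "s ^ height j = s ^ height i * s ^ (height j - height i)" by (metis power_add)
   then show ?thesis using that \<open>i < j\<close> by (simp add: v_def power_inverse field_simps)
  qed (use u in \<open>auto simp: v_def upper_tri_def\<close>)
  then show ?thesis
   by (simp add: cvec_eq_iff torus_def dmat_mult_left_entry dmat_mult_right_entry)
 qed
 have "poly R' s = poly P (inverse s)" if "s ~= 0" for s
 proof -
  have "s ^ K * poly R' s = q (Z ** torus height s ** u)" by (simp add: R(1) R' poly_monom)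
  also have "... = s ^ K * poly P (inverse s)"
   using q_weight[of "Z ** v (inverse s)" s]
   by (simp add: comm[OF that] P flip: matrix_mul_assoc)
  finally show ?thesis using that by simp
 qed
 from poly_inverse_variable_const[OF this, of 1] have "q (Z ** v 1) = q (Z ** v 0)" by (simp add: P)
 then show ?thesis by (simp add: v0 v1 q_def)
qed

text \<open>
  Conjugation by a suitable one-parameter group of diagonal matrices contracts the unipotent
  upper triangular matrices to the identity. The lowest-order coefficient along this group
  is therefore invariant under them. This replaces the Lie-Kolchin theorem.
\<close>

lemma right_invariant_lowest_coefficient:
 fixes V :: "(('n::{finite,linorder}) cmat => complex) set"
 assumes V: "fun_subspace V" and poly: "!!p. p : V ==> polynomial_fun p"
  and inv: "!!p B. p : V ==> invertible B ==> (%Z. p (Z ** B)) : V"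
  and nz: "p0 : V" "p0 Z0 ~= 0"
 obtains K where "ALL p:V. ALL k<K. ALL Z. wcoeff height p k Z = 0"
  "EX p:V. wcoeff height p K ~= (%_. 0)" "ALL p:V. wcoeff height p K : V"
  "ALL p:V. ALL u. upper_tri u --> (ALL i. u $ i $ i = 1) -->
   (ALL Z. wcoeff height p K (Z ** u) = wcoeff height p K Z)"
proof -
 define P where "P k \<longleftrightarrow> (EX p:V. EX Z. wcoeff height p k Z ~= 0)" for k
 have "EX k. P k"
  using wcoeff_nonzero[OF poly[OF nz(1)] nz(2), of height] nz(1) unfolding P_def by blast
 then have "P (LEAST k. P k)" by (rule LeastI_ex)
 then obtain p Z where p: "p : V" "wcoeff height p (LEAST k. P k) Z ~= 0" by (auto simp: P_def)
 have low: "wcoeff height p k Z = 0" if "p : V" "k < (LEAST k. P k)" for p k Z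
  using not_less_Least[OF that(2)] that(1) by (auto simp: P_def)
 show ?thesis
 proof (rule that[of "LEAST k. P k"])
  show "EX p:V. wcoeff height p (LEAST k. P k) ~= (%_. 0)" using p by (auto simp: fun_eq_iff)
  show "ALL p:V. wcoeff height p (LEAST k. P k) : V"
  proof
   show "wcoeff height p (LEAST k. P k) : V" if "p : V" for p
    by (rule wcoeff_in_subspace[OF V poly _ that]) (auto intro: inv invertible_torus)
  qed
  have "wcoeff height p (LEAST k. P k) (Z ** u) = wcoeff height p (LEAST k. P k) Z"
   if "p : V" "upper_tri u" "ALL i. u $ i $ i = 1" for p u Z
   using lowest_coefficient_unipotent_invariant[OF V poly inv low that] .
  then show "ALL p:V. ALL u. upper_tri u --> (ALL i. u $ i $ i = 1) -->
   (ALL Z. wcoeff height p (LEAST k. P k) (Z ** u) = wcoeff height p (LEAST k. P k) Z)" by blast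
 qed (use low in blast)
qed

lemma left_invariant_unipotent_vector:
 fixes V :: "(('n::{finite,linorder}) cmat => complex) set"
 assumes V: "fun_subspace V" and poly: "!!p. p : V ==> polynomial_fun p"
  and inv: "!!p A. p : V ==> invertible A ==> (%Z. p (A ** Z)) : V"
  and nz: "p0 : V" "p0 Z0 ~= 0"
 obtains q where "q : V" "q ~= (%_. 0)"
  "!!L Z. lower_tri L ==> ALL i. L $ i $ i = 1 ==> q (L ** Z) = q Z"
proof -
 define W where "W = (%p Z. p (transpose Z)) ` V"
 have W: "p : W \<longleftrightarrow> (%Z. p (transpose Z)) : V" for p
  unfolding W_def by (auto simp: image_iff intro!: bexI[of _ "%Z. p (transpose Z)"])
 have subsp: "fun_subspace W" using V by (auto simp: fun_subspace_def W)
 have polyW: "polynomial_fun p" if "p : W" for p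
 proof -
  have "polynomial_fun (%Z. p (transpose Z))" using that by (simp add: W poly)
  from polynomial_fun_compose[OF this, of transpose]
  have "polynomial_fun (%Z. p (transpose (transpose Z)))"
   by (simp add: Finite_Cartesian_Product.transpose_def polynomial_fun.entry)
  then show ?thesis by (simp add: ctranspose_transpose)
 qed
 have invW: "(%Z. p (Z ** B)) : W" if "p : W" "invertible B" for p B
  using inv[of "%Z. p (transpose Z)" "transpose B"] that
  by (simp add: W matrix_transpose_mul invertible_det_nz det_transpose)
 have nzW: "(%Z. p0 (transpose Z)) : W" "(%Z. p0 (transpose Z)) (transpose Z0) ~= 0"
  using nz by (auto simp: W)
 obtain K where K: "EX p:W. wcoeff height p K ~= (%_. 0)" "ALL p:W. wcoeff height p K : W"
  "ALL p:W. ALL u. upper_tri u --> (ALL i. u $ i $ i = 1) -->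
   (ALL Z. wcoeff height p K (Z ** u) = wcoeff height p K Z)"
  by (rule right_invariant_lowest_coefficient[OF subsp polyW invW nzW])
 then obtain p where *: "p : W" "wcoeff height p K ~= (%_. 0)" by blast
 let ?q = "%Z. wcoeff height p K (transpose Z)"
 show ?thesis
 proof (rule that[of ?q])
  show "?q : V" using K(2) *(1) by (simp add: W)
  obtain Y where "wcoeff height p K Y ~= 0" using *(2) by auto
  then have "?q (transpose Y) ~= 0" by (simp add: ctranspose_transpose)
  then show "?q ~= (%_. 0)" by metis
  fix L Z :: "'n cmat" assume "lower_tri L" "ALL i. L $ i $ i = 1"
  then show "?q (L ** Z) = ?q Z"
   using K(3)[rule_format, OF *(1), of "transpose L" "transpose Z"]
   by (simp add: matrix_transpose_mul upper_tri_transpose) (simp add: transpose_def)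
 qed
qed

lemma torus_weight_vector:
 fixes V :: "(('n::finite) cmat => complex) set"
 assumes V: "fun_subspace V" and poly: "!!p. p : V ==> polynomial_fun p"
  and inv: "!!p d. p : V ==> (!!i. d i ~= 0) ==> (%Z. p (Z ** dmat d)) : V"
  and nz: "p0 : V" "p0 Z0 ~= 0"
 obtains q \<alpha> where "q : V" "q ~= (%_. 0)" "!!Z d. q (Z ** dmat d) = (\<Prod>i\<in>UNIV. d i ^ \<alpha> i) * q Z"
proof -
 let ?E = "%b. torus (%i. if i = b then 1 else 0)"
 have E_comm: "?E b s ** ?E c t = ?E c t ** ?E b s" for b c s t
  by (simp add: torus_def dmat_mult mult.commute)
 have "finite (UNIV :: 'n set)" by simp
 then have "EX q:V. EX \<alpha>. q ~= (%_. 0) & (ALL i:J. ALL Z s. q (Z ** ?E i s) = s ^ \<alpha> i * q Z)" for J :: "'n set"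
 proof (induction J rule: infinite_finite_induct)
  case empty
  have "p0 ~= (%_. 0)" using nz(2) by auto
  then show ?case using nz(1) by blast
 next
  case (insert b J)
  then obtain q \<alpha> where q: "q : V" "q ~= (%_. 0)" "!!i Z s. i : J ==> q (Z ** ?E i s) = s ^ \<alpha> i * q Z"
   by blast
  let ?c = "wcoeff (%i. if i = b then 1 else 0) q"
  obtain Z where "q Z ~= 0" using q(2) by auto
  from wcoeff_nonzero[OF poly[OF q(1)] this] obtain k where k: "?c k Z ~= 0" by blast
  have "?c k : V"
  proof (rule wcoeff_in_subspace[OF V poly _ q(1)])
   show "(%Z. p (Z ** ?E b s)) : V" if "p : V" "s ~= 0" for p s
    unfolding torus_def using that by (intro inv) auto
  qed
  moreover have "?c k ~= (%_. 0)" using k by (auto simp: fun_eq_iff)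
  moreover have "?c k (Z ** ?E i s) = s ^ (\<alpha>(b := k)) i * ?c k Z" if "i : insert b J" for i Z s
  proof (cases "i = b")
   case True
   then show ?thesis by (simp add: wcoeff_weight[OF poly[OF q(1)]])
  next
   case False
   with that have i: "i : J" by simp
   obtain Q where Q: "!!s. q (Z ** ?E b s) = poly Q s" "!!k. ?c k Z = coeff Q k"
    using wcoeff_poly[OF poly[OF q(1)], where Z=Z and w="%i. if i = b then 1 else 0"] by blast
   have "q ((Z ** ?E i s) ** ?E b t) = poly (Polynomial.smult (s ^ \<alpha> i) Q) t" for t
    using q(3)[OF i, of "Z ** ?E b t" s] by (simp add: Q E_comm flip: matrix_mul_assoc)
   from wcoeff_eqI[of q, OF this, of k] show ?thesis using False by (simp add: Q)
  qed
  ultimately show ?case by blast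
 qed simp
 from this[of UNIV] obtain q \<alpha> where q: "q : V" "q ~= (%_. 0)" "!!i Z s. q (Z ** ?E i s) = s ^ \<alpha> i * q Z"
  by blast
 have "q (Z ** dmat (%i. if i : J then d i else 1)) = (\<Prod>i\<in>J. d i ^ \<alpha> i) * q Z" for J :: "'n set" and Z d
 proof (induction J rule: infinite_finite_induct)
  case empty
  then show ?case by (simp add: dmat_one)
 next
  case (insert b J)
  have "dmat (%i. if i : insert b J then d i else 1) = dmat (%i. if i : J then d i else 1) ** ?E b (d b)"
   unfolding torus_def dmat_mult using insert.hyps by (intro arg_cong[of _ _ dmat]) auto
  then show ?case
   using insert q(3)[of "Z ** dmat (%i. if i : J then d i else 1)" b "d b"]
   by (simp add: matrix_mul_assoc)
 qed simp
 from this[of _ UNIV] have "q (Z ** dmat d) = (\<Prod>i\<in>UNIV. d i ^ \<alpha> i) * q Z" for Z d by simp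
 from that[OF q(1,2) this] show ?thesis .
qed

text \<open>
  An exponent that increases would produce a pole of the polynomial on a two by two block.
\<close>

lemma hw_weight_antimono:
 fixes q :: "('n::{finite,linorder}) cmat => complex"
 assumes q: "polynomial_fun q" and q1: "c ~= 0"
  and eq: "!!L U. lower_tri L ==> (ALL i. L $ i $ i = 1) ==> upper_tri U ==> (ALL i. U $ i $ i ~= 0)
   ==> q (L ** U) = tri_char \<alpha> U * c"
 shows "antimono \<alpha>"
proof (rule antimonoI, rule ccontr)
 fix i j assume "i <= j" "\<not> \<alpha> j <= \<alpha> i"
 then have ij: "i < j" "\<alpha> i < \<alpha> j" by (auto simp: le_less)
 (* The curve X stays polynomial at a = 0, whereas its LU factors have a pole there. *)
 define N :: "'n => 'n => complex" where "N k l = (if k = i & l = j then 1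
  else if k = j & l = i then -1 else if k = j & l = j then 0 else if k = l then 1 else 0)" for k l
 define X :: "complex => 'n cmat" where "X a = (\<chi> k l. if k = i & l = i then a else N k l)" for a
 define L :: "complex => 'n cmat" where "L a = (\<chi> k l. if k = j & l = i then - inverse a else if k = l then 1 else 0)" for a
 define U :: "complex => 'n cmat" where "U a = (\<chi> k l. if k = i & l = i then a else if k = i & l = j then 1
  else if k = j & l = j then inverse a else if k = l then 1 else 0)" for a
 have LU: "L a ** U a = X a" if "a ~= 0" for a
 proof -
  have "(L a ** U a) $ k $ l = X a $ k $ l" for k l
  proof -
   have "(L a ** U a) $ k $ l = (\<Sum>m\<in>UNIV. (if m = k then U a $ k $ l else 0) +
     (if m = i then (if k = j then - inverse a * U a $ i $ l else 0) else 0))"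
    unfolding matrix_matrix_mult_def vec_lambda_beta
    using ij by (intro sum.cong) (auto simp: L_def)
   also have "... = X a $ k $ l"
    using ij that by (simp add: sum.distrib) (auto simp: U_def X_def N_def)
   finally show ?thesis .
  qed
  then show ?thesis by (simp add: cvec_eq_iff)
 qed
 have val: "q (X a) = a ^ \<alpha> i * inverse a ^ \<alpha> j * c" if "a ~= 0" for a
 proof -
  have "tri_char \<alpha> (U a) = (\<Prod>k\<in>UNIV. (if k = i then a ^ \<alpha> i else 1) * (if k = j then inverse a ^ \<alpha> j else 1))"
   unfolding tri_char_def using ij by (intro prod.cong) (auto simp: U_def)
  then have "tri_char \<alpha> (U a) = a ^ \<alpha> i * inverse a ^ \<alpha> j" by (simp add: prod.distrib)
  moreover have "q (L a ** U a) = tri_char \<alpha> (U a) * c"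
   using ij that by (intro eq) (auto simp: L_def U_def lower_tri_def upper_tri_def)
  ultimately show ?thesis by (simp add: LU[OF that])
 qed
 have "cpoly_fun (%a. X a $ k $ l)" for k l
 proof (cases "k = i & l = i")
  case True
  then show ?thesis by (simp add: X_def cpoly_fun_id)
 next
  case False
  then have "(%a. X a $ k $ l) = (%_. N k l)" by (auto simp: X_def fun_eq_iff)
  then show ?thesis by (simp only: cpoly_fun_const)
 qed
 from cpoly_fun_curve[OF q this] obtain Q where Q: "!!a. q (X a) = poly Q a" by (auto simp: cpoly_fun_def)
 have "poly (Q * monom 1 (\<alpha> j)) a = poly (monom c (\<alpha> i)) a" if "a ~= 0" for a
  using val[OF that] that by (simp add: Q poly_monom field_simps)
 then have "UNIV - {0} <= {a. poly (Q * monom 1 (\<alpha> j) - monom c (\<alpha> i)) a = 0}" by auto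
 moreover have "infinite (UNIV - {0 :: complex})" by (simp add: infinite_UNIV_char_0)
 ultimately have "Q * monom 1 (\<alpha> j) - monom c (\<alpha> i) = 0"
  using finite_subset poly_roots_finite by metis
 then have "coeff (monom 1 (\<alpha> j) * Q) (\<alpha> i) = coeff (monom c (\<alpha> i)) (\<alpha> i)" by (simp add: mult.commute)
 then show False using ij q1 by (simp add: coeff_monom_mult)
qed

text \<open>
  Lowest coefficients give a vector invariant under both unipotent groups; splitting it by the
  torus keeps it in the space. A joint eigenvector of this kind is a highest weight polynomial.
\<close>

theorem biinvariant_subspace_contains_hw_poly:
 fixes V :: "(('n::{finite,linorder}) cmat => complex) set"
 assumes V: "fun_subspace V" and poly: "!!p. p : V ==> polynomial_fun p"
  and right: "!!p B. p : V ==> invertible B ==> (%Z. p (Z ** B)) : V"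
  and left: "!!p A. p : V ==> invertible A ==> (%Z. p (A ** Z)) : V"
  and nz: "p0 : V" "p0 Z0 ~= 0"
 obtains \<alpha> \<Delta> where "antimono \<alpha>" "hw_poly \<alpha> \<Delta>" "\<Delta> : V"
proof -
 note VD = fun_subspaceD[OF V]
 define V1 where "V1 = {p\<in>V. ALL u Z. upper_tri u --> (ALL i. u $ i $ i = 1) --> p (Z ** u) = p Z}"
 have V1: "fun_subspace V1" using VD by (auto simp: fun_subspace_def V1_def)
 obtain p1 where p1: "p1 : V1" "p1 ~= (%_. 0)"
 proof -
  obtain K where K: "EX p:V. wcoeff height p K ~= (%_. 0)" "ALL p:V. wcoeff height p K : V"
   "ALL p:V. ALL u. upper_tri u --> (ALL i. u $ i $ i = 1) -->
    (ALL Z. wcoeff height p K (Z ** u) = wcoeff height p K Z)"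
   by (rule right_invariant_lowest_coefficient[OF V poly right nz])
  then obtain p where p: "p : V" "wcoeff height p K ~= (%_. 0)" by blast
  then have "wcoeff height p K : V1" using K(2,3) by (simp add: V1_def)
  from that[OF this p(2)] show ?thesis .
 qed
 then obtain Z1 where Z1: "p1 Z1 ~= 0" by auto
 have left1: "(%Z. p (A ** Z)) : V1" if "p : V1" "invertible A" for p A
  using left that by (auto simp: V1_def matrix_mul_assoc)
 have poly1: "polynomial_fun p" if "p : V1" for p using that poly by (simp add: V1_def)
 obtain p2 where p2: "p2 : V1" "p2 ~= (%_. 0)"
  "!!L Z. lower_tri L ==> ALL i. L $ i $ i = 1 ==> p2 (L ** Z) = p2 Z"
  using left_invariant_unipotent_vector[OF V1 poly1 left1 p1(1) Z1] by blast
 obtain Z2 where Z2: "p2 Z2 ~= 0" using p2(2) by auto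
 define V2 where "V2 = {p\<in>V1. ALL L Z. lower_tri L --> (ALL i. L $ i $ i = 1) --> p (L ** Z) = p Z}"
 have V2: "fun_subspace V2" using fun_subspaceD[OF V1] by (auto simp: fun_subspace_def V2_def)
 have p2V2: "p2 : V2" using p2 by (simp add: V2_def)
 have diag: "(%Z. p (Z ** dmat d)) : V2" if p: "p : V2" and d: "!!i. d i ~= 0" for p d
 proof -
  have "p (Z ** u ** dmat d) = p (Z ** dmat d)" if u: "upper_tri u" "ALL i. u $ i $ i = 1" for u Z
  proof -
   let ?u = "dmat (%i. inverse (d i)) ** u ** dmat d"
   have "dmat d ** ?u = dmat d ** dmat (%i. inverse (d i)) ** u ** dmat d"
    by (simp add: matrix_mul_assoc)
   also have "... = u ** dmat d" using d by (simp add: dmat_mult dmat_one)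
   finally have "Z ** u ** dmat d = Z ** dmat d ** ?u" by (simp add: matrix_mul_assoc[symmetric])
   moreover have "upper_tri ?u" "ALL i. ?u $ i $ i = 1"
    using u d by (auto simp: upper_tri_mult upper_tri_dmat)
   ultimately show ?thesis using p by (simp add: V2_def V1_def)
  qed
  moreover have "(%Z. p (Z ** dmat d)) : V"
   using p by (intro right invertible_dmat d) (simp add: V2_def V1_def)
  ultimately show ?thesis using p by (auto simp: V2_def V1_def matrix_mul_assoc[symmetric])
 qed
 have poly2: "polynomial_fun p" if "p : V2" for p using that poly1 by (simp add: V2_def)
 obtain q \<alpha> where q: "q : V2" "q ~= (%_. 0)" "!!Z d. q (Z ** dmat d) = (\<Prod>i\<in>UNIV. d i ^ \<alpha> i) * q Z"
  using torus_weight_vector[OF V2 poly2 diag p2V2 Z2] by blast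
 have eq: "q (L ** U) = tri_char \<alpha> U * q (mat 1)"
  if L: "lower_tri L" "ALL i. L $ i $ i = 1" and U: "upper_tri U" "ALL i. U $ i $ i ~= 0" for L U
 proof -
  let ?d = "%i. U $ i $ i" and ?u = "U ** dmat (%i. inverse (U $ i $ i))"
  have u: "upper_tri ?u" "ALL i. ?u $ i $ i = 1"
   using U by (auto simp: upper_tri_mult upper_tri_dmat)
  have "?u ** dmat ?d = U ** (dmat (%i. inverse (U $ i $ i)) ** dmat ?d)"
   by (simp add: matrix_mul_assoc)
  also have "... = U" using U by (simp add: dmat_mult dmat_one)
  finally have "q (L ** U) = q ((L ** ?u) ** dmat ?d)" by (simp add: matrix_mul_assoc[symmetric])
  also have "... = tri_char \<alpha> U * q (L ** mat 1 ** ?u)" by (simp add: q(3) tri_char_def)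
  also have "q (L ** mat 1 ** ?u) = q (L ** mat 1)" using q(1) u by (simp add: V2_def V1_def)
  also have "... = q (mat 1)" using q(1) L unfolding V2_def by blast
  finally show ?thesis .
 qed
 have q1: "q (mat 1) ~= 0"
 proof
  assume *: "q (mat 1) = 0"
  have "q Z = 0" for Z
   by (rule polynomial_fun_0_on_LU[OF poly2[OF q(1)]]) (simp add: eq *)
  with q(2) show False by auto
 qed
 have anti: "antimono \<alpha>" by (rule hw_weight_antimono[OF poly2[OF q(1)] q1 eq])
 then obtain \<Delta> where \<Delta>: "hw_poly \<alpha> \<Delta>" using hw_poly_exists by blast
 have "q = (%Z. q (mat 1) * \<Delta> Z)" by (rule hw_poly_unique[OF \<Delta> poly2[OF q(1)] eq])
 then have qZ: "q Z = q (mat 1) * \<Delta> Z" for Z by metis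
 have "\<Delta> = (%Z. inverse (q (mat 1)) * q Z)"
  by (rule ext, subst qZ) (simp add: q1)
 moreover have "q : V" using q(1) by (simp add: V2_def V1_def)
 ultimately have "\<Delta> : V" using VD(3) by metis
 from that[OF anti \<Delta> this] show ?thesis .
qed

section \<open>Finite-dimensional spaces of functions\<close>

interpretation cfun: vector_space "(%c f x. c * f x) :: complex => ('x => complex) => 'x => complex"
 by unfold_locales (auto simp: fun_eq_iff algebra_simps)

lemma fun_subspace_iff: "fun_subspace V \<longleftrightarrow> cfun.subspace V"
 unfolding fun_subspace_def cfun.subspace_def zero_fun_def plus_fun_def by auto

lemma fun_subspace_span: "fun_subspace (cfun.span S)"
 by (simp add: fun_subspace_iff cfun.subspace_span)

lemma span_le_fun_subspace: "S <= V ==> fun_subspace V ==> cfun.span S <= V"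
 by (simp add: fun_subspace_iff cfun.span_minimal)

lemma separable_finite_span:
 "separable F ==> EX T. finite T & (ALL A. F A : cfun.span T)"
proof (induction rule: separable.induct)
 case (base a r)
 have "(%Z. a A * r Z) : cfun.span {r}" for A
  by (rule fun_subspaceD(3)[OF fun_subspace_span]) (simp add: cfun.span_base)
 then show ?case by (intro exI[of _ "{r}"]) auto
next
 case (sum F G)
 then obtain S T where S: "finite S" "!!A. F A : cfun.span S" and T: "finite T" "!!A. G A : cfun.span T"
  by blast
 have "(%Z. F A Z + G A Z) : cfun.span (S \<union> T)" for A
  using S(2)[of A] T(2)[of A] cfun.span_mono[of S "S \<union> T"] cfun.span_mono[of T "S \<union> T"]
  by (intro fun_subspaceD(2)[OF fun_subspace_span]) auto
 then show ?case using S(1) T(1) by (intro exI[of _ "S \<union> T"]) auto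
qed

lemma translates_finite_span:
 fixes p :: "('n::finite) cmat => complex"
 assumes "polynomial_fun p"
 shows "EX T. finite T & (ALL A B. (%Z::'n cmat. p (A ** Z ** B)) : cfun.span T)"
proof -
 have "EX T. finite T & (ALL A B. (%Z::'n cmat. F B (A ** Z)) : cfun.span T)"
  if "separable F" for F :: "'n cmat => 'n cmat => complex"
  using that
 proof (induction rule: separable.induct)
  case (base a r)
  obtain T :: "('n cmat => complex) set" where T: "finite T" "!!A. (%Z. r (A ** Z)) : cfun.span T"
   using separable_finite_span[OF separable_mult_left[OF base(2)]] by blast
  have "(%Z. a B * r (A ** Z)) : cfun.span T" for A B
   by (rule fun_subspaceD(3)[OF fun_subspace_span T(2)])
  then show ?case using T(1) by blast
 next
  case (sum F G)
  then obtain S T :: "('n cmat => complex) set" where S: "finite S" "!!A B. (%Z. F B (A ** Z)) : cfun.span S"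
   and T: "finite T" "!!A B. (%Z. G B (A ** Z)) : cfun.span T"
   by blast
  have "(%Z. F B (A ** Z) + G B (A ** Z)) : cfun.span (S \<union> T)" for A B
   using S(2)[of B A] T(2)[of B A] cfun.span_mono[of S "S \<union> T"] cfun.span_mono[of T "S \<union> T"]
   by (intro fun_subspaceD(2)[OF fun_subspace_span]) auto
  then show ?case using S(1) T(1) by (intro exI[of _ "S \<union> T"]) auto
 qed
 from this[OF separable_mult_right[OF assms]] show ?thesis .
qed

inductive eval_comb :: "'x set => (('x => complex) => complex) => bool" for X where
 eval: "x : X ==> eval_comb X (%f. f x)"
| add: "eval_comb X l ==> eval_comb X l' ==> eval_comb X (%f. l f + l' f)"
| scale: "eval_comb X l ==> eval_comb X (%f. c * l f)"

lemma eval_comb_linear: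
 assumes "eval_comb X l"
 shows "l (%x. f x + g x) = l f + l g" "l (%x. c * f x) = c * l f"
 using assms by (induction, auto simp: algebra_simps)

lemma eval_comb_zero: "eval_comb X l ==> l (%_. 0) = 0"
 using eval_comb_linear(2)[of X l 0 "%_. 0"] by simp

lemma eval_comb_sum:
 assumes "eval_comb X l"
 shows "l (%x. \<Sum>i\<in>I. c i * f i x) = (\<Sum>i\<in>I. c i * l (f i))"
 by (induction I rule: infinite_finite_induct)
  (auto simp: eval_comb_zero[OF assms] eval_comb_linear[OF assms])

lemma eval_comb_0: "x : X ==> eval_comb X (%f. 0)"
 using eval_comb.scale[OF eval_comb.eval[of x X], of 0] by simp

lemma eval_comb_sum_comb:
 assumes "x0 : X" "!!i. i : I ==> eval_comb X (l i)"
 shows "eval_comb X (%f. \<Sum>i\<in>I. c i * l i f)"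
 using assms(2)
proof (induction I rule: infinite_finite_induct)
 case (insert i I)
 then have "eval_comb X (%f. c i * l i f + (\<Sum>i\<in>I. c i * l i f))"
  by (intro eval_comb.add eval_comb.scale) auto
 then show ?case using insert by simp
qed (simp_all add: eval_comb_0[OF assms(1)])

text \<open>
  Evaluations at points separate functions, so a finite-dimensional space of functions has dual
  bases consisting of combinations of evaluations. Such functionals act polynomially on translates.
\<close>

lemma dual_evaluations:
 fixes e :: "nat => 'x => complex"
 assumes "!!c. (!!x. x : X ==> (\<Sum>j<d. c j * e j x) = 0) ==> ALL j<d. c j = 0"
 shows "EX l. (ALL i<d. eval_comb X (l i)) & (ALL i<d. ALL j<d. l i (e j) = (if i = j then 1 else 0))"
 using assms
proof (induction d)
 case 0
 then show ?case by simp
next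
 case (Suc d)
 have "ALL j<d. c j = 0" if c: "!!x. x : X ==> (\<Sum>j<d. c j * e j x) = 0" for c
 proof -
  have "ALL j<Suc d. (c(d := 0)) j = 0"
   by (rule Suc.prems) (use c in simp)
  then show ?thesis by (metis fun_upd_apply less_Suc_eq nat_neq_iff)
 qed
 from Suc.IH[OF this] obtain l where l: "!!i. i < d ==> eval_comb X (l i)"
  "!!i j. i < d ==> j < d ==> l i (e j) = (if i = j then 1 else 0)" by blast
 define r where "r x = e d x - (\<Sum>i<d. l i (e d) * e i x)" for x
 obtain x where x: "x : X" "r x ~= 0"
 proof (rule ccontr)
  assume "\<not> thesis"
  with that have 0: "!!x. x : X ==> r x = 0" by blast
  have "ALL j<Suc d. ((%j. - l j (e d))(d := 1)) j = 0"
  proof (rule Suc.prems)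
   fix x assume "x : X"
   then show "(\<Sum>j<Suc d. ((%j. - l j (e d))(d := 1)) j * e j x) = 0"
    using 0[of x] by (simp add: r_def sum_negf)
  qed
  then show False by auto
 qed
 define l' where "l' f = inverse (r x) * (f x + (\<Sum>i<d. - e i x * l i f))" for f
 have l': "eval_comb X l'"
  unfolding l'_def using l(1) x(1)
  by (intro eval_comb.scale eval_comb.add eval_comb.eval eval_comb_sum_comb[where ?x0.0 = x]) auto
 have l'_old: "l' (e j) = 0" if "j < d" for j
 proof -
  have "(\<Sum>i<d. - e i x * l i (e j)) = (\<Sum>i<d. if i = j then - e j x else 0)"
   using l(2) that by (intro sum.cong) auto
  then show ?thesis using that by (simp add: l'_def)
 qed
 have l'_new: "l' (e d) = 1"
 proof -
  have "e d x + (\<Sum>i<d. - e i x * l i (e d)) = r x"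
   by (simp add: r_def sum_negf mult.commute)
  then show ?thesis using x(2) by (simp add: l'_def)
 qed
 define L where "L i = (if i = d then l' else (%f. l i f + (- l i (e d)) * l' f))" for i
 have "eval_comb X (L i)" if "i < Suc d" for i
 proof (cases "i = d")
  case False
  then have "eval_comb X (l i)" using l(1) that by simp
  then have "eval_comb X (%f. l i f + (- l i (e d)) * l' f)"
   by (rule eval_comb.add[OF _ eval_comb.scale[OF l']])
  then show ?thesis using False by (simp add: L_def)
 qed (simp add: L_def l')
 moreover have "L i (e j) = (if i = j then 1 else 0)" if "i < Suc d" "j < Suc d" for i j
  using that l(2)[of i j] l'_old[of j] l'_new by (cases "i = d"; cases "j = d") (auto simp: L_def)
 ultimately show ?case by blast
qed

section \<open>The module generated by a highest weight polynomial\<close>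

text \<open>
  The bi-module will turn out to be the component of weight \<open>\<mu>\<close>, and the right module its
  factor \<open>W\<close>.
\<close>

locale hw_module =
 fixes \<mu> :: "'n::{finite,linorder} => nat" and \<Delta> :: "'n cmat => complex"
 assumes hw: "hw_poly \<mu> \<Delta>"
begin

definition right_module :: "('n cmat => complex) set" where
 "right_module = cfun.span {%Z. \<Delta> (Z ** B) | B. invertible B}"

definition bi_module :: "('n cmat => complex) set" where
 "bi_module = cfun.span {%Z. \<Delta> (A ** Z ** B) | A B. invertible A & invertible B}"

lemma fun_subspace_right_module: "fun_subspace right_module"
 and fun_subspace_bi_module: "fun_subspace bi_module"
 by (simp_all add: right_module_def bi_module_def fun_subspace_span)

lemma invertible_mat_1: "invertible (mat 1 :: 'n cmat)"
 by (simp add: invertible_det_nz)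

lemma generator_in_bi_module: "invertible A ==> invertible B ==> (%Z. \<Delta> (A ** Z ** B)) : bi_module"
 unfolding bi_module_def by (rule cfun.span_base) blast

lemma generator_in_right_module: "invertible B ==> (%Z. \<Delta> (Z ** B)) : right_module"
 unfolding right_module_def by (rule cfun.span_base) blast

lemma hw_in_right_module: "\<Delta> : right_module"
 using generator_in_right_module[OF invertible_mat_1] by simp

lemma hw_in_bi_module: "\<Delta> : bi_module"
 using generator_in_bi_module[OF invertible_mat_1 invertible_mat_1] by simp

lemma right_module_le:
 assumes "fun_subspace V" "!!B. invertible B ==> (%Z. \<Delta> (Z ** B)) : V"
 shows "right_module <= V"
 unfolding right_module_def by (rule span_le_fun_subspace) (use assms in auto)

lemma bi_module_le:
 assumes "fun_subspace V" "!!A B. invertible A ==> invertible B ==> (%Z. \<Delta> (A ** Z ** B)) : V"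
 shows "bi_module <= V"
 unfolding bi_module_def by (rule span_le_fun_subspace) (use assms in auto)

lemma fun_subspace_polynomial_fun: "fun_subspace (Collect polynomial_fun)"
 by (auto simp: fun_subspace_def intro: polynomial_fun.intros polynomial_fun_cmult)

lemma bi_module_polynomial: "p : bi_module ==> polynomial_fun p"
 using bi_module_le[OF fun_subspace_polynomial_fun] hw_polyD(1)[OF hw]
 by (auto intro: polynomial_fun_translate)

lemma right_module_polynomial: "p : right_module ==> polynomial_fun p"
 using right_module_le[OF fun_subspace_polynomial_fun]
  polynomial_fun_translate[OF hw_polyD(1)[OF hw], of "mat 1"] by auto

lemma bi_module_invariant:
 assumes "invertible A" "invertible B" "p : bi_module"
 shows "(%Z. p (A ** Z ** B)) : bi_module"
proof -
 let ?V = "{p. (%Z. p (A ** Z ** B)) : bi_module}"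
 have "bi_module <= ?V"
 proof (rule bi_module_le)
  show "fun_subspace ?V"
   using fun_subspaceD[OF fun_subspace_bi_module] by (auto simp: fun_subspace_def)
  fix A' B' :: "'n cmat" assume "invertible A'" "invertible B'"
  then have "(%Z. \<Delta> ((A' ** A) ** Z ** (B ** B'))) : bi_module"
   using assms by (intro generator_in_bi_module invertible_mult)
  then show "(%Z. \<Delta> (A' ** Z ** B')) : ?V" by (simp add: matrix_mul_assoc)
 qed
 then show ?thesis using assms(3) by auto
qed

lemma right_module_invariant:
 assumes "invertible B" "p : right_module"
 shows "(%Z. p (Z ** B)) : right_module"
proof -
 let ?V = "{p. (%Z. p (Z ** B)) : right_module}"
 have "right_module <= ?V"
 proof (rule right_module_le)
  show "fun_subspace ?V"
   using fun_subspaceD[OF fun_subspace_right_module] by (auto simp: fun_subspace_def)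
  fix B' :: "'n cmat" assume "invertible B'"
  then have "(%Z. \<Delta> (Z ** (B ** B'))) : right_module"
   using assms by (intro generator_in_right_module invertible_mult)
  then show "(%Z. \<Delta> (Z ** B')) : ?V" by (simp add: matrix_mul_assoc)
 qed
 then show ?thesis using assms(2) by auto
qed

lemma right_module_left_translate:
 assumes "invertible A" "p : right_module"
 shows "(%Z. p (A ** Z)) : bi_module"
proof -
 let ?V = "{p. (%Z. p (A ** Z)) : bi_module}"
 have "right_module <= ?V"
 proof (rule right_module_le)
  show "fun_subspace ?V"
   using fun_subspaceD[OF fun_subspace_bi_module] by (auto simp: fun_subspace_def)
  show "(%Z. \<Delta> (Z ** B)) : ?V" if "invertible B" for B
   using generator_in_bi_module[OF assms(1) that] by simp
 qed
 then show ?thesis using assms(2) by auto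
qed

lemma right_module_lower:
 assumes "lower_tri L" "p : right_module"
 shows "p (L ** Z) = tri_char \<mu> L * p Z"
proof -
 have "right_module <= {p. ALL Z. p (L ** Z) = tri_char \<mu> L * p Z}"
 proof (rule right_module_le)
  show "fun_subspace {p. ALL Z. p (L ** Z) = tri_char \<mu> L * p Z}"
   by (auto simp: fun_subspace_def algebra_simps)
  show "(%Z. \<Delta> (Z ** B)) : {p. ALL Z. p (L ** Z) = tri_char \<mu> L * p Z}" for B
   using hw_polyD(3)[OF hw assms(1)] by (simp flip: matrix_mul_assoc)
 qed
 then show ?thesis using assms(2) by auto
qed

lemma right_module_unipotent_vector:
 assumes q: "q : right_module"
  and inv: "!!u Z. upper_tri u ==> ALL i. u $ i $ i = 1 ==> q (Z ** u) = q Z"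
 shows "q = (%Z. q (mat 1) * \<Delta> Z)"
proof (rule hw_poly_unique[OF hw right_module_polynomial[OF q]])
 fix L U :: "'n cmat"
 assume L: "lower_tri L" "ALL i. L $ i $ i = 1" and U: "upper_tri U" "ALL i. U $ i $ i ~= 0"
 let ?D = "dmat (%i. U $ i $ i)" and ?u = "dmat (%i. inverse (U $ i $ i)) ** U"
 have u: "upper_tri ?u" "ALL i. ?u $ i $ i = 1"
  using U by (auto simp: upper_tri_mult upper_tri_dmat)
 have "?D ** ?u = (?D ** dmat (%i. inverse (U $ i $ i))) ** U" by (simp add: matrix_mul_assoc)
 also have "... = U" using U by (simp add: dmat_mult dmat_one)
 finally have "q (L ** U) = q ((L ** ?D) ** ?u)" by (simp add: matrix_mul_assoc[symmetric])
 also have "... = q ((L ** ?D) ** mat 1)" using inv[OF u] by simp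
 also have "... = tri_char \<mu> (L ** ?D) * q (mat 1)"
  by (rule right_module_lower[OF _ q]) (simp add: lower_tri_mult L lower_tri_dmat)
 also have "tri_char \<mu> (L ** ?D) = tri_char \<mu> U"
  unfolding tri_char_def using L by (intro prod.cong) (auto simp: lower_tri_mult lower_tri_dmat)
 finally show "q (L ** U) = tri_char \<mu> U * q (mat 1)" .
qed

lemma right_module_irreducible:
 assumes V: "fun_subspace V" "V <= right_module"
  and inv: "!!p B. p : V ==> invertible B ==> (%Z. p (Z ** B)) : V"
  and nz: "p0 : V" "p0 Z0 ~= 0"
 shows "V = right_module"
proof -
 have poly: "!!p. p : V ==> polynomial_fun p" using V(2) right_module_polynomial by blast
 obtain K where K: "EX p:V. wcoeff height p K ~= (%_. 0)" "ALL p:V. wcoeff height p K : V"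
  "ALL p:V. ALL u. upper_tri u --> (ALL i. u $ i $ i = 1) -->
   (ALL Z. wcoeff height p K (Z ** u) = wcoeff height p K Z)"
  by (rule right_invariant_lowest_coefficient[OF V(1) poly inv nz])
 then obtain q where q: "q : V" "q ~= (%_. 0)"
  "!!u Z. upper_tri u ==> ALL i. u $ i $ i = 1 ==> q (Z ** u) = q Z" by blast
 have eq: "q = (%Z. q (mat 1) * \<Delta> Z)"
  using V(2) q by (intro right_module_unipotent_vector) auto
 have q1: "q (mat 1) ~= 0"
 proof
  assume 0: "q (mat 1) = 0"
  have "q = (%_. 0)" by (subst eq) (simp add: 0)
  with q(2) show False by simp
 qed
 have qZ: "q Z = q (mat 1) * \<Delta> Z" for Z by (rule fun_cong[OF eq])
 have "\<Delta> = (%Z. inverse (q (mat 1)) * q Z)" by (rule ext, subst qZ) (simp add: q1)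
 then have "\<Delta> : V" using fun_subspaceD(3)[OF V(1) q(1)] by metis
 then have "right_module <= V" by (intro right_module_le V(1) inv)
 then show ?thesis using V(2) by blast
qed

definition lowest :: nat where
 "lowest = (\<Sum>i\<in>UNIV. height i * \<mu> i)"

lemma right_module_wcoeff_one:
 assumes "p : right_module"
 shows "wcoeff height p k (mat 1) = (if k = lowest then p (mat 1) else 0)"
proof -
 have "p (mat 1 ** torus height s) = poly (monom (p (mat 1)) lowest) s" for s
 proof -
  have "p (torus height s ** mat 1) = tri_char \<mu> (torus height s) * p (mat 1)"
   by (rule right_module_lower[OF _ assms]) (simp add: torus_def lower_tri_dmat)
  also have "tri_char \<mu> (torus height s) = s ^ lowest"
   by (simp add: tri_char_def torus_def lowest_def power_sum power_mult)
  finally show ?thesis by (simp add: poly_monom mult.commute)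
 qed
 from wcoeff_eqI[of p, OF this] show ?thesis by simp
qed

lemma right_module_lowest_coefficient:
 assumes p: "p : right_module"
 shows "wcoeff height p lowest Z = p (mat 1) * \<Delta> Z"
proof -
 obtain K where K: "EX p:right_module. wcoeff height p K ~= (%_. 0)"
  "ALL p:right_module. wcoeff height p K : right_module"
  "ALL p:right_module. ALL u. upper_tri u --> (ALL i. u $ i $ i = 1) -->
   (ALL Z. wcoeff height p K (Z ** u) = wcoeff height p K Z)"
  by (rule right_invariant_lowest_coefficient[OF fun_subspace_right_module right_module_polynomial
     right_module_invariant hw_in_right_module, of "mat 1"]) (auto simp: hw_polyD(2)[OF hw])
 have eq: "wcoeff height p K = (%Z. wcoeff height p K (mat 1) * \<Delta> Z)" if "p : right_module" for p
  using K(2,3) that by (intro right_module_unipotent_vector) auto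
 obtain q where q: "q : right_module" "wcoeff height q K ~= (%_. 0)" using K(1) by blast
 have "K = lowest"
 proof (rule ccontr)
  assume "K ~= lowest"
  then have 0: "wcoeff height q K (mat 1) = 0" by (simp add: right_module_wcoeff_one[OF q(1)])
  have "wcoeff height q K = (%_. 0)" by (subst eq[OF q(1)]) (simp add: 0)
  with q(2) show False by simp
 qed
 then show ?thesis
  using fun_cong[OF eq[OF p], of Z] by (simp add: right_module_wcoeff_one[OF p])
qed

lemma right_module_basis:
 "\<exists>(d::nat) e. (ALL j<d. e j : right_module) \<and>
  (ALL p:right_module. EX c. ALL Z. p Z = (\<Sum>j<d. c j * e j Z)) \<and>
  (ALL c. (ALL Z. invertible Z --> (\<Sum>j<d. c j * e j Z) = 0) --> (ALL j<d. c j = 0))"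
proof -
 obtain T :: "('n cmat => complex) set" where T: "finite T" "!!A B. (%Z. \<Delta> (A ** Z ** B)) : cfun.span T"
  using translates_finite_span[OF hw_polyD(1)[OF hw]] by blast
 have WT: "right_module <= cfun.span T"
  by (rule right_module_le[OF fun_subspace_span]) (use T(2)[of "mat 1"] in simp)
 obtain B where B: "B <= right_module" "cfun.independent B" "right_module <= cfun.span B"
  using cfun.maximal_independent_subset[of right_module] by blast
 have finB: "finite B"
  using cfun.independent_span_bound[OF T(1) B(2)] B(1) WT by blast
 define d where "d = card B"
 obtain e where e: "bij_betw e {..<d} B"
  using ex_bij_betw_nat_finite[OF finB] by (auto simp: d_def atLeast0LessThan)
 have eB: "e j : right_module" if "j < d" for j
  using e B(1) that by (auto simp: bij_betw_def)
 have span: "EX c. ALL Z. p Z = (\<Sum>j<d. c j * e j Z)" if p: "p : right_module" for p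
 proof -
  have "cfun.span B <= {p. EX c. ALL Z. p Z = (\<Sum>j<d. c j * e j Z)}"
  proof (rule span_le_fun_subspace)
   show "B <= {p. EX c. ALL Z. p Z = (\<Sum>j<d. c j * e j Z)}"
   proof
    fix b assume "b : B"
    then obtain i where i: "i < d" "b = e i" using e by (auto simp: bij_betw_def)
    have "b Z = (\<Sum>j<d. (if j = i then 1 else 0) * e j Z)" for Z
    proof -
     have "(\<Sum>j<d. (if j = i then 1 else 0) * e j Z) = (\<Sum>j<d. if j = i then e i Z else 0)"
      by (rule sum.cong) auto
     then show ?thesis using i by simp
    qed
    then show "b : {p. EX c. ALL Z. p Z = (\<Sum>j<d. c j * e j Z)}"
     unfolding mem_Collect_eq by (intro exI allI)
   qed
   show "fun_subspace {p. EX c. ALL Z. p Z = (\<Sum>j<d. c j * e j Z)}"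
    unfolding fun_subspace_def
   proof (intro conjI ballI allI)
    show "(%_. 0) : {p. EX c. ALL Z. p Z = (\<Sum>j<d. c j * e j Z)}"
     by (auto intro!: exI[of _ "%_. 0"])
    fix f g assume "f : {p. EX c. ALL Z. p Z = (\<Sum>j<d. c j * e j Z)}"
     "g : {p. EX c. ALL Z. p Z = (\<Sum>j<d. c j * e j Z)}"
    then obtain a b where "ALL Z. f Z = (\<Sum>j<d. a j * e j Z)" "ALL Z. g Z = (\<Sum>j<d. b j * e j Z)" by blast
    then have "ALL Z. f Z + g Z = (\<Sum>j<d. (a j + b j) * e j Z)"
     by (simp add: distrib_right sum.distrib)
    then show "(%x. f x + g x) : {p. EX c. ALL Z. p Z = (\<Sum>j<d. c j * e j Z)}"
     unfolding mem_Collect_eq by (rule exI[of _ "%j. a j + b j"])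
   next
    fix c f assume "f : {p. EX c. ALL Z. p Z = (\<Sum>j<d. c j * e j Z)}"
    then obtain a where "ALL Z. f Z = (\<Sum>j<d. a j * e j Z)" by blast
    then have "ALL Z. c * f Z = (\<Sum>j<d. (c * a j) * e j Z)" by (simp add: sum_distrib_left mult.assoc)
    then show "(%x. c * f x) : {p. EX c. ALL Z. p Z = (\<Sum>j<d. c j * e j Z)}"
     unfolding mem_Collect_eq by (rule exI[of _ "%j. c * a j"])
   qed
  qed
  then show ?thesis using B(3) p by blast
 qed
 have indep: "ALL j<d. c j = 0" if c: "!!Z. invertible Z ==> (\<Sum>j<d. c j * e j Z) = 0" for c
 proof -
  have "polynomial_fun (%Z. \<Sum>j<d. c j * e j Z)"
   by (intro polynomial_fun_sum polynomial_fun_cmult right_module_polynomial eB) auto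
  from polynomial_fun_0_on_invertible[OF this c] have 0: "(\<Sum>j<d. c j * e j Z) = 0" for Z .
  define u where "u b = c (inv_into {..<d} e b)" for b
  have ue: "u (e j) = c j" if "j < d" for j
   using e that by (simp add: u_def bij_betw_def inv_into_f_f)
  have "(\<Sum>b\<in>B. (%x. u b * b x)) = (%_. 0)"
  proof
   fix Z
   have "(\<Sum>b\<in>B. (%x. u b * b x)) Z = (\<Sum>b\<in>B. u b * b Z)"
    using finB by (induction B rule: finite_induct) (auto simp: plus_fun_def zero_fun_def)
   also have "... = (\<Sum>j<d. u (e j) * e j Z)"
    by (rule sum.reindex_bij_betw[OF e, symmetric])
   also have "... = 0" using 0[of Z] by (simp add: ue)
   finally show "(\<Sum>b\<in>B. (%x. u b * b x)) Z = 0" .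
  qed
  then have "(\<Sum>b\<in>B. (%x. u b * b x)) = 0" by (simp add: zero_fun_def)
  from cfun.independentD[OF B(2) finB order_refl this] have "u b = 0" if "b : B" for b
   using that by blast
  then show ?thesis using ue e by (force simp: bij_betw_def)
 qed
 show ?thesis by (rule exI[of _ d], rule exI[of _ e]) (use eB span indep in blast)
qed

end

lemma wcoeff_linear:
 assumes p: "polynomial_fun p" and q: "polynomial_fun q"
 shows "wcoeff w (%Z. p Z + q Z) k Z = wcoeff w p k Z + wcoeff w q k Z"
  "wcoeff w (%Z. c * p Z) k Z = c * wcoeff w p k Z"
proof -
 obtain P where P: "!!s. p (Z ** torus w s) = poly P s" "!!k. wcoeff w p k Z = coeff P k"
  using wcoeff_poly[OF p, of Z w] by blast
 obtain Q where Q: "!!s. q (Z ** torus w s) = poly Q s" "!!k. wcoeff w q k Z = coeff Q k"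
  using wcoeff_poly[OF q, of Z w] by blast
 show "wcoeff w (%Z. p Z + q Z) k Z = wcoeff w p k Z + wcoeff w q k Z"
  using wcoeff_eqI[of "%Z. p Z + q Z" Z w "P + Q" k] by (simp add: P Q)
 show "wcoeff w (%Z. c * p Z) k Z = c * wcoeff w p k Z"
  using wcoeff_eqI[of "%Z. c * p Z" Z w "Polynomial.smult c P" k] by (simp add: P)
qed

lemma wcoeff_left_translate: "wcoeff w (%Z. p (A ** Z)) k Z = wcoeff w p k (A ** Z)"
 by (simp add: wcoeff_def matrix_mul_assoc)

lemma wcoeff_const_zero: "wcoeff w (%_. 0) k Z = 0"
 using wcoeff_eqI[of "%_. 0" Z w 0 k] by simp

lemma eval_comb_translate_polynomial:
 assumes "eval_comb X l" "polynomial_fun p"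
 shows "polynomial_fun (%Z. l (%Y. p (Y ** Z)))"
 using assms(1)
proof induction
 case (eval x)
 show ?case using polynomial_fun_translate[OF assms(2), of x "mat 1"] by simp
qed (auto intro: polynomial_fun.add polynomial_fun_cmult)

lemma wcoeff_eval_comb:
 assumes "eval_comb X l" "polynomial_fun p"
 shows "wcoeff w (%Z. l (%Y. p (Y ** Z))) k Z = l (%Y. wcoeff w p k (Y ** Z))"
 using assms(1)
proof induction
 case (add l l')
 then show ?case
  using wcoeff_linear(1)[OF eval_comb_translate_polynomial[OF add.hyps(1) assms(2)]
   eval_comb_translate_polynomial[OF add.hyps(2) assms(2)]] by simp
next
 case (scale l c)
 have poly: "polynomial_fun (%Z. l (%Y. p (Y ** Z)))"
  using scale.hyps assms(2) by (rule eval_comb_translate_polynomial)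
 show ?case using wcoeff_linear(2)[OF poly poly] scale.IH by simp
qed (simp add: wcoeff_left_translate)

lemma wcoeff_sum:
 assumes "!!i. i : I ==> polynomial_fun (p i)"
 shows "wcoeff w (%Z. \<Sum>i\<in>I. c i * p i Z) k Z = (\<Sum>i\<in>I. c i * wcoeff w (p i) k Z)"
 using assms
proof (induction I rule: infinite_finite_induct)
 case (insert i I)
 have pi: "polynomial_fun (%Z. c i * p i Z)" "polynomial_fun (p i)"
  "polynomial_fun (%Z. \<Sum>i\<in>I. c i * p i Z)"
  using insert.prems by (auto intro!: polynomial_fun_sum polynomial_fun_cmult)
 show ?case
  using insert by (simp add: wcoeff_linear(1)[OF pi(1,3)] wcoeff_linear(2)[OF pi(2,2)])
qed (simp_all add: wcoeff_const_zero)

lemma mult_mat_vec_index: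
 assumes "A : carrier_mat d d" "v : carrier_vec d" "i < d"
 shows "vec_index (A *\<^sub>v v) i = (\<Sum>j<d. A $$ (i, j) * vec_index v j)"
 using assms by (simp add: scalar_prod_def atLeast0LessThan)

lemma mult_mat_index:
 assumes "A : carrier_mat d d" "B : carrier_mat d d" "i < d" "j < d"
 shows "(A * B) $$ (i, j) = (\<Sum>k<d. A $$ (i, k) * B $$ (k, j))"
 using assms by (simp add: scalar_prod_def atLeast0LessThan)

lemma matrix_inv_matrix_inv:
 fixes A :: "('n::finite) cmat"
 assumes "invertible A"
 shows "invertible (matrix_inv A)" "matrix_inv (matrix_inv A) = A"
proof -
 note I = matrix_inv_left[OF assms] matrix_inv_right[OF assms]
 show inv: "invertible (matrix_inv A)" unfolding invertible_def using I by blast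
 have "matrix_inv (matrix_inv A) = (A ** matrix_inv A) ** matrix_inv (matrix_inv A)"
  by (simp add: I)
 also have "... = A" by (simp add: matrix_mul_assoc[symmetric] matrix_inv_right[OF inv])
 finally show "matrix_inv (matrix_inv A) = A" .
qed

context hw_module begin

lemma poly_submodule_bi_module: "poly_submodule bi_module"
 unfolding poly_submodule_def poly_act_def
 using bi_module_polynomial fun_subspace_bi_module bi_module_invariant matrix_inv_matrix_inv(1) by blast

section \<open>Identification of the components\<close>

text \<open>
  In a basis \<open>e\<^sub>i\<close> of the right module, the matrix coefficients \<open>\<rho>\<^sub>i\<^sub>j\<close> are polynomials, and the map
  sending a matrix \<open>X\<close> to \<open>\<Sum> X\<^sub>i\<^sub>j \<rho>\<^sub>i\<^sub>j\<close> is equivariant. For injectivity take lowest-order coefficients along a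
  one-parameter group of diagonal matrices: a function \<open>w\<close> of the right module degenerates to
  \<open>w(1) \<Delta>\<close>, which isolates values of \<open>w\<close> at points of the group.
\<close>

theorem bi_module_is_dual_tensor:
 assumes m: "!!i. m $ i = int (\<mu> i)"
 shows "EX d \<rho>. rational_rep d \<rho> & irreducible_rep d \<rho> & has_highest_weight d \<rho> m \<and>
  iso_dual_tensor d \<rho> bi_module"
proof -
 obtain d :: nat and e :: "nat => 'n cmat => complex" where basis: "ALL j<d. e j : right_module"
  "ALL p:right_module. EX c. ALL Z. p Z = (\<Sum>j<d. c j * e j Z)"
  "ALL c. (ALL Z. invertible Z --> (\<Sum>j<d. c j * e j Z) = 0) --> (ALL j<d. c j = 0)"
  using right_module_basis by blast
 note e = basis(1)[rule_format] and span = basis(2)[rule_format]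
 have indep: "ALL j<d. c j = 0" if "!!Z. invertible Z ==> (\<Sum>j<d. c j * e j Z) = 0" for c
  using basis(3) that by blast
 let ?X = "Collect invertible :: 'n cmat set"
 have "EX l. (ALL i<d. eval_comb ?X (l i)) & (ALL i<d. ALL j<d. l i (e j) = (if i = j then 1 else 0))"
  by (rule dual_evaluations, rule indep) simp
 then obtain l where dl: "ALL i<d. eval_comb ?X (l i)" "ALL i<d. ALL j<d. l i (e j) = (if i = j then 1 else 0)"
  by blast
 note l = dl(1)[rule_format] and dual = dl(2)[rule_format]
 have poly_e: "polynomial_fun (e j)" if "j < d" for j using e[OF that] by (rule right_module_polynomial)
 have coords: "p Z = (\<Sum>i<d. l i p * e i Z)" if p: "p : right_module" for p Z
 proof -
  obtain c where c: "!!Z. p Z = (\<Sum>j<d. c j * e j Z)" using span[OF p] by blast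
  have "l i p = c i" if i: "i < d" for i
  proof -
   have "p = (%Z. \<Sum>j<d. c j * e j Z)" using c by auto
   then have "l i p = (\<Sum>j<d. c j * l i (e j))" by (simp add: eval_comb_sum[OF l[OF i]])
   also have "... = (\<Sum>j<d. if j = i then c i else 0)" by (rule sum.cong) (auto simp: dual i)
   finally show ?thesis using i by simp
  qed
  then show ?thesis by (simp add: c)
 qed
 define r where "r i j Z = l i (%Y. e j (Y ** Z))" for i j and Z :: "'n cmat"
 define \<rho> where "\<rho> Z = Matrix.mat d d (%(i, j). r i j Z)" for Z
 have \<rho>_carrier: "\<rho> Z : carrier_mat d d" for Z by (simp add: \<rho>_def)
 have \<rho>_index: "i < d ==> j < d ==> \<rho> Z $$ (i, j) = r i j Z" for i j Z by (simp add: \<rho>_def)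
 have poly_r: "polynomial_fun (r i j)" if "i < d" "j < d" for i j
  unfolding r_def using l[OF that(1)] poly_e[OF that(2)] by (rule eval_comb_translate_polynomial)
 have act: "e j (Z ** B) = (\<Sum>i<d. r i j B * e i Z)" if B: "invertible B" and j: "j < d" for j Z B
  unfolding r_def by (rule coords[OF right_module_invariant[OF B e[OF j]]])
 have r_mult': "r i j (A ** B) = (\<Sum>k<d. r i k A * r k j B)" if B: "invertible B" and ij: "i < d" "j < d" for i j A B
 proof -
  have "r i j (A ** B) = l i (%Y. \<Sum>k<d. r k j B * e k (Y ** A))"
   by (simp add: r_def[of i j] matrix_mul_assoc act[OF B ij(2)])
  also have "... = (\<Sum>k<d. r k j B * r i k A)"
   by (simp add: eval_comb_sum[OF l[OF ij(1)]] r_def[of i])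
  finally show ?thesis by (simp add: mult.commute)
 qed
 have r_mult: "r i j (A ** B) = (\<Sum>k<d. r i k A * r k j B)" if ij: "i < d" "j < d" for i j A B
 proof -
  have "polynomial_fun (%B. r i j (A ** B) - (\<Sum>k<d. r i k A * r k j B))"
   using polynomial_fun_translate[OF poly_r[OF ij], of A "mat 1"] ij
   by (intro polynomial_fun_diff polynomial_fun_sum polynomial_fun_cmult poly_r) auto
  from polynomial_fun_0_on_invertible[OF this, of B] show ?thesis using r_mult'[OF _ ij] by simp
 qed
 have r_1: "r i j (mat 1) = (if i = j then 1 else 0)" if "i < d" "j < d" for i j
  using that by (simp add: r_def dual)
 have rational: "rational_rep d \<rho>"
  unfolding rational_rep_def
 proof (intro conjI allI impI)
  show "\<rho> A : carrier_mat d d" for A by (rule \<rho>_carrier)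
  show "\<rho> (mat 1) = 1\<^sub>m d" by (rule eq_matI) (simp_all add: \<rho>_def r_1)
  show "\<rho> (A ** B) = \<rho> A * \<rho> B" for A B
  proof (rule eq_matI)
   fix i j assume "i < dim_row (\<rho> A * \<rho> B)" "j < dim_col (\<rho> A * \<rho> B)"
   then have "i < d" "j < d" by (simp_all add: \<rho>_def)
   then show "\<rho> (A ** B) $$ (i, j) = (\<rho> A * \<rho> B) $$ (i, j)"
    by (simp add: mult_mat_index[OF \<rho>_carrier \<rho>_carrier] \<rho>_index r_mult)
  qed (simp_all add: \<rho>_def)
  fix i j assume "i < d" "j < d"
  then show "EX p k. polynomial_fun p & (ALL A. invertible A --> \<rho> A $$ (i, j) = p A / det A ^ k)"
   by (intro exI[of _ "r i j"] exI[of _ 0]) (simp add: poly_r \<rho>_index)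
 qed
 define \<delta> where "\<delta> i = l i \<Delta>" for i
 have hw_coords: "\<Delta> Z = (\<Sum>i<d. \<delta> i * e i Z)" for Z
  using coords[OF hw_in_right_module] by (simp add: \<delta>_def)
 have d0: "d > 0"
  using hw_coords[of "mat 1"] hw_polyD(2)[OF hw] by (cases d) auto
 define vf where "vf u Z = (\<Sum>i<d. vec_index u i * e i Z)" for u :: "complex Matrix.vec" and Z
 have vf_right: "vf u : right_module" for u
 proof -
  have "(%Z. \<Sum>i\<in>I. vec_index u i * e i Z) : right_module" if "I <= {..<d}" for I
   using finite_subset[OF that finite_lessThan] that
  proof (induction I rule: finite_induct)
   case empty
   then show ?case using fun_subspaceD(1)[OF fun_subspace_right_module] by simp
  next
   case (insert i I)
   then have "(%Z. vec_index u i * e i Z + (\<Sum>i\<in>I. vec_index u i * e i Z)) : right_module"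
    by (intro fun_subspaceD(2)[OF fun_subspace_right_module] fun_subspaceD(3)[OF fun_subspace_right_module] e) auto
   then show ?case using insert by simp
  qed
  from this[of "{..<d}"] show ?thesis by (simp add: vf_def[abs_def])
 qed
 have l_vf: "l i (vf u) = vec_index u i" if "i < d" for i u
 proof -
  have "l i (vf u) = (\<Sum>j<d. vec_index u j * l i (e j))"
   unfolding vf_def[abs_def] by (rule eval_comb_sum[OF l[OF that]])
  also have "... = (\<Sum>j<d. if j = i then vec_index u i else 0)"
   by (rule sum.cong) (auto simp: dual that)
  finally show ?thesis using that by simp
 qed
 have vf_act: "vf (\<rho> B *\<^sub>v u) Z = vf u (Z ** B)" if B: "invertible B" and u: "u : carrier_vec d" for B u Z
 proof -
  have "vf (\<rho> B *\<^sub>v u) Z = (\<Sum>i<d. \<Sum>j<d. r i j B * vec_index u j * e i Z)"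
   unfolding vf_def
   by (rule sum.cong) (simp_all add: mult_mat_vec_index[OF \<rho>_carrier u] \<rho>_index sum_distrib_right del: index_mult_mat_vec)
  also have "... = (\<Sum>j<d. \<Sum>i<d. r i j B * vec_index u j * e i Z)" by (rule sum.swap)
  also have "... = vf u (Z ** B)"
   unfolding vf_def by (rule sum.cong) (simp_all add: act[OF B] sum_distrib_left mult_ac)
  finally show ?thesis .
 qed
 have vec_eq: "u = w" if "u : carrier_vec d" "w : carrier_vec d" "vf u = vf w" for u w
  using that l_vf[of _ u] l_vf[of _ w] by (intro eq_vecI) auto
 have irreducible: "irreducible_rep d \<rho>"
  unfolding irreducible_rep_def
 proof (intro conjI allI impI, rule d0)
  fix U :: "complex Matrix.vec set"
  assume "U <= carrier_vec d & 0\<^sub>v d : U & (ALL u:U. ALL w:U. u + w : U) & (ALL c. ALL u:U. c \<cdot>\<^sub>v u : U) \<and>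
     (ALL A. invertible A --> (ALL u:U. \<rho> A *\<^sub>v u : U))"
  then have U: "U <= carrier_vec d" "0\<^sub>v d : U" "!!u w. u : U ==> w : U ==> u + w : U"
   "!!c u. u : U ==> c \<cdot>\<^sub>v u : U" "!!A u. invertible A ==> u : U ==> \<rho> A *\<^sub>v u : U" by auto
  have "U = carrier_vec d" if "U ~= {0\<^sub>v d}"
  proof -
   have "\<not> U <= {0\<^sub>v d}"
   proof
    assume "U <= {0\<^sub>v d}"
    with U(2) have "U = {0\<^sub>v d}" by (intro subset_antisym) simp_all
    with that show False by simp
   qed
   then obtain u0 where u0: "u0 : U" "u0 ~= 0\<^sub>v d"
    unfolding subset_iff singleton_iff by metis
   have u0c: "u0 : carrier_vec d" using U(1) u0(1) by (rule subsetD)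
   have "vf u0 ~= vf (0\<^sub>v d)"
   proof
    assume "vf u0 = vf (0\<^sub>v d)"
    then have "u0 = 0\<^sub>v d" by (rule vec_eq[OF u0c zero_carrier_vec])
    with u0(2) show False by simp
   qed
   then obtain Z0 where "vf u0 Z0 ~= vf (0\<^sub>v d) Z0" by (auto simp: fun_eq_iff)
   then have Z0: "vf u0 Z0 ~= 0" by (simp add: vf_def)
   have add: "vf (u + w) Z = vf u Z + vf w Z" if "u : U" "w : U" for u w Z
    using that U(1) unfolding vf_def sum.distrib[symmetric]
    by (intro sum.cong) (auto simp: distrib_right subset_iff)
   have scale: "vf (c \<cdot>\<^sub>v u) Z = c * vf u Z" if "u : U" for c u Z
    using that U(1) unfolding vf_def sum_distrib_left
    by (intro sum.cong) (auto simp: mult.assoc subset_iff)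
   have "vf ` U = right_module"
   proof (rule right_module_irreducible[where ?p0.0="vf u0" and ?Z0.0=Z0])
    show "fun_subspace (vf ` U)"
     unfolding fun_subspace_def
    proof (intro conjI ballI allI)
     have "vf (0\<^sub>v d) = (%_. 0)" by (auto simp: vf_def fun_eq_iff)
     then show "(%_. 0) : vf ` U" using U(2) by (metis imageI)
     fix f g assume "f : vf ` U" "g : vf ` U"
     then obtain u w where "u : U" "w : U" "f = vf u" "g = vf w" by auto
     then show "(%x. f x + g x) : vf ` U"
      using U(3)[of u w] by (intro image_eqI[of _ _ "u + w"]) (auto simp: add)
    next
     fix c f assume "f : vf ` U"
     then obtain u where "u : U" "f = vf u" by auto
     then show "(%x. c * f x) : vf ` U"
      using U(4)[of u c] by (intro image_eqI[of _ _ "c \<cdot>\<^sub>v u"]) (auto simp: scale)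
    qed
    show "vf ` U <= right_module" using vf_right by auto
    show "vf u0 : vf ` U" using u0 by simp
    show "vf u0 Z0 ~= 0" by (rule Z0)
    fix p and B :: "'n cmat" assume p: "p : vf ` U" and B: "invertible B"
    then obtain u where u: "u : U" "p = vf u" by auto
    have uc: "u : carrier_vec d" using U(1) u(1) by (rule subsetD)
    have "(%Z. p (Z ** B)) = vf (\<rho> B *\<^sub>v u)"
     by (rule ext) (simp only: u(2) vf_act[OF B uc])
    then show "(%Z. p (Z ** B)) : vf ` U" using U(5)[OF B u(1)] by simp
   qed
   then have "w : U" if w: "w : carrier_vec d" for w
   proof -
    have "vf w : vf ` U" using vf_right[of w] \<open>vf ` U = right_module\<close> by simp
    then obtain u where u: "vf w = vf u" "u : U" by (rule imageE)
    have "u : carrier_vec d" using U(1) u(2) by (rule subsetD)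
    then have "w = u" by (rule vec_eq[OF w _ u(1)])
    then show ?thesis using u(2) by simp
   qed
   then have "carrier_vec d <= U" by (rule subsetI)
   with U(1) show ?thesis by (rule subset_antisym)
  qed
  then show "U = {0\<^sub>v d} \<or> U = carrier_vec d" by blast
 qed
 have highest: "has_highest_weight d \<rho> m"
  unfolding has_highest_weight_def
 proof (intro bexI conjI allI impI)
  let ?v = "Matrix.vec d \<delta>"
  have vf_v: "vf ?v = \<Delta>" by (auto simp: vf_def hw_coords fun_eq_iff)
  show v: "?v : carrier_vec d" by simp
  show "?v ~= 0\<^sub>v d"
  proof
   assume "?v = 0\<^sub>v d"
   then have "\<Delta> (mat 1) = vf (0\<^sub>v d) (mat 1)" by (simp add: vf_v[symmetric])
   then show False using hw_polyD(2)[OF hw] by (simp add: vf_def)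
  qed
  fix A :: "'n cmat" assume "invertible A & (ALL i j. j < i --> A $ i $ j = 0)"
  then have A: "invertible A" "upper_tri A" by (auto simp: upper_tri_def)
  have char: "(\<Prod>i\<in>UNIV. A $ i $ i powi m $ i) = tri_char \<mu> A"
   by (simp add: m tri_char_def)
  show "\<rho> A *\<^sub>v ?v = (\<Prod>i\<in>UNIV. A $ i $ i powi m $ i) \<cdot>\<^sub>v ?v"
  proof (rule vec_eq)
   show "\<rho> A *\<^sub>v ?v : carrier_vec d" using \<rho>_carrier v by (rule mult_mat_vec_carrier)
   show "vf (\<rho> A *\<^sub>v ?v) = vf ((\<Prod>i\<in>UNIV. A $ i $ i powi m $ i) \<cdot>\<^sub>v ?v)"
   proof
    fix Z
    have "vf (\<rho> A *\<^sub>v ?v) Z = tri_char \<mu> A * \<Delta> Z"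
     by (simp add: vf_act[OF A(1) v] vf_v hw_polyD(4)[OF hw A(2)])
    also have "... = vf (tri_char \<mu> A \<cdot>\<^sub>v ?v) Z"
     by (simp add: vf_v[symmetric] vf_def sum_distrib_left mult.assoc)
    finally show "vf (\<rho> A *\<^sub>v ?v) Z = vf ((\<Prod>i\<in>UNIV. A $ i $ i powi m $ i) \<cdot>\<^sub>v ?v) Z"
     by (simp add: char)
   qed
  qed simp
 qed
 define \<phi> where "\<phi> X Z = (\<Sum>i<d. \<Sum>j<d. X $$ (i, j) * r i j Z)" for X :: "complex Matrix.mat" and Z
 have \<phi>_add: "\<phi> (X + Y) = (%Z. \<phi> X Z + \<phi> Y Z)" if "X : carrier_mat d d" "Y : carrier_mat d d" for X Y
  using that by (auto simp: \<phi>_def fun_eq_iff distrib_right sum.distrib)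
 have \<phi>_scale: "\<phi> (c \<cdot>\<^sub>m X) = (%Z. c * \<phi> X Z)" if "X : carrier_mat d d" for c X
  using that by (auto simp: \<phi>_def fun_eq_iff sum_distrib_left mult.assoc)
 have \<phi>_act: "\<phi> (dual_rep \<rho> A * X * transpose_mat (\<rho> B)) = poly_act A B (\<phi> X)"
  if A: "invertible A" and B: "invertible B" and X: "X : carrier_mat d d" for A B X
 proof
  fix Z
  let ?A = "matrix_inv A"
  have dual_carrier: "dual_rep \<rho> A : carrier_mat d d" by (simp add: dual_rep_def \<rho>_def)
  have ind: "(dual_rep \<rho> A * X * transpose_mat (\<rho> B)) $$ (k, n)
    = (\<Sum>i<d. \<Sum>j<d. r i k ?A * X $$ (i, j) * r n j B)" if kn: "k < d" "n < d" for k n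
  proof -
   have "(dual_rep \<rho> A * X * transpose_mat (\<rho> B)) $$ (k, n)
     = (\<Sum>j<d. (dual_rep \<rho> A * X) $$ (k, j) * transpose_mat (\<rho> B) $$ (j, n))"
    using dual_carrier X \<rho>_carrier[of B] kn by (intro mult_mat_index) auto
   also have "... = (\<Sum>j<d. \<Sum>i<d. r i k ?A * X $$ (i, j) * r n j B)"
   proof (rule sum.cong)
    fix j assume "j : {..<d}"
    then have j: "j < d" by simp
    have "(dual_rep \<rho> A * X) $$ (k, j) = (\<Sum>i<d. dual_rep \<rho> A $$ (k, i) * X $$ (i, j))"
     using dual_carrier X kn j by (intro mult_mat_index) auto
    also have "... = (\<Sum>i<d. r i k ?A * X $$ (i, j))"
     by (rule sum.cong) (use kn in \<open>simp_all add: dual_rep_def \<rho>_def\<close>)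
    finally show "(dual_rep \<rho> A * X) $$ (k, j) * transpose_mat (\<rho> B) $$ (j, n)
      = (\<Sum>i<d. r i k ?A * X $$ (i, j) * r n j B)"
     using kn j by (simp add: sum_distrib_right \<rho>_def)
   qed simp
   finally show ?thesis by (subst sum.swap)
  qed
  have "\<phi> (dual_rep \<rho> A * X * transpose_mat (\<rho> B)) Z
    = (\<Sum>k<d. \<Sum>n<d. \<Sum>i<d. \<Sum>j<d. X $$ (i, j) * (r i k ?A * r k n Z * r n j B))"
   unfolding \<phi>_def by (intro sum.cong refl) (simp add: ind sum_distrib_left sum_distrib_right mult_ac)
  also have "... = (\<Sum>k<d. \<Sum>i<d. \<Sum>n<d. \<Sum>j<d. X $$ (i, j) * (r i k ?A * r k n Z * r n j B))"
   by (intro sum.cong refl sum.swap)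
  also have "... = (\<Sum>i<d. \<Sum>k<d. \<Sum>n<d. \<Sum>j<d. X $$ (i, j) * (r i k ?A * r k n Z * r n j B))"
   by (rule sum.swap)
  also have "... = (\<Sum>i<d. \<Sum>k<d. \<Sum>j<d. \<Sum>n<d. X $$ (i, j) * (r i k ?A * r k n Z * r n j B))"
   by (intro sum.cong refl sum.swap)
  also have "... = (\<Sum>i<d. \<Sum>j<d. \<Sum>k<d. \<Sum>n<d. X $$ (i, j) * (r i k ?A * r k n Z * r n j B))"
   by (intro sum.cong refl sum.swap)
  also have "... = (\<Sum>i<d. \<Sum>j<d. X $$ (i, j) * r i j (?A ** (Z ** B)))"
   by (intro sum.cong refl) (simp add: r_mult sum_distrib_left mult_ac)
  finally show "\<phi> (dual_rep \<rho> A * X * transpose_mat (\<rho> B)) Z = poly_act A B (\<phi> X) Z"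
   by (simp add: poly_act_def \<phi>_def matrix_mul_assoc)
 qed
 have r_in: "r i j : bi_module" if "i < d" "j < d" for i j
 proof -
  have "(%Z. l' (%Y. e j (Y ** Z))) : bi_module" if "eval_comb ?X l'" for l'
   using that
  proof induction
   case (eval x)
   then show ?case using right_module_left_translate[OF _ e[OF \<open>j < d\<close>]] by simp
  qed (auto intro: fun_subspaceD(2,3)[OF fun_subspace_bi_module])
  from this[OF l[OF that(1)]] show ?thesis by (simp add: r_def[abs_def])
 qed
 have \<phi>_in: "\<phi> X : bi_module" for X
 proof -
  have sums: "(%Z. \<Sum>i\<in>I. f i Z) : bi_module" if "finite I" "!!i. i : I ==> f i : bi_module"
   for I :: "nat set" and f
   using that
   by (induction I rule: finite_induct)
    (auto intro: fun_subspaceD(1,2)[OF fun_subspace_bi_module])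
  show ?thesis unfolding \<phi>_def[abs_def]
   by (intro sums finite_lessThan fun_subspaceD(3)[OF fun_subspace_bi_module] r_in) auto
 qed
 have hw_image: "\<Delta> = \<phi> (Matrix.mat d d (%(i, j). e i (mat 1) * \<delta> j))" (is "_ = \<phi> ?D")
 proof -
  have poly: "polynomial_fun (%Z. \<Delta> Z - \<phi> ?D Z)"
   by (intro polynomial_fun_diff hw_polyD(1)[OF hw] bi_module_polynomial \<phi>_in)
  have "\<Delta> Z - \<phi> ?D Z = 0" if Z: "invertible Z" for Z
  proof -
   have "\<Delta> Z = (\<Sum>j<d. \<delta> j * e j (mat 1 ** Z))" using hw_coords by simp
   also have "... = (\<Sum>j<d. \<Sum>i<d. \<delta> j * (r i j Z * e i (mat 1)))"
    by (intro sum.cong refl) (simp add: act[OF Z] sum_distrib_left del: matrix_mul_lid)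
   also have "... = (\<Sum>i<d. \<Sum>j<d. \<delta> j * (r i j Z * e i (mat 1)))" by (rule sum.swap)
   also have "... = \<phi> ?D Z" unfolding \<phi>_def by (intro sum.cong refl) simp
   finally show ?thesis by simp
  qed
  from polynomial_fun_0_on_invertible[OF poly this] show ?thesis by (simp add: fun_eq_iff)
 qed
 have surj: "bi_module <= \<phi> ` carrier_mat d d"
 proof (rule bi_module_le)
  show "fun_subspace (\<phi> ` carrier_mat d d)"
   unfolding fun_subspace_def
  proof (intro conjI ballI allI)
   have "\<phi> (0\<^sub>m d d) = (%_. 0)" by (auto simp: \<phi>_def fun_eq_iff)
   then show "(%_. 0) : \<phi> ` carrier_mat d d" by (metis imageI zero_carrier_mat)
   fix f g assume "f : \<phi> ` carrier_mat d d" "g : \<phi> ` carrier_mat d d"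
   then obtain X Y where XY: "X : carrier_mat d d" "Y : carrier_mat d d" "f = \<phi> X" "g = \<phi> Y" by auto
   then show "(%x. f x + g x) : \<phi> ` carrier_mat d d"
    using \<phi>_add[OF XY(1,2)] by (intro image_eqI[of _ _ "X + Y"]) auto
  next
   fix c f assume "f : \<phi> ` carrier_mat d d"
   then obtain X where X: "X : carrier_mat d d" "f = \<phi> X" by auto
   then show "(%x. c * f x) : \<phi> ` carrier_mat d d"
    using \<phi>_scale[OF X(1), of c] by (intro image_eqI[of _ _ "c \<cdot>\<^sub>m X"]) auto
  qed
  fix A B :: "'n cmat" assume A: "invertible A" and B: "invertible B"
  let ?D = "Matrix.mat d d (%(i, j). e i (mat 1) * \<delta> j)"
  let ?X = "dual_rep \<rho> (matrix_inv A) * ?D * transpose_mat (\<rho> B)"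
  have "\<phi> ?X = poly_act (matrix_inv A) B \<Delta>"
   using \<phi>_act[OF matrix_inv_matrix_inv(1)[OF A] B, of ?D] hw_image by simp
  then have eq: "(%Z. \<Delta> (A ** Z ** B)) = \<phi> ?X"
   by (simp add: poly_act_def[abs_def] matrix_inv_matrix_inv(2)[OF A])
  have "?X : carrier_mat d d" by (rule carrier_matI) (simp_all add: dual_rep_def \<rho>_def)
  then show "(%Z. \<Delta> (A ** Z ** B)) : \<phi> ` carrier_mat d d" unfolding eq by (rule imageI)
 qed
 have kernel: "X $$ (i, j) = 0" if X0: "\<phi> X = (%_. 0)" and ij: "i < d" "j < d" for X i j
 proof -
  have main: "(\<Sum>i<d. X $$ (i, j) * l i (%Y. \<Delta> (Y ** B))) = 0" if B: "invertible B" and j: "j < d" for B j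
  proof -
   have "(\<Sum>j<d. (\<Sum>i<d. X $$ (i, j) * l i (%Y. \<Delta> (Y ** B))) * e j C) = 0" if C: "invertible C" for C
   proof -
    let ?w = "%j Z. e j (Z ** C)"
    have w: "?w j : right_module" if "j < d" for j using right_module_invariant[OF C e[OF that]] .
    have g0: "(\<Sum>i<d. 1 * (\<Sum>j<d. X $$ (i, j) * l i (%Y. ?w j (Y ** Z)))) = 0" for Z
    proof -
     have "(\<Sum>i<d. 1 * (\<Sum>j<d. X $$ (i, j) * l i (%Y. ?w j (Y ** Z)))) = \<phi> X (Z ** C)"
      by (simp add: \<phi>_def r_def matrix_mul_assoc)
     then show ?thesis by (simp add: X0)
    qed
    have poly_in: "polynomial_fun (%Z. l i (%Y. ?w j (Y ** Z)))" if "i < d" "j < d" for i j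
     using l[OF that(1)] right_module_polynomial[OF w[OF that(2)]] by (rule eval_comb_translate_polynomial)
    have poly_out: "polynomial_fun (%Z. \<Sum>j<d. X $$ (i, j) * l i (%Y. ?w j (Y ** Z)))" if "i < d" for i
     by (intro polynomial_fun_sum polynomial_fun_cmult poly_in that) simp
    have "wcoeff height (%Z. \<Sum>i<d. 1 * (\<Sum>j<d. X $$ (i, j) * l i (%Y. ?w j (Y ** Z)))) lowest B
      = (\<Sum>i<d. 1 * wcoeff height (%Z. \<Sum>j<d. X $$ (i, j) * l i (%Y. ?w j (Y ** Z))) lowest B)"
     by (rule wcoeff_sum) (use poly_out in simp)
    also have "... = (\<Sum>i<d. \<Sum>j<d. X $$ (i, j) * wcoeff height (%Z. l i (%Y. ?w j (Y ** Z))) lowest B)"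
     by (intro sum.cong refl) (simp, rule wcoeff_sum, use poly_in in simp)
    also have "... = (\<Sum>i<d. \<Sum>j<d. X $$ (i, j) * l i (%Y. \<Delta> (Y ** B)) * e j C)"
    proof (intro sum.cong refl)
     fix i j assume "i : {..<d}" "j : {..<d}"
     then have i: "i < d" and j: "j < d" by auto
     have "wcoeff height (%Z. l i (%Y. ?w j (Y ** Z))) lowest B = l i (%Y. wcoeff height (?w j) lowest (Y ** B))"
      by (rule wcoeff_eval_comb[OF l[OF i] right_module_polynomial[OF w[OF j]]])
     also have "... = l i (%Y. e j C * \<Delta> (Y ** B))"
      by (simp add: right_module_lowest_coefficient[OF w[OF j]])
     also have "... = e j C * l i (%Y. \<Delta> (Y ** B))" by (rule eval_comb_linear(2)[OF l[OF i]])
     finally show "X $$ (i, j) * wcoeff height (%Z. l i (%Y. ?w j (Y ** Z))) lowest B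
       = X $$ (i, j) * l i (%Y. \<Delta> (Y ** B)) * e j C" by simp
    qed
    also have "... = (\<Sum>j<d. \<Sum>i<d. X $$ (i, j) * l i (%Y. \<Delta> (Y ** B)) * e j C)" by (rule sum.swap)
    finally show ?thesis unfolding g0 by (simp add: wcoeff_const_zero sum_distrib_right)
   qed
   from indep[of "%j. \<Sum>i<d. X $$ (i, j) * l i (%Y. \<Delta> (Y ** B))", OF this] j show ?thesis by blast
  qed
  have "right_module <= {w. (\<Sum>i<d. X $$ (i, j) * l i w) = 0}"
  proof (rule right_module_le)
   show "fun_subspace {w. (\<Sum>i<d. X $$ (i, j) * l i w) = 0}"
    unfolding fun_subspace_def
   proof (intro conjI ballI allI)
    have "(\<Sum>i<d. X $$ (i, j) * l i (%_. 0)) = 0"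
     by (rule sum.neutral) (use eval_comb_zero[OF l] in auto)
    then show "(%_. 0) : {w. (\<Sum>i<d. X $$ (i, j) * l i w) = 0}" by simp
    fix f g assume fg: "f : {w. (\<Sum>i<d. X $$ (i, j) * l i w) = 0}" "g : {w. (\<Sum>i<d. X $$ (i, j) * l i w) = 0}"
    have "(\<Sum>i<d. X $$ (i, j) * l i (%x. f x + g x))
      = (\<Sum>i<d. X $$ (i, j) * l i f + X $$ (i, j) * l i g)"
     by (rule sum.cong) (simp_all add: eval_comb_linear[OF l] distrib_left)
    then show "(%x. f x + g x) : {w. (\<Sum>i<d. X $$ (i, j) * l i w) = 0}"
     using fg by (simp add: sum.distrib)
   next
    fix c f assume f: "f : {w. (\<Sum>i<d. X $$ (i, j) * l i w) = 0}"
    have "(\<Sum>i<d. X $$ (i, j) * l i (%x. c * f x)) = c * (\<Sum>i<d. X $$ (i, j) * l i f)"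
     unfolding sum_distrib_left by (rule sum.cong) (simp_all add: eval_comb_linear[OF l] mult_ac)
    then show "(%x. c * f x) : {w. (\<Sum>i<d. X $$ (i, j) * l i w) = 0}" using f by simp
   qed
   show "(%Z. \<Delta> (Z ** B)) : {w. (\<Sum>i<d. X $$ (i, j) * l i w) = 0}" if "invertible B" for B
    using main[OF that ij(2)] by simp
  qed
  then have "(\<Sum>k<d. X $$ (k, j) * l k (e i)) = 0" using e[OF ij(1)] by blast
  moreover have "(\<Sum>k<d. X $$ (k, j) * l k (e i)) = (\<Sum>k<d. if k = i then X $$ (i, j) else 0)"
   by (rule sum.cong) (auto simp: dual ij)
  ultimately show ?thesis using ij by simp
 qed
 have "inj_on \<phi> (carrier_mat d d)"
 proof (rule inj_onI)
  fix X Y assume X: "X : carrier_mat d d" and Y: "Y : carrier_mat d d" and eq: "\<phi> X = \<phi> Y"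
  have "\<phi> (X + (-1) \<cdot>\<^sub>m Y) = (%_. 0)"
   using X Y by (simp add: \<phi>_add \<phi>_scale eq)
  then have "(X + (-1) \<cdot>\<^sub>m Y) $$ (i, j) = 0" if "i < d" "j < d" for i j
   by (rule kernel[OF _ that])
  then show "X = Y" using X Y by (intro eq_matI) auto
 qed
 then have "bij_betw \<phi> (carrier_mat d d) bi_module"
  using surj \<phi>_in by (auto simp: bij_betw_def)
 then have "iso_dual_tensor d \<rho> bi_module"
  unfolding iso_dual_tensor_def using \<phi>_add \<phi>_scale \<phi>_act by blast
 then show ?thesis using rational irreducible highest by blast
qed

end

definition outer_mat :: "nat => complex Matrix.vec => complex Matrix.vec => complex Matrix.mat" where
 "outer_mat d \<xi> w = Matrix.mat d d (%(i, j). vec_index \<xi> i * vec_index w j)"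

lemma outer_mat_carrier [simp]: "outer_mat d \<xi> w : carrier_mat d d"
 by (simp add: outer_mat_def)

lemma outer_mat_index: "i < d ==> j < d ==> outer_mat d \<xi> w $$ (i, j) = vec_index \<xi> i * vec_index w j"
 by (simp add: outer_mat_def)

lemma outer_mat_add_left:
 assumes "\<xi> : carrier_vec d" "\<xi>' : carrier_vec d"
 shows "outer_mat d (\<xi> + \<xi>') w = outer_mat d \<xi> w + outer_mat d \<xi>' w"
 by (rule eq_matI) (use assms in \<open>auto simp: outer_mat_def distrib_right\<close>)

lemma outer_mat_add_right:
 assumes "w : carrier_vec d" "w' : carrier_vec d"
 shows "outer_mat d \<xi> (w + w') = outer_mat d \<xi> w + outer_mat d \<xi> w'"
 by (rule eq_matI) (use assms in \<open>auto simp: outer_mat_def distrib_left\<close>)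

lemma outer_mat_scale_left:
 assumes "\<xi> : carrier_vec d"
 shows "outer_mat d (c \<cdot>\<^sub>v \<xi>) w = c \<cdot>\<^sub>m outer_mat d \<xi> w"
 by (rule eq_matI) (use assms in \<open>auto simp: outer_mat_def\<close>)

lemma outer_mat_scale_right:
 assumes "w : carrier_vec d"
 shows "outer_mat d \<xi> (c \<cdot>\<^sub>v w) = c \<cdot>\<^sub>m outer_mat d \<xi> w"
 by (rule eq_matI) (use assms in \<open>auto simp: outer_mat_def\<close>)

lemma outer_mat_transform:
 assumes P: "P : carrier_mat d d" and Q: "Q : carrier_mat d d"
  and \<xi>: "\<xi> : carrier_vec d" and w: "w : carrier_vec d"
 shows "P * outer_mat d \<xi> w * transpose_mat Q = outer_mat d (P *\<^sub>v \<xi>) (Q *\<^sub>v w)"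
proof (rule eq_matI)
 fix i j assume "i < dim_row (outer_mat d (P *\<^sub>v \<xi>) (Q *\<^sub>v w))" "j < dim_col (outer_mat d (P *\<^sub>v \<xi>) (Q *\<^sub>v w))"
 then have i: "i < d" and j: "j < d" by (simp_all add: outer_mat_def)
 have PX: "P * outer_mat d \<xi> w : carrier_mat d d" using P outer_mat_carrier by (rule mult_carrier_mat)
 have QT: "transpose_mat Q : carrier_mat d d" using Q by simp
 have "(P * outer_mat d \<xi> w * transpose_mat Q) $$ (i, j)
   = (\<Sum>k<d. (P * outer_mat d \<xi> w) $$ (i, k) * transpose_mat Q $$ (k, j))"
  by (rule mult_mat_index[OF PX QT i j])
 also have "... = (\<Sum>k<d. (\<Sum>l<d. P $$ (i, l) * vec_index \<xi> l) * (Q $$ (j, k) * vec_index w k))"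
 proof (rule sum.cong)
  fix k assume "k : {..<d}"
  then have k: "k < d" by simp
  have "(P * outer_mat d \<xi> w) $$ (i, k) = (\<Sum>l<d. P $$ (i, l) * vec_index \<xi> l) * vec_index w k"
   unfolding mult_mat_index[OF P outer_mat_carrier i k] sum_distrib_right
   by (rule sum.cong) (simp_all add: outer_mat_index k mult.assoc)
  then show "(P * outer_mat d \<xi> w) $$ (i, k) * transpose_mat Q $$ (k, j)
    = (\<Sum>l<d. P $$ (i, l) * vec_index \<xi> l) * (Q $$ (j, k) * vec_index w k)"
   using Q j k by simp
 qed simp
 also have "... = outer_mat d (P *\<^sub>v \<xi>) (Q *\<^sub>v w) $$ (i, j)"
  unfolding outer_mat_index[OF i j] mult_mat_vec_index[OF P \<xi> i] mult_mat_vec_index[OF Q w j]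
  by (simp add: sum_distrib_left)
 finally show "(P * outer_mat d \<xi> w * transpose_mat Q) $$ (i, j) = outer_mat d (P *\<^sub>v \<xi>) (Q *\<^sub>v w) $$ (i, j)" .
qed (use P Q in \<open>auto simp: outer_mat_def\<close>)

lemma transpose_mult_vec_index:
 assumes "A : carrier_mat d d" "\<xi> : carrier_vec d" "j < d"
 shows "vec_index (transpose_mat A *\<^sub>v \<xi>) j = (\<Sum>i<d. A $$ (i, j) * vec_index \<xi> i)"
 using mult_mat_vec_index[of "transpose_mat A" d \<xi> j] assms by simp

context hw_module begin

text \<open>
  In another copy of \<open>W\<^sup>* \<otimes> W\<close>, the vectors \<open>\<xi> \<otimes> v\<close> with \<open>v\<close> a highest weight vector
  contain a vector that is also a highest weight vector for the left action; it must be \<open>\<Delta>\<close>.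
\<close>

theorem dual_tensor_submodule_unique:
 assumes m: "!!i. m $ i = int (\<mu> i)"
  and S: "poly_submodule S" and rat: "rational_rep d \<rho>" and irr: "irreducible_rep d \<rho>"
  and high: "has_highest_weight d \<rho> m" and iso: "iso_dual_tensor d \<rho> S"
 shows "S = bi_module"
proof
 have S_sub: "fun_subspace S" and S_poly: "!!p. p : S ==> polynomial_fun p"
  and S_inv: "!!A B p. invertible A ==> invertible B ==> p : S ==> poly_act A B p : S"
  using S by (auto simp: poly_submodule_def)
 have \<rho>_carrier: "!!A. invertible A ==> \<rho> A : carrier_mat d d" and \<rho>_1: "\<rho> (mat 1) = 1\<^sub>m d"
  and \<rho>_mult: "!!A B. invertible A ==> invertible B ==> \<rho> (A ** B) = \<rho> A * \<rho> B"
  using rat unfolding rational_rep_def by blast+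
 have irrD: "U = {0\<^sub>v d} \<or> U = carrier_vec d" if "U <= carrier_vec d" "0\<^sub>v d : U"
  "!!u w. u : U ==> w : U ==> u + w : U" "!!c u. u : U ==> c \<cdot>\<^sub>v u : U"
  "!!A u. invertible A ==> u : U ==> \<rho> A *\<^sub>v u : U" for U
  using irr that unfolding irreducible_rep_def by simp
 obtain v where v: "v : carrier_vec d" "v ~= 0\<^sub>v d"
  and v_weight': "ALL A. invertible A & (ALL i j. j < i --> A $ i $ j = 0) -->
   \<rho> A *\<^sub>v v = (\<Prod>i\<in>UNIV. A $ i $ i powi m $ i) \<cdot>\<^sub>v v"
  using high unfolding has_highest_weight_def by blast
 have v_weight: "\<rho> A *\<^sub>v v = tri_char \<mu> A \<cdot>\<^sub>v v" if "invertible A" "upper_tri A" for A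
  using v_weight'[rule_format, of A] that by (simp add: upper_tri_def tri_char_def m)
 obtain \<phi> where bij: "bij_betw \<phi> (carrier_mat d d) S"
  and \<phi>_add': "ALL X:carrier_mat d d. ALL Y:carrier_mat d d. \<phi> (X + Y) = (%Z. \<phi> X Z + \<phi> Y Z)"
  and \<phi>_scale': "ALL c. ALL X:carrier_mat d d. \<phi> (c \<cdot>\<^sub>m X) = (%Z. c * \<phi> X Z)"
  and \<phi>_act': "ALL A B. invertible A & invertible B --> (ALL X:carrier_mat d d.
       \<phi> (dual_rep \<rho> A * X * transpose_mat (\<rho> B)) = poly_act A B (\<phi> X))"
  using iso unfolding iso_dual_tensor_def by blast
 note \<phi>_add = \<phi>_add'[rule_format] and \<phi>_scale = \<phi>_scale'[rule_format]
 have \<phi>_S: "\<phi> X : S" if "X : carrier_mat d d" for X using bij that by (auto simp: bij_betw_def)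
 define p where "p \<xi> w = \<phi> (outer_mat d \<xi> w)" for \<xi> w
 have p_add_left: "p (\<xi> + \<xi>') w = (%Z. p \<xi> w Z + p \<xi>' w Z)" if "\<xi> : carrier_vec d" "\<xi>' : carrier_vec d" for \<xi> \<xi>' w
  using that by (simp add: p_def outer_mat_add_left \<phi>_add)
 have p_add_right: "p \<xi> (w + w') = (%Z. p \<xi> w Z + p \<xi> w' Z)" if "w : carrier_vec d" "w' : carrier_vec d" for \<xi> w w'
  using that by (simp add: p_def outer_mat_add_right \<phi>_add)
 have p_scale_left: "p (c \<cdot>\<^sub>v \<xi>) w = (%Z. c * p \<xi> w Z)" if "\<xi> : carrier_vec d" for c \<xi> w
  using that by (simp add: p_def outer_mat_scale_left \<phi>_scale)
 have p_scale_right: "p \<xi> (c \<cdot>\<^sub>v w) = (%Z. c * p \<xi> w Z)" if "w : carrier_vec d" for c \<xi> w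
  using that by (simp add: p_def outer_mat_scale_right \<phi>_scale)
 have p_S: "p \<xi> w : S" for \<xi> w unfolding p_def by (rule \<phi>_S) simp
 have p_poly: "polynomial_fun (p \<xi> w)" for \<xi> w using p_S by (rule S_poly)
 have p_act: "p \<xi> w (A ** Z ** B) = p (transpose_mat (\<rho> A) *\<^sub>v \<xi>) (\<rho> B *\<^sub>v w) Z"
  if A: "invertible A" and B: "invertible B" and \<xi>: "\<xi> : carrier_vec d" and w: "w : carrier_vec d" for A B \<xi> w Z
 proof -
  have "poly_act (matrix_inv A) B (p \<xi> w) = \<phi> (dual_rep \<rho> (matrix_inv A) * outer_mat d \<xi> w * transpose_mat (\<rho> B))"
   using \<phi>_act' matrix_inv_matrix_inv(1)[OF A] B by (simp add: p_def)
  also have "... = p (transpose_mat (\<rho> A) *\<^sub>v \<xi>) (\<rho> B *\<^sub>v w)"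
   using outer_mat_transform[of "transpose_mat (\<rho> A)" d "\<rho> B" \<xi> w] \<rho>_carrier[OF A] \<rho>_carrier[OF B] \<xi> w
   by (simp add: dual_rep_def matrix_inv_matrix_inv(2)[OF A] p_def)
  finally have "poly_act (matrix_inv A) B (p \<xi> w) Z = p (transpose_mat (\<rho> A) *\<^sub>v \<xi>) (\<rho> B *\<^sub>v w) Z" by simp
  then show ?thesis by (simp add: poly_act_def matrix_inv_matrix_inv(2)[OF A])
 qed
 have \<rho>v: "\<rho> B *\<^sub>v w : carrier_vec d" if "invertible B" "w : carrier_vec d" for B w
  using \<rho>_carrier[OF that(1)] that(2) by (rule mult_mat_vec_carrier)
 have \<rho>tv: "transpose_mat (\<rho> A) *\<^sub>v \<xi> : carrier_vec d" if "invertible A" "\<xi> : carrier_vec d" for A \<xi>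
  using \<rho>_carrier[OF that(1)] that(2) by (intro mult_mat_vec_carrier[of _ d d]) auto
 have one_v: "\<rho> (mat 1) *\<^sub>v w = w" if "w : carrier_vec d" for w
  using that by (simp add: \<rho>_1)
 have one_tv: "transpose_mat (\<rho> (mat 1)) *\<^sub>v w = w" if "w : carrier_vec d" for w
  using that by (simp add: \<rho>_1)
 have p_left: "p \<xi> w (A ** Z) = p (transpose_mat (\<rho> A) *\<^sub>v \<xi>) w Z"
  if "invertible A" "\<xi> : carrier_vec d" "w : carrier_vec d" for A \<xi> w Z
  using p_act[OF that(1) invertible_mat_1 that(2,3), of Z] by (simp add: one_v that)
 have p_right: "p \<xi> w (Z ** B) = p \<xi> (\<rho> B *\<^sub>v w) Z"
  if "invertible B" "\<xi> : carrier_vec d" "w : carrier_vec d" for B \<xi> w Z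
  using p_act[OF invertible_mat_1 that, of Z] by (simp add: one_tv that)
 have p_nonzero: "p \<xi> w ~= (%_. 0)" if nz: "\<xi> : carrier_vec d" "\<xi> ~= 0\<^sub>v d" "w : carrier_vec d" "w ~= 0\<^sub>v d" for \<xi> w
 proof
  assume 0: "p \<xi> w = (%_. 0)"
  have "\<phi> (0 \<cdot>\<^sub>m outer_mat d \<xi> w) = (%_. 0)" by (simp add: \<phi>_scale)
  then have "\<phi> (outer_mat d \<xi> w) = \<phi> (0 \<cdot>\<^sub>m outer_mat d \<xi> w)" using 0 by (simp add: p_def)
  then have eq: "outer_mat d \<xi> w = 0 \<cdot>\<^sub>m outer_mat d \<xi> w"
   using bij by (intro inj_onD[of \<phi> "carrier_mat d d"]) (auto simp: bij_betw_def)
  have "EX i<d. vec_index \<xi> i ~= 0"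
  proof (rule ccontr)
   assume "\<not> (EX i<d. vec_index \<xi> i ~= 0)"
   then have "\<xi> = 0\<^sub>v d" using nz(1) by (intro eq_vecI) auto
   with nz(2) show False by simp
  qed
  then obtain i where i: "i < d" "vec_index \<xi> i ~= 0" by blast
  have "EX j<d. vec_index w j ~= 0"
  proof (rule ccontr)
   assume "\<not> (EX j<d. vec_index w j ~= 0)"
   then have "w = 0\<^sub>v d" using nz(3) by (intro eq_vecI) auto
   with nz(4) show False by simp
  qed
  then obtain j where j: "j < d" "vec_index w j ~= 0" by blast
  have "outer_mat d \<xi> w $$ (i, j) = (0 \<cdot>\<^sub>m outer_mat d \<xi> w) $$ (i, j)" using eq by simp
  then show False using i j by (simp add: outer_mat_def)
 qed
 define V where "V = (%\<xi>. p \<xi> v) ` carrier_vec d"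
 have V: "fun_subspace V"
  unfolding fun_subspace_def
 proof (intro conjI ballI allI)
  have "p (0 \<cdot>\<^sub>v v) v = (%_. 0)" using p_scale_left[OF v(1), of 0] by simp
  then show "(%_. 0) : V" unfolding V_def using v(1) by (intro image_eqI[of _ _ "0 \<cdot>\<^sub>v v"]) auto
  fix f g assume "f : V" "g : V"
  then obtain \<xi> \<xi>' where "\<xi> : carrier_vec d" "\<xi>' : carrier_vec d" "f = p \<xi> v" "g = p \<xi>' v" by (auto simp: V_def)
  then show "(%x. f x + g x) : V"
   unfolding V_def by (intro image_eqI[of _ _ "\<xi> + \<xi>'"]) (auto simp: p_add_left)
 next
  fix c f assume "f : V"
  then obtain \<xi> where "\<xi> : carrier_vec d" "f = p \<xi> v" by (auto simp: V_def)
  then show "(%x. c * f x) : V"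
   unfolding V_def by (intro image_eqI[of _ _ "c \<cdot>\<^sub>v \<xi>"]) (auto simp: p_scale_left)
 qed
 have V_left: "(%Z. f (A ** Z)) : V" if f: "f : V" and A: "invertible A" for f A
 proof -
  obtain \<xi> where "\<xi> : carrier_vec d" "f = p \<xi> v" using f by (auto simp: V_def)
  then show ?thesis
   unfolding V_def using p_left[OF A _ v(1)] \<rho>tv[OF A]
   by (intro image_eqI[of _ _ "transpose_mat (\<rho> A) *\<^sub>v \<xi>"]) (simp_all add: fun_eq_iff)
 qed
 have V_poly: "polynomial_fun f" if "f : V" for f using that p_poly by (auto simp: V_def)
 have pvv: "p v v : V" using v(1) by (simp add: V_def)
 obtain Z0 where Z0: "p v v Z0 ~= 0" using p_nonzero[OF v v] by (auto simp: fun_eq_iff)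
 obtain q where q: "q : V" "q ~= (%_. 0)"
  and q_left: "!!L Z. lower_tri L ==> ALL i. L $ i $ i = 1 ==> q (L ** Z) = q Z"
  using left_invariant_unipotent_vector[OF V V_poly V_left pvv Z0] by metis
 obtain \<xi>1 where \<xi>1: "\<xi>1 : carrier_vec d" "q = p \<xi>1 v" using q(1) by (auto simp: V_def)
 have q_eq: "q = (%Z. q (mat 1) * \<Delta> Z)"
 proof (rule hw_poly_unique[OF hw V_poly[OF q(1)]])
  fix L U :: "'n cmat"
  assume L: "lower_tri L" "ALL i. L $ i $ i = 1" and U: "upper_tri U" "ALL i. U $ i $ i ~= 0"
  have "invertible U" using U by (simp add: invertible_upper_tri)
  then have "q (mat 1 ** U) = tri_char \<mu> U * q (mat 1)"
   using U by (simp only: \<xi>1(2) p_right[OF _ \<xi>1(1) v(1)] v_weight p_scale_right[OF v(1)])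
  then show "q (L ** U) = tri_char \<mu> U * q (mat 1)" using q_left[OF L, of U] by simp
 qed
 have q1: "q (mat 1) ~= 0"
 proof
  assume 0: "q (mat 1) = 0"
  have "q = (%_. 0)" by (subst q_eq) (simp add: 0)
  with q(2) show False by simp
 qed
 define \<xi>0 where "\<xi>0 = inverse (q (mat 1)) \<cdot>\<^sub>v \<xi>1"
 have \<xi>0: "\<xi>0 : carrier_vec d" using \<xi>1(1) by (simp add: \<xi>0_def)
 have \<Delta>_eq: "p \<xi>0 v = \<Delta>"
 proof
  fix Z
  have "p \<xi>0 v Z = inverse (q (mat 1)) * q Z"
   by (simp add: \<xi>0_def p_scale_left[OF \<xi>1(1)] \<xi>1(2))
  also have "q Z = q (mat 1) * \<Delta> Z" by (rule fun_cong[OF q_eq])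
  finally show "p \<xi>0 v Z = \<Delta> Z" using q1 by simp
 qed
 show "bi_module <= S"
 proof (rule bi_module_le[OF S_sub])
  fix A B :: "'n cmat" assume A: "invertible A" and B: "invertible B"
  have "poly_act (matrix_inv A) B \<Delta> : S"
   by (rule S_inv[OF matrix_inv_matrix_inv(1)[OF A] B]) (simp add: \<Delta>_eq[symmetric] p_S)
  then show "(%Z. \<Delta> (A ** Z ** B)) : S"
   by (simp add: poly_act_def[abs_def] matrix_inv_matrix_inv(2)[OF A])
 qed
 note bi = fun_subspaceD[OF fun_subspace_bi_module]
 have zero_bi: "p \<xi> w : bi_module" if "!!i. i < d ==> vec_index \<xi> i = 0" for \<xi> w
 proof -
  have "outer_mat d \<xi> w = 0 \<cdot>\<^sub>m outer_mat d \<xi> w"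
   by (rule eq_matI) (auto simp: outer_mat_def that)
  then have "p \<xi> w = (%Z. 0 * p \<xi> w Z)" by (metis p_def \<phi>_scale outer_mat_carrier)
  then have "p \<xi> w = (%Z. 0)" by simp
  then show ?thesis using bi(1) by simp
 qed
 have left_bi: "p \<xi> v : bi_module" if \<xi>: "\<xi> : carrier_vec d" for \<xi>
 proof -
  let ?X = "Collect invertible :: 'n cmat set"
  define f where "f j A = vec_index (transpose_mat (\<rho> A) *\<^sub>v \<xi>0) j" for j A
  have indep: "ALL j<d. c j = 0" if c: "!!A. A : ?X ==> (\<Sum>j<d. c j * f j A) = 0" for c
  proof -
   define pair where "pair w = (\<Sum>i<d. vec_index \<xi>0 i * vec_index w i)" for w
   define U where "U = {w : carrier_vec d. ALL A. invertible A --> pair (\<rho> A *\<^sub>v w) = 0}"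
   have pair_add: "pair (w + w') = pair w + pair w'" if "w : carrier_vec d" "w' : carrier_vec d" for w w'
    unfolding pair_def sum.distrib[symmetric] by (rule sum.cong) (use that in \<open>auto simp: distrib_left\<close>)
   have pair_scale: "pair (c \<cdot>\<^sub>v w) = c * pair w" if "w : carrier_vec d" for c w
    unfolding pair_def sum_distrib_left by (rule sum.cong) (use that in auto)
   have mv_add: "\<rho> A *\<^sub>v (u + w) = \<rho> A *\<^sub>v u + \<rho> A *\<^sub>v w"
    if "invertible A" "u : carrier_vec d" "w : carrier_vec d" for A u w
    using mult_add_distrib_mat_vec[OF \<rho>_carrier[OF that(1)] that(2,3)] .
   have mv_scale: "\<rho> A *\<^sub>v (c \<cdot>\<^sub>v u) = c \<cdot>\<^sub>v (\<rho> A *\<^sub>v u)"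
    if "invertible A" "u : carrier_vec d" for A u c
    using mult_mat_vec[OF \<rho>_carrier[OF that(1)] that(2)] .
   have "U = {0\<^sub>v d} \<or> U = carrier_vec d"
   proof (rule irrD)
    show "U <= carrier_vec d" by (auto simp: U_def)
    show "u + w : U" if "u : U" "w : U" for u w
     using that by (auto simp: U_def mv_add pair_add \<rho>v)
    show scale: "c \<cdot>\<^sub>v u : U" if "u : U" for c u
     using that by (auto simp: U_def mv_scale pair_scale \<rho>v)
    have pair0: "pair (0\<^sub>v d) = 0" by (simp add: pair_def)
    have mv0: "\<rho> A *\<^sub>v 0\<^sub>v d = 0\<^sub>v d" if "invertible A" for A
     using \<rho>_carrier[OF that] by (intro eq_vecI) auto
    show "0\<^sub>v d : U" unfolding U_def by (simp add: mv0 pair0)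
    fix A :: "'n cmat" and u assume A: "invertible A" and u: "u : U"
    have "pair (\<rho> B *\<^sub>v (\<rho> A *\<^sub>v u)) = 0" if B: "invertible B" for B
    proof -
     have "\<rho> B *\<^sub>v (\<rho> A *\<^sub>v u) = \<rho> (B ** A) *\<^sub>v u"
      using u assoc_mult_mat_vec[OF \<rho>_carrier[OF B] \<rho>_carrier[OF A], of u]
      by (simp add: \<rho>_mult[OF B A] U_def)
     then show ?thesis using u invertible_mult[OF B A] by (simp add: U_def)
    qed
    then show "\<rho> A *\<^sub>v u : U" using u \<rho>v[OF A] by (simp add: U_def)
   qed
   moreover have "U ~= carrier_vec d"
   proof
    assume "U = carrier_vec d"
    then have all: "pair w = 0" if "w : carrier_vec d" for w
    proof -
     have "w : U" using that \<open>U = carrier_vec d\<close> by simp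
     then have "pair (\<rho> (mat 1) *\<^sub>v w) = 0" using invertible_mat_1 unfolding U_def by blast
     then show ?thesis by (simp only: one_v[OF that])
    qed
    have "vec_index \<xi>0 i = 0" if i: "i < d" for i
    proof -
     have "pair (unit_vec d i) = (\<Sum>k<d. if k = i then vec_index \<xi>0 i else 0)"
      unfolding pair_def by (rule sum.cong) (use i in auto)
     then show ?thesis using all[of "unit_vec d i"] i by simp
    qed
    then have "outer_mat d \<xi>0 v = 0 \<cdot>\<^sub>m outer_mat d \<xi>0 v"
     by (intro eq_matI) (auto simp: outer_mat_def)
    then have "p \<xi>0 v = (%Z. 0 * p \<xi>0 v Z)" by (metis p_def \<phi>_scale outer_mat_carrier)
    then have "\<Delta> (mat 1) = 0 * \<Delta> (mat 1)" unfolding \<Delta>_eq by (rule fun_cong)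
    then show False using hw_polyD(2)[OF hw] by simp
   qed
   ultimately have U0: "U = {0\<^sub>v d}" by simp
   have "Matrix.vec d c : U"
    unfolding U_def
   proof (intro CollectI conjI allI impI)
    fix A :: "'n cmat" assume A: "invertible A"
    have "pair (\<rho> A *\<^sub>v Matrix.vec d c) = (\<Sum>i<d. \<Sum>j<d. vec_index \<xi>0 i * (\<rho> A $$ (i, j) * c j))"
     unfolding pair_def
     by (rule sum.cong) (simp_all add: mult_mat_vec_index[OF \<rho>_carrier[OF A]] sum_distrib_left del: index_mult_mat_vec)
    also have "... = (\<Sum>j<d. \<Sum>i<d. vec_index \<xi>0 i * (\<rho> A $$ (i, j) * c j))" by (rule sum.swap)
    also have "... = (\<Sum>j<d. c j * f j A)"
     unfolding f_def
     by (rule sum.cong) (simp_all add: transpose_mult_vec_index[OF \<rho>_carrier[OF A] \<xi>0] sum_distrib_left mult_ac del: index_mult_mat_vec)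
    also have "... = 0" using c A by simp
    finally show "pair (\<rho> A *\<^sub>v Matrix.vec d c) = 0" .
   qed simp
   then have "Matrix.vec d c = 0\<^sub>v d" by (simp add: U0)
   then have "vec_index (Matrix.vec d c) j = vec_index (0\<^sub>v d) j" for j by simp
   then show ?thesis by (metis index_vec index_zero_vec(1))
  qed
  have "EX l. (ALL i<d. eval_comb ?X (l i)) & (ALL i<d. ALL j<d. l i (f j) = (if i = j then 1 else 0))"
   by (rule dual_evaluations, rule indep) simp
  then obtain l where dl: "ALL i<d. eval_comb ?X (l i)" "ALL i<d. ALL j<d. l i (f j) = (if i = j then 1 else 0)"
   by blast
  have comb: "p (Matrix.vec d (%j. l' (f j))) v : bi_module" if "eval_comb ?X l'" for l'
   using that
  proof induction
   case (eval A)
   then have A: "invertible A" by simp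
   have "Matrix.vec d (%j. f j A) = transpose_mat (\<rho> A) *\<^sub>v \<xi>0"
   proof -
    have "Matrix.vec d (vec_index X) = X" if "X : carrier_vec d" for X :: "complex Matrix.vec"
     by (rule eq_vecI) (use that in auto)
    from this[OF \<rho>tv[OF A \<xi>0]] show ?thesis by (simp only: f_def)
   qed
   moreover have "p (transpose_mat (\<rho> A) *\<^sub>v \<xi>0) v = (%Z. \<Delta> (A ** Z ** mat 1))"
    using p_left[OF A \<xi>0 v(1)] by (simp add: \<Delta>_eq fun_eq_iff)
   ultimately show ?case using generator_in_bi_module[OF A invertible_mat_1] by simp
  next
   case (add l1 l2)
   have "Matrix.vec d (%j. l1 (f j) + l2 (f j)) = Matrix.vec d (%j. l1 (f j)) + Matrix.vec d (%j. l2 (f j))"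
    by (rule eq_vecI) auto
   then show ?case using bi(2)[OF add.IH] by (simp add: p_add_left)
  next
   case (scale l1 c)
   have "Matrix.vec d (%j. c * l1 (f j)) = c \<cdot>\<^sub>v Matrix.vec d (%j. l1 (f j))"
    by (rule eq_vecI) auto
   then show ?case using bi(3)[OF scale.IH] by (simp add: p_scale_left)
  qed
  show ?thesis
  proof (cases "d = 0")
   case True
   then show ?thesis by (intro zero_bi) simp
  next
   case False
   have "eval_comb ?X (%g. \<Sum>i<d. vec_index \<xi> i * l i g)"
    by (rule eval_comb_sum_comb[of "mat 1"]) (use invertible_mat_1 dl(1) in auto)
   from comb[OF this]
   have "p (Matrix.vec d (%j. \<Sum>i<d. vec_index \<xi> i * l i (f j))) v : bi_module" .
   moreover have "Matrix.vec d (%j. \<Sum>i<d. vec_index \<xi> i * l i (f j)) = \<xi>"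
   proof (rule eq_vecI)
    fix j assume "j < dim_vec \<xi>"
    then have j: "j < d" using \<xi> by simp
    have "(\<Sum>i<d. vec_index \<xi> i * l i (f j)) = (\<Sum>i<d. if i = j then vec_index \<xi> j else 0)"
     by (rule sum.cong) (use dl(2) j in auto)
    then show "vec_index (Matrix.vec d (%j. \<Sum>i<d. vec_index \<xi> i * l i (f j))) j = vec_index \<xi> j"
     using j by simp
   qed (use \<xi> in simp)
   ultimately show ?thesis by simp
  qed
 qed
 have all_bi: "p \<xi> w : bi_module" if \<xi>: "\<xi> : carrier_vec d" and w: "w : carrier_vec d" for \<xi> w
 proof -
  define U where "U = {w : carrier_vec d. ALL \<xi>:carrier_vec d. p \<xi> w : bi_module}"
  have zero: "p \<xi> (0\<^sub>v d) : bi_module" if "\<xi> : carrier_vec d" for \<xi>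
  proof -
   have "0 \<cdot>\<^sub>v v = 0\<^sub>v d" using v(1) by (intro eq_vecI) auto
   then show ?thesis using p_scale_right[OF v(1), of \<xi> 0] bi(1) by simp
  qed
  have "U = {0\<^sub>v d} \<or> U = carrier_vec d"
  proof (rule irrD)
   show "U <= carrier_vec d" by (auto simp: U_def)
   show "0\<^sub>v d : U" by (simp add: U_def zero)
   show "u + w : U" if "u : U" "w : U" for u w
    using that bi(2) by (auto simp: U_def p_add_right)
   show "c \<cdot>\<^sub>v u : U" if "u : U" for c u
    using that bi(3) by (auto simp: U_def p_scale_right)
   fix B :: "'n cmat" and u assume B: "invertible B" and u: "u : U"
   have uc: "u : carrier_vec d" using u by (simp add: U_def)
   have "p \<xi> (\<rho> B *\<^sub>v u) : bi_module" if \<xi>: "\<xi> : carrier_vec d" for \<xi>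
   proof -
    have "p \<xi> u : bi_module" using u \<xi> by (simp add: U_def)
    from bi_module_invariant[OF invertible_mat_1 B this] show ?thesis
     by (simp add: p_right[OF B \<xi> uc])
   qed
   then show "\<rho> B *\<^sub>v u : U" using \<rho>v[OF B uc] by (simp add: U_def)
  qed
  moreover have "v : U" using v(1) left_bi by (simp add: U_def)
  ultimately have "U = carrier_vec d" using v(2) by auto
  then have "w : U" using w by simp
  then show ?thesis using \<xi> by (simp add: U_def)
 qed
 show "S <= bi_module"
 proof
  fix s assume "s : S"
  then obtain X where X: "X : carrier_mat d d" "s = \<phi> X" using bij by (auto simp: bij_betw_def)
  define Xk where "Xk k = Matrix.mat d d (%(i, j). if i < k then X $$ (i, j) else 0)" for k
  have "\<phi> (Xk k) : bi_module" for k
  proof (induction k)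
   case 0
   have "Xk 0 = outer_mat d (0\<^sub>v d) v" by (rule eq_matI) (auto simp: Xk_def outer_mat_def)
   then show ?case using all_bi[of "0\<^sub>v d" v] v(1) by (simp add: p_def)
  next
   case (Suc k)
   show ?case
   proof (cases "k < d")
    case True
    have "Xk (Suc k) = Xk k + outer_mat d (unit_vec d k) (Matrix.row X k)"
     by (rule eq_matI) (use X(1) True in \<open>auto simp: Xk_def outer_mat_def less_Suc_eq\<close>)
    moreover have "Xk k : carrier_mat d d" by (simp add: Xk_def)
    moreover have "p (unit_vec d k) (Matrix.row X k) : bi_module"
     using X(1) True by (intro all_bi) auto
    ultimately show ?thesis using bi(2)[OF Suc.IH] by (simp add: \<phi>_add p_def)
   next
    case False
    then have "Xk (Suc k) = Xk k" by (intro eq_matI) (auto simp: Xk_def)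
    then show ?thesis using Suc.IH by simp
   qed
  qed
  moreover have "Xk d = X" by (rule eq_matI) (use X(1) in \<open>auto simp: Xk_def\<close>)
  ultimately show "s : bi_module" using X(2) by metis
 qed
qed

end

lemma poly_component_eq:
 fixes m :: "int^('n::{finite,linorder})"
 assumes m: "m : dominant_weights" and \<Delta>: "hw_poly (%i. nat (m $ i)) \<Delta>"
 shows "poly_component m = hw_module.bi_module \<Delta>"
proof -
 interpret hw_module "%i. nat (m $ i)" \<Delta> by unfold_locales (rule \<Delta>)
 have m': "m $ i = int (nat (m $ i))" for i using m by (simp add: dominant_weights_def)
 show ?thesis
  unfolding poly_component_def
 proof (rule the_equality)
  show "poly_submodule bi_module & (EX d \<rho>. rational_rep d \<rho> & irreducible_rep d \<rho> \<and>
    has_highest_weight d \<rho> m & iso_dual_tensor d \<rho> bi_module)"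
   using poly_submodule_bi_module bi_module_is_dual_tensor[OF m'] by blast
  fix S assume "poly_submodule S & (EX d \<rho>. rational_rep d \<rho> & irreducible_rep d \<rho> \<and>
    has_highest_weight d \<rho> m & iso_dual_tensor d \<rho> S)"
  then show "S = bi_module" using dual_tensor_submodule_unique[OF m'] by blast
 qed
qed

lemma hw_poly_dominant_weight:
 fixes m :: "int^('n::{finite,linorder})"
 assumes "m : dominant_weights"
 shows "\<exists>\<Delta>. hw_poly (%i. nat (m $ i)) \<Delta>"
 using assms by (intro hw_poly_exists) (auto simp: dominant_weights_def antimono_def intro: nat_mono)

section \<open>Lebesgue measure and isometries\<close>

text \<open>
  The image measure is translation invariant, and Fubini's theorem shows that such a measure is
  determined up to a factor.
\<close>

lemma lborel_isometry_invariant: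
 fixes T :: "'a::euclidean_space => 'a"
 assumes lin: "linear T" and iso: "!!x. norm (T x) = norm x"
 shows "distr lborel borel T = lborel"
proof -
 have T_meas [measurable]: "T : borel_measurable borel"
  using lin by (intro borel_measurable_continuous_onI linear_continuous_on linear_conv_bounded_linear[THEN iffD1])
 define N where "N = distr lborel borel T"
 have sets_N [measurable_cong]: "sets N = sets borel" by (simp add: N_def)
 have inj: "inj T"
  using lin by (rule linear_injective_0[THEN iffD2]) (metis iso norm_eq_zero)
 have "surj T" using lin inj by (rule linear_inj_imp_surj)
 have N_eq: "emeasure N A = emeasure lborel (T -` A)" if "A : sets borel" for A
  using that by (simp add: N_def emeasure_distr)
 have N_ball: "emeasure N (ball 0 r) = emeasure lborel (ball (0::'a) r)" for r
 proof -
  have "T -` ball 0 r = ball 0 r" by (auto simp: iso)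
  then show ?thesis by (simp add: N_eq)
 qed
 have sf: "sigma_finite_measure N"
 proof
  show "EX A. countable A & A <= sets N & \<Union> A = space N & (ALL a:A. emeasure N a ~= \<infinity>)"
  proof (intro exI conjI ballI)
   let ?A = "range (%n::nat. ball (0::'a) (real n))"
   show "countable ?A" by simp
   show "?A <= sets N" by (auto simp: sets_N)
   show "\<Union> ?A = space N"
    using sets_eq_imp_space_eq[OF sets_N] reals_Archimedean2 by auto
   show "emeasure N a ~= \<infinity>" if "a : ?A" for a
    using that emeasure_bounded_finite[of "ball (0::'a) _"] by (auto simp: N_ball less_top[symmetric])
  qed
 qed
 interpret N: sigma_finite_measure N by (rule sf)
 interpret P: pair_sigma_finite N "lborel :: 'a measure" ..
 have N_shift: "distr N borel ((+) a) = N" for a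
 proof -
  obtain b where b: "a = T b" using \<open>surj T\<close> by (metis surjD)
  have "distr N borel ((+) a) = distr lborel borel ((+) a \<circ> T)"
   unfolding N_def by (rule distr_distr) simp_all
  also have "(+) a \<circ> T = T \<circ> (+) b"
   using linear_add[OF lin] by (auto simp: fun_eq_iff b)
  also have "distr lborel borel (T \<circ> (+) b) = distr (distr lborel borel ((+) b)) borel T"
   by (rule distr_distr[symmetric]) simp_all
  finally show ?thesis by (simp add: lborel_distr_plus N_def)
 qed
 have reflect: "distr lborel borel (%y. x - y) = lborel" for x :: 'a
  using lborel_affine[of "-1" x] by (simp add: density_1)
 have main: "emeasure N A * emeasure lborel B = emeasure N B * emeasure lborel A"
  if A [measurable]: "A : sets borel" and B [measurable]: "B : sets borel" for A B :: "'a set"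
 proof -
  have i1: "(\<integral>\<^sup>+y. indicator B (x + y) \<partial>lborel) = emeasure lborel B" for x :: 'a
  proof -
   have "emeasure lborel B = (\<integral>\<^sup>+y. indicator B y \<partial>distr lborel borel ((+) x))"
    by (simp add: lborel_distr_plus)
   also have "... = (\<integral>\<^sup>+y. indicator B (x + y) \<partial>lborel)"
    by (rule nn_integral_distr) simp_all
   finally show ?thesis by simp
  qed
  have i2: "(\<integral>\<^sup>+y. indicator A (x - y) \<partial>lborel) = emeasure lborel A" for x :: 'a
  proof -
   have "emeasure lborel A = (\<integral>\<^sup>+y. indicator A y \<partial>distr lborel borel (%y. x - y))"
    by (simp add: reflect)
   also have "... = (\<integral>\<^sup>+y. indicator A (x - y) \<partial>lborel)"
    by (rule nn_integral_distr) simp_all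
   finally show ?thesis by simp
  qed
  have i3: "(\<integral>\<^sup>+x. indicator A x * indicator B (x + y) \<partial>N) = (\<integral>\<^sup>+x. indicator A (x - y) * indicator B x \<partial>N)" for y :: 'a
  proof -
   have "(\<integral>\<^sup>+x. indicator A x * indicator B (x + y) \<partial>N)
     = (\<integral>\<^sup>+x. indicator A x * indicator B (x + y) \<partial>distr N borel ((+) (- y)))"
    by (simp only: N_shift)
   also have "... = (\<integral>\<^sup>+x. indicator A (- y + x) * indicator B (- y + x + y) \<partial>N)"
    by (rule nn_integral_distr) simp_all
   finally show ?thesis by (simp add: algebra_simps)
  qed
  have "emeasure N A * emeasure lborel B = (\<integral>\<^sup>+x. indicator A x * emeasure lborel B \<partial>N)"
   by (simp add: nn_integral_multc sets_N)
  also have "... = (\<integral>\<^sup>+x. (\<integral>\<^sup>+y. indicator A x * indicator B (x + y) \<partial>lborel) \<partial>N)"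
   by (intro nn_integral_cong) (simp add: nn_integral_cmult i1)
  also have "... = (\<integral>\<^sup>+y. (\<integral>\<^sup>+x. indicator A x * indicator B (x + y) \<partial>N) \<partial>lborel)"
   by (rule P.Fubini'[symmetric]) measurable
  also have "... = (\<integral>\<^sup>+y. (\<integral>\<^sup>+x. indicator A (x - y) * indicator B x \<partial>N) \<partial>lborel)"
   by (simp add: i3)
  also have "... = (\<integral>\<^sup>+x. (\<integral>\<^sup>+y. indicator A (x - y) * indicator B x \<partial>lborel) \<partial>N)"
   by (rule P.Fubini') measurable
  also have "... = (\<integral>\<^sup>+x. emeasure lborel A * indicator B x \<partial>N)"
   by (intro nn_integral_cong) (simp add: nn_integral_multc i2)
  also have "... = emeasure lborel A * emeasure N B"
   by (rule nn_integral_cmult_indicator) (simp add: sets_N)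
  also have "... = emeasure N B * emeasure lborel A" by (rule mult.commute)
  finally show ?thesis .
 qed
 have "N = lborel"
 proof (rule measure_eqI)
  show "sets N = sets lborel" by (simp add: sets_N)
  fix A assume "A : sets N"
  then have A: "A : sets borel" by (simp add: sets_N)
  let ?b = "emeasure lborel (ball (0::'a) 1)"
  have b_fin: "?b ~= \<infinity>" using emeasure_bounded_finite[of "ball (0::'a) 1"] by (simp add: less_top[symmetric])
  have b_pos: "?b ~= 0"
  proof
   assume "?b = 0"
   then have "ball (0::'a) 1 : null_sets lborel" by (simp add: null_sets_def)
   then have "negligible (ball (0::'a) 1)"
    using null_sets_completionI negligible_iff_null_sets by blast
   then show False using open_not_negligible[of "ball (0::'a) 1"] by simp
  qed
  have "emeasure N A * ?b = emeasure lborel A * ?b"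
   using main[OF A, of "ball 0 1"] by (simp add: N_ball mult.commute)
  then show "emeasure N A = emeasure lborel A"
   using b_fin b_pos by (metis ennreal_mult_cancel_left infinity_ennreal_def mult.commute)
 qed
 then show ?thesis by (simp add: N_def)
qed

section \<open>Norms of matrices and vectors\<close>

lemma norm_sq_vec: "(norm (v :: complex^'n))^2 = (\<Sum>i\<in>UNIV. (cmod (v $ i))^2)"
 by (simp add: norm_vec_def L2_set_def sum_nonneg)

lemma norm_sq_mat: "(norm (Z :: complex^'n^'m))^2 = (\<Sum>i\<in>UNIV. \<Sum>j\<in>UNIV. (cmod (Z $ i $ j))^2)"
 by (simp add: norm_vec_def[of Z] L2_set_def sum_nonneg norm_sq_vec)

definition herm :: "complex^'n => complex^'n => complex" where
 "herm v w = (\<Sum>i\<in>UNIV. cnj (v $ i) * w $ i)"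

lemma herm_self: "herm v v = of_real ((norm v)^2)"
 unfolding herm_def norm_sq_vec of_real_sum complex_norm_square by (simp add: mult.commute)

lemma herm_adjoint: "herm (A *v v) w = herm v (conj_transpose A *v w)"
proof -
 have "herm (A *v v) w = (\<Sum>i\<in>UNIV. \<Sum>k\<in>UNIV. cnj (A $ i $ k) * cnj (v $ k) * w $ i)"
  by (simp add: herm_def matrix_vector_mult_def sum_distrib_right)
 also have "... = (\<Sum>k\<in>UNIV. \<Sum>i\<in>UNIV. cnj (A $ i $ k) * cnj (v $ k) * w $ i)" by (rule sum.swap)
 also have "... = herm v (conj_transpose A *v w)"
  by (simp add: herm_def matrix_vector_mult_def conj_transpose_def sum_distrib_left mult_ac)
 finally show ?thesis .
qed

lemma herm_cnj: "cnj (herm v w) = herm w v"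
 by (simp add: herm_def mult.commute)

lemma herm_add_right: "herm v (u + w) = herm v u + herm v w"
 and herm_diff_right: "herm v (u - w) = herm v u - herm v w"
 by (simp_all add: herm_def algebra_simps sum.distrib sum_subtractf)

lemma unitary_groupD:
 assumes "A : unitary_group"
 shows "conj_transpose A ** A = mat 1" "A ** conj_transpose A = mat 1" "invertible A"
  "matrix_inv A = conj_transpose A" "conj_transpose A : unitary_group"
proof -
 show 1: "conj_transpose A ** A = mat 1" using assms by (simp add: unitary_group_def)
 then show 2: "A ** conj_transpose A = mat 1" by (simp add: matrix_left_right_inverse)
 show 3: "invertible A" unfolding invertible_def using 1 2 by blast
 have "matrix_inv A = (conj_transpose A ** A) ** matrix_inv A" by (simp add: 1)
 also have "... = conj_transpose A" by (simp add: matrix_mul_assoc[symmetric] matrix_inv_right[OF 3])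
 finally show "matrix_inv A = conj_transpose A" .
 show "conj_transpose A : unitary_group" by (simp add: unitary_group_def 2)
qed

lemma norm_unitary_vec:
 assumes "A : unitary_group" shows "norm (A *v v) = norm v"
proof -
 have "herm (A *v v) (A *v v) = herm v v"
  by (simp add: herm_adjoint matrix_vector_mul_assoc unitary_groupD(1)[OF assms])
 then have "(norm (A *v v))^2 = (norm v)^2" by (simp only: herm_self of_real_eq_iff)
 then show ?thesis by (simp add: power2_eq_iff_nonneg)
qed

lemma norm_conj_transpose: "norm (conj_transpose Z) = norm (Z :: complex^'n^'m)"
proof -
 have "(norm (conj_transpose Z))^2 = (norm Z)^2"
  unfolding norm_sq_mat by (subst sum.swap) (simp add: conj_transpose_def)
 then show ?thesis by (simp add: power2_eq_iff_nonneg)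
qed

lemma norm_sq_mat_columns: "(norm (Z :: complex^'n^'m))^2 = (\<Sum>j\<in>UNIV. (norm (Z *v axis j 1))^2)"
proof -
 have "(Z *v axis j 1) $ i = Z $ i $ j" for i j
 proof -
  have "(Z *v axis j 1) $ i = (\<Sum>k\<in>UNIV. if k = j then Z $ i $ j else 0)"
   unfolding matrix_vector_mult_def vec_lambda_beta by (rule sum.cong) (auto simp: caxis_def)
  then show ?thesis by simp
 qed
 then show ?thesis unfolding norm_sq_mat norm_sq_vec by (subst sum.swap) simp
qed

lemma norm_unitary_left:
 assumes "A : unitary_group" shows "norm (A ** Z) = norm (Z :: 'n::finite cmat)"
proof -
 have "(norm (A ** Z))^2 = (norm Z)^2"
  unfolding norm_sq_mat_columns by (simp add: matrix_vector_mul_assoc[symmetric] norm_unitary_vec[OF assms])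
 then show ?thesis by (simp add: power2_eq_iff_nonneg)
qed

lemma norm_unitary_right:
 assumes "B : unitary_group" shows "norm (Z ** B) = norm (Z :: 'n::finite cmat)"
proof -
 have "norm (Z ** B) = norm (conj_transpose B ** conj_transpose Z)"
  by (metis norm_conj_transpose conj_transpose_mult)
 also have "... = norm Z" by (simp add: norm_unitary_left[OF unitary_groupD(5)[OF assms]] norm_conj_transpose)
 finally show ?thesis .
qed

lemma norm_matrix_vector_mult_le: "norm ((Z :: complex^'n^'m) *v v) <= norm Z * norm v"
proof (rule power2_le_imp_le)
 have CS: "(cmod ((Z *v v) $ i))^2 <= (\<Sum>j\<in>UNIV. (cmod (Z $ i $ j))^2) * (norm v)^2" for i
 proof -
  have "cmod ((Z *v v) $ i) <= (\<Sum>j\<in>UNIV. cmod (Z $ i $ j) * cmod (v $ j))"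
   unfolding matrix_vector_mult_def by (simp add: sum_norm_le norm_mult)
  then have "(cmod ((Z *v v) $ i))^2 <= (\<Sum>j\<in>UNIV. cmod (Z $ i $ j) * cmod (v $ j))^2"
   by (rule power_mono) simp
  also have "... <= (\<Sum>j\<in>UNIV. (cmod (Z $ i $ j))^2) * (\<Sum>j\<in>UNIV. (cmod (v $ j))^2)"
   by (rule Cauchy_Schwarz_ineq_sum)
  finally show ?thesis by (simp add: norm_sq_vec)
 qed
 have "(norm (Z *v v))^2 = (\<Sum>i\<in>UNIV. (cmod ((Z *v v) $ i))^2)" by (rule norm_sq_vec)
 also have "... <= (\<Sum>i\<in>UNIV. (\<Sum>j\<in>UNIV. (cmod (Z $ i $ j))^2) * (norm v)^2)" by (rule sum_mono[OF CS])
 also have "... = (norm Z * norm v)^2" by (simp add: norm_sq_mat sum_distrib_right power_mult_distrib)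
 finally show "(norm (Z *v v))^2 <= (norm Z * norm v)^2" .
qed simp

lemma matrix_mult_scalar: "mat c ** (Z :: complex^'n^'m) = (\<chi> i j. c * Z $ i $ j)"
proof -
 have "(mat c ** Z) $ i $ j = c * Z $ i $ j" for i j
 proof -
  have "(mat c ** Z) $ i $ j = (\<Sum>k\<in>UNIV. if k = i then c * Z $ i $ j else 0)"
   unfolding matrix_matrix_mult_def vec_lambda_beta by (rule sum.cong) (auto simp: cmat_def)
  then show ?thesis by simp
 qed
 then show ?thesis by (simp add: cvec_eq_iff)
qed

lemma norm_scalar_mat: "norm (mat c ** (Z :: complex^'n^'m)) = cmod c * norm Z"
proof -
 have "(norm (mat c ** Z))^2 = (cmod c * norm Z)^2"
  by (simp add: norm_sq_mat matrix_mult_scalar norm_mult power_mult_distrib sum_distrib_left)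
 then show ?thesis by (simp add: power2_eq_iff_nonneg)
qed

lemma scalar_mat_vec: "(mat c ** Z) *v v = Z *v (c *s v)" "Z *v (c *s v) = c *s (Z *v (v :: complex^'n))"
 by (simp_all add: cvec_eq_iff matrix_vector_mult_def matrix_mult_scalar sum_distrib_left mult_ac)

lemma norm_scale_vec: "norm (c *s (v :: complex^'n)) = cmod c * norm v"
proof -
 have "(norm (c *s v))^2 = (cmod c * norm v)^2"
  by (simp add: norm_sq_vec norm_mult power_mult_distrib sum_distrib_left)
 then show ?thesis by (simp add: power2_eq_iff_nonneg)
qed

section \<open>The domain\<close>

lemma cartan_domain_iff:
 "Z : cartan_domain \<longleftrightarrow> (ALL v. v ~= 0 --> norm (Z *v v) < norm v)"
proof -
 have "(\<Sum>i\<in>UNIV. cnj (v $ i) * ((mat 1 - conj_transpose Z ** Z) *v v) $ i)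
   = of_real ((norm v)^2 - (norm (Z *v v))^2)" for v
 proof -
  have "(\<Sum>i\<in>UNIV. cnj (v $ i) * ((mat 1 - conj_transpose Z ** Z) *v v) $ i)
    = herm v (v - conj_transpose Z *v (Z *v v))"
   by (simp add: herm_def matrix_vector_mult_diff_rdistrib matrix_vector_mul_assoc)
  also have "... = herm v v - herm (Z *v v) (Z *v v)" by (simp add: herm_diff_right herm_adjoint)
  finally show ?thesis by (simp add: herm_self)
 qed
 moreover have "0 < (norm v)^2 - (norm (Z *v v))^2 \<longleftrightarrow> norm (Z *v v) < norm v" for v
  using power_mono_iff[of "norm v" "norm (Z *v v)" 2] by (simp add: not_le[symmetric])
 ultimately show ?thesis
  unfolding cartan_domain_def positive_definite_def mem_Collect_eq by simp
qed

lemma cartan_domain_unitary: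
 fixes A B Z :: "('n::finite) cmat"
 assumes A: "A : unitary_group" and B: "B : unitary_group"
 shows "A ** Z ** B : cartan_domain \<longleftrightarrow> Z : cartan_domain"
proof -
 have imp: "A ** Z ** B : cartan_domain"
  if A: "A : unitary_group" and B: "B : unitary_group" and Z: "Z : cartan_domain" for A B Z :: "'n cmat"
  unfolding cartan_domain_iff
 proof (intro allI impI)
  fix v :: "complex^'n" assume "v ~= 0"
  then have "B *v v ~= 0" using norm_unitary_vec[OF B, of v] by auto
  then have "norm (Z *v (B *v v)) < norm (B *v v)" using Z by (simp add: cartan_domain_iff)
  then show "norm ((A ** Z ** B) *v v) < norm v"
   using norm_unitary_vec[OF A, of "Z *v (B *v v)"] norm_unitary_vec[OF B, of v]
   by (simp add: matrix_vector_mul_assoc matrix_mul_assoc)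
 qed
 have "conj_transpose A ** (A ** Z ** B) ** conj_transpose B
   = (conj_transpose A ** A) ** Z ** (B ** conj_transpose B)" by (simp add: matrix_mul_assoc)
 then have "conj_transpose A ** (A ** Z ** B) ** conj_transpose B = Z"
  by (simp add: unitary_groupD[OF A] unitary_groupD[OF B])
 then show ?thesis
  using imp[OF A B] imp[OF unitary_groupD(5)[OF A] unitary_groupD(5)[OF B], of "A ** Z ** B"] by auto
qed

lemma cartan_domain_balanced:
 assumes Z: "Z : cartan_domain" and c: "cmod c <= 1"
 shows "mat c ** Z : cartan_domain"
 unfolding cartan_domain_iff
proof (intro allI impI)
 fix v :: "complex^'a" assume v: "v ~= 0"
 have "norm ((mat c ** Z) *v v) = cmod c * norm (Z *v v)"
  by (simp add: scalar_mat_vec norm_scale_vec)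
 also have "... <= 1 * norm (Z *v v)" using c by (rule mult_right_mono) simp
 also have "1 * norm (Z *v v) < norm v" using Z v by (simp add: cartan_domain_iff)
 finally show "norm ((mat c ** Z) *v v) < norm v" .
qed

lemma zero_in_cartan_domain: "0 : cartan_domain"
 by (simp add: cartan_domain_iff)

lemma continuous_on_matrix_vector: "continuous_on S (%v. (Z :: complex^'n^'m) *v v)"
proof (rule linear_continuous_on, rule bounded_linear_intro[where K="norm Z"])
 show "Z *v (u + v) = Z *v u + Z *v v" for u v by (rule matrix_vector_right_distrib)
 show "Z *v (r *\<^sub>R v) = r *\<^sub>R (Z *v v)" for r v
  by (simp add: cvec_eq_iff matrix_vector_mult_def scaleR_sum_right)
 show "norm (Z *v v) <= norm v * norm Z" for v
  using norm_matrix_vector_mult_le[of Z v] by (simp add: mult.commute)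
qed

lemma open_cartan_domain: "open (cartan_domain :: ('n::finite cmat) set)"
 unfolding open_contains_ball
proof
 fix Z :: "'n cmat" assume Z: "Z : cartan_domain"
 let ?S = "sphere (0 :: complex^'n) 1"
 have "compact ?S" "?S ~= {}" by simp_all
 moreover have "continuous_on ?S (%v. norm (Z *v v))"
  by (intro continuous_on_norm continuous_on_matrix_vector)
 ultimately obtain v0 where v0: "v0 : ?S" "!!v. v : ?S ==> norm (Z *v v) <= norm (Z *v v0)"
  using continuous_attains_sup[of ?S "%v. norm (Z *v v)"] by blast
 define c where "c = norm (Z *v v0)"
 have "v0 ~= 0" "norm v0 = 1" using v0(1) by auto
 then have c1: "c < 1" using Z unfolding c_def cartan_domain_iff by metis
 have Zc: "norm (Z *v v) <= c * norm v" for v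
 proof (cases "v = 0")
  case False
  let ?u = "(1 / norm v) *\<^sub>R v"
  have "norm (Z *v ?u) <= c" unfolding c_def by (rule v0(2)) (use False in simp)
  moreover have "Z *v ?u = (1 / norm v) *\<^sub>R (Z *v v)"
   by (simp add: matrix_vector_mult_def cvec_eq_iff scaleR_sum_right)
  ultimately show ?thesis using False by (simp add: field_simps)
 qed simp
 show "EX e>0. ball Z e <= cartan_domain"
 proof (intro exI conjI subsetI)
  show "1 - c > 0" using c1 by simp
  fix W assume "W : ball Z (1 - c)"
  then have W: "norm (W - Z) < 1 - c" by (simp add: dist_norm norm_minus_commute)
  show "W : cartan_domain"
   unfolding cartan_domain_iff
  proof (intro allI impI)
   fix v :: "complex^'n" assume v: "v ~= 0"
   have "W *v v = Z *v v + (W - Z) *v v" by (simp add: matrix_vector_mult_diff_rdistrib)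
   then have "norm (W *v v) <= norm (Z *v v) + norm ((W - Z) *v v)" by (simp add: norm_triangle_ineq)
   also have "... <= c * norm v + norm (W - Z) * norm v"
    by (intro add_mono Zc norm_matrix_vector_mult_le)
   also have "... < c * norm v + (1 - c) * norm v" using W v by simp
   finally show "norm (W *v v) < norm v" by (simp add: algebra_simps)
  qed
 qed
qed

lemma cartan_domain_row_norm:
 assumes "Z : cartan_domain" shows "norm (Z $ i) < 1"
proof (cases "Z $ i = 0")
 case False
 let ?v = "\<chi> j. cnj (Z $ i $ j)"
 have nv: "norm ?v = norm (Z $ i)" by (simp add: norm_vec_def)
 have "(Z *v ?v) $ i = of_real ((norm (Z $ i))^2)"
  unfolding norm_sq_vec of_real_sum complex_norm_square by (simp add: matrix_vector_mult_def)
 then have "(norm (Z $ i))^2 = cmod ((Z *v ?v) $ i)" by (simp del: of_real_power)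
 also have "... <= norm (Z *v ?v)" by (rule Finite_Cartesian_Product.norm_nth_le)
 also have "... < norm ?v" using assms False nv unfolding cartan_domain_iff by (metis norm_eq_zero)
 finally have "norm (Z $ i) * norm (Z $ i) < 1 * norm (Z $ i)" by (simp add: nv power2_eq_square)
 then show ?thesis using False by simp
qed simp

lemma bounded_cartan_domain: "bounded (cartan_domain :: ('n::finite cmat) set)"
proof (rule boundedI)
 fix Z :: "'n cmat" assume Z: "Z : cartan_domain"
 have "norm Z <= (\<Sum>i\<in>UNIV. norm (Z $ i))" by (simp add: norm_vec_def[of Z] L2_set_le_sum)
 also have "... <= (\<Sum>i\<in>(UNIV :: 'n set). 1)"
  by (rule sum_mono) (use cartan_domain_row_norm[OF Z] less_imp_le in blast)
 finally show "norm Z <= real CARD('n)" by simp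
qed

section \<open>Positivity of the density\<close>

lemma Sylvester_det:
 fixes A B :: "('n::{finite,linorder}) cmat"
 shows "det (mat 1 - A ** B) = det (mat 1 - B ** A)"
proof -
 have p1: "polynomial_fun (%A::'n cmat. (mat 1 - A ** B) $ i $ j)" for i j
  using polynomial_fun_diff[OF polynomial_fun.const polynomial_fun_mult_right] by simp
 have p2: "polynomial_fun (%A::'n cmat. (mat 1 - B ** A) $ i $ j)" for i j
  using polynomial_fun_diff[OF polynomial_fun.const polynomial_fun_mult_left] by simp
 have "polynomial_fun (%A::'n cmat. det (mat 1 - A ** B) - det (mat 1 - B ** A))"
  by (rule polynomial_fun_diff[OF polynomial_fun_det[OF p1] polynomial_fun_det[OF p2]])
 then have "det (mat 1 - A ** B) - det (mat 1 - B ** A) = 0"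
 proof (rule polynomial_fun_0_on_invertible)
  fix A :: "'n cmat" assume A: "invertible A"
  have "mat 1 - A ** B = A ** (mat 1 - B ** A) ** matrix_inv A"
   by (simp add: matrix_sub_ldistrib matrix_sub_rdistrib matrix_mul_assoc[symmetric] matrix_inv_right[OF A])
  then have "det (mat 1 - A ** B) = det (A ** matrix_inv A) * det (mat 1 - B ** A)"
   by (simp add: det_mul)
  then show "det (mat 1 - A ** B) - det (mat 1 - B ** A) = 0"
   by (simp add: matrix_inv_right[OF A])
 qed
 then show ?thesis by simp
qed

definition gram_det :: "('n => real) => ('n::finite) cmat => complex" where
 "gram_det c Z = det (mat 1 - dmat (%i. of_real (c i)) ** (Z ** conj_transpose Z))"

lemma conj_transpose_dmat_real: "conj_transpose (dmat (%i. of_real (c i))) = dmat (%i. of_real (c i))"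
 by (auto simp: conj_transpose_def dmat_def cvec_eq_iff)

lemma gram_det_real:
 fixes Z :: "('n::{finite,linorder}) cmat"
 shows "gram_det c Z : \<real>"
proof -
 let ?C = "dmat (%i. of_real (c i)) :: 'n cmat"
 have "cnj (gram_det c Z) = det (conj_transpose (mat 1 - ?C ** (Z ** conj_transpose Z)))"
  by (simp add: gram_det_def det_conj_transpose)
 also have "... = det (mat 1 - (Z ** conj_transpose Z) ** ?C)"
  by (simp add: conj_transpose_diff conj_transpose_mult conj_transpose_dmat_real matrix_mul_assoc)
 also have "... = gram_det c Z" unfolding gram_det_def by (rule Sylvester_det)
 finally show ?thesis using Reals_cnj_iff by blast
qed

lemma gram_det_nonzero:
 fixes Z :: "('n::{finite,linorder}) cmat"
 assumes Z: "Z : cartan_domain" and c: "!!i. c i <= 1"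
 shows "gram_det c Z ~= 0"
proof
 let ?C = "dmat (%i. of_real (c i)) :: 'n cmat"
 assume "gram_det c Z = 0"
 then have "\<not> invertible (mat 1 - ?C ** (Z ** conj_transpose Z))"
  by (simp add: gram_det_def invertible_det_nz)
 then obtain v where v: "v ~= 0" "(mat 1 - ?C ** (Z ** conj_transpose Z)) *v v = 0"
  unfolding invertible_iff_kernel by blast
 define u where "u = conj_transpose Z *v v"
 have v_eq: "v = ?C *v (Z *v u)"
  using v(2) by (simp add: u_def matrix_vector_mult_diff_rdistrib matrix_vector_mul_assoc matrix_mul_assoc)
 have u0: "u ~= 0" using v(1) v_eq by auto
 have Cw: "(?C *v w) $ i = of_real (c i) * w $ i" for w i
 proof -
  have "(?C *v w) $ i = (\<Sum>k\<in>UNIV. if k = i then of_real (c i) * w $ i else 0)"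
   unfolding matrix_vector_mult_def vec_lambda_beta by (rule sum.cong) (auto simp: dmat_def)
  then show ?thesis by simp
 qed
 have "of_real ((norm u)^2) = herm (Z *v u) v"
  unfolding herm_adjoint u_def[symmetric] by (rule herm_self[symmetric])
 also have "... = (\<Sum>i\<in>UNIV. cnj ((Z *v u) $ i) * (of_real (c i) * (Z *v u) $ i))"
  by (subst v_eq) (simp add: herm_def Cw)
 also have "... = of_real (\<Sum>i\<in>UNIV. c i * (cmod ((Z *v u) $ i))^2)"
  unfolding of_real_sum of_real_mult complex_norm_square by (simp add: mult_ac)
 finally have "(norm u)^2 = (\<Sum>i\<in>UNIV. c i * (cmod ((Z *v u) $ i))^2)" by (simp only: of_real_eq_iff)
 also have "... <= (\<Sum>i\<in>UNIV. 1 * (cmod ((Z *v u) $ i))^2)"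
  by (intro sum_mono mult_right_mono c) simp
 also have "... = (norm (Z *v u))^2" by (simp add: norm_sq_vec)
 also have "... < (norm u)^2"
  using Z u0 by (intro power_strict_mono) (auto simp: cartan_domain_iff)
 finally show False by simp
qed

lemma gram_det_pos:
 fixes Z :: "('n::{finite,linorder}) cmat"
 assumes Z: "Z : cartan_domain" and c: "!!i. c i <= 1"
 shows "0 < Re (gram_det c Z)"
proof (rule ccontr)
 assume "\<not> 0 < Re (gram_det c Z)"
 define g where "g t = Re (gram_det (%i. t * c i) Z)" for t
 have g0: "g 0 = 1"
 proof -
  have "dmat (%i. 0) = (0 :: 'n cmat)" by (simp add: dmat_def cvec_eq_iff)
  then show ?thesis by (simp add: g_def gram_det_def)
 qed
 have g1: "g 1 <= 0" using \<open>\<not> 0 < Re (gram_det c Z)\<close> by (simp add: g_def)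
 have cif: "continuous_on {0..1} (%t. if P then complex_of_real (t * c i) else 0)" for P i
  by (cases P) (auto intro!: continuous_intros)
 have "continuous_on {0..1} g"
  unfolding g_def gram_det_def det_def matrix_matrix_mult_def dmat_def
  by (simp add: cif, intro continuous_intros cif)
 then obtain t where t: "0 <= t" "t <= 1" "g t = 0"
  using IVT2'[of g 1 0 0] g0 g1 by auto
 have "t * c i <= 1" for i
 proof (cases "c i <= 0")
  case True
  then have "t * c i <= 0" using t(1) by (rule mult_nonneg_nonpos[rotated])
  then show ?thesis by simp
 next
  case False
  then show ?thesis using mult_mono[of t 1 "c i" 1] t c[of i] by simp
 qed
 then have "gram_det (%i. t * c i) Z ~= 0" by (rule gram_det_nonzero[OF Z])
 then show False using t(3) gram_det_real[of "%i. t * c i" Z]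
  by (simp add: g_def complex_is_Real_iff complex_eq_iff)
qed

lemma gram_det_affine:
 "gram_det (c(b := x)) Z = (1 - of_real x) * gram_det (c(b := 0)) Z + of_real x * gram_det (c(b := 1)) Z"
proof -
 let ?G = "Z ** conj_transpose Z"
 define r where "r i = (mat 1 - dmat (%i. of_real (c i)) ** ?G) $ i" for i
 define e where "e = (mat 1 :: 'a cmat) $ b"
 define w where "w = - (?G $ b)"
 have M: "mat 1 - dmat (%i. of_real ((c(b := x)) i)) ** ?G = (\<chi> i. if i = b then e + of_real x *s w else r i)" for x
  by (simp add: cvec_eq_iff dmat_mult_left_entry r_def e_def w_def)
 have D: "gram_det (c(b := x)) Z = det (\<chi> i. if i = b then e else r i) + of_real x * det (\<chi> i. if i = b then w else r i)" for x
  unfolding gram_det_def M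
  using det_row_add[of b "%_. e" "%_. of_real x *s w" r] det_row_mul[of b "of_real x" "%_. w" r] by simp
 show ?thesis unfolding D[of x] D[of 0] D[of 1] by (simp add: algebra_simps)
qed

lemma continuous_on_matrix_mult [continuous_intros]:
 fixes f :: "'x::topological_space => complex^'n^'m" and g :: "'x => complex^'k^'n"
 assumes "continuous_on S f" "continuous_on S g"
 shows "continuous_on S (%x. f x ** g x)"
 unfolding matrix_matrix_mult_def
 by (intro continuous_on_vec_lambda continuous_on_sum continuous_on_mult continuous_on_component assms)

lemma continuous_on_conj_transpose [continuous_intros]:
 fixes f :: "'x::topological_space => complex^'n^'m"
 assumes "continuous_on S f"
 shows "continuous_on S (%x. conj_transpose (f x))"
 unfolding conj_transpose_def
 by (intro continuous_on_vec_lambda continuous_on_cnj continuous_on_component assms)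

lemma continuous_on_det [continuous_intros]:
 fixes f :: "'x::topological_space => complex^'n^'n"
 assumes "continuous_on S f"
 shows "continuous_on S (%x. det (f x))"
 unfolding det_def
 by (intro continuous_on_sum continuous_on_mult continuous_on_const continuous_on_prod continuous_on_component assms)

lemma continuous_gram_det: "continuous_on S (gram_det c)"
 unfolding gram_det_def[abs_def] by (intro continuous_intros)

lemma gram_det_dmat_mult:
 fixes Z :: "('n::{finite,linorder}) cmat"
 shows "gram_det c (dmat (%i. of_real (s i)) ** Z) = gram_det (%i. c i * (s i)^2) Z"
proof -
 let ?S = "dmat (%i. of_real (s i)) :: 'n cmat" and ?C = "dmat (%i. of_real (c i)) :: 'n cmat"
 have "gram_det c (?S ** Z) = det (mat 1 - (?C ** ?S ** (Z ** conj_transpose Z)) ** ?S)"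
  by (simp add: gram_det_def conj_transpose_mult conj_transpose_dmat_real matrix_mul_assoc)
 also have "... = det (mat 1 - ?S ** (?C ** ?S ** (Z ** conj_transpose Z)))" by (rule Sylvester_det)
 also have "?S ** (?C ** ?S ** (Z ** conj_transpose Z)) = (?S ** (?C ** ?S)) ** (Z ** conj_transpose Z)"
  by (simp add: matrix_mul_assoc)
 also have "?S ** (?C ** ?S) = dmat (%i. of_real (c i * (s i)^2))"
  by (simp add: dmat_mult power2_eq_square mult_ac)
 finally show ?thesis by (simp add: gram_det_def)
qed

lemma dmat_mult_vec: "(dmat s *v w) $ i = s i * w $ i"
proof -
 have "(dmat s *v w) $ i = (\<Sum>k\<in>UNIV. if k = i then s i * w $ i else 0)"
  unfolding matrix_vector_mult_def vec_lambda_beta by (rule sum.cong) (auto simp: dmat_def)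
 then show ?thesis by simp
qed

lemma dmat_contraction:
 assumes Z: "Z : cartan_domain" and s: "!!i. cmod (s i) <= 1"
 shows "dmat s ** Z : cartan_domain"
 unfolding cartan_domain_iff
proof (intro allI impI)
 fix v :: "complex^'a" assume v: "v ~= 0"
 have "(norm ((dmat s ** Z) *v v))^2 = (\<Sum>i\<in>UNIV. (cmod (s i) * cmod ((Z *v v) $ i))^2)"
  by (simp add: norm_sq_vec matrix_vector_mul_assoc[symmetric] dmat_mult_vec norm_mult)
 also have "... <= (\<Sum>i\<in>UNIV. (1 * cmod ((Z *v v) $ i))^2)"
  by (intro sum_mono power_mono mult_right_mono s) simp_all
 also have "... = (norm (Z *v v))^2" by (simp add: norm_sq_vec)
 finally have "norm ((dmat s ** Z) *v v) <= norm (Z *v v)" by (rule power2_le_imp_le) simp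
 also have "... < norm v" using Z v by (simp add: cartan_domain_iff)
 finally show "norm ((dmat s ** Z) *v v) < norm v" .
qed

definition one_on :: "'n set => 'n => real" where
 "one_on J i = (if i : J then 1 else 0)"

definition row_part :: "'n set => ('n::finite) cmat => 'n cmat" where
 "row_part J Z = dmat (%i. of_real (one_on J i)) ** Z"

definition partial_domain :: "'n set => (('n::finite) cmat) set" where
 "partial_domain J = {Z. row_part J Z : cartan_domain & (ALL i. i \<notin> J --> norm (Z $ i) < 1)}"

definition partial_gram :: "'n set => ('n::finite) cmat => real" where
 "partial_gram J Z = Re (gram_det (one_on J) Z)"

lemma row_part_UNIV: "row_part UNIV Z = Z"
 by (simp add: row_part_def one_on_def dmat_one)

lemma gram_det_row_part:
 fixes Z :: "('n::{finite,linorder}) cmat"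
 assumes "!!i. i \<notin> J ==> c i = 0"
 shows "gram_det c (row_part J Z) = gram_det c Z"
proof -
 have "(%i. c i * (one_on J i)^2) = c" using assms by (auto simp: one_on_def)
 then show ?thesis by (simp add: row_part_def gram_det_dmat_mult)
qed

lemma partial_gram_pos:
 fixes Z :: "('n::{finite,linorder}) cmat"
 assumes "Z : partial_domain J" "!!i. i \<notin> J ==> c i = 0" "!!i. c i <= 1"
 shows "0 < Re (gram_det c Z)"
 using gram_det_pos[of "row_part J Z" c] gram_det_row_part[of J c Z] assms
 by (auto simp: partial_domain_def)

lemma row_part_row: "row_part J Z $ i = (if i : J then Z $ i else 0)"
 by (auto simp: row_part_def cvec_eq_iff dmat_mult_left_entry one_on_def)

lemma partial_domain_mono:
 assumes "J <= K" "Z : partial_domain K"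
 shows "Z : partial_domain J"
proof -
 have K: "row_part K Z : cartan_domain" using assms(2) by (simp add: partial_domain_def)
 have "row_part J (row_part K Z) = row_part J Z"
  unfolding row_part_def matrix_mul_assoc dmat_mult
  using assms(1) by (intro arg_cong2[of _ _ _ _ "(**)"] arg_cong[of _ _ dmat]) (auto simp: one_on_def fun_eq_iff)
 moreover have "row_part J (row_part K Z) : cartan_domain"
  unfolding row_part_def[of J] by (rule dmat_contraction[OF K]) (simp add: one_on_def)
 moreover have "norm (Z $ i) < 1" if "i \<notin> J" for i
 proof (cases "i : K")
  case True
  then show ?thesis using cartan_domain_row_norm[OF K, of i] by (simp add: row_part_row)
 next
  case False
  then show ?thesis using assms(2) by (simp add: partial_domain_def)
 qed
 ultimately show ?thesis by (simp add: partial_domain_def)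
qed

lemma open_partial_domain: "open (partial_domain J)"
proof -
 have "partial_domain J = row_part J -` cartan_domain \<inter> (\<Inter>i\<in>-J. (%Z. norm (Z $ i)) -` {..<1})"
  by (auto simp: partial_domain_def)
 moreover have "open (row_part J -` cartan_domain)"
  unfolding row_part_def[abs_def]
  by (intro open_vimage open_cartan_domain continuous_intros)
 moreover have "open ((%Z :: 'a cmat. norm (Z $ i)) -` {..<1})" for i
  by (intro open_vimage open_lessThan continuous_intros)
 ultimately show ?thesis by (auto intro!: open_Int open_INT)
qed

lemma bounded_partial_domain_empty: "bounded (partial_domain {} :: (('n::finite) cmat) set)"
proof (rule boundedI)
 fix Z :: "'n cmat" assume "Z : partial_domain {}"
 then have Z: "norm (Z $ i) <= 1" for i by (auto simp: partial_domain_def less_imp_le)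
 have "norm Z <= (\<Sum>i\<in>UNIV. norm (Z $ i))" by (simp add: norm_vec_def[of Z] L2_set_le_sum)
 also have "... <= (\<Sum>i\<in>(UNIV :: 'n set). 1)" by (rule sum_mono[OF Z])
 finally show "norm Z <= real CARD('n)" by simp
qed

definition scale_row :: "'n => real => ('n::finite) cmat => 'n cmat" where
 "scale_row b r Z = dmat (%i. of_real (if i = b then r else 1)) ** Z"

lemma scale_row_inverse: "r ~= 0 ==> scale_row b (inverse r) (scale_row b r Z) = Z"
 unfolding scale_row_def matrix_mul_assoc dmat_mult
 by (subst (2) matrix_mul_lid[of Z, symmetric], subst dmat_one[symmetric],
   intro arg_cong2[of _ _ _ _ "(**)"] arg_cong[of _ _ dmat]) (auto simp: fun_eq_iff)

lemma measurable_scale_row [measurable]: "scale_row b r : borel_measurable borel"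
 unfolding scale_row_def[abs_def]
 by (intro borel_measurable_continuous_onI continuous_intros)

lemma nn_integral_scale_row:
 fixes b :: "'n::finite"
 shows "EX m. ALL r>0. ALL g:borel_measurable borel.
  (\<integral>\<^sup>+Z. g Z \<partial>(lborel :: 'n cmat measure)) = ennreal (r ^ m) * (\<integral>\<^sup>+Z. g (scale_row b r Z) \<partial>lborel)"
proof (intro exI allI ballI impI)
 fix r :: real and g :: "'n cmat => ennreal" assume r: "0 < r" and g [measurable]: "g : borel_measurable borel"
 define c where "c j = (if j $ b = 0 then 1 else r)" for j :: "'n cmat"
 have eq: "(0 :: 'n cmat) + (\<Sum>j\<in>Basis. (c j * (x \<bullet> j)) *\<^sub>R j) = scale_row b r x" for x
 proof (rule euclidean_eqI)
  fix j :: "'n cmat" assume j: "j : Basis"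
  then obtain i u where iu: "j = axis i u" "u : Basis" by (auto simp: Basis_vec_def)
  have "u ~= 0" using iu(2) nonzero_Basis by auto
  then have c: "c j = (if i = b then r else 1)" by (auto simp: c_def iu(1) caxis_def)
  have row: "scale_row b r x $ i = (if i = b then r *\<^sub>R x $ i else x $ i)"
   by (auto simp: scale_row_def cvec_eq_iff dmat_mult_left_entry vector_scaleR_component complex_eq_iff)
  have "scale_row b r x \<bullet> j = c j * (x \<bullet> j)"
   by (simp add: iu(1) inner_axis row c[unfolded iu(1)])
  moreover have "(0 + (\<Sum>j\<in>Basis. (c j * (x \<bullet> j)) *\<^sub>R j)) \<bullet> j = c j * (x \<bullet> j)"
   using j by (simp add: inner_sum_left_Basis)
  ultimately show "(0 + (\<Sum>j\<in>Basis. (c j * (x \<bullet> j)) *\<^sub>R j)) \<bullet> j = scale_row b r x \<bullet> j" by simp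
 qed
 have prod: "(\<Prod>j\<in>(Basis :: 'n cmat set). \<bar>c j\<bar>) = r ^ card {j : (Basis :: 'n cmat set). j $ b ~= 0}"
 proof -
  have "(\<Prod>j\<in>(Basis :: 'n cmat set). \<bar>c j\<bar>) = (\<Prod>j\<in>(Basis :: 'n cmat set). if j $ b ~= 0 then r else 1)"
   using r by (intro prod.cong) (auto simp: c_def)
  also have "... = (\<Prod>j\<in>{j : (Basis :: 'n cmat set). j $ b ~= 0}. r)"
   by (rule prod.inter_filter[symmetric]) simp
  finally show ?thesis by simp
 qed
 have "lborel = density (distr lborel borel (%x. 0 + (\<Sum>j\<in>Basis. (c j * (x \<bullet> j)) *\<^sub>R j))) (%_. ennreal (\<Prod>j\<in>Basis. \<bar>c j\<bar>))"
  using r by (intro lborel_affine_euclidean) (auto simp: c_def)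
 then have L: "lborel = density (distr lborel borel (scale_row b r)) (%_. ennreal (r ^ card {j : (Basis :: 'n cmat set). j $ b ~= 0}))"
  by (simp only: eq prod)
 have "(\<integral>\<^sup>+Z. g Z \<partial>lborel) = (\<integral>\<^sup>+Z. ennreal (r ^ card {j : (Basis :: 'n cmat set). j $ b ~= 0}) * g Z \<partial>distr lborel borel (scale_row b r))"
  by (subst L) (simp add: nn_integral_density)
 also have "... = (\<integral>\<^sup>+Z. ennreal (r ^ card {j : (Basis :: 'n cmat set). j $ b ~= 0}) * g (scale_row b r Z) \<partial>lborel)"
  by (rule nn_integral_distr) simp_all
 also have "... = ennreal (r ^ card {j : (Basis :: 'n cmat set). j $ b ~= 0}) * (\<integral>\<^sup>+Z. g (scale_row b r Z) \<partial>lborel)"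
  by (rule nn_integral_cmult) simp
 finally show "(\<integral>\<^sup>+Z. g Z \<partial>lborel) = ennreal (r ^ card {j : (Basis :: 'n cmat set). j $ b ~= 0}) * (\<integral>\<^sup>+Z. g (scale_row b r Z) \<partial>lborel)" .
qed

text \<open>
  If the sublevel sets of \<open>h\<close> at height \<open>d\<close> have measure of order \<open>d\<close>, negative powers of exponent above
  \<open>-1\<close> are integrable.
\<close>

lemma nn_integral_powr_layers:
 fixes h :: "'a => real"
 assumes h [measurable]: "h : borel_measurable N" and h01: "!!x. 0 < h x" "!!x. h x <= 1"
  and s: "-1 < s" "s < 0" and C: "0 <= C"
  and layer: "!!\<delta>. 0 < \<delta> ==> \<delta> <= 1 ==> emeasure N {x : space N. h x <= \<delta>} <= ennreal (C * \<delta>)"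
 shows "(\<integral>\<^sup>+x. ennreal (h x powr s) \<partial>N) < \<infinity>"
proof -
 define q where "q = 2 powr (- s)"
 have q: "0 < q" "q < 2" using s powr_less_mono[of "-s" 1 2] by (auto simp: q_def)
 have half: "((1/2) ^ n) powr s = q ^ n" for n :: nat
 proof -
  have "((1/2) ^ n) powr s = ((1/2) powr real n) powr s" by (simp add: powr_realpow)
  also have "... = (1/2) powr (real n * s)" by (simp add: powr_powr)
  also have "... = 2 powr (real n * (- s))" by (simp add: powr_divide powr_minus_divide)
  also have "... = q ^ n" unfolding q_def by (subst powr_power) (simp_all add: mult.commute)
  finally show ?thesis .
 qed
 let ?A = "%k::nat. {x : space N. h x <= (1/2) ^ k}"
 have bound: "ennreal (h x powr s) <= (\<Sum>k. ennreal (q ^ Suc k) * indicator (?A k) x)" if x: "x : space N" for x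
 proof -
  obtain n0 where "(1/2) ^ n0 < h x" using real_arch_pow_inv[of "h x" "1/2"] h01(1)[of x] by auto
  define n where "n = (LEAST n. (1/2) ^ n < h x)"
  have n: "(1/2) ^ n < h x" unfolding n_def using \<open>(1/2) ^ n0 < h x\<close> by (rule LeastI)
  have "n ~= 0"
  proof
   assume "n = 0"
   with n h01(2)[of x] show False by simp
  qed
  then obtain k where k: "n = Suc k" using not0_implies_Suc by blast
  have "\<not> (1/2) ^ k < h x" using not_less_Least[of k "%n. (1/2) ^ n < h x"] k by (simp add: n_def)
  then have xA: "x : ?A k" using x by simp
  have "h x powr s <= ((1/2) ^ Suc k) powr s"
   using s n by (intro powr_mono2') (auto simp: k)
  then have "ennreal (h x powr s) <= ennreal (q ^ Suc k) * indicator (?A k) x"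
   using xA unfolding half by (simp add: ennreal_leI)
  also have "... <= (\<Sum>k. ennreal (q ^ Suc k) * indicator (?A k) x)"
  proof -
   have "f k <= suminf f" for f :: "nat => ennreal" using sum_le_suminf[of f "{k}"] by simp
   then show ?thesis .
  qed
  finally show ?thesis .
 qed
 have "(\<integral>\<^sup>+x. ennreal (h x powr s) \<partial>N) <= (\<integral>\<^sup>+x. (\<Sum>k. ennreal (q ^ Suc k) * indicator (?A k) x) \<partial>N)"
  by (rule nn_integral_mono[OF bound])
 also have "... = (\<Sum>k. \<integral>\<^sup>+x. ennreal (q ^ Suc k) * indicator (?A k) x \<partial>N)"
  by (rule nn_integral_suminf) measurable
 also have "... <= (\<Sum>k. ennreal (q * C * (q / 2) ^ k))"
 proof (intro suminf_le summableI)
  fix k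
  have "(\<integral>\<^sup>+x. ennreal (q ^ Suc k) * indicator (?A k) x \<partial>N) = ennreal (q ^ Suc k) * emeasure N (?A k)"
   by (rule nn_integral_cmult_indicator) measurable
  also have "... <= ennreal (q ^ Suc k) * ennreal (C * (1/2) ^ k)"
   by (intro mult_left_mono layer) (auto simp: power_le_one)
  also have "... = ennreal (q ^ Suc k * (C * (1/2) ^ k))"
   using q C by (intro ennreal_mult[symmetric]) auto
  also have "q ^ Suc k * (C * (1/2) ^ k) = q * C * (q / 2) ^ k" by (simp add: power_divide field_simps)
  finally show "(\<integral>\<^sup>+x. ennreal (q ^ Suc k) * indicator (?A k) x \<partial>N) <= ennreal (q * C * (q / 2) ^ k)" .
 qed
 also have "... = ennreal (\<Sum>k. q * C * (q / 2) ^ k)"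
  using q C by (intro suminf_ennreal2 summable_mult summable_geometric) auto
 also have "... < \<infinity>" by simp
 finally show ?thesis .
qed

lemma partial_gram_insert:
 fixes Z :: "('n::{finite,linorder}) cmat"
 assumes b: "b \<notin> J" and Z: "Z : partial_domain (insert b J)"
 shows "0 < partial_gram J Z" "0 < partial_gram (insert b J) Z"
  "partial_gram (insert b J) Z <= partial_gram J Z"
  "partial_gram (insert b J) (scale_row b r Z) = (1 - r^2) * partial_gram J Z + r^2 * partial_gram (insert b J) Z"
  "partial_gram J (scale_row b r Z) = partial_gram J Z"
proof -
 let ?F = "%x. Re (gram_det ((one_on J)(b := x)) Z)"
 have upd: "(one_on J)(b := 0) = one_on J" "(one_on J)(b := 1) = one_on (insert b J)"
  using b by (auto simp: one_on_def fun_eq_iff)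
 have aff: "?F x = (1 - x) * partial_gram J Z + x * partial_gram (insert b J) Z" for x
  using gram_det_affine[of "one_on J" b x Z] by (simp add: partial_gram_def upd)
 have pos: "0 < ?F x" if "x <= 1" for x
  using that by (intro partial_gram_pos[OF Z]) (auto simp: one_on_def)
 show P0: "0 < partial_gram J Z" using pos[of 0] by (simp add: aff)
 show P1: "0 < partial_gram (insert b J) Z" using pos[of 1] by (simp add: aff)
 show "partial_gram (insert b J) Z <= partial_gram J Z"
 proof (rule ccontr)
  assume "\<not> ?thesis"
  then have d: "0 < partial_gram (insert b J) Z - partial_gram J Z" by simp
  define x where "x = - (partial_gram J Z / (partial_gram (insert b J) Z - partial_gram J Z))"
  have "x <= 1" using d P0 by (simp add: x_def field_simps)
  moreover have "?F x = partial_gram J Z + x * (partial_gram (insert b J) Z - partial_gram J Z)"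
   by (simp add: aff algebra_simps)
  then have "?F x = 0" using d by (simp add: x_def)
  ultimately show False using pos[of x] by simp
 qed
 have "(%i. one_on (insert b J) i * (if i = b then r else 1)^2) = (one_on J)(b := r^2)"
  using b by (auto simp: one_on_def fun_eq_iff)
 then show "partial_gram (insert b J) (scale_row b r Z) = (1 - r^2) * partial_gram J Z + r^2 * partial_gram (insert b J) Z"
  unfolding aff[symmetric] by (simp add: partial_gram_def scale_row_def gram_det_dmat_mult)
 have "(%i. one_on J i * (if i = b then r else 1)^2) = one_on J"
  using b by (auto simp: one_on_def fun_eq_iff)
 then show "partial_gram J (scale_row b r Z) = partial_gram J Z"
  by (simp add: partial_gram_def scale_row_def gram_det_dmat_mult)
qed

lemma scale_row_partial_domain:
 assumes b: "b : K" and r: "0 <= r" "r <= 1" and Z: "Z : partial_domain K"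
 shows "scale_row b r Z : partial_domain K"
proof -
 have "row_part K (scale_row b r Z) = scale_row b r (row_part K Z)"
  unfolding row_part_def scale_row_def matrix_mul_assoc dmat_mult by (simp add: mult.commute)
 moreover have "scale_row b r (row_part K Z) : cartan_domain"
  unfolding scale_row_def
  using Z r by (intro dmat_contraction) (auto simp: partial_domain_def)
 moreover have "scale_row b r Z $ i = Z $ i" if "i \<notin> K" for i
  using that b by (auto simp: scale_row_def cvec_eq_iff dmat_mult_left_entry)
 ultimately show ?thesis using Z by (simp add: partial_domain_def)
qed

lemma measurable_partial_gram [measurable]: "partial_gram J : borel_measurable borel"
 unfolding partial_gram_def[abs_def]
 by (intro borel_measurable_continuous_onI continuous_on_Re continuous_gram_det)

text \<open>
  Rows are added one at a time. The determinant is affine in the squared scale of the new row, so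
  rescaling that row controls the measure of its sublevel sets.
\<close>

lemma partial_gram_integrable:
 fixes J :: "('n::{finite,linorder}) set"
 assumes s: "-1 < s" "s < 0"
 shows "(\<integral>\<^sup>+Z. indicator (partial_domain J) Z * ennreal (partial_gram J Z powr s) \<partial>lborel) < \<infinity> \<and>
  (ALL Z:partial_domain J. partial_gram J Z <= 1)"
proof -
 have "finite J" by simp
 then show ?thesis
 proof (induction J rule: finite_induct)
  case empty
  have one: "partial_gram {} Z = 1" for Z :: "'n cmat"
  proof -
   have "dmat (%i. of_real (one_on {} i)) = (0 :: 'n cmat)" by (simp add: dmat_def one_on_def cvec_eq_iff)
   then show ?thesis by (simp add: partial_gram_def gram_det_def)
  qed
  have "(\<integral>\<^sup>+Z. indicator (partial_domain {} :: 'n cmat set) Z * ennreal (partial_gram {} Z powr s) \<partial>lborel)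
    = emeasure lborel (partial_domain {} :: 'n cmat set)"
   by (simp add: one open_partial_domain)
  also have "... < \<infinity>"
   using emeasure_bounded_finite[OF bounded_partial_domain_empty] by simp
  finally show ?case by (simp add: one)
 next
  case (insert b J)
  let ?K = "insert b J"
  note gram = partial_gram_insert[OF insert.hyps(2)]
  have [measurable]: "partial_domain J : sets borel" "partial_domain ?K : sets borel"
   by (simp_all add: open_partial_domain)
  define w where "w Z = indicator (partial_domain ?K) Z * ennreal (partial_gram J Z powr s)" for Z :: "'n cmat"
  have w [measurable]: "w : borel_measurable borel" unfolding w_def[abs_def] by measurable
  define N where "N = density lborel w"
  have sets_N [measurable_cong]: "sets N = sets borel" and space_N: "space N = UNIV"
   by (simp_all add: N_def)
  (* The Schur complement of the new row in the Gram determinant. *)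
 define h where "h Z = (if Z : partial_domain ?K then partial_gram ?K Z / partial_gram J Z else 1)" for Z :: "'n cmat"
  have h_meas: "h : borel_measurable N" unfolding h_def[abs_def] by measurable
  have h01: "0 < h Z" "h Z <= 1" for Z using gram(1-3)[of Z] by (auto simp: h_def)
  have mono: "partial_domain ?K <= partial_domain J" using partial_domain_mono[of J ?K] by auto
  have N_UNIV: "emeasure N UNIV = (\<integral>\<^sup>+Z. w Z \<partial>lborel)"
   by (simp add: N_def emeasure_density)
  have "(\<integral>\<^sup>+Z. w Z \<partial>lborel) <= (\<integral>\<^sup>+Z. indicator (partial_domain J) Z * ennreal (partial_gram J Z powr s) \<partial>lborel)"
   unfolding w_def using mono by (intro nn_integral_mono) (auto split: split_indicator)
  also have "... < \<infinity>" using insert.IH by simp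
  finally have fin: "emeasure N UNIV < \<infinity>" by (simp add: N_UNIV)
  define m0 where "m0 = enn2real (emeasure N UNIV)"
  have m0: "emeasure N UNIV = ennreal m0" "0 <= m0" using fin by (auto simp: m0_def ennreal_enn2real_if less_top)
  obtain m where m: "!!r g. 0 < r ==> g : borel_measurable borel ==>
   (\<integral>\<^sup>+Z. g Z \<partial>lborel) = ennreal (r ^ m) * (\<integral>\<^sup>+Z. g (scale_row b r Z) \<partial>(lborel :: 'n cmat measure))"
   using nn_integral_scale_row[of b] by blast
  have layer: "emeasure N {Z : space N. h Z <= \<delta>} <= ennreal ((real m + 1) * m0 * \<delta>)" if \<delta>: "0 < \<delta>" "\<delta> <= 1" for \<delta>
  proof (cases "\<delta> = 1")
   case True
   have "emeasure N {Z : space N. h Z <= \<delta>} <= ennreal m0"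
    using emeasure_space[of N] by (simp add: space_N m0(1))
   also have "... <= ennreal ((real m + 1) * m0 * \<delta>)"
    using m0(2) by (intro ennreal_leI) (simp add: True algebra_simps)
   finally show ?thesis .
  next
   case False
   define r where "r = sqrt (1 - \<delta>)"
   have r: "0 < r" "r < 1" "r^2 = 1 - \<delta>" using \<delta> False by (auto simp: r_def)
   define E where "E = {Z. scale_row b (inverse r) Z : partial_domain ?K}"
   have [measurable]: "E : sets borel"
   proof -
    have "E = scale_row b (inverse r) -` partial_domain ?K \<inter> space borel" by (auto simp: E_def)
    also have "... : sets borel" by (rule measurable_sets[OF measurable_scale_row]) measurable
    finally show ?thesis .
   qed
   have E_h: "\<delta> < h Z" if "Z : E" for Z
   proof -
    let ?Y = "scale_row b (inverse r) Z"
    have Y: "?Y : partial_domain ?K" using that by (simp add: E_def)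
    have Z: "Z = scale_row b r ?Y" using scale_row_inverse[of "inverse r" b Z] r by simp
    have ZK: "Z : partial_domain ?K"
     by (subst Z) (use r Y in \<open>auto intro!: scale_row_partial_domain\<close>)
    have "partial_gram ?K Z = (1 - r^2) * partial_gram J ?Y + r^2 * partial_gram ?K ?Y"
     by (subst Z) (rule gram(4)[OF Y])
    moreover have J: "partial_gram J Z = partial_gram J ?Y" by (subst Z) (rule gram(5)[OF Y])
    moreover have "0 < r^2 * partial_gram ?K ?Y" using gram(2)[OF Y] r \<delta> False by simp
    ultimately have "\<delta> * partial_gram J ?Y < partial_gram ?K Z" using r(3) by simp
    then show ?thesis using ZK gram(1)[OF Y] by (simp add: h_def J pos_less_divide_eq)
   qed
   have "ennreal (r ^ m) * emeasure N UNIV <= emeasure N E"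
   proof -
    have "emeasure N E = (\<integral>\<^sup>+Z. w Z * indicator E Z \<partial>lborel)" by (simp add: N_def emeasure_density)
    also have "... = ennreal (r ^ m) * (\<integral>\<^sup>+Z. w (scale_row b r Z) * indicator E (scale_row b r Z) \<partial>lborel)"
     by (rule m[OF r(1)]) measurable
    also have "... \<ge> ennreal (r ^ m) * (\<integral>\<^sup>+Z. w Z \<partial>lborel)"
    proof (intro mult_left_mono nn_integral_mono)
     fix Z :: "'n cmat"
     show "w Z <= w (scale_row b r Z) * indicator E (scale_row b r Z)"
     proof (cases "Z : partial_domain ?K")
      case True
      have "scale_row b r Z : E" using True r by (simp add: E_def scale_row_inverse)
      moreover have "scale_row b r Z : partial_domain ?K"
       using True r by (intro scale_row_partial_domain) auto
      ultimately show ?thesis using True by (simp add: w_def gram(5))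
     qed (simp add: w_def)
    qed simp
    finally show ?thesis by (simp add: N_UNIV)
   qed
   then have Em: "ennreal (r ^ m * m0) <= emeasure N E"
    using r m0 by (simp add: ennreal_mult)
   have Efin: "emeasure N E ~= \<infinity>"
    using emeasure_mono[of E UNIV N] fin by (auto simp: sets_N)
   have sub: "{Z : space N. h Z <= \<delta>} <= UNIV - E" using E_h by force
   have "emeasure N {Z : space N. h Z <= \<delta>} <= emeasure N (UNIV - E)"
    by (rule emeasure_mono[OF sub]) (simp add: sets_N)
   also have "... = emeasure N UNIV - emeasure N E"
    by (rule emeasure_Diff[OF Efin]) (simp_all add: sets_N)
   also have "... <= ennreal m0 - ennreal (r ^ m * m0)"
    unfolding m0(1) by (rule ennreal_minus_mono[OF order_refl Em])
   also have "... = ennreal (m0 - r ^ m * m0)"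
    using r m0 by (intro ennreal_minus) simp
   also have "... <= ennreal ((real m + 1) * m0 * \<delta>)"
   proof (rule ennreal_leI)
    have "1 + real m * (r - 1) <= (1 + (r - 1)) ^ m"
     using r by (intro Bernoulli_inequality) simp
    then have "1 - r ^ m <= real m * (1 - r)" by (simp add: algebra_simps)
    also have "... <= real m * \<delta>"
    proof (rule mult_left_mono)
     have "r * r <= r * 1" using r by (intro mult_left_mono) auto
     then show "1 - r <= \<delta>" using r(3) by (simp add: power2_eq_square)
    qed simp
    also have "... <= (real m + 1) * \<delta>" using \<delta> by (simp add: algebra_simps)
    finally have "m0 * (1 - r ^ m) <= m0 * ((real m + 1) * \<delta>)" using m0(2) by (rule mult_left_mono)
    then show "m0 - r ^ m * m0 <= (real m + 1) * m0 * \<delta>" by (simp add: algebra_simps)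
   qed
   finally show ?thesis .
  qed
  have "(\<integral>\<^sup>+Z. ennreal (h Z powr s) \<partial>N) < \<infinity>"
   using m0(2) by (intro nn_integral_powr_layers[OF h_meas h01 s _ layer]) auto
  also have "(\<integral>\<^sup>+Z. ennreal (h Z powr s) \<partial>N) = (\<integral>\<^sup>+Z. w Z * ennreal (h Z powr s) \<partial>lborel)"
   unfolding N_def using h_meas by (intro nn_integral_density) (simp_all add: N_def)
  also have "... = (\<integral>\<^sup>+Z. indicator (partial_domain ?K) Z * ennreal (partial_gram ?K Z powr s) \<partial>lborel)"
  proof (intro nn_integral_cong)
   fix Z :: "'n cmat"
   show "w Z * ennreal (h Z powr s) = indicator (partial_domain ?K) Z * ennreal (partial_gram ?K Z powr s)"
   proof (cases "Z : partial_domain ?K")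
    case True
    have "partial_gram J Z powr s * h Z powr s = partial_gram ?K Z powr s"
     using gram(1,2)[OF True] True by (simp add: h_def powr_divide)
    then show ?thesis using True by (simp add: w_def ennreal_mult[symmetric])
   qed (simp add: w_def)
  qed
  finally have "(\<integral>\<^sup>+Z. indicator (partial_domain ?K) Z * ennreal (partial_gram ?K Z powr s) \<partial>lborel) < \<infinity>" .
  moreover have "partial_gram ?K Z <= 1" if "Z : partial_domain ?K" for Z
  proof -
   have "partial_gram J Z <= 1" using mono insert.IH that by blast
   then show ?thesis using gram(3)[OF that] by simp
  qed
  ultimately show ?case by blast
 qed
qed

section \<open>Square integrable functions\<close>

definition sq_int :: "'a measure => ('a => complex) set" where
 "sq_int M = {f : borel_measurable M. integrable M (%x. (cmod (f x))^2)}"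

definition ip :: "'a measure => ('a => complex) => ('a => complex) => complex" where
 "ip M f g = (LINT x|M. f x * cnj (g x))"

definition nrm :: "'a measure => ('a => complex) => real" where
 "nrm M f = sqrt (LINT x|M. (cmod (f x))^2)"

lemma sq_int_measurable: "f : sq_int M ==> f : borel_measurable M"
 by (simp add: sq_int_def)

lemma sq_int_product_integrable:
 assumes "f : sq_int M" "g : sq_int M"
 shows "integrable M (%x. f x * cnj (g x))"
proof (rule Bochner_Integration.integrable_bound)
 show "integrable M (%x. (cmod (f x))^2 + (cmod (g x))^2)"
  using assms by (simp add: sq_int_def)
 have [measurable]: "cnj : borel_measurable borel"
  by (intro borel_measurable_continuous_onI continuous_intros)
 have [measurable]: "f : borel_measurable M" "g : borel_measurable M"
  using assms by (auto simp: sq_int_def)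
 show "(%x. f x * cnj (g x)) : borel_measurable M" by measurable
 have "cmod (f x * cnj (g x)) <= norm ((cmod (f x))^2 + (cmod (g x))^2)" for x
 proof -
  have "0 <= (cmod (f x) - cmod (g x))^2" by simp
  then have "2 * (cmod (f x) * cmod (g x)) <= (cmod (f x))^2 + (cmod (g x))^2"
   by (simp add: power2_diff)
  moreover have "0 <= cmod (f x) * cmod (g x)" by simp
  ultimately have "cmod (f x) * cmod (g x) <= (cmod (f x))^2 + (cmod (g x))^2" by linarith
  then show ?thesis by (simp add: norm_mult)
 qed
 then show "AE x in M. cmod (f x * cnj (g x)) <= norm ((cmod (f x))^2 + (cmod (g x))^2)" by simp
qed

lemma sq_int_scale: "f : sq_int M ==> (%x. c * f x) : sq_int M"
 by (auto simp: sq_int_def norm_mult power_mult_distrib)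

lemma sq_int_add:
 assumes "f : sq_int M" "g : sq_int M"
 shows "(%x. f x + g x) : sq_int M"
proof -
 have "integrable M (%x. (cmod (f x + g x))^2)"
 proof (rule Bochner_Integration.integrable_bound)
  show "integrable M (%x. 2 * (cmod (f x))^2 + 2 * (cmod (g x))^2)"
   using assms by (simp add: sq_int_def)
  show "(%x. (cmod (f x + g x))^2) : borel_measurable M"
   using assms[THEN sq_int_measurable] by measurable
  have "(cmod (f x + g x))^2 <= 2 * (cmod (f x))^2 + 2 * (cmod (g x))^2" for x
  proof -
   have "(cmod (f x + g x))^2 <= (cmod (f x) + cmod (g x))^2"
    by (intro power_mono norm_triangle_ineq) simp
   moreover have "0 <= (cmod (f x) - cmod (g x))^2" by simp
   ultimately show ?thesis by (simp add: power2_diff power2_sum)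
  qed
  then show "AE x in M. norm ((cmod (f x + g x))^2) <= norm (2 * (cmod (f x))^2 + 2 * (cmod (g x))^2)" by simp
 qed
 moreover have "(%x. f x + g x) : borel_measurable M"
  using assms[THEN sq_int_measurable] by (rule borel_measurable_add)
 ultimately show ?thesis by (simp add: sq_int_def)
qed

lemma sq_int_diff: "f : sq_int M ==> g : sq_int M ==> (%x. f x - g x) : sq_int M"
 using sq_int_add[of f M "%x. (-1) * g x"] sq_int_scale[of g M "-1"] by simp

lemma sq_int_zero: "(%_. 0) : sq_int M"
 by (simp add: sq_int_def)

lemma fun_subspace_sq_int: "fun_subspace (sq_int M)"
 by (simp add: fun_subspace_def sq_int_zero sq_int_add sq_int_scale)

lemma nrm_nonneg: "0 <= nrm M f"
 by (simp add: nrm_def)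

lemma nrm_square: "(nrm M f)^2 = (LINT x|M. (cmod (f x))^2)"
 by (simp add: nrm_def)

lemma ip_self: "ip M f f = of_real ((nrm M f)^2)"
 unfolding ip_def nrm_square complex_norm_square[symmetric]
 using integral_complex_of_real[of M "%x. (cmod (f x))^2"] by simp

lemma ip_cnj: "cnj (ip M f g) = ip M g f"
proof -
 have "cnj (ip M f g) = (LINT x|M. cnj (f x * cnj (g x)))"
  unfolding ip_def by (rule Bochner_Integration.integral_cnj[symmetric])
 then show ?thesis by (simp add: ip_def mult.commute)
qed

lemma ip_linear:
 assumes "f : sq_int M" "g : sq_int M" "h : sq_int M"
 shows "ip M (%x. f x + g x) h = ip M f h + ip M g h"
  "ip M (%x. f x - g x) h = ip M f h - ip M g h"
  "ip M (%x. c * f x) h = c * ip M f h"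
 using sq_int_product_integrable[OF assms(1,3)] sq_int_product_integrable[OF assms(2,3)]
 by (simp_all add: ip_def distrib_right left_diff_distrib mult.assoc)

lemma ip_linear_right:
 assumes "f : sq_int M" "g : sq_int M" "h : sq_int M"
 shows "ip M h (%x. f x + g x) = ip M h f + ip M h g"
  "ip M h (%x. f x - g x) = ip M h f - ip M h g"
  "ip M h (%x. c * f x) = cnj c * ip M h f"
 using sq_int_product_integrable[OF assms(3,1)] sq_int_product_integrable[OF assms(3,2)]
 by (simp_all add: ip_def distrib_left right_diff_distrib mult.left_commute)

lemma nrm_square_diff:
 assumes f: "f : sq_int M" and g: "g : sq_int M"
 shows "(nrm M (%x. f x - t * g x))^2 = (nrm M f)^2 - 2 * Re (cnj t * ip M f g) + (cmod t)^2 * (nrm M g)^2"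
proof -
 note tg = sq_int_scale[OF g, of t]
 have "complex_of_real ((nrm M (%x. f x - t * g x))^2) = ip M (%x. f x - t * g x) (%x. f x - t * g x)"
  by (rule ip_self[symmetric])
 also have "... = ip M f f - ip M f (%x. t * g x) - (ip M (%x. t * g x) f - ip M (%x. t * g x) (%x. t * g x))"
  by (simp add: ip_linear(2)[OF f tg sq_int_diff[OF f tg]] ip_linear_right(2)[OF f tg f] ip_linear_right(2)[OF f tg tg])
 also have "... = ip M f f - cnj t * ip M f g - (t * ip M g f - t * (cnj t * ip M g g))"
  by (simp add: ip_linear_right(3)[OF g g f] ip_linear(3)[OF g g f] ip_linear(3)[OF g g tg] ip_linear_right(3)[OF g g g])
 also have "... = complex_of_real ((nrm M f)^2) - (cnj t * ip M f g + cnj (cnj t * ip M f g)) + t * cnj t * complex_of_real ((nrm M g)^2)"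
  by (simp add: ip_self ip_cnj algebra_simps)
 also have "... = complex_of_real ((nrm M f)^2 - 2 * Re (cnj t * ip M f g) + (cmod t)^2 * (nrm M g)^2)"
  by (simp only: complex_add_cnj complex_norm_square[symmetric] of_real_diff of_real_add of_real_mult)
 finally show ?thesis by (simp only: of_real_eq_iff)
qed

text \<open>Minimality of the distance forces near orthogonality; the case of distance zero is Cauchy-Schwarz.\<close>

lemma ip_bound_of_distance:
 assumes f: "f : sq_int M" and g: "g : sq_int M"
  and \<delta>: "!!t. \<delta> <= (nrm M (%x. f x - t * g x))^2"
 shows "(cmod (ip M f g))^2 <= ((nrm M f)^2 - \<delta>) * (nrm M g)^2"
proof (cases "nrm M g = 0")
 case True
 have "2 * l * (cmod (ip M f g))^2 <= (nrm M f)^2 - \<delta>" for l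
 proof -
  have "cnj (of_real l * ip M f g) * ip M f g = of_real (l * (cmod (ip M f g))^2)"
   unfolding of_real_mult complex_norm_square by (simp add: mult_ac)
  then have "Re (cnj (of_real l * ip M f g) * ip M f g) = l * (cmod (ip M f g))^2"
   by (simp only: Re_complex_of_real)
  moreover have "\<delta> <= (nrm M f)^2 - 2 * Re (cnj (of_real l * ip M f g) * ip M f g) + (cmod (of_real l * ip M f g))^2 * (nrm M g)^2"
   using \<delta>[of "of_real l * ip M f g"] unfolding nrm_square_diff[OF f g, of "of_real l * ip M f g"] .
  ultimately show ?thesis using True by simp
 qed
 from this[of "((nrm M f)^2 - \<delta> + 1) / (2 * (cmod (ip M f g))^2)"]
 have "ip M f g = 0" by (cases "ip M f g = 0") auto
 then show ?thesis using True by simp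
next
 case False
 then have N: "0 < (nrm M g)^2" by simp
 let ?t = "ip M f g / of_real ((nrm M g)^2)"
 have r1: "Re (cnj ?t * ip M f g) = (cmod (ip M f g))^2 / (nrm M g)^2"
 proof -
  have "cnj ?t * ip M f g = of_real ((cmod (ip M f g))^2 / (nrm M g)^2)"
   unfolding of_real_divide complex_norm_square by (simp add: mult.commute)
  then show ?thesis by (simp only: Re_complex_of_real)
 qed
 have r2: "(cmod ?t)^2 * (nrm M g)^2 = (cmod (ip M f g))^2 / (nrm M g)^2"
 proof -
  have "cmod ?t = cmod (ip M f g) / (nrm M g)^2"
   unfolding norm_divide norm_of_real by simp
  then show ?thesis using N by (simp add: power_divide power2_eq_square)
 qed
 have "\<delta> <= (nrm M f)^2 - (cmod (ip M f g))^2 / (nrm M g)^2"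
  using \<delta>[of ?t] unfolding nrm_square_diff[OF f g, of ?t] r1 r2 by simp
 then show ?thesis using N by (simp add: field_simps)
qed

lemma ip_Cauchy_Schwarz:
 assumes "f : sq_int M" "g : sq_int M"
 shows "cmod (ip M f g) <= nrm M f * nrm M g"
 using ip_bound_of_distance[OF assms, of 0]
 by - (rule power2_le_imp_le, simp_all add: power_mult_distrib nrm_nonneg)

lemma nrm_scale: "nrm M (%x. c * f x) = cmod c * nrm M f"
 by (simp add: nrm_def norm_mult power_mult_distrib real_sqrt_mult)

lemma nrm_diff_commute: "nrm M (%x. f x - g x) = nrm M (%x. g x - f x)"
 by (simp add: nrm_def norm_minus_commute)

lemma nrm_triangle:
 assumes f: "f : sq_int M" and g: "g : sq_int M"
 shows "nrm M (%x. f x + g x) <= nrm M f + nrm M g"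
proof (rule power2_le_imp_le)
 have "(nrm M (%x. f x + g x))^2 = (nrm M f)^2 + 2 * Re (ip M f g) + (nrm M g)^2"
  using nrm_square_diff[OF f g, of "-1"] by simp
 also have "... <= (nrm M f)^2 + 2 * (nrm M f * nrm M g) + (nrm M g)^2"
  using ip_Cauchy_Schwarz[OF f g] complex_Re_le_cmod[of "ip M f g"] by simp
 finally show "(nrm M (%x. f x + g x))^2 <= (nrm M f + nrm M g)^2" by (simp add: power2_sum)
qed (simp add: nrm_nonneg)

lemma nrm_triangle_diff:
 assumes f: "f : sq_int M" and g: "g : sq_int M" and h: "h : sq_int M"
 shows "nrm M (%x. f x - h x) <= nrm M (%x. f x - g x) + nrm M (%x. g x - h x)"
 using nrm_triangle[OF sq_int_diff[OF f g] sq_int_diff[OF g h]] by simp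

lemma nrm_parallelogram:
 assumes f: "f : sq_int M" and g: "g : sq_int M"
 shows "(nrm M (%x. f x + g x))^2 + (nrm M (%x. f x - g x))^2 = 2 * (nrm M f)^2 + 2 * (nrm M g)^2"
 using nrm_square_diff[OF f g, of "-1"] nrm_square_diff[OF f g, of 1] by simp

text \<open>
  A minimising sequence is Cauchy by the parallelogram identity. The limit may leave \<open>V\<close>
 for a set \<open>A\<close>, so that spaces that are not closed can be projected onto.
\<close>

theorem orthogonal_projection_exists:
 assumes V: "fun_subspace V" "V <= sq_int M" and A: "A <= sq_int M" and u: "u : sq_int M"
  and complete: "!!g. (!!n. g n : V) ==>
   (ALL e>0. EX N. ALL m>=N. ALL n>=N. nrm M (%x. g m x - g n x) < e) ==>
   EX l:A. (%n. nrm M (%x. g n x - l x)) \<longlonglongrightarrow> 0"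
 shows "EX l:A. (EX g. (ALL n. g n : V) & (%n. nrm M (%x. g n x - l x)) \<longlonglongrightarrow> 0) \<and>
  (ALL h:V. ip M (%x. u x - l x) h = 0)"
proof -
 note VD = fun_subspaceD[OF V(1)]
 have VS: "h : sq_int M" if "h : V" for h using V(2) that by blast
 define \<delta> where "\<delta> = (INF h\<in>V. (nrm M (%x. u x - h x))^2)"
 have bdd: "bdd_below ((%h. (nrm M (%x. u x - h x))^2) ` V)" by (rule bdd_belowI2[of _ 0]) simp
 have \<delta>: "\<delta> <= (nrm M (%x. u x - h x))^2" if "h : V" for h
  unfolding \<delta>_def using bdd that by (rule cINF_lower)
 have "EX h:V. (nrm M (%x. u x - h x))^2 < \<delta> + inverse (real (Suc n))" for n
  using cINF_less_iff[OF _ bdd, of "\<delta> + inverse (real (Suc n))"] VD(1) by (auto simp: \<delta>_def)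
 then obtain g where g: "!!n. g n : V" "!!n. (nrm M (%x. u x - g n x))^2 < \<delta> + inverse (real (Suc n))"
  by metis
 have ug: "(%x. u x - g n x) : sq_int M" for n using u VS[OF g(1)] by (rule sq_int_diff)
 have cauchy: "(nrm M (%x. g m x - g n x))^2 <= 2 * inverse (real (Suc m)) + 2 * inverse (real (Suc n))" for m n
 proof -
  have mid: "(%x. (1/2) * (g m x + g n x)) : V" by (intro VD g)
  have "(nrm M (%x. 2 * (u x - (1/2) * (g m x + g n x))))^2 + (nrm M (%x. g n x - g m x))^2
    = 2 * (nrm M (%x. u x - g m x))^2 + 2 * (nrm M (%x. u x - g n x))^2"
   using nrm_parallelogram[OF ug[of m] ug[of n]] by (simp add: algebra_simps)
  moreover have "4 * \<delta> <= (nrm M (%x. 2 * (u x - (1/2) * (g m x + g n x))))^2"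
   using \<delta>[OF mid] unfolding nrm_scale power_mult_distrib by simp
  ultimately show ?thesis using g(2)[of m] g(2)[of n] by (simp add: nrm_diff_commute[of M "g n"])
 qed
 have "EX l:A. (%n. nrm M (%x. g n x - l x)) \<longlonglongrightarrow> 0"
 proof (rule complete[OF g(1)], intro allI impI)
  fix e :: real assume e: "0 < e"
  obtain N :: nat where N: "inverse (real (Suc N)) < e^2 / 4"
   using reals_Archimedean[of "e^2 / 4"] e by auto
  show "EX N. ALL m>=N. ALL n>=N. nrm M (%x. g m x - g n x) < e"
  proof (intro exI allI impI)
   fix m n assume mn: "N <= m" "N <= n"
   have le: "inverse (real (Suc k)) <= inverse (real (Suc N))" if "N <= k" for k
    using that by (intro le_imp_inverse_le) auto
   have "(nrm M (%x. g m x - g n x))^2 < e^2"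
    using cauchy[of m n] N le[OF mn(1)] le[OF mn(2)] by linarith
   then show "nrm M (%x. g m x - g n x) < e" by (rule power2_less_imp_less) (use e in simp)
  qed
 qed
 then obtain l where l: "l : A" "(%n. nrm M (%x. g n x - l x)) \<longlonglongrightarrow> 0" by blast
 have lS: "l : sq_int M" using A l(1) by blast
 have "ip M (%x. u x - l x) h = 0" if h: "h : V" for h
 proof -
  note hS = VS[OF h]
  have near: "cmod (ip M (%x. u x - g n x) h) <= sqrt (inverse (real (Suc n))) * nrm M h" for n
  proof -
   have "\<delta> <= (nrm M (%x. (u x - g n x) - t * h x))^2" for t
    using \<delta>[of "%x. g n x + t * h x"] VD(2)[OF g(1) VD(3)[OF h]] by (simp add: algebra_simps)
   from ip_bound_of_distance[OF ug hS this]
   have "(cmod (ip M (%x. u x - g n x) h))^2 <= ((nrm M (%x. u x - g n x))^2 - \<delta>) * (nrm M h)^2" .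
   also have "... <= inverse (real (Suc n)) * (nrm M h)^2"
    using g(2)[of n] by (intro mult_right_mono) auto
   finally have "(cmod (ip M (%x. u x - g n x) h))^2 <= (sqrt (inverse (real (Suc n))) * nrm M h)^2"
    by (simp add: power_mult_distrib)
   then show ?thesis by (rule power2_le_imp_le) (simp add: nrm_nonneg)
  qed
  have bound: "cmod (ip M (%x. u x - l x) h)
   <= sqrt (inverse (real (Suc n))) * nrm M h + nrm M (%x. g n x - l x) * nrm M h" for n
  proof -
   note gl = sq_int_diff[OF VS[OF g(1)] lS, of n]
   have "ip M (%x. u x - l x) h = ip M (%x. u x - g n x) h + ip M (%x. g n x - l x) h"
    using ip_linear(1)[OF ug[of n] gl hS] by (simp only: add_diff_eq diff_add_cancel)
   also have "cmod ... <= cmod (ip M (%x. u x - g n x) h) + cmod (ip M (%x. g n x - l x) h)"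
    by (rule norm_triangle_ineq)
   also have "... <= sqrt (inverse (real (Suc n))) * nrm M h + nrm M (%x. g n x - l x) * nrm M h"
    by (rule add_mono[OF near[of n] ip_Cauchy_Schwarz[OF gl hS]])
   finally show ?thesis .
  qed
  have "(%n. sqrt (inverse (real (Suc n))) * nrm M h + nrm M (%x. g n x - l x) * nrm M h)
   \<longlonglongrightarrow> sqrt 0 * nrm M h + 0 * nrm M h"
   by (intro tendsto_intros LIMSEQ_inverse_real_of_nat l(2))
  then have "cmod (ip M (%x. u x - l x) h) <= sqrt 0 * nrm M h + 0 * nrm M h"
   by (rule LIMSEQ_le_const) (use bound in blast)
  then show ?thesis by simp
 qed
 then show ?thesis using l g(1) by blast
qed

text \<open>
  Gram-Schmidt for a seminorm: a new vector of length zero needs no correction.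
\<close>

lemma finite_span_projection:
 assumes "finite T" "T <= sq_int M" "u : sq_int M"
 shows "EX g:cfun.span T. ALL h:cfun.span T. ip M (%x. u x - g x) h = 0"
 using assms
proof (induction T arbitrary: u rule: finite_induct)
 case empty
 have "ip M (%x. u x - 0) h = 0" if "h = 0" for h by (simp add: that ip_def zero_fun_def)
 then show ?case by (intro bexI[of _ "%_. 0"]) (auto simp: zero_fun_def)
next
 case (insert a T)
 have span_S: "h : sq_int M" if "h : cfun.span T" for h
  using span_le_fun_subspace[OF _ fun_subspace_sq_int, of T M] insert.prems that by auto
 have aS: "a : sq_int M" using insert.prems by simp
 obtain g where g: "g : cfun.span T" "!!h. h : cfun.span T ==> ip M (%x. u x - g x) h = 0"
  using insert.IH[of u] insert.prems by auto
 obtain g' where g': "g' : cfun.span T" "!!h. h : cfun.span T ==> ip M (%x. a x - g' x) h = 0"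
  using insert.IH[of a] insert.prems by auto
 define a' where "a' x = a x - g' x" for x
 have a'S: "a' : sq_int M" unfolding a'_def[abs_def] using aS span_S[OF g'(1)] by (rule sq_int_diff)
 have a'_orth: "ip M a' h = 0" if "h : cfun.span T" for h using g'(2)[OF that] by (simp add: a'_def[abs_def])
 have ugS: "(%x. u x - g x) : sq_int M" using insert.prems(2) span_S[OF g(1)] by (rule sq_int_diff)
 define c where "c = ip M (%x. u x - g x) a' / ip M a' a'"
 define k where "k x = g x + c * a' x" for x
 have sub: "cfun.span T <= cfun.span (insert a T)" by (rule cfun.span_mono) auto
 note SD = fun_subspaceD[OF fun_subspace_span[of "insert a T"]]
 have a'_in: "a' : cfun.span (insert a T)"
 proof -
  have "(%x. a x + (-1) * g' x) : cfun.span (insert a T)"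
   by (intro SD cfun.span_base subsetD[OF sub g'(1)]) simp
  then show ?thesis by (simp add: a'_def[abs_def])
 qed
 have k_in: "k : cfun.span (insert a T)"
  unfolding k_def[abs_def] using sub g(1) a'_in by (intro SD) auto
 have uk: "ip M (%x. u x - k x) h = ip M (%x. u x - g x) h - c * ip M a' h" if "h : sq_int M" for h
  using ip_linear(2)[OF ugS sq_int_scale[OF a'S] that, of c] ip_linear(3)[OF a'S a'S that]
  by (simp add: k_def algebra_simps)
 have uk_T: "ip M (%x. u x - k x) h = 0" if "h : cfun.span T" for h
  using uk[OF span_S[OF that]] g(2)[OF that] a'_orth[OF that] by simp
 have uk_a': "ip M (%x. u x - k x) a' = 0"
 proof (cases "ip M a' a' = 0")
  case True
  then have "nrm M a' = 0" by (simp add: ip_self)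
  then have "ip M (%x. u x - g x) a' = 0" using ip_Cauchy_Schwarz[OF ugS a'S] by simp
  then show ?thesis using uk[OF a'S] by (simp add: c_def)
 next
  case False
  then show ?thesis using uk[OF a'S] by (simp add: c_def)
 qed
 have ukS: "(%x. u x - k x) : sq_int M"
  unfolding k_def using sq_int_diff[OF ugS sq_int_scale[OF a'S, of c]] by (simp add: algebra_simps)
 let ?O = "{h : sq_int M. ip M (%x. u x - k x) h = 0}"
 have O: "fun_subspace ?O"
  unfolding fun_subspace_def
  using ip_linear_right(1,3)[OF _ _ ukS] sq_int_add sq_int_scale by (auto simp: sq_int_zero ip_def)
 have "a : ?O"
 proof -
  have "(%x. a' x + g' x) : ?O"
   using uk_a' uk_T[OF g'(1)] a'S span_S[OF g'(1)] by (intro fun_subspaceD(2)[OF O]) auto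
  then show ?thesis by (simp add: a'_def)
 qed
 moreover have "T <= ?O"
  using uk_T span_S cfun.span_base by blast
 ultimately have "cfun.span (insert a T) <= ?O" by (intro span_le_fun_subspace O) auto
 then show ?case using k_in by (intro bexI[of _ k]) auto
qed

section \<open>The measure\<close>

text \<open>
  The first parameter only fixes the index type of the matrices.
\<close>

locale weighted_bergman =
 fixes index_type :: "'n::{finite,linorder} itself" and lam :: real
 assumes lam: "lam > 2 * real CARD('n) - 1"
begin

lemma partial_UNIV:
 "partial_domain UNIV = (cartan_domain :: 'n cmat set)"
 "partial_gram UNIV (Z :: 'n cmat) = Re (det (mat 1 - Z ** conj_transpose Z))"
 by (simp_all add: partial_domain_def row_part_UNIV partial_gram_def gram_det_def one_on_def dmat_one)

lemma weight_density_eq: "weight_density lam (Z :: 'n cmat) = partial_gram UNIV Z powr (lam - 2 * real CARD('n))"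
 by (simp add: weight_density_def partial_UNIV)

lemma weight_density_pos: "Z : cartan_domain ==> 0 < weight_density lam (Z :: 'n cmat)"
 using partial_gram_pos[of Z UNIV "one_on UNIV"]
 by (simp add: weight_density_eq partial_UNIV(1) partial_gram_def one_on_def)

lemma measurable_weight_density [measurable]: "weight_density lam : borel_measurable (borel :: 'n cmat measure)"
 unfolding weight_density_eq[abs_def] by measurable

lemma sets_cartan_domain [measurable]: "(cartan_domain :: 'n cmat set) : sets borel"
 by (simp add: open_cartan_domain)

text \<open>
  The determinant lies between 0 and 1, so the exponent may be lowered into the interval from \<open>-1\<close> to 0.
\<close>

lemma weight_integrable:
 "(\<integral>\<^sup>+Z. indicator cartan_domain Z * ennreal (weight_density lam Z) \<partial>(lborel :: 'n cmat measure)) < \<infinity>"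
proof -
 define s where "s = min (lam - 2 * real CARD('n)) (-1/2)"
 have s: "-1 < s" "s < 0" "s <= lam - 2 * real CARD('n)" using lam by (auto simp: s_def)
 note P = partial_gram_integrable[OF s(1,2), of "UNIV :: 'n set", unfolded partial_UNIV(1)]
 have "(\<integral>\<^sup>+Z. indicator cartan_domain Z * ennreal (weight_density lam Z) \<partial>(lborel :: 'n cmat measure))
  <= (\<integral>\<^sup>+Z. indicator cartan_domain Z * ennreal (partial_gram UNIV Z powr s) \<partial>(lborel :: 'n cmat measure))"
 proof (rule nn_integral_mono)
  fix Z :: "'n cmat"
  show "indicator cartan_domain Z * ennreal (weight_density lam Z)
   <= indicator cartan_domain Z * ennreal (partial_gram UNIV Z powr s)"
  proof (cases "Z : cartan_domain")
   case True
   have "partial_gram UNIV Z <= 1" using P True by blast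
   moreover have "0 < partial_gram UNIV Z"
    using partial_gram_pos[of Z UNIV "one_on UNIV"] True
    by (simp add: partial_UNIV(1) partial_gram_def one_on_def)
   ultimately have "partial_gram UNIV Z powr (lam - 2 * real CARD('n)) <= partial_gram UNIV Z powr s"
    using s(3) by (intro powr_mono') auto
   then show ?thesis using True by (simp add: weight_density_eq ennreal_leI)
  qed simp
 qed
 then show ?thesis using P by (auto intro: le_less_trans)
qed

lemma norm_const_pos: "0 < norm_const TYPE('n) lam"
proof -
 let ?I = "LINT Z|(domain_lebesgue :: 'n cmat measure). weight_density lam Z"
 have I: "?I = (LINT Z|lborel. indicator cartan_domain Z *\<^sub>R weight_density lam (Z :: 'n cmat))"
  by (rule integral_restrict_space) simp
 have int: "integrable lborel (%Z. indicator cartan_domain Z *\<^sub>R weight_density lam (Z :: 'n cmat))"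
  unfolding integrable_iff_bounded
 proof
  have "(\<integral>\<^sup>+Z. ennreal (norm (indicator cartan_domain Z *\<^sub>R weight_density lam (Z :: 'n cmat))) \<partial>(lborel :: 'n cmat measure))
   = (\<integral>\<^sup>+Z. indicator cartan_domain Z * ennreal (weight_density lam Z) \<partial>(lborel :: 'n cmat measure))"
   by (intro nn_integral_cong) (auto split: split_indicator simp: weight_density_pos[THEN less_imp_le])
  then show "(\<integral>\<^sup>+Z. ennreal (norm (indicator cartan_domain Z *\<^sub>R weight_density lam (Z :: 'n cmat))) \<partial>(lborel :: 'n cmat measure)) < \<infinity>"
   using weight_integrable by simp
 qed measurable
 have nonneg: "0 <= indicator cartan_domain Z *\<^sub>R weight_density lam (Z :: 'n cmat)" for Z
  by (auto split: split_indicator intro: weight_density_pos[THEN less_imp_le])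
 have "?I ~= 0"
 proof
  assume "?I = 0"
  then have "AE Z in lborel. indicator cartan_domain Z *\<^sub>R weight_density lam (Z :: 'n cmat) = 0"
   unfolding I using integral_nonneg_eq_0_iff_AE[OF int] nonneg by simp
  then have "AE Z in (lborel :: 'n cmat measure). Z \<notin> (cartan_domain :: 'n cmat set)"
  proof (rule AE_mp, intro AE_I2 impI notI)
   fix Z :: "'n cmat" assume "indicator cartan_domain Z *\<^sub>R weight_density lam Z = 0" "Z : cartan_domain"
   then show False using weight_density_pos[of Z] by simp
  qed
  then have "(cartan_domain :: 'n cmat set) : null_sets lborel"
   using AE_iff_null_sets[of cartan_domain "lborel :: 'n cmat measure"] by simp
  then have "negligible (cartan_domain :: 'n cmat set)"
   using null_sets_completionI negligible_iff_null_sets by blast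
  then show False
   using open_not_negligible[OF open_cartan_domain] zero_in_cartan_domain by blast
 qed
 moreover have "0 <= ?I" unfolding I by (rule Bochner_Integration.integral_nonneg[OF nonneg])
 ultimately show ?thesis by (simp add: norm_const_def)
qed

abbreviation "\<B> \<equiv> bergman_measure lam :: 'n cmat measure"

definition dens :: "'n cmat => real" where
 "dens Z = norm_const TYPE('n) lam * weight_density lam Z"

lemma dens_pos: "Z : cartan_domain ==> 0 < dens Z"
 by (simp add: dens_def norm_const_pos weight_density_pos)

lemma measurable_dens [measurable]: "dens : borel_measurable borel"
 unfolding dens_def[abs_def] by measurable

lemma bergman_measure_eq: "\<B> = density domain_lebesgue (%Z. ennreal (dens Z))"
 by (simp add: bergman_measure_def dens_def)

lemma space_bergman [simp]: "space \<B> = cartan_domain"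
 by (simp add: bergman_measure_eq space_restrict_space)

lemma sets_bergman: "sets \<B> = sets (restrict_space borel cartan_domain)"
 unfolding bergman_measure_eq sets_density by (rule sets_restrict_space_cong) simp

lemma measurable_bergman_iff: "f : measurable \<B> N \<longleftrightarrow> f : measurable (restrict_space borel cartan_domain) N"
 by (rule measurable_cong_sets[OF sets_bergman refl, THEN arg_cong[of _ _ "(\<in>) f"]])

lemma measurable_bergman: "f : borel_measurable borel ==> f : borel_measurable \<B>"
 unfolding measurable_bergman_iff by (rule measurable_restrict_space1)

lemma measurable_bergman_continuous:
 fixes f :: "'n cmat => complex"
 shows "continuous_on cartan_domain f ==> f : borel_measurable \<B>"
 unfolding measurable_bergman_iff by (rule borel_measurable_continuous_on_restrict)

lemma dens_measurable_restrict: "(%Z. ennreal (dens Z)) : borel_measurable domain_lebesgue"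
 by (intro measurable_restrict_space1) measurable

lemma nn_integral_bergman:
 assumes "f : borel_measurable \<B>"
 shows "(\<integral>\<^sup>+Z. f Z \<partial>\<B>) = (\<integral>\<^sup>+Z. ennreal (dens Z) * f Z * indicator cartan_domain Z \<partial>(lborel :: 'n cmat measure))"
proof -
 have f: "f : borel_measurable domain_lebesgue"
  using assms unfolding bergman_measure_eq by simp
 have "(\<integral>\<^sup>+Z. f Z \<partial>\<B>) = (\<integral>\<^sup>+Z. ennreal (dens Z) * f Z \<partial>domain_lebesgue)"
  unfolding bergman_measure_eq by (rule nn_integral_density[OF dens_measurable_restrict f])
 also have "... = (\<integral>\<^sup>+Z. ennreal (dens Z) * f Z * indicator cartan_domain Z \<partial>(lborel :: 'n cmat measure))"
  by (rule nn_integral_restrict_space) simp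
 finally show ?thesis .
qed

lemma finite_measure_bergman: "finite_measure \<B>"
proof
 have "emeasure \<B> (space \<B>) = (\<integral>\<^sup>+Z. 1 \<partial>\<B>)" by simp
 also have "... = (\<integral>\<^sup>+Z. ennreal (dens Z) * 1 * indicator cartan_domain Z \<partial>(lborel :: 'n cmat measure))"
  by (rule nn_integral_bergman) simp
 also have "... = (\<integral>\<^sup>+Z. ennreal (norm_const TYPE('n) lam) * (indicator cartan_domain Z * ennreal (weight_density lam Z)) \<partial>(lborel :: 'n cmat measure))"
  by (intro nn_integral_cong) (auto split: split_indicator simp: dens_def ennreal_mult'' norm_const_pos[THEN less_imp_le] weight_density_pos[THEN less_imp_le])
 also have "... = ennreal (norm_const TYPE('n) lam) * (\<integral>\<^sup>+Z. indicator cartan_domain Z * ennreal (weight_density lam Z) \<partial>(lborel :: 'n cmat measure))"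
  by (rule nn_integral_cmult) measurable
 also have "... ~= \<infinity>" using weight_integrable by (simp add: ennreal_mult_eq_top_iff less_top[symmetric])
 finally show "emeasure \<B> (space \<B>) ~= \<infinity>" .
qed

lemma AE_bergman_iff: "(AE Z in \<B>. P Z) \<longleftrightarrow> (AE Z in domain_lebesgue. P Z)"
proof -
 have "(AE Z in \<B>. P Z) \<longleftrightarrow> (AE Z in domain_lebesgue. 0 < ennreal (dens Z) --> P Z)"
  unfolding bergman_measure_eq by (rule AE_density[OF dens_measurable_restrict])
 also have "... \<longleftrightarrow> (AE Z in domain_lebesgue. P Z)"
  by (rule AE_cong) (simp add: space_restrict_space dens_pos)
 finally show ?thesis .
qed

lemma bergman_measure_invariant:
 fixes T :: "'n cmat => 'n cmat"
 assumes lin: "linear T" and iso: "!!Z. norm (T Z) = norm Z"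
  and dom: "!!Z. T Z : cartan_domain \<longleftrightarrow> Z : cartan_domain"
  and weight: "!!Z. weight_density lam (T Z) = weight_density lam Z"
 shows "T : measurable \<B> \<B>" "distr \<B> \<B> T = \<B>"
proof -
 have T [measurable]: "T : borel_measurable borel"
  using lin by (intro borel_measurable_continuous_onI linear_continuous_on linear_conv_bounded_linear[THEN iffD1])
 show TB: "T : measurable \<B> \<B>"
  unfolding measurable_cong_sets[OF sets_bergman sets_bergman]
  by (rule measurable_restrict_space3[OF T]) (use dom in auto)
 show "distr \<B> \<B> T = \<B>"
 proof (rule measure_eqI)
  fix A assume "A : sets (distr \<B> \<B> T)"
  then have A: "A : sets \<B>" by simp
  have pre: "T -` A \<inter> space \<B> : sets \<B>" using TB A by (rule measurable_sets)
  have Ab [measurable]: "A : sets borel" and AD: "A <= cartan_domain"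
   using A unfolding sets_bergman by (auto simp: sets_restrict_space open_cartan_domain)
  have em: "emeasure \<B> C = (\<integral>\<^sup>+Z. ennreal (dens Z) * indicator C Z * indicator cartan_domain Z \<partial>(lborel :: 'n cmat measure))"
   if "C : sets \<B>" for C
   using nn_integral_bergman[of "indicator C"] that by simp
  have "emeasure (distr \<B> \<B> T) A = emeasure \<B> (T -` A \<inter> space \<B>)" by (rule emeasure_distr[OF TB A])
  also have "... = (\<integral>\<^sup>+Z. ennreal (dens Z) * indicator (T -` A \<inter> space \<B>) Z * indicator cartan_domain Z \<partial>(lborel :: 'n cmat measure))"
   by (rule em[OF pre])
  also have "... = (\<integral>\<^sup>+Z. ennreal (dens (T Z)) * indicator A (T Z) * indicator cartan_domain (T Z) \<partial>(lborel :: 'n cmat measure))"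
   by (intro nn_integral_cong) (simp add: dens_def weight dom split: split_indicator)
  also have "... = (\<integral>\<^sup>+Z. ennreal (dens Z) * indicator A Z * indicator cartan_domain Z \<partial>distr lborel borel T)"
   by (rule nn_integral_distr[symmetric]) measurable
  also have "... = emeasure \<B> A" by (simp add: lborel_isometry_invariant[OF lin iso] em[OF A])
  finally show "emeasure (distr \<B> \<B> T) A = emeasure \<B> A" .
 qed simp
qed

end

section \<open>Holomorphic functions of a matrix\<close>

lemma scalar_mat_mult: "mat a ** (mat b ** (W :: complex^'n^'m)) = mat (a * b) ** W"
 unfolding matrix_mult_scalar by (simp add: cvec_eq_iff)

lemma scalar_mat_zero [simp]: "mat 0 ** (W :: complex^'n^'m) = 0"
 by (simp add: cvec_eq_iff matrix_mult_scalar)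

lemma bounded_linear_scalar_curve: "bounded_linear (%t. mat t ** (W :: complex^'n^'m))"
 unfolding linear_conv_bounded_linear[symmetric]
 by (rule linearI) (simp_all add: cvec_eq_iff matrix_mult_scalar distrib_right)

lemma bounded_linear_scalar_mat: "bounded_linear (%W. mat t ** (W :: complex^'n^'m))"
 unfolding linear_conv_bounded_linear[symmetric]
 by (rule linearI) (simp_all add: cvec_eq_iff matrix_mult_scalar distrib_left)

lemma holomorphic_line_deriv:
 fixes f :: "('n::finite) cmat => complex"
 assumes d: "(f has_derivative f') (at (Z + mat t ** W))" "ALL c W. f' (mat c ** W) = c * f' W"
 shows "((%s. f (Z + mat s ** W)) has_field_derivative f' W) (at t)"
proof -
 have "((%s. Z + mat s ** W) has_derivative (%s. 0 + mat s ** W)) (at t)"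
  by (intro has_derivative_add has_derivative_const
   bounded_linear_imp_has_derivative bounded_linear_scalar_curve)
 from has_derivative_compose[OF this d(1)]
 have "((%s. f (Z + mat s ** W)) has_derivative (%s. f' (mat s ** W))) (at t)" by simp
 moreover have "(%s. f' (mat s ** W)) = (*) (f' W)" by (rule ext) (simp add: d(2) mult.commute)
 ultimately show ?thesis by (simp add: has_field_derivative_def)
qed

lemma mat_holomorphic_line:
 assumes f: "mat_holomorphic_on f S" and sub: "!!t. t : T ==> Z + mat t ** W : S"
 shows "(%t. f (Z + mat t ** W)) holomorphic_on T"
 unfolding holomorphic_on_def field_differentiable_def
proof
 fix t assume "t : T"
 then obtain f' where "(f has_derivative f') (at (Z + mat t ** W))" "ALL c W. f' (mat c ** W) = c * f' W"
  using f sub unfolding mat_holomorphic_on_def by blast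
 from holomorphic_line_deriv[OF this]
 show "EX d. ((%t. f (Z + mat t ** W)) has_field_derivative d) (at t within T)"
  using has_field_derivative_at_within by blast
qed

lemma mat_holomorphic_continuous: "mat_holomorphic_on f S ==> continuous_on S f"
 unfolding mat_holomorphic_on_def
 by (intro continuous_at_imp_continuous_on) (blast intro: has_derivative_continuous)

lemma mat_holomorphic_const: "mat_holomorphic_on (%Z. c) S"
 unfolding mat_holomorphic_on_def by (auto intro!: exI[of _ "%_. 0"])

lemma mat_holomorphic_add:
 assumes "mat_holomorphic_on f S" "mat_holomorphic_on g S"
 shows "mat_holomorphic_on (%Z. f Z + g Z) S"
 unfolding mat_holomorphic_on_def
proof
 fix Z assume Z: "Z : S"
 obtain f' where f': "(f has_derivative f') (at Z)" "ALL c W. f' (mat c ** W) = c * f' W"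
  using assms(1) Z unfolding mat_holomorphic_on_def by blast
 obtain g' where g': "(g has_derivative g') (at Z)" "ALL c W. g' (mat c ** W) = c * g' W"
  using assms(2) Z unfolding mat_holomorphic_on_def by blast
 show "EX h'. ((%Z. f Z + g Z) has_derivative h') (at Z) & (ALL c W. h' (mat c ** W) = c * h' W)"
  using has_derivative_add[OF f'(1) g'(1)] f'(2) g'(2)
  by (intro exI[of _ "%W. f' W + g' W"]) (auto simp: distrib_left)
qed

lemma mat_holomorphic_mult:
 assumes "mat_holomorphic_on f S" "mat_holomorphic_on g S"
 shows "mat_holomorphic_on (%Z. f Z * g Z) S"
 unfolding mat_holomorphic_on_def
proof
 fix Z assume Z: "Z : S"
 obtain f' where f': "(f has_derivative f') (at Z)" "ALL c W. f' (mat c ** W) = c * f' W"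
  using assms(1) Z unfolding mat_holomorphic_on_def by blast
 obtain g' where g': "(g has_derivative g') (at Z)" "ALL c W. g' (mat c ** W) = c * g' W"
  using assms(2) Z unfolding mat_holomorphic_on_def by blast
 show "EX h'. ((%Z. f Z * g Z) has_derivative h') (at Z) & (ALL c W. h' (mat c ** W) = c * h' W)"
  using has_derivative_mult[OF f'(1) g'(1)] f'(2) g'(2)
  by (intro exI[of _ "%W. f Z * g' W + f' W * g Z"]) (auto simp: algebra_simps)
qed

lemma mat_holomorphic_cmult: "mat_holomorphic_on f S ==> mat_holomorphic_on (%Z. c * f Z) S"
 by (intro mat_holomorphic_mult mat_holomorphic_const)

lemma mat_holomorphic_diff:
 assumes "mat_holomorphic_on f S" "mat_holomorphic_on g S"
 shows "mat_holomorphic_on (%Z. f Z - g Z) S"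
 using mat_holomorphic_add[OF assms(1) mat_holomorphic_cmult[OF assms(2), of "-1"]] by simp

lemma mat_holomorphic_scalar:
 assumes "mat_holomorphic_on f S"
 shows "mat_holomorphic_on (%Z. f (mat s ** Z)) {Z. mat s ** Z : S}"
 unfolding mat_holomorphic_on_def
proof
 fix Z assume "Z : {Z. mat s ** Z : S}"
 then obtain f' where f': "(f has_derivative f') (at (mat s ** Z))" "ALL c W. f' (mat c ** W) = c * f' W"
  using assms unfolding mat_holomorphic_on_def by blast
 have "((%Z. f (mat s ** Z)) has_derivative (%W. f' (mat s ** W))) (at Z)"
  using has_derivative_compose[OF bounded_linear_imp_has_derivative[OF bounded_linear_scalar_mat] f'(1)] .
 then show "EX h'. ((%Z. f (mat s ** Z)) has_derivative h') (at Z) & (ALL c W. h' (mat c ** W) = c * h' W)"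
  using f'(2) by (intro exI[of _ "%W. f' (mat s ** W)"]) auto
qed

lemma mat_holomorphic_subset: "mat_holomorphic_on f S ==> T <= S ==> mat_holomorphic_on f T"
 unfolding mat_holomorphic_on_def by blast

lemma polynomial_fun_holomorphic: "polynomial_fun p ==> mat_holomorphic_on p S"
proof (induction rule: polynomial_fun.induct)
 case (entry i j)
 have "bounded_linear (%Z :: 'a cmat. Z $ i $ j)"
  unfolding linear_conv_bounded_linear[symmetric] by (rule linearI) simp_all
 then show ?case unfolding mat_holomorphic_on_def
  by (intro ballI exI[of _ "%Z. Z $ i $ j"]) (auto intro: bounded_linear_imp_has_derivative simp: matrix_mult_scalar)
qed (auto intro: mat_holomorphic_const mat_holomorphic_add mat_holomorphic_mult)

lemma derivative_Cauchy_estimate: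
 fixes f :: "('n::finite) cmat => complex"
 assumes hol: "mat_holomorphic_on f S" and r: "0 < r" "cball Z r <= S"
  and B: "!!X. X : cball Z r ==> cmod (f X) <= B"
  and d: "(f has_derivative f') (at Z)" "ALL c W. f' (mat c ** W) = c * f' W"
 shows "cmod (f' W) <= B / r * norm W"
proof (cases "W = 0")
 case True
 then show ?thesis
  using linear_0[OF bounded_linear.linear[OF has_derivative_bounded_linear[OF d(1)]]] by simp
next
 case False
 define c where "c = complex_of_real (r / norm W)"
 have nc: "cmod c = r / norm W" using r by (simp add: c_def norm_divide)
 define V where "V = mat c ** W"
 have nV: "norm V = r" using False by (simp add: V_def norm_scalar_mat nc)
 define g where "g t = f (Z + mat t ** V)" for t
 have sub: "Z + mat t ** V : cball Z r" if "cmod t <= 1" for t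
  using that r(1) by (simp add: dist_norm norm_scalar_mat nV mult_left_le_one_le)
 have holg: "g holomorphic_on cball 0 1"
  unfolding g_def[abs_def] by (rule mat_holomorphic_line[OF hol]) (use sub r in auto)
 have "cmod ((deriv ^^ 1) g 0) <= fact 1 * B / 1 ^ 1"
 proof (rule Cauchy_inequality)
  show "g holomorphic_on ball 0 1" using holg by (rule holomorphic_on_subset) auto
  show "continuous_on (cball 0 1) g" using holg by (rule holomorphic_on_imp_continuous_on)
  show "cmod (g x) <= B" if "norm (0 - x) = 1" for x
   unfolding g_def by (rule B[OF sub]) (use that in simp)
 qed simp
 moreover have "deriv g 0 = f' V"
  unfolding g_def[abs_def] using d by (intro DERIV_imp_deriv holomorphic_line_deriv) simp_all
 ultimately have "cmod c * cmod (f' W) <= B" using d(2) by (simp add: V_def norm_mult)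
 then show ?thesis using r False by (simp add: nc field_simps)
qed

text \<open>Cauchy's estimate makes the derivatives converge uniformly as well.\<close>

lemma mat_holomorphic_limit:
 fixes f :: "nat => ('n::finite) cmat => complex"
 assumes hol: "ALL n. mat_holomorphic_on (f n) S"
  and loc: "!!Z. Z : S ==> EX r>0. cball Z r <= S & (ALL e>0. EX N. ALL n>=N. ALL X:cball Z r. cmod (f n X - g X) <= e)"
 shows "mat_holomorphic_on g S"
 unfolding mat_holomorphic_on_def
proof
 fix Z0 assume "Z0 : S"
 from loc[OF this] obtain r where r: "0 < r" "cball Z0 r <= S"
  and unif: "ALL e>0. EX N. ALL n>=N. ALL X:cball Z0 r. cmod (f n X - g X) <= e" by blast
 define f' where "f' n Z = (SOME f'. (f n has_derivative f') (at Z) & (ALL c W. f' (mat c ** W) = c * f' W))" for n Z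
 have "(f n has_derivative f' n Z) (at Z) & (ALL c W. f' n Z (mat c ** W) = c * f' n Z W)" if "Z : S" for n Z
 proof -
  have "EX f'. (f n has_derivative f') (at Z) & (ALL c W. f' (mat c ** W) = c * f' W)"
   using hol that unfolding mat_holomorphic_on_def by blast
  from someI_ex[OF this] show ?thesis unfolding f'_def .
 qed
 then have f': "(f n has_derivative f' n Z) (at Z)" "ALL c W. f' n Z (mat c ** W) = c * f' n Z W" if "Z : S" for n Z
  using that by simp_all
 let ?U = "ball Z0 (r/2)"
 have cb: "cball X (r/2) <= cball Z0 r" if "X : ?U" for X
 proof
  fix Y assume "Y : cball X (r/2)"
  then show "Y : cball Z0 r" using that dist_triangle[of Z0 Y X] by simp
 qed
 have US: "X : S" if "X : ?U" for X
 proof -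
  have "X : cball X (r/2)" using r by simp
  then show ?thesis using cb[OF that] r(2) by blast
 qed
 have est: "cmod (f' m X W - f' n X W) <= e / (r/2) * norm W"
  if X: "X : ?U" and e: "ALL Y:cball Z0 r. cmod (f m Y - f n Y) <= e" for m n X W e
 proof (rule derivative_Cauchy_estimate)
  show "mat_holomorphic_on (%Y. f m Y - f n Y) S" using hol by (intro mat_holomorphic_diff) auto
  show "0 < r/2" using r by simp
  show "cball X (r/2) <= S" using cb[OF X] r by blast
  show "cmod (f m Y - f n Y) <= e" if "Y : cball X (r/2)" for Y using e cb[OF X] that by blast
  show "((%Y. f m Y - f n Y) has_derivative (%W. f' m X W - f' n X W)) (at X)"
   by (intro has_derivative_diff f' US X)
  show "ALL c W. f' m X (mat c ** W) - f' n X (mat c ** W) = c * (f' m X W - f' n X W)"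
   using f'(2)[OF US[OF X]] by (simp add: right_diff_distrib)
 qed
 have cauchy: "EX N. ALL m>=N. ALL n>=N. ALL X:?U. ALL W. cmod (f' m X W - f' n X W) <= e * norm W" if e: "0 < e" for e
 proof -
  have "0 < e * r / 4" using e r by simp
  with unif obtain N where N: "ALL n>=N. ALL X:cball Z0 r. cmod (f n X - g X) <= e * r / 4" by blast
  have "cmod (f' m X W - f' n X W) <= e * norm W" if "N <= m" "N <= n" "X : ?U" for m n X W
  proof -
   have "ALL Y:cball Z0 r. cmod (f m Y - f n Y) <= e * (r / 2)"
   proof
    fix Y assume Y: "Y : cball Z0 r"
    have "cmod (f m Y - f n Y) <= cmod (f m Y - g Y) + cmod (f n Y - g Y)"
     using norm_triangle_ineq4[of "f m Y - g Y" "f n Y - g Y"] by simp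
    moreover have "cmod (f m Y - g Y) <= e * r / 4" "cmod (f n Y - g Y) <= e * r / 4" using N that Y by blast+
    ultimately show "cmod (f m Y - f n Y) <= e * (r / 2)" by simp
   qed
   from est[OF that(3) this] show ?thesis using r by simp
  qed
  then show ?thesis by blast
 qed
 define g' where "g' X W = lim (%n. f' n X W)" for X W
 have lim: "(%n. f' n X W) \<longlonglongrightarrow> g' X W" if X: "X : ?U" for X W
 proof -
  have "Cauchy (%n. f' n X W)"
  proof (rule CauchyI)
   fix e :: real assume e: "0 < e"
   have pos: "0 < norm W + 1" by (simp add: add_nonneg_pos)
   obtain N where N: "ALL m>=N. ALL n>=N. ALL X:?U. ALL V. cmod (f' m X V - f' n X V) <= e / (norm W + 1) * norm V"
    using cauchy[OF divide_pos_pos[OF e pos]] by blast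
   have "e / (norm W + 1) * norm W < e"
    using e pos by (simp add: pos_divide_less_eq distrib_left)
   then show "EX N. ALL m>=N. ALL n>=N. cmod (f' m X W - f' n X W) < e"
    using N X by (meson le_less_trans)
  qed
  then show ?thesis unfolding g'_def using Cauchy_convergent_iff convergent_LIMSEQ_iff by blast
 qed
 have est2: "EX N. ALL n>=N. ALL X:?U. ALL W. cmod (f' n X W - g' X W) <= e * norm W" if e: "0 < e" for e
 proof -
  obtain N where N: "ALL m>=N. ALL n>=N. ALL X:?U. ALL W. cmod (f' m X W - f' n X W) <= e * norm W"
   using cauchy[OF e] by blast
  have "cmod (f' n X W - g' X W) <= e * norm W" if "N <= n" "X : ?U" for n X W
  proof (rule LIMSEQ_le_const2)
   show "(%m. cmod (f' n X W - f' m X W)) \<longlonglongrightarrow> cmod (f' n X W - g' X W)"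
    by (intro tendsto_intros lim that)
   show "EX M. ALL m>=M. cmod (f' n X W - f' m X W) <= e * norm W" using N that by blast
  qed
  then show ?thesis by blast
 qed
 have pt: "(%n. f n X) \<longlonglongrightarrow> g X" if "X : cball Z0 r" for X
 proof (rule LIMSEQ_I)
  fix e :: real assume "0 < e"
  then have "0 < e / 2" by simp
  with unif obtain N where "ALL n>=N. ALL X:cball Z0 r. cmod (f n X - g X) <= e / 2" by blast
  then show "EX N. ALL n>=N. norm (f n X - g X) < e" using that \<open>0 < e\<close> by (intro exI[of _ N]) fastforce
 qed
 have Z0U: "Z0 : ?U" using r by simp
 have "EX h. ALL X:?U. (%n. f n X) \<longlonglongrightarrow> h X & (h has_derivative g' X) (at X within ?U)"
 proof (rule has_derivative_sequence)
  show "(f n has_derivative f' n X) (at X within ?U)" if "X : ?U" for n X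
   by (rule has_derivative_at_withinI[OF f'(1)[OF US[OF that]]])
  show "\<forall>\<^sub>F n in sequentially. ALL x:?U. ALL h. cmod (f' n x h - g' x h) <= e * norm h" if "0 < e" for e
   using est2[OF that] unfolding eventually_sequentially .
  show "(%n. f n Z0) \<longlonglongrightarrow> g Z0" by (rule pt) (use r in simp)
 qed (rule convex_ball, rule Z0U)
 then obtain h where h: "ALL X:?U. (%n. f n X) \<longlonglongrightarrow> h X & (h has_derivative g' X) (at X within ?U)" by blast
 have hg: "h X = g X" if "X : ?U" for X
  using LIMSEQ_unique[of "%n. f n X" "h X" "g X"] h pt[of X] that r by auto
 have "(h has_derivative g' Z0) (at Z0)"
  using bspec[OF h Z0U] unfolding at_within_open[OF Z0U open_ball] by blast
 then have "(g has_derivative g' Z0) (at Z0)"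
  by (rule has_derivative_transform_within_open[OF _ open_ball Z0U hg])
 moreover have "g' Z0 (mat c ** W) = c * g' Z0 W" for c W
 proof (rule LIMSEQ_unique[OF lim[OF Z0U]])
  have "(%n. c * f' n Z0 W) \<longlonglongrightarrow> c * g' Z0 W" by (intro tendsto_intros lim Z0U)
  then show "(%n. f' n Z0 (mat c ** W)) \<longlonglongrightarrow> c * g' Z0 W" using f'(2)[OF \<open>Z0 : S\<close>] by simp
 qed
 ultimately show "EX g'. (g has_derivative g') (at Z0) & (ALL c W. g' (mat c ** W) = c * g' W)" by blast
qed

section \<open>Functions that are polynomial in each entry\<close>

lemma lagrange_basis:
 "\<exists>L :: nat => complex poly. ALL q t. Polynomial.degree q <= k --> poly q t = (\<Sum>m\<le>k. poly q (of_nat m) * poly (L m) t)"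
proof -
 define L where "L m = (\<Prod>j\<in>{..k}-{m}. Polynomial.smult (1 / (of_nat m - of_nat j)) [:- of_nat j, 1 :: complex:])" for m
 have deg: "Polynomial.degree (L m) <= k" if "m <= k" for m
 proof -
  have "Polynomial.degree (L m) <= (\<Sum>j\<in>{..k}-{m}. Polynomial.degree (Polynomial.smult (1 / (of_nat m - of_nat j)) [:- of_nat j, 1 :: complex:]))"
   unfolding L_def by (rule degree_prod_sum_le[THEN order_trans]) (auto simp: o_def)
  also have "... <= (\<Sum>j\<in>{..k}-{m}. 1)" by (intro sum_mono) simp
  finally show ?thesis using that by simp
 qed
 have ev: "poly (L m) (of_nat i) = (if i = m then 1 else 0)" if "m <= k" "i <= k" for m i
  using that unfolding L_def poly_prod by (auto simp: prod_zero_iff diff_divide_distrib[symmetric] intro!: prod.neutral)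
 have "poly q t = (\<Sum>m\<le>k. poly q (of_nat m) * poly (L m) t)" if q: "Polynomial.degree q <= k" for q t
 proof -
  let ?s = "\<Sum>m\<le>k. Polynomial.smult (poly q (of_nat m)) (L m)"
  have "q = ?s"
  proof (rule poly_eqI_degree[of "of_nat ` {..k}"])
   fix x :: complex assume "x : of_nat ` {..k}"
   then obtain i where i: "i <= k" "x = of_nat i" by auto
   have "poly ?s x = (\<Sum>m\<le>k. poly q (of_nat m) * (if i = m then 1 else 0))"
    unfolding poly_sum using ev i by (intro sum.cong) auto
   also have "... = poly q x" using i by (simp add: if_distrib cong: if_cong)
   finally show "poly q x = poly ?s x" by simp
  next
   have card: "card ((of_nat :: nat => complex) ` {..k}) = Suc k" by (subst card_image) (auto intro: inj_onI)
   show "Polynomial.degree q < card ((of_nat :: nat => complex) ` {..k})" using q card by simp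
   have "Polynomial.degree ?s <= k" using deg by (intro degree_sum_le) (auto intro: order_trans[OF degree_smult_le])
   then show "Polynomial.degree ?s < card ((of_nat :: nat => complex) ` {..k})" using card by simp
  qed
  then have "poly q t = poly ?s t" by simp
  then show ?thesis by (simp add: poly_sum)
 qed
 then show ?thesis by (intro exI[of _ L] allI impI)
qed

lemma polynomial_fun_poly: "polynomial_fun p ==> polynomial_fun (%Z. poly q (p Z))"
 unfolding poly_altdef
 by (rule polynomial_fun_sum, rule polynomial_fun_cmult, rule polynomial_fun_power)

definition set_entry :: "('n::finite) => 'n => complex => 'n cmat => 'n cmat" where
 "set_entry i j t Z = (\<chi> a b. if a = i & b = j then t else Z $ a $ b)"

text \<open>
  Lagrange interpolation in one entry expresses the function by its values with that entry frozen;
  induct over the entries.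
\<close>

lemma polynomial_fun_if_entrywise:
 fixes p :: "('n::finite) cmat => complex"
 assumes p: "!!Z i j. EX q. Polynomial.degree q <= k & (ALL t. p (set_entry i j t Z) = poly q t)"
 shows "polynomial_fun p"
proof -
 from lagrange_basis[of k] obtain L :: "nat => complex poly" where
  L: "ALL q t. Polynomial.degree q <= k --> poly q t = (\<Sum>m\<le>k. poly q (of_nat m) * poly (L m) t)" ..
 have interp: "p (set_entry i j t Z) = (\<Sum>m\<le>k. p (set_entry i j (of_nat m) Z) * poly (L m) t)" for i j t Z
 proof -
  from p[of i j Z] obtain q where q: "Polynomial.degree q <= k" "ALL t. p (set_entry i j t Z) = poly q t" by auto
  have "poly q t = (\<Sum>m\<le>k. poly q (of_nat m) * poly (L m) t)" by (rule L[rule_format, OF q(1)])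
  then show ?thesis unfolding q(2)[rule_format] .
 qed
 have "ALL Z0. polynomial_fun (%X. p (\<chi> a b. if (a, b) : I then X $ a $ b else Z0 $ a $ b))" if "finite I" for I
  using that
 proof (induction I rule: finite_induct)
  case empty
  show ?case by (auto intro: polynomial_fun.const)
 next
  case (insert ij I)
  obtain i j where ij: "ij = (i, j)" by force
  show ?case
  proof
   fix Z0 :: "'n cmat"
   have "p (\<chi> a b. if (a, b) : insert ij I then X $ a $ b else Z0 $ a $ b) =
    (\<Sum>m\<le>k. p (\<chi> a b. if (a, b) : I then X $ a $ b else set_entry i j (of_nat m) Z0 $ a $ b) * poly (L m) (X $ i $ j))" for X
   proof -
    have e1: "(\<chi> a b. if (a, b) : insert ij I then X $ a $ b else Z0 $ a $ b)
     = set_entry i j (X $ i $ j) (\<chi> a b. if (a, b) : I then X $ a $ b else Z0 $ a $ b)"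
     using insert.hyps ij by (simp add: set_entry_def cvec_eq_iff)
    have e2: "set_entry i j c (\<chi> a b. if (a, b) : I then X $ a $ b else Z0 $ a $ b)
     = (\<chi> a b. if (a, b) : I then X $ a $ b else set_entry i j c Z0 $ a $ b)" for c
     using insert.hyps ij by (auto simp: set_entry_def cvec_eq_iff)
    show ?thesis by (subst e1, subst interp, simp only: e2)
   qed
   moreover have "polynomial_fun (%X. \<Sum>m\<le>k. p (\<chi> a b. if (a, b) : I then X $ a $ b else set_entry i j (of_nat m) Z0 $ a $ b) * poly (L m) (X $ i $ j))"
    by (rule polynomial_fun_sum, rule polynomial_fun.mult, rule spec[OF insert.IH], rule polynomial_fun_poly, rule polynomial_fun.entry)
   ultimately show "polynomial_fun (%X. p (\<chi> a b. if (a, b) : insert ij I then X $ a $ b else Z0 $ a $ b))" by simp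
  qed
 qed
 from spec[OF this[of UNIV], of 0] show ?thesis by simp
qed

section \<open>Taylor expansion in homogeneous polynomials\<close>

text \<open>
  The homogeneous component of degree \<open>k\<close> of the Taylor series at the origin.
\<close>

definition taylor_part :: "nat => (('n::finite) cmat => complex) => 'n cmat => complex" where
 "taylor_part k f Z = (deriv ^^ k) (%t. f (mat t ** Z)) 0 / fact k"

context
 fixes f :: "('n::finite) cmat => complex"
 assumes hol: "mat_holomorphic_on f cartan_domain"
begin

lemma open_disc: "open {t. mat t ** (Z :: 'n cmat) : cartan_domain}"
proof -
 have "continuous_on UNIV (%t. mat t ** Z)" by (intro linear_continuous_on bounded_linear_scalar_curve)
 from open_vimage[OF open_cartan_domain this] show ?thesis by (simp add: vimage_def)
qed

lemma disc_holomorphic: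
 assumes "!!t. t : T ==> mat t ** Z : cartan_domain"
 shows "(%t. f (mat t ** Z)) holomorphic_on T"
 using mat_holomorphic_line[OF hol, of T 0 Z] assms by simp

lemma taylor_part_scalar: "taylor_part k f (mat s ** Z) = s ^ k * taylor_part k f Z"
proof -
 let ?T = "{t. mat t ** Z : cartan_domain}"
 have "(deriv ^^ k) (%w. (%t. f (mat t ** Z)) (s * w)) 0 = s ^ k * (deriv ^^ k) (%t. f (mat t ** Z)) (s * 0)"
 proof (rule higher_deriv_compose_linear)
  show "(%t. f (mat t ** Z)) holomorphic_on ?T" by (rule disc_holomorphic) simp
  show "open {w. s * w : ?T}"
   using open_vimage[OF open_disc[of Z], of "%w. s * w"] by (simp add: vimage_def continuous_on_mult_left)
 qed (auto simp: open_disc zero_in_cartan_domain)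
 then show ?thesis by (simp add: taylor_part_def scalar_mat_mult mult.commute[of s])
qed

lemma bounded_near_zero: "EX \<rho>>0. cball 0 \<rho> <= (cartan_domain :: 'n cmat set) & (EX B>=0. ALL Z:cball 0 \<rho>. cmod (f Z) <= B)"
proof -
 obtain \<rho> where \<rho>: "0 < \<rho>" "cball 0 \<rho> <= (cartan_domain :: 'n cmat set)"
  using open_cartan_domain zero_in_cartan_domain open_contains_cball by blast
 have "continuous_on (cball 0 \<rho>) f"
  using mat_holomorphic_continuous[OF hol] \<rho>(2) by (rule continuous_on_subset)
 then have "bounded (f ` cball 0 \<rho>)" by (intro compact_imp_bounded compact_continuous_image) auto
 then obtain B where "ALL x:f ` cball 0 \<rho>. cmod x <= B" unfolding bounded_iff by blast
 then have "ALL Z:cball 0 \<rho>. cmod (f Z) <= max B 0" by (auto intro: le_max_iff_disj[THEN iffD2])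
 then show ?thesis using \<rho> by (intro exI[of _ \<rho>]) (auto intro!: exI[of _ "max B 0"])
qed

context
 fixes \<rho> B :: real
 assumes \<rho>: "0 < \<rho>" "cball 0 \<rho> <= (cartan_domain :: 'n cmat set)"
  and B: "0 <= B" "ALL Z:cball 0 \<rho>. cmod (f Z) <= B"
begin

lemma small_disc: "norm (Z :: 'n cmat) <= \<rho> ==> cmod t <= 1 ==> mat t ** Z : cball 0 \<rho>"
 using mult_mono[of "cmod t" 1 "norm Z" \<rho>] by (simp add: norm_scalar_mat)

lemma taylor_part_bound: "norm Z <= \<rho> ==> cmod (taylor_part k f Z) <= B"
proof -
 assume Z: "norm Z <= \<rho>"
 have h: "(%t. f (mat t ** Z)) holomorphic_on cball 0 1"
  by (rule disc_holomorphic) (use small_disc[OF Z] \<rho> in auto)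
 have "cmod ((deriv ^^ k) (%t. f (mat t ** Z)) 0) <= fact k * B / 1 ^ k"
 proof (rule Cauchy_inequality)
  show "(%t. f (mat t ** Z)) holomorphic_on ball 0 1" using h by (rule holomorphic_on_subset) auto
  show "continuous_on (cball 0 1) (%t. f (mat t ** Z))" using h by (rule holomorphic_on_imp_continuous_on)
  show "cmod (f (mat x ** Z)) <= B" if "norm (0 - x) = 1" for x
   using B small_disc[OF Z] that by auto
 qed simp
 then show ?thesis by (simp add: taylor_part_def norm_divide divide_le_eq mult.commute)
qed

lemma taylor_sums:
 assumes Z: "norm Z <= \<rho>" and s: "cmod s < 1"
 shows "(%n. taylor_part n f Z * s ^ n) sums f (mat s ** Z)"
proof -
 have "(%t. f (mat t ** Z)) holomorphic_on ball 0 1"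
  by (rule disc_holomorphic) (use small_disc[OF Z] \<rho> in auto)
 from holomorphic_power_series[OF this, of s] show ?thesis using s by (simp add: taylor_part_def)
qed

lemma taylor_remainder:
 assumes Z: "norm Z <= \<rho>" and s: "cmod s <= 1/2"
 shows "cmod (f (mat s ** Z) - (\<Sum>i<k. taylor_part i f Z * s ^ i)) <= 2 * B * cmod s ^ k"
proof -
 have s1: "cmod s < 1" using s by linarith
 have "(%n. taylor_part (n + k) f Z * s ^ (n + k)) sums (f (mat s ** Z) - (\<Sum>i<k. taylor_part i f Z * s ^ i))"
  by (rule sums_split_initial_segment[OF taylor_sums[OF Z s1]])
 moreover have "(%n. B * cmod s ^ k * cmod s ^ n) sums (B * cmod s ^ k * (1 / (1 - cmod s)))"
  by (intro sums_mult geometric_sums) (use s1 in simp)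
 ultimately have "cmod (f (mat s ** Z) - (\<Sum>i<k. taylor_part i f Z * s ^ i)) <= B * cmod s ^ k * (1 / (1 - cmod s))"
 proof (rule norm_sums_le)
  fix n
  have "cmod (taylor_part (n + k) f Z * s ^ (n + k)) <= B * cmod s ^ (n + k)"
   unfolding norm_mult norm_power by (intro mult_right_mono taylor_part_bound Z) simp
  then show "cmod (taylor_part (n + k) f Z * s ^ (n + k)) <= B * cmod s ^ k * cmod s ^ n"
   by (simp add: power_add mult_ac)
 qed
 also have "... <= B * cmod s ^ k * 2"
  using s B by (intro mult_left_mono) (auto simp: divide_le_eq)
 finally show ?thesis by (simp add: mult_ac)
qed

lemma taylor_part_limit:
 assumes Z: "norm Z <= \<rho>" and s: "s ~= 0" "cmod s <= 1/2"
 shows "cmod ((f (mat s ** Z) - (\<Sum>i<k. taylor_part i f Z * s ^ i)) / s ^ k - taylor_part k f Z) <= 2 * B * cmod s"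
proof -
 have "(f (mat s ** Z) - (\<Sum>i<k. taylor_part i f Z * s ^ i)) / s ^ k - taylor_part k f Z
  = (f (mat s ** Z) - (\<Sum>i<Suc k. taylor_part i f Z * s ^ i)) / s ^ k"
  using s by (simp add: field_simps)
 also have "cmod ... <= 2 * B * cmod s ^ Suc k / cmod s ^ k"
  unfolding norm_divide norm_power
  by (intro divide_right_mono taylor_remainder Z s) simp
 also have "... = 2 * B * cmod s" using s by simp
 finally show ?thesis .
qed

text \<open>
  The component is the locally uniform limit of \<open>s\<^sup>-\<^sup>k\<close> times the Taylor remainder at \<open>s Z\<close>, as \<open>s\<close> tends to 0.
  Homogeneity extends holomorphy from a ball to the whole space.
\<close>

lemma taylor_part_holomorphic:
 assumes IH: "ALL i<k. polynomial_fun (taylor_part i f)"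
 shows "mat_holomorphic_on (taylor_part k f) UNIV"
proof -
 define s where "s m = complex_of_real (1 / (real m + 2))" for m
 have s: "s m ~= 0" "cmod (s m) <= 1/2" "cmod (s m) = 1 / (real m + 2)" for m
 proof -
  show c: "cmod (s m) = 1 / (real m + 2)" unfolding s_def norm_of_real by simp
  show "cmod (s m) <= 1/2" unfolding c by (simp add: divide_le_eq)
  have "0 < cmod (s m)" unfolding c by simp
  then show "s m ~= 0" by simp
 qed
 define F where "F m Z = inverse (s m ^ k) * (f (mat (s m) ** Z) - (\<Sum>i<k. taylor_part i f Z * s m ^ i))" for m Z
 have small: "mat_holomorphic_on (taylor_part k f) (ball 0 \<rho>)"
 proof (rule mat_holomorphic_limit)
  show "ALL m. mat_holomorphic_on (F m) (ball 0 \<rho>)"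
  proof
   fix m
   have "mat_holomorphic_on (%Z. f (mat (s m) ** Z)) (ball 0 \<rho>)"
   proof (rule mat_holomorphic_subset[OF mat_holomorphic_scalar[OF hol]])
    have "cmod (s m) <= 1" using s(2)[of m] by linarith
    then have in_D: "mat (s m) ** Z : cartan_domain" if "Z : ball 0 \<rho>" for Z :: "'n cmat"
     using subsetD[OF \<rho>(2) small_disc[of Z "s m"]] that by simp
    show "ball 0 \<rho> <= {Z :: 'n cmat. mat (s m) ** Z : cartan_domain}"
     by (rule subsetI, rule CollectI, rule in_D)
   qed
   moreover have "polynomial_fun (%Z. \<Sum>i<k. taylor_part i f Z * s m ^ i)"
    by (rule polynomial_fun_sum, rule polynomial_fun.mult) (use IH in \<open>auto intro: polynomial_fun.const\<close>)
   ultimately show "mat_holomorphic_on (F m) (ball 0 \<rho>)"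
    unfolding F_def[abs_def]
    by - (rule mat_holomorphic_cmult, rule mat_holomorphic_diff, assumption, rule polynomial_fun_holomorphic)
  qed
  fix Z :: "'n cmat" assume "Z : ball 0 \<rho>"
  then obtain r where r: "0 < r" "cball Z r <= ball 0 \<rho>" using open_contains_cball open_ball by blast
  have "EX N. ALL n>=N. ALL X:cball Z r. cmod (F n X - taylor_part k f X) <= e" if e: "0 < e" for e
  proof -
   obtain N :: nat where N: "2 * B / e < real N" using reals_Archimedean2 by blast
   have "cmod (F n X - taylor_part k f X) <= e" if "N <= n" "X : cball Z r" for n X
   proof -
    have "norm X <= \<rho>" using r(2) that(2) by force
    from taylor_part_limit[OF this s(1,2), where k=k]
    have "cmod (F n X - taylor_part k f X) <= 2 * B * cmod (s n)"
     by (simp add: F_def divide_inverse mult.commute)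
    also have "... = 2 * B / (real n + 2)" by (simp add: s(3))
    also have "... <= e"
    proof -
     have "2 * B < e * real N" using N e by (simp add: field_simps)
     also have "... <= e * (real n + 2)" using that(1) e by (intro mult_left_mono) auto
     finally show ?thesis by (simp add: divide_le_eq)
    qed
    finally show ?thesis .
   qed
   then show ?thesis by blast
  qed
  then show "EX r>0. cball Z r <= ball 0 \<rho> & (ALL e>0. EX N. ALL n>=N. ALL X:cball Z r. cmod (F n X - taylor_part k f X) <= e)"
   using r by blast
 qed
 show ?thesis
  unfolding mat_holomorphic_on_def
 proof
  fix Z :: "'n cmat"
  define c where "c = complex_of_real (\<rho> / (norm Z + 1))"
  have pos: "0 < norm Z + 1" by (simp add: add_nonneg_pos)
  have cn: "cmod c = \<rho> / (norm Z + 1)" unfolding c_def norm_of_real using \<rho> pos by simp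
  then have c0: "c ~= 0" using \<rho>(1) pos by auto
  have "mat c ** Z : ball 0 \<rho>" using \<rho>(1) pos by (simp add: norm_scalar_mat cn pos_divide_less_eq distrib_left)
  then have "Z : {Z. mat c ** Z : ball 0 \<rho>}" by simp
  moreover have "mat_holomorphic_on (%Z. inverse (c ^ k) * taylor_part k f (mat c ** Z)) {Z. mat c ** Z : ball 0 \<rho>}"
   by (intro mat_holomorphic_cmult mat_holomorphic_scalar small)
  moreover have "(%Z. inverse (c ^ k) * taylor_part k f (mat c ** Z)) = taylor_part k f"
   using c0 by (simp add: taylor_part_scalar fun_eq_iff)
  ultimately show "EX f'. (taylor_part k f has_derivative f') (at Z) & (ALL c W. f' (mat c ** W) = c * f' W)"
   unfolding mat_holomorphic_on_def by (simp only:)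
 qed
qed

lemma taylor_part_growth:
 assumes "0 < s" "norm X <= s * \<rho>"
 shows "cmod (taylor_part k f X) <= s ^ k * B"
proof -
 have X: "X = mat (of_real s) ** (mat (of_real (1 / s)) ** X)"
  unfolding scalar_mat_mult of_real_mult[symmetric] using assms by simp
 have "norm (mat (complex_of_real (1 / s)) ** X) = norm X / s"
  unfolding norm_scalar_mat norm_of_real using assms(1) by simp
 also have "... <= \<rho>" using assms by (simp add: divide_le_eq mult.commute)
 finally have "cmod (taylor_part k f (mat (of_real (1 / s)) ** X)) <= B" by (rule taylor_part_bound)
 moreover have "taylor_part k f X = of_real s ^ k * taylor_part k f (mat (of_real (1 / s)) ** X)"
  by (subst X) (rule taylor_part_scalar)
 ultimately show ?thesis using assms(1) by (simp add: norm_mult norm_power)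
qed

end

text \<open>Homogeneity bounds the growth, so Liouville's theorem applies to every entry.\<close>

theorem taylor_part_polynomial: "polynomial_fun (taylor_part k f)"
proof (induction k rule: less_induct)
 case (less k)
 obtain \<rho> B where \<rho>: "0 < \<rho>" "cball 0 \<rho> <= (cartan_domain :: 'n cmat set)"
  and B: "0 <= B" "ALL Z:cball 0 \<rho>. cmod (f Z) <= B"
  using bounded_near_zero by blast
 note hol_k = taylor_part_holomorphic[OF \<rho> B, of k]
 have h: "mat_holomorphic_on (taylor_part k f) UNIV" using hol_k less.IH by blast
 show ?case
 proof (rule polynomial_fun_if_entrywise[of k])
  fix Z :: "'n cmat" and i j
  define E :: "'n cmat" where "E = set_entry i j 1 0"
  define Z' where "Z' = set_entry i j 0 Z"
  have line: "set_entry i j t Z = Z' + mat t ** E" for t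
   unfolding matrix_mult_scalar by (simp add: cvec_eq_iff Z'_def E_def set_entry_def)
  have "(%t. taylor_part k f (Z' + mat t ** E)) holomorphic_on UNIV"
   by (rule mat_holomorphic_line[OF h]) simp
  moreover define K where "K = (norm E + 1) / \<rho>"
  have K: "0 < K" using \<rho>(1) by (simp add: K_def add_nonneg_pos)
  have "cmod (taylor_part k f (Z' + mat t ** E)) <= (K ^ k * B) * cmod t ^ k" if t: "norm Z' + 1 <= cmod t" for t
  proof -
   have t0: "0 < cmod t" using t norm_ge_zero[of Z'] by linarith
   have "norm (Z' + mat t ** E) <= norm Z' + cmod t * norm E"
    using norm_triangle_ineq[of Z' "mat t ** E"] by (simp add: norm_scalar_mat)
   also have "... <= cmod t + cmod t * norm E" using t by simp
   also have "... = (K * cmod t) * \<rho>" using \<rho>(1) by (simp add: K_def field_simps)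
   finally have "cmod (taylor_part k f (Z' + mat t ** E)) <= (K * cmod t) ^ k * B"
    using K t0 by (intro taylor_part_growth[OF \<rho> B]) auto
   then show ?thesis by (simp add: power_mult_distrib mult_ac)
  qed
  ultimately have L: "taylor_part k f (Z' + mat t ** E) =
    (\<Sum>m\<le>k. (deriv ^^ m) (%t. taylor_part k f (Z' + mat t ** E)) 0 / fact m * t ^ m)" for t
   by (rule Liouville_polynomial)
  let ?q = "\<Sum>m\<le>k. Polynomial.monom ((deriv ^^ m) (%t. taylor_part k f (Z' + mat t ** E)) 0 / fact m) m"
  have "Polynomial.degree ?q <= k"
   by (rule degree_sum_le) (auto intro: order_trans[OF degree_monom_le])
  moreover have "taylor_part k f (set_entry i j t Z) = poly ?q t" for t
   unfolding line poly_sum poly_monom by (rule L)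
  ultimately show "EX q. Polynomial.degree q <= k & (ALL t. taylor_part k f (set_entry i j t Z) = poly q t)"
   by blast
 qed
qed

lemma disc_in_cartan_domain: "Z : cartan_domain ==> cmod t <= 1 ==> mat t ** (Z :: 'n cmat) : cartan_domain"
 by (rule cartan_domain_balanced)

lemma zero_if_taylor_parts_zero:
 assumes zero: "ALL k. ALL Z:cartan_domain. taylor_part k f Z = 0" and Z: "Z : cartan_domain"
 shows "f Z = 0"
proof -
 let ?T = "{t. mat t ** Z : cartan_domain}"
 have "(1 :: complex) : ?T" using Z by simp
 then obtain e where e: "0 < e" "ball 1 e <= ?T" using open_disc[of Z] open_contains_ball by blast
 define t where "t = complex_of_real (1 + e / 2)"
 have tn: "cmod t = 1 + e / 2" unfolding t_def norm_of_real using e by simp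
 have "t : ball 1 e"
 proof -
  have "dist 1 t = cmod (complex_of_real (e / 2))" unfolding dist_norm t_def norm_minus_commute[of 1] by simp
  also have "... = e / 2" unfolding norm_of_real using e by simp
  finally show ?thesis using e by simp
 qed
 then have W: "mat t ** Z : cartan_domain" using e by blast
 have t0: "t ~= 0" using tn e(1) by auto
 have "(%u. f (mat u ** (mat t ** Z))) holomorphic_on ball 0 1"
  by (rule disc_holomorphic) (use disc_in_cartan_domain[OF W] in auto)
 moreover have "1 / t : ball 0 1" using tn e by (simp add: norm_divide)
 ultimately have "(%n. (deriv ^^ n) (%u. f (mat u ** (mat t ** Z))) 0 / fact n * (1 / t - 0) ^ n) sums f (mat (1 / t) ** (mat t ** Z))"
  by (rule holomorphic_power_series)
 moreover have "(deriv ^^ n) (%u. f (mat u ** (mat t ** Z))) 0 / fact n = 0" for n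
  using zero W unfolding taylor_part_def by blast
 ultimately have "f (mat (1 / t) ** (mat t ** Z)) = 0" by (simp add: sums_iff)
 then show ?thesis using t0 by (simp add: scalar_mat_mult)
qed

end

section \<open>Averages over rotations\<close>

definition turn :: "real => complex" where
 "turn \<theta> = exp (2 * of_real pi * \<i> * of_real \<theta>)"

lemma cmod_turn [simp]: "cmod (turn \<theta>) = 1"
 by (simp add: turn_def norm_exp_eq_Re)

lemma continuous_on_turn: "continuous_on S turn"
 unfolding turn_def[abs_def] by (intro continuous_intros)

lemma turn_cnj: "turn \<theta> * cnj (turn \<theta>) = 1"
 by (simp add: complex_norm_square[symmetric])

lemma turn_nonzero [simp]: "turn \<theta> ~= 0"
 by (simp add: turn_def)

lemma Taylor_coefficient_circle_average:
 assumes "continuous_on (cball 0 1) g" "g holomorphic_on ball 0 1"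
 shows "((%\<theta>. g (turn \<theta>) * cnj (turn \<theta>) ^ k) has_integral (deriv ^^ k) g 0 / fact k) {0..1}"
proof -
 have "((%u. g u / (u - 0) ^ Suc k) has_contour_integral ((2 * pi * \<i>) / fact k * (deriv ^^ k) g 0)) (circlepath 0 1)"
  by (rule Cauchy_has_contour_integral_higher_derivative_circlepath[OF assms]) simp
 then have "((%x. g (circlepath 0 1 x) / (circlepath 0 1 x - 0) ^ Suc k * vector_derivative (circlepath 0 1) (at x within {0..1}))
  has_integral ((2 * pi * \<i>) / fact k * (deriv ^^ k) g 0)) {0..1}"
  unfolding has_contour_integral_def .
 from has_integral_mult_right[OF this, of "1 / (2 * pi * \<i>)"]
 have "((%x. 1 / (2 * pi * \<i>) * (g (circlepath 0 1 x) / (circlepath 0 1 x - 0) ^ Suc k * vector_derivative (circlepath 0 1) (at x within {0..1})))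
  has_integral (deriv ^^ k) g 0 / fact k) {0..1}"
  by simp
 then show ?thesis
 proof (rule has_integral_eq[rotated])
  fix x :: real assume x: "x : {0..1}"
  have "vector_derivative (circlepath 0 1) (at x within {0..1}) = 2 * pi * \<i> * turn x"
   using x by (simp add: vector_derivative_circlepath01 turn_def)
  moreover have "circlepath 0 1 x = turn x" by (simp add: circlepath turn_def)
  moreover have "cnj (turn x) = 1 / turn x" using turn_cnj[of x] by (simp add: field_simps)
  ultimately show "1 / (2 * pi * \<i>) * (g (circlepath 0 1 x) / (circlepath 0 1 x - 0) ^ Suc k * vector_derivative (circlepath 0 1) (at x within {0..1}))
   = g (turn x) * cnj (turn x) ^ k" by (simp add: power_one_over)
 qed
qed

definition circle :: "real measure" where
 "circle = restrict_space lborel {0..1}"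

lemma circle_integral:
 fixes F :: "real => complex"
 assumes "continuous_on {0..1} F" "(F has_integral I) {0..1}"
 shows "integral\<^sup>L circle F = I"
proof -
 have "set_integrable lborel {0..1} F" using assms(1) by (rule borel_integrable_atLeastAtMost')
 from set_borel_integral_eq_integral(2)[OF this] assms(2)
 have "(LINT x|lborel. indicator {0..1} x *\<^sub>R F x) = I"
  by (simp add: set_lebesgue_integral_def integral_unique)
 then show ?thesis unfolding circle_def by (subst integral_restrict_space) auto
qed

lemma emeasure_circle: "emeasure circle (space circle) = 1"
 unfolding circle_def by (subst emeasure_restrict_space) (auto simp: space_restrict_space)

lemma finite_measure_circle: "finite_measure circle"
 by (rule finite_measureI) (simp add: emeasure_circle)

text \<open>Rotating the integrand and averaging over the rotations extracts a Fourier coefficient.\<close>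

lemma rotation_average:
 fixes f h :: "('n::finite) cmat => complex"
 assumes fin: "finite_measure M" and id: "(%Z. Z) : measurable M borel"
  and f: "f : borel_measurable borel" and h: "h : borel_measurable M"
  and int: "integrable M (%Z. f Z * cnj (h Z))"
  and rot: "ALL \<theta>. (%Z. mat (turn \<theta>) ** Z) : measurable M M" "ALL \<theta>. distr M M (%Z. mat (turn \<theta>) ** Z) = M"
  and hom: "ALL \<theta>. ALL Z:space M. h (mat (turn \<theta>) ** Z) = turn \<theta> ^ k * h Z"
  and avg: "ALL Z:space M. (LINT \<theta>|circle. f (mat (turn \<theta>) ** Z) * cnj (turn \<theta>) ^ k) = F Z"
 shows "(LINT Z|M. f Z * cnj (h Z)) = (LINT Z|M. F Z * cnj (h Z))"
proof -
 interpret M: finite_measure M by (rule fin)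
 interpret U: finite_measure circle by (rule finite_measure_circle)
 interpret pair_sigma_finite circle M ..
 define G where "G \<theta> Z = f (mat (turn \<theta>) ** Z) * cnj (turn \<theta>) ^ k * cnj (h Z)" for \<theta> Z
 have G_eq: "G \<theta> Z = f (mat (turn \<theta>) ** Z) * cnj (h (mat (turn \<theta>) ** Z))" if "Z : space M" for \<theta> Z
  using hom that by (simp add: G_def)
 have cnj_m: "cnj : borel_measurable borel" by (intro borel_measurable_continuous_onI continuous_intros)
 have fM: "f : borel_measurable M" using measurable_compose[OF id f] .
 have prod_m: "(%Z. f Z * cnj (h Z)) : borel_measurable M"
  by (intro borel_measurable_times fM measurable_compose[OF h cnj_m])
 have Gint: "integrable M (G \<theta>)" for \<theta>
 proof -
  have "integrable (distr M M (%Z. mat (turn \<theta>) ** Z)) (%Z. f Z * cnj (h Z))" using rot(2) int by simp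
  then have "integrable M (%Z. f (mat (turn \<theta>) ** Z) * cnj (h (mat (turn \<theta>) ** Z)))"
   using integrable_distr_eq[OF spec[OF rot(1)] prod_m] by simp
  then show ?thesis by (rule Bochner_Integration.integrable_cong[THEN iffD2, rotated 2]) (simp_all add: G_eq)
 qed
 have GI: "(LINT Z|M. G \<theta> Z) = (LINT Z|M. f Z * cnj (h Z))" for \<theta>
 proof -
  have "(LINT Z|M. f Z * cnj (h Z)) = (LINT Z|distr M M (%Z. mat (turn \<theta>) ** Z). f Z * cnj (h Z))" using rot(2) by simp
  also have "... = (LINT Z|M. f (mat (turn \<theta>) ** Z) * cnj (h (mat (turn \<theta>) ** Z)))"
   by (rule integral_distr[OF spec[OF rot(1)] prod_m])
  also have "... = (LINT Z|M. G \<theta> Z)" by (rule Bochner_Integration.integral_cong) (simp_all add: G_eq)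
  finally show ?thesis by simp
 qed
 have GN: "(LINT Z|M. norm (G \<theta> Z)) = (LINT Z|M. norm (f Z * cnj (h Z)))" for \<theta>
 proof -
  have "(LINT Z|M. norm (f Z * cnj (h Z))) = (LINT Z|distr M M (%Z. mat (turn \<theta>) ** Z). norm (f Z * cnj (h Z)))" using rot(2) by simp
  also have "... = (LINT Z|M. norm (f (mat (turn \<theta>) ** Z) * cnj (h (mat (turn \<theta>) ** Z))))"
   by (rule integral_distr[OF spec[OF rot(1)] measurable_compose[OF prod_m borel_measurable_norm]])
  also have "... = (LINT Z|M. norm (G \<theta> Z))" by (rule Bochner_Integration.integral_cong) (simp_all add: G_eq)
  finally show ?thesis by simp
 qed
 have turn_m: "(%p. turn (fst p)) : borel_measurable (circle \<Otimes>\<^sub>M M)"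
 proof -
  have "turn : borel_measurable circle"
   unfolding circle_def by (intro measurable_restrict_space1) (simp add: borel_measurable_continuous_onI continuous_on_turn)
  from measurable_compose[OF measurable_fst this] show ?thesis .
 qed
 have snd_m: "(%p. snd p) : measurable (circle \<Otimes>\<^sub>M M) borel"
  using measurable_compose[OF measurable_snd id] .
 have arg_m: "(%p. mat (turn (fst p)) ** snd p) : borel_measurable (circle \<Otimes>\<^sub>M M)"
 proof (rule borel_measurable_continuous_Pair[OF turn_m snd_m])
  show "continuous_on UNIV (%x :: complex \<times> 'n cmat. mat (fst x) ** snd x)"
   unfolding matrix_mult_scalar by (intro continuous_intros)
 qed
 have Gm: "case_prod G : borel_measurable (circle \<Otimes>\<^sub>M M)"
 proof -
  have "(%p. f (mat (turn (fst p)) ** snd p) * cnj (turn (fst p)) ^ k * cnj (h (snd p))) : borel_measurable (circle \<Otimes>\<^sub>M M)"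
   by (intro borel_measurable_times borel_measurable_power measurable_compose[OF arg_m f]
     measurable_compose[OF turn_m cnj_m] measurable_compose[OF measurable_compose[OF measurable_snd h] cnj_m])
  then show ?thesis by (simp add: G_def case_prod_beta')
 qed
 have Gpair: "integrable (circle \<Otimes>\<^sub>M M) (case_prod G)"
  by (rule Fubini_integrable[OF Gm]) (simp_all add: GN Gint)
 have "(LINT Z|M. F Z * cnj (h Z)) = (LINT Z|M. LINT \<theta>|circle. G \<theta> Z)"
 proof (rule Bochner_Integration.integral_cong[OF refl])
  fix Z assume "Z : space M"
  then have "(LINT \<theta>|circle. f (mat (turn \<theta>) ** Z) * cnj (turn \<theta>) ^ k) = F Z" using avg by blast
  then show "F Z * cnj (h Z) = (LINT \<theta>|circle. G \<theta> Z)" unfolding G_def by simp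
 qed
 also have "... = (LINT \<theta>|circle. LINT Z|M. G \<theta> Z)" by (rule Fubini_integral[OF Gpair])
 also have "... = (LINT Z|M. f Z * cnj (h Z))"
  using emeasure_circle by (simp add: GI measure_def)
 finally show ?thesis by simp
qed

section \<open>Completeness of the Bergman space\<close>

lemma distr_ball_isometry:
 fixes T :: "('n::finite) cmat => 'n cmat" and r :: real
 assumes lin: "linear T" and iso: "!!Z. norm (T Z) = norm Z"
 defines "M \<equiv> restrict_space lborel (ball 0 r)"
 shows "T : measurable M M" "distr M M T = M"
proof -
 have T: "T : borel_measurable borel"
  using lin by (intro borel_measurable_continuous_onI linear_continuous_on linear_conv_bounded_linear[THEN iffD1])
 have Tl: "T : measurable lborel lborel" using T by simp
 show TM: "T : measurable M M"
  unfolding M_def by (rule measurable_restrict_space3[OF Tl]) (use iso in auto)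
 show "distr M M T = M"
 proof (rule measure_eqI)
  fix A assume "A : sets (distr M M T)"
  then have A: "A : sets M" by simp
  then have Ab: "A : sets lborel" and AD: "A <= ball 0 r"
   unfolding M_def by (auto simp: sets_restrict_space)
  have eq: "T -` A \<inter> space M = T -` A"
   unfolding M_def space_restrict_space using AD iso by force
  have TA: "T -` A : sets lborel" using measurable_sets[OF Tl Ab] by simp
  have em: "emeasure M C = emeasure lborel C" if "C : sets lborel" "C <= ball 0 r" for C
   unfolding M_def using that by (intro emeasure_restrict_space) auto
  have "emeasure (distr M M T) A = emeasure M (T -` A)" using emeasure_distr[OF TM A] eq by simp
  also have "... = emeasure lborel (T -` A)" by (rule em[OF TA]) (use AD iso in force)
  also have "... = emeasure (distr lborel borel T) A"
   using emeasure_distr[of T lborel borel A] T Ab by simp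
  also have "... = emeasure M A" by (simp add: lborel_isometry_invariant[OF lin iso] em[OF Ab AD])
  finally show "emeasure (distr M M T) A = emeasure M A" .
 qed simp
qed

context weighted_bergman begin

abbreviation "\<A> \<equiv> bergman_space lam :: ('n cmat => complex) set"

lemma L2_eqs: "L2_fun lam = sq_int \<B>" "L2_inner lam f g = ip \<B> f g" "L2_nrm lam f = nrm \<B> f"
 by (simp_all add: L2_fun_def sq_int_def L2_inner_def ip_def L2_nrm_def nrm_def)

lemma bergmanI:
 assumes "f : sq_int \<B>" "mat_holomorphic_on f cartan_domain" "!!Z. Z \<notin> cartan_domain ==> f Z = 0"
 shows "f : \<A>"
 using assms by (simp add: bergman_space_def L2_eqs)

lemma bergmanD:
 assumes "f : \<A>"
 shows "f : sq_int \<B>" "mat_holomorphic_on f cartan_domain" "Z \<notin> cartan_domain ==> f Z = 0"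
 using assms by (simp_all add: bergman_space_def L2_eqs)

lemma fun_subspace_bergman: "fun_subspace \<A>"
 unfolding fun_subspace_def
proof (intro conjI ballI allI)
 show "(%_. 0) : \<A>" by (rule bergmanI) (simp_all add: sq_int_zero mat_holomorphic_const)
 show "(%x. f x + g x) : \<A>" if "f : \<A>" "g : \<A>" for f g
  using that by (intro bergmanI sq_int_add mat_holomorphic_add) (simp_all add: bergmanD)
 show "(%x. c * f x) : \<A>" if "f : \<A>" for c f
  using that by (intro bergmanI sq_int_scale mat_holomorphic_cmult) (simp_all add: bergmanD)
qed

lemma bergman_sub: "\<A> <= sq_int \<B>" using bergmanD by blast

lemma bergman_diff: "f : \<A> ==> g : \<A> ==> (%x. f x - g x) : \<A>"
 using fun_subspaceD(2)[OF fun_subspace_bergman, of f "%x. (-1) * g x"]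
  fun_subspaceD(3)[OF fun_subspace_bergman, of g "-1"] by simp

lemma bergman_borel: assumes "f : \<A>" shows "f : borel_measurable borel"
proof -
 have "f : borel_measurable (restrict_space borel cartan_domain)"
  using sq_int_measurable[OF bergmanD(1)[OF assms]] unfolding measurable_bergman_iff .
 then have "(%x. indicator cartan_domain x *\<^sub>R f x) : borel_measurable borel"
  by (subst (asm) borel_measurable_restrict_space_iff) (auto simp: open_cartan_domain)
 moreover have "(%x. indicator cartan_domain x *\<^sub>R f x) = f"
  using bergmanD(3)[OF assms] by (auto simp: fun_eq_iff split: split_indicator)
 ultimately show ?thesis by simp
qed

lemma one_sq_int: "(%_. 1) : sq_int \<B>"
 using finite_measure.integrable_const[OF finite_measure_bergman, of "1 :: real"] by (simp add: sq_int_def)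

lemma sq_int_integrable:
 assumes "f : sq_int \<B>"
 shows "integrable \<B> (%Z. cmod (f Z))" "(LINT Z|\<B>. cmod (f Z)) <= nrm \<B> f * nrm \<B> (%_. 1)"
proof -
 show int: "integrable \<B> (%Z. cmod (f Z))"
  using sq_int_product_integrable[OF assms one_sq_int] by (auto dest: integrable_norm)
 have af: "(%Z. complex_of_real (cmod (f Z))) : sq_int \<B>"
  using assms by (auto simp: sq_int_def)
 have "ip \<B> (%Z. complex_of_real (cmod (f Z))) (%_. 1) = of_real (LINT Z|\<B>. cmod (f Z))"
  by (simp add: ip_def)
 moreover have "nrm \<B> (%Z. complex_of_real (cmod (f Z))) = nrm \<B> f" by (simp add: nrm_def)
 ultimately show "(LINT Z|\<B>. cmod (f Z)) <= nrm \<B> f * nrm \<B> (%_. 1)"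
  using ip_Cauchy_Schwarz[OF af one_sq_int] by simp
qed

lemma continuous_on_dens: "continuous_on cartan_domain dens"
proof -
 have "continuous_on cartan_domain (%Z :: 'n cmat. Re (det (mat 1 - Z ** conj_transpose Z)))"
  by (intro continuous_intros)
 moreover have "Re (det (mat 1 - Z ** conj_transpose Z)) ~= 0" if "Z : cartan_domain" for Z :: "'n cmat"
  using weight_density_pos[OF that] by (auto simp: weight_density_def)
 ultimately show ?thesis
  unfolding dens_def[abs_def] weight_density_def[abs_def] by (intro continuous_intros) auto
qed

text \<open>
  Averaging over the rotations of the ball about its centre turns the integral into Cauchy's formula on discs.
\<close>

lemma ball_average:
 assumes f: "f : \<A>" and r: "0 < r" "cball Z r <= cartan_domain"
 shows "(LINT W|restrict_space lborel (ball 0 r). f (Z + W)) = f Z * measure lborel (ball (0 :: 'n cmat) r)"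
proof -
 let ?M = "restrict_space lborel (ball (0 :: 'n cmat) r)"
 have spM: "space ?M = ball 0 r" by (simp add: space_restrict_space)
 have fb: "(%W. f (Z + W)) : borel_measurable borel"
  using measurable_compose[OF _ bergman_borel[OF f], of "%W. Z + W" borel] by simp
 have id: "(%W. W) : measurable ?M borel" by (intro measurable_restrict_space1) simp
 have emM: "emeasure ?M (ball 0 r) = emeasure lborel (ball (0 :: 'n cmat) r)"
  by (rule emeasure_restrict_space) auto
 have "emeasure ?M (space ?M) < \<infinity>" unfolding spM emM by (rule emeasure_lborel_ball_finite)
 then have fin: "finite_measure ?M" by (intro finite_measureI less_imp_neq)
 have disc: "Z + mat t ** W : cball Z r" if "W : ball 0 r" "cmod t <= 1" for W t
  using that mult_mono[of "cmod t" 1 "norm W" r] r(1) by (simp add: dist_norm norm_scalar_mat)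
 have "continuous_on (cball Z r) f"
  using mat_holomorphic_continuous[OF bergmanD(2)[OF f]] r(2) by (rule continuous_on_subset)
 then have "bounded (f ` cball Z r)" by (intro compact_imp_bounded compact_continuous_image) auto
 then obtain B where "ALL x:f ` cball Z r. cmod x <= B" unfolding bounded_iff by blast
 then have B: "ALL X:cball Z r. cmod (f X) <= B" by blast
 have inc: "Z + W : cball Z r" if "W : ball 0 r" for W using that by (simp add: dist_norm)
 have avg: "(LINT \<theta>|circle. f (Z + mat (turn \<theta>) ** W) * cnj (turn \<theta>) ^ 0) = f Z" if W: "W : ball 0 r" for W
 proof -
  let ?g = "%t. f (Z + mat t ** W)"
  have h: "?g holomorphic_on cball 0 1"
   by (rule mat_holomorphic_line[OF bergmanD(2)[OF f]]) (use disc[OF W] r(2) in auto)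
  have c: "continuous_on (cball 0 1) ?g" using h by (rule holomorphic_on_imp_continuous_on)
  have "?g holomorphic_on ball 0 1" using h by (rule holomorphic_on_subset) auto
  from Taylor_coefficient_circle_average[OF c this, of 0]
  have "((%\<theta>. ?g (turn \<theta>) * cnj (turn \<theta>) ^ 0) has_integral f Z) {0..1}" by simp
  moreover have "continuous_on {0..1} (%\<theta>. ?g (turn \<theta>) * cnj (turn \<theta>) ^ 0)"
   using continuous_on_compose2[OF c continuous_on_turn, of "{0..1}"] by (simp add: image_subset_iff)
  ultimately show ?thesis by (rule circle_integral[rotated])
 qed
 have "(LINT W|?M. f (Z + W) * cnj ((%_. 1) W)) = (LINT W|?M. (%_. f Z) W * cnj ((%_. 1) W))"
 proof (rule rotation_average[OF fin id fb, where k=0])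
  show "integrable ?M (%W. f (Z + W) * cnj ((%_. 1) W))"
  proof (rule finite_measure.integrable_const_bound[OF fin, where B=B])
   show "AE W in ?M. cmod (f (Z + W) * cnj ((%_. 1) W)) <= B"
    by (rule AE_I2) (use B inc in \<open>simp add: spM\<close>)
   show "(%W. f (Z + W) * cnj ((%_. 1) W)) : borel_measurable ?M"
    using measurable_compose[OF id fb] by simp
  qed
  show "ALL \<theta>. (%W. mat (turn \<theta>) ** W) : measurable ?M ?M" "ALL \<theta>. distr ?M ?M (%W. mat (turn \<theta>) ** W) = ?M"
   by (intro allI distr_ball_isometry; simp add: bounded_linear.linear[OF bounded_linear_scalar_mat] norm_scalar_mat)+
  show "ALL W:space ?M. (LINT \<theta>|circle. f (Z + mat (turn \<theta>) ** W) * cnj (turn \<theta>) ^ 0) = f Z"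
   using avg by (simp add: spM)
 qed simp_all
 moreover have "measure ?M (space ?M) = measure lborel (ball (0 :: 'n cmat) r)"
  unfolding spM measure_def emM ..
 ultimately show ?thesis by (simp add: mult.commute scaleR_conv_of_real)
qed

text \<open>
  The mean value property on a ball of fixed radius, where the density is bounded below.
\<close>

lemma point_evaluation_bound:
 assumes Z0: "Z0 : cartan_domain"
 shows "EX r>0. EX C>=0. cball Z0 r <= cartan_domain & (ALL f:\<A>. ALL Z:cball Z0 r. cmod (f Z) <= C * nrm \<B> f)"
proof -
 obtain R where R: "0 < R" "cball Z0 R <= (cartan_domain :: 'n cmat set)"
  using open_cartan_domain Z0 open_contains_cball by blast
 define r where "r = R / 2"
 have r: "0 < r" using R by (simp add: r_def)
 have cb: "cball Z r <= cball Z0 R" if "Z : cball Z0 r" for Z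
 proof
  fix Y assume "Y : cball Z r"
  then show "Y : cball Z0 R" using that dist_triangle[of Z0 Y Z] by (simp add: r_def)
 qed
 obtain Zm where Zm: "Zm : cball Z0 R" "ALL Y:cball Z0 R. dens Zm <= dens Y"
  using continuous_attains_inf[of "cball Z0 R" dens] continuous_on_subset[OF continuous_on_dens R(2)] R(1) by auto
 define m where "m = dens Zm"
 have m: "0 < m" unfolding m_def using Zm(1) R(2) by (intro dens_pos) auto
 define V where "V = measure lborel (ball (0 :: 'n cmat) r)"
 have V: "0 < V" unfolding V_def by (rule content_ball_pos[OF r])
 have main: "cmod (f Z) * V <= nrm \<B> f * nrm \<B> (%_. 1) / m" if f: "f : \<A>" and Z: "Z : cball Z0 r" for f Z
 proof -
  let ?M = "restrict_space lborel (ball (0 :: 'n cmat) r)"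
  have fb [measurable]: "f : borel_measurable borel" by (rule bergman_borel[OF f])
  have ball_m [measurable]: "ball Z r : sets borel" by simp
  have nf [measurable]: "(%Z. ennreal (cmod (f Z))) : borel_measurable borel" using fb by measurable
  have ZD: "cball Z r <= cartan_domain" using cb[OF Z] R(2) by blast
  have "ennreal (cmod (f Z) * V) = ennreal (cmod (LINT W|?M. f (Z + W)))"
   using ball_average[OF f r ZD] V by (simp add: norm_mult V_def)
  also have "... <= (\<integral>\<^sup>+W. ennreal (cmod (f (Z + W))) \<partial>?M)"
  proof (cases "integrable ?M (%W. f (Z + W))")
   case True then show ?thesis by (rule integral_norm_bound_ennreal)
  next
   case False then show ?thesis by (simp add: not_integrable_integral_eq)
  qed
  also have "... = (\<integral>\<^sup>+W. ennreal (cmod (f (Z + W))) * indicator (ball 0 r) W \<partial>lborel)"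
   by (rule nn_integral_restrict_space) simp
  also have "... = (\<integral>\<^sup>+W. ennreal (cmod (f (Z + W))) * indicator (ball Z r) (Z + W) \<partial>lborel)"
   by (intro nn_integral_cong) (simp add: indicator_def dist_norm)
  also have "... = (\<integral>\<^sup>+X. ennreal (cmod (f X)) * indicator (ball Z r) X \<partial>distr lborel borel ((+) Z))"
  proof (rule nn_integral_distr[symmetric])
   have "(%X. ennreal (cmod (f X)) * indicator (ball Z r) X) : borel_measurable borel" by measurable
   then show "(%X. ennreal (cmod (f X)) * indicator (ball Z r) X) : borel_measurable (distr lborel borel ((+) Z))"
    by simp
  qed measurable
  also have "... = (\<integral>\<^sup>+X. ennreal (cmod (f X)) * indicator (ball Z r) X \<partial>lborel)"
   by (simp add: lborel_distr_plus)
  also have "... <= (\<integral>\<^sup>+X. ennreal (1 / m) * (ennreal (dens X) * ennreal (cmod (f X)) * indicator cartan_domain X) \<partial>lborel)"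
  proof (rule nn_integral_mono)
   fix X
   show "ennreal (cmod (f X)) * indicator (ball Z r) X <= ennreal (1 / m) * (ennreal (dens X) * ennreal (cmod (f X)) * indicator cartan_domain X)"
   proof (cases "X : ball Z r")
    case True
    then have X: "X : cball Z0 R" by (intro subsetD[OF cb[OF Z]]) simp
    then have XD: "X : cartan_domain" using R(2) by blast
    have "m <= dens X" unfolding m_def using Zm(2) X by blast
    then have "cmod (f X) <= 1 / m * (dens X * cmod (f X))"
     using m mult_right_mono[of m "dens X" "cmod (f X)"] by (simp add: field_simps)
    then show ?thesis using True XD m dens_pos[OF XD]
     by (simp add: ennreal_mult'[symmetric] ennreal_leI)
   qed simp
  qed
  also have "... = ennreal (1 / m) * (\<integral>\<^sup>+X. ennreal (dens X) * ennreal (cmod (f X)) * indicator cartan_domain X \<partial>lborel)"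
   by (rule nn_integral_cmult) measurable
  also have "(\<integral>\<^sup>+X. ennreal (dens X) * ennreal (cmod (f X)) * indicator cartan_domain X \<partial>lborel) = (\<integral>\<^sup>+X. ennreal (cmod (f X)) \<partial>\<B>)"
   by (rule nn_integral_bergman[symmetric]) (rule measurable_bergman[OF nf])
  also have "... = ennreal (LINT X|\<B>. cmod (f X))"
   by (rule nn_integral_eq_integral[OF sq_int_integrable(1)[OF bergmanD(1)[OF f]]]) simp
  also have "ennreal (1 / m) * ennreal (LINT X|\<B>. cmod (f X)) = ennreal (1 / m * (LINT X|\<B>. cmod (f X)))"
   by (rule ennreal_mult'[symmetric]) (use m in simp)
  finally have "cmod (f Z) * V <= 1 / m * (LINT X|\<B>. cmod (f X))"
   using m by (subst (asm) ennreal_le_iff) auto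
  also have "... <= 1 / m * (nrm \<B> f * nrm \<B> (%_. 1))"
   using m by (intro mult_left_mono sq_int_integrable(2)[OF bergmanD(1)[OF f]]) auto
  finally show ?thesis by simp
 qed
 have "cmod (f Z) <= (nrm \<B> (%_. 1) / m / V) * nrm \<B> f" if "f : \<A>" "Z : cball Z0 r" for f Z
 proof -
  have "cmod (f Z) <= nrm \<B> f * nrm \<B> (%_. 1) / m / V"
   unfolding pos_le_divide_eq[OF V] by (rule main[OF that])
  then show ?thesis by (simp add: mult.commute)
 qed
 note bound = this
 have "cball Z0 r <= cartan_domain" using subset_cball[of r R Z0] R by (simp add: r_def)
 moreover have "0 <= nrm \<B> (%_. 1) / m / V" using m V by (simp add: nrm_nonneg)
 ultimately show ?thesis
  by (intro exI[of _ r] exI[of _ "nrm \<B> (%_. 1) / m / V"] conjI ballI bound r)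
qed

lemma nrm_zero_imp_zero:
 assumes f: "f : \<A>" and 0: "nrm \<B> f = 0"
 shows "f = (%_. 0)"
proof
 fix Z
 show "f Z = 0"
 proof (cases "Z : cartan_domain")
  case True
  from point_evaluation_bound[OF this] obtain r C where r: "0 < r"
   and C: "ALL f:\<A>. ALL X:cball Z r. cmod (f X) <= C * nrm \<B> f" by blast
  then have "cmod (f Z) <= C * nrm \<B> f" using r by (intro C[rule_format, OF f]) simp
  then show ?thesis using 0 by simp
 qed (rule bergmanD(3)[OF f])
qed

text \<open>
  Point evaluation bounds make the sequence converge locally uniformly, hence to a holomorphic
  function; Fatou's lemma gives convergence in norm.
\<close>

theorem bergman_complete:
 assumes g: "!!n. g n : \<A>"
  and cauchy: "ALL e>0. EX K. ALL m>=K. ALL n>=K. nrm \<B> (%x. g m x - g n x) < e"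
 shows "EX l:\<A>. (%n. nrm \<B> (%x. g n x - l x)) \<longlonglongrightarrow> 0"
proof -
 have gd: "(%x. g m x - g n x) : \<A>" for m n by (rule bergman_diff[OF g g])
 have unif: "EX r>0. cball Z r <= cartan_domain \<and>
   (ALL e>0. EX K. ALL m>=K. ALL n>=K. ALL X:cball Z r. cmod (g m X - g n X) <= e)" if Z: "Z : cartan_domain" for Z
 proof -
  from point_evaluation_bound[OF Z] obtain r C where r: "0 < r" "0 <= C" "cball Z r <= cartan_domain"
   and C: "ALL f:\<A>. ALL X:cball Z r. cmod (f X) <= C * nrm \<B> f" by blast
  have "EX K. ALL m>=K. ALL n>=K. ALL X:cball Z r. cmod (g m X - g n X) <= e" if e: "0 < e" for e
  proof -
   have "0 < e / (C + 1)" using e r by simp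
   with cauchy obtain K where K: "ALL m>=K. ALL n>=K. nrm \<B> (%x. g m x - g n x) < e / (C + 1)" by blast
   have "cmod (g m X - g n X) <= e" if "K <= m" "K <= n" "X : cball Z r" for m n X
   proof -
    have "cmod (g m X - g n X) <= C * nrm \<B> (%x. g m x - g n x)" by (rule C[rule_format, OF gd that(3)])
    also have "... <= C * (e / (C + 1))"
     using K that r(2) by (intro mult_left_mono) (auto intro: less_imp_le)
    also have "... <= e" using e r(2) by (simp add: divide_le_eq)
    finally show ?thesis .
   qed
   then show ?thesis by blast
  qed
  then show ?thesis using r by blast
 qed
 define l where "l X = lim (%n. g n X)" for X
 have l0: "l X = 0" if "X \<notin> cartan_domain" for X
  unfolding l_def using bergmanD(3)[OF g that] by (simp add: limI)
 have lim: "(%n. g n X) \<longlonglongrightarrow> l X" if X: "X : cartan_domain" for X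
 proof -
  from unif[OF X] obtain r where r: "0 < r"
   "ALL e>0. EX K. ALL m>=K. ALL n>=K. ALL Y:cball X r. cmod (g m Y - g n Y) <= e" by blast
  have "Cauchy (%n. g n X)"
  proof (rule CauchyI)
   fix e :: real assume "0 < e"
   then have "0 < e / 2" by simp
   with r(2) obtain K where K: "ALL m>=K. ALL n>=K. ALL Y:cball X r. cmod (g m Y - g n Y) <= e / 2" by blast
   have "X : cball X r" using r(1) by simp
   then have "cmod (g m X - g n X) < e" if "K <= m" "K <= n" for m n
    using K that \<open>0 < e\<close> by fastforce
   then show "EX K. ALL m>=K. ALL n>=K. norm (g m X - g n X) < e" by blast
  qed
  then show ?thesis unfolding l_def using Cauchy_convergent_iff convergent_LIMSEQ_iff by blast
 qed
 have l_hol: "mat_holomorphic_on l cartan_domain"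
 proof (rule mat_holomorphic_limit[of g])
  show "ALL n. mat_holomorphic_on (g n) cartan_domain" using bergmanD(2)[OF g] by blast
  fix Z :: "'n cmat" assume "Z : cartan_domain"
  from unif[OF this] obtain r where r: "0 < r" "cball Z r <= cartan_domain"
   and u: "ALL e>0. EX K. ALL m>=K. ALL n>=K. ALL X:cball Z r. cmod (g m X - g n X) <= e" by blast
  have "EX K. ALL n>=K. ALL X:cball Z r. cmod (g n X - l X) <= e" if e: "0 < e" for e
  proof -
   obtain K where K: "ALL m>=K. ALL n>=K. ALL X:cball Z r. cmod (g m X - g n X) <= e" using u e by blast
   have "cmod (g n X - l X) <= e" if "K <= n" "X : cball Z r" for n X
   proof (rule LIMSEQ_le_const2)
    show "(%m. cmod (g n X - g m X)) \<longlonglongrightarrow> cmod (g n X - l X)"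
     using r(2) that(2) by (intro tendsto_intros lim) blast
    show "EX M. ALL m>=M. cmod (g n X - g m X) <= e" using K that by blast
   qed
   then show ?thesis by blast
  qed
  then show "EX r>0. cball Z r <= cartan_domain & (ALL e>0. EX K. ALL n>=K. ALL X:cball Z r. cmod (g n X - l X) <= e)"
   using r by blast
 qed
 have gm: "g n : borel_measurable \<B>" for n by (rule sq_int_measurable[OF bergmanD(1)[OF g]])
 have lm: "l : borel_measurable \<B>"
  by (rule measurable_bergman_continuous[OF mat_holomorphic_continuous[OF l_hol]])
 have dm: "(%x. (cmod (g n x - l x))^2) : borel_measurable \<B>" for n
  using gm[of n] lm by measurable
 have fatou: "(\<integral>\<^sup>+x. ennreal ((cmod (g n x - l x))^2) \<partial>\<B>) <= ennreal (e^2)"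
  if e: "0 < e" and K: "ALL m>=K. ALL n>=K. nrm \<B> (%x. g m x - g n x) < e" and n: "K <= n" for e K n
 proof -
  have "(\<integral>\<^sup>+x. ennreal ((cmod (g n x - l x))^2) \<partial>\<B>)
   = (\<integral>\<^sup>+x. liminf (%m. ennreal ((cmod (g n x - g m x))^2)) \<partial>\<B>)"
  proof (rule nn_integral_cong)
   fix x assume "x : space \<B>"
   then have "(%m. ennreal ((cmod (g n x - g m x))^2)) \<longlonglongrightarrow> ennreal ((cmod (g n x - l x))^2)"
    by (intro tendsto_ennrealI tendsto_intros lim) simp
   then show "ennreal ((cmod (g n x - l x))^2) = liminf (%m. ennreal ((cmod (g n x - g m x))^2))"
    by (intro lim_imp_Liminf[symmetric]) simp
  qed
  also have "... <= liminf (%m. \<integral>\<^sup>+x. ennreal ((cmod (g n x - g m x))^2) \<partial>\<B>)"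
  proof (rule nn_integral_liminf)
   show "(%x. ennreal ((cmod (g n x - g m x))^2)) : borel_measurable \<B>" for m
    using gm[of n] gm[of m] by measurable
  qed
  also have "... <= limsup (%m. \<integral>\<^sup>+x. ennreal ((cmod (g n x - g m x))^2) \<partial>\<B>)"
   by (rule Liminf_le_Limsup) simp
  also have "... <= ennreal (e^2)"
  proof (rule Limsup_bounded)
   have "(\<integral>\<^sup>+x. ennreal ((cmod (g n x - g m x))^2) \<partial>\<B>) <= ennreal (e^2)" if "K <= m" for m
   proof -
    have "(\<integral>\<^sup>+x. ennreal ((cmod (g n x - g m x))^2) \<partial>\<B>) = ennreal ((nrm \<B> (%x. g n x - g m x))^2)"
     unfolding nrm_square using bergmanD(1)[OF gd[of n m]]
     by (intro nn_integral_eq_integral) (auto simp: sq_int_def)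
    also have "... <= ennreal (e^2)"
     using K n that nrm_nonneg by (intro ennreal_leI power_mono) (auto intro: less_imp_le)
    finally show ?thesis .
   qed
   then show "\<forall>\<^sub>F m in sequentially. (\<integral>\<^sup>+x. ennreal ((cmod (g n x - g m x))^2) \<partial>\<B>) <= ennreal (e^2)"
    unfolding eventually_sequentially by blast
  qed
  finally show ?thesis .
 qed
 have close: "(%x. g n x - l x) : sq_int \<B> & nrm \<B> (%x. g n x - l x) <= e"
  if e: "0 < e" and K: "ALL m>=K. ALL n>=K. nrm \<B> (%x. g m x - g n x) < e" and n: "K <= n" for e K n
 proof -
  note F = fatou[OF that]
  have "(\<integral>\<^sup>+x. ennreal (norm ((cmod (g n x - l x))^2)) \<partial>\<B>) < \<infinity>"
   using F by (simp add: le_less_trans[OF F ennreal_less_top])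
  then have int: "integrable \<B> (%x. (cmod (g n x - l x))^2)"
   using dm unfolding integrable_iff_bounded by blast
  then have S: "(%x. g n x - l x) : sq_int \<B>"
   unfolding sq_int_def using gm[of n] lm by (simp add: borel_measurable_diff)
  have "ennreal ((nrm \<B> (%x. g n x - l x))^2) <= ennreal (e^2)"
   unfolding nrm_square using F nn_integral_eq_integral[OF int] by simp
  then have "(nrm \<B> (%x. g n x - l x))^2 <= e^2" by (subst (asm) ennreal_le_iff) auto
  then have "nrm \<B> (%x. g n x - l x) <= e" by (rule power2_le_imp_le) (use e in simp)
  then show ?thesis using S by blast
 qed
 have "l : sq_int \<B>"
 proof -
  have one: "0 < (1 :: real)" by simp
  from mp[OF spec[OF cauchy, of 1] one]
  obtain K where K: "ALL m>=K. ALL n>=K. nrm \<B> (%x. g m x - g n x) < 1" ..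
  have "(%x. g K x - l x) : sq_int \<B>" by (rule close[of 1 K K, THEN conjunct1]) (use K in auto)
  from sq_int_diff[OF bergmanD(1)[OF g[of K]] this] show ?thesis by simp
 qed
 then have "l : \<A>" using l_hol l0 by (intro bergmanI)
 moreover have "(%n. nrm \<B> (%x. g n x - l x)) \<longlonglongrightarrow> 0"
 proof (rule LIMSEQ_I)
  fix e :: real assume "0 < e"
  then have e2: "0 < e / 2" by simp
  with cauchy obtain K where K: "ALL m>=K. ALL n>=K. nrm \<B> (%x. g m x - g n x) < e / 2" by blast
  have "norm (nrm \<B> (%x. g n x - l x) - 0) < e" if "K <= n" for n
   using close[OF e2 K that] \<open>0 < e\<close> nrm_nonneg[of \<B> "%x. g n x - l x"] by simp
  then show "EX K. ALL n>=K. norm (nrm \<B> (%x. g n x - l x) - 0) < e" by blast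
 qed
 ultimately show ?thesis by blast
qed

end

section \<open>Invariant forms on polynomials\<close>

lemma zero_ext_add: "zero_ext (%Z. p Z + q Z) = (%Z. zero_ext p Z + zero_ext q Z)"
 by (simp add: zero_ext_def fun_eq_iff)

lemma zero_ext_cmult: "zero_ext (%Z. c * p Z) = (%Z. c * zero_ext p Z)"
 by (simp add: zero_ext_def fun_eq_iff)

lemma mat_holomorphic_cong:
 assumes "mat_holomorphic_on f S" "open S" "!!Z. Z : S ==> f Z = g Z"
 shows "mat_holomorphic_on g S"
 unfolding mat_holomorphic_on_def
proof
 fix Z assume Z: "Z : S"
 then obtain f' where f': "(f has_derivative f') (at Z)" "ALL c W. f' (mat c ** W) = c * f' W"
  using assms(1) unfolding mat_holomorphic_on_def by blast
 have "(g has_derivative f') (at Z)"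
  by (rule has_derivative_transform_within_open[OF f'(1) assms(2) Z assms(3)])
 then show "EX f'. (g has_derivative f') (at Z) & (ALL c W. f' (mat c ** W) = c * f' W)" using f'(2) by blast
qed

lemma linear_two_sided: "linear (%Z :: ('n::finite) cmat. A ** Z ** B)"
 by (rule linearI) (simp_all add: cvec_eq_iff matrix_matrix_mult_def sum.distrib distrib_left distrib_right
   scaleR_sum_right sum_distrib_right)

lemma weight_density_unitary:
 fixes A B Z :: "('n::finite) cmat"
 assumes A: "A : unitary_group" and B: "B : unitary_group"
 shows "weight_density lam (A ** Z ** B) = weight_density lam Z"
proof -
 let ?X = "Z ** conj_transpose Z"
 have "(A ** Z ** B) ** conj_transpose (A ** Z ** B) = A ** (Z ** (B ** conj_transpose B) ** conj_transpose Z) ** conj_transpose A"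
  by (simp only: conj_transpose_mult matrix_mul_assoc)
 then have "(A ** Z ** B) ** conj_transpose (A ** Z ** B) = A ** ?X ** conj_transpose A"
  by (simp add: unitary_groupD(2)[OF B])
 then have "mat 1 - (A ** Z ** B) ** conj_transpose (A ** Z ** B) = A ** (mat 1 - ?X) ** conj_transpose A"
  by (simp add: matrix_sub_ldistrib matrix_sub_rdistrib unitary_groupD(2)[OF A])
 then have "det (mat 1 - (A ** Z ** B) ** conj_transpose (A ** Z ** B)) = det (mat 1 - ?X) * (det A * det (conj_transpose A))"
  by (simp add: det_mul mult_ac)
 also have "det A * det (conj_transpose A) = 1"
  unfolding det_mul[symmetric] unitary_groupD(2)[OF A] by simp
 finally show ?thesis by (simp add: weight_density_def)
qed

lemma polynomial_fun_two_sided: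
 fixes A B :: "('n::finite) cmat"
 shows "polynomial_fun p ==> polynomial_fun (%Z. p (A ** Z ** B))"
 by (rule polynomial_fun_translate)

lemma polynomial_fun_left: "polynomial_fun p ==> polynomial_fun (%Z. p (A ** Z))"
 using polynomial_fun_translate[of p A "mat 1"] by simp

lemma polynomial_fun_right: "polynomial_fun p ==> polynomial_fun (%Z. p (Z ** B))"
 using polynomial_fun_translate[of p "mat 1" B] by simp

lemma lower_tri_conj_transpose: "upper_tri U ==> lower_tri (conj_transpose U)"
 by (simp add: upper_tri_def lower_tri_def conj_transpose_def)

lemma upper_tri_conj_transpose: "lower_tri L ==> upper_tri (conj_transpose L)"
 by (simp add: upper_tri_def lower_tri_def conj_transpose_def)

context weighted_bergman begin

lemma zero_ext_polynomial:
 assumes p: "polynomial_fun p"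
 shows "zero_ext p : \<A>"
proof -
 have hol: "mat_holomorphic_on p S" for S by (rule polynomial_fun_holomorphic[OF p])
 have "continuous_on (closure cartan_domain) p" by (rule mat_holomorphic_continuous[OF hol])
 then have "bounded (p ` closure cartan_domain)"
  by (intro compact_imp_bounded compact_continuous_image) (auto simp: bounded_cartan_domain)
 then obtain K where K: "ALL x:p ` closure cartan_domain. cmod x <= K" unfolding bounded_iff by blast
 have bound: "cmod (zero_ext p Z) <= K" if "Z : cartan_domain" for Z
  using that K closure_subset by (auto simp: zero_ext_def)
 have h: "mat_holomorphic_on (zero_ext p) cartan_domain"
  by (rule mat_holomorphic_cong[OF hol open_cartan_domain]) (simp add: zero_ext_def)
 have m: "zero_ext p : borel_measurable \<B>"
  by (rule measurable_bergman_continuous[OF mat_holomorphic_continuous[OF h]])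
 have "integrable \<B> (%Z. (cmod (zero_ext p Z))^2)"
 proof (rule finite_measure.integrable_const_bound[OF finite_measure_bergman, where B="K^2"])
  show "AE Z in \<B>. norm ((cmod (zero_ext p Z))^2) <= K^2"
   by (rule AE_I2) (simp add: bound power_mono)
  show "(%Z. (cmod (zero_ext p Z))^2) : borel_measurable \<B>" using m by measurable
 qed
 then show ?thesis using m h by (intro bergmanI) (simp_all add: sq_int_def zero_ext_def)
qed

lemma bounded_symbol:
 assumes "a : Linf_fun"
 shows "EX C>=0. ALL f:sq_int \<B>. (%Z. a Z * f Z) : sq_int \<B> & nrm \<B> (%Z. a Z * f Z) <= C * nrm \<B> f"
proof -
 have am: "a : borel_measurable \<B>" using assms by (simp add: Linf_fun_def bergman_measure_eq)
 obtain C0 where "AE Z in (domain_lebesgue :: 'n cmat measure). cmod (a Z) <= C0"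
  using assms unfolding Linf_fun_def by blast
 then have AE0: "AE Z in \<B>. cmod (a Z) <= C0" unfolding AE_bergman_iff .
 define C where "C = max C0 0"
 have C: "0 <= C" by (simp add: C_def)
 have "(%Z. a Z * f Z) : sq_int \<B> & nrm \<B> (%Z. a Z * f Z) <= C * nrm \<B> f" if f: "f : sq_int \<B>" for f
 proof -
  have fm: "f : borel_measurable \<B>" by (rule sq_int_measurable[OF f])
  have m: "(%Z. a Z * f Z) : borel_measurable \<B>" using am fm by (rule borel_measurable_times)
  have int0: "integrable \<B> (%Z. C^2 * (cmod (f Z))^2)" using f by (simp add: sq_int_def)
  have AE1: "AE Z in \<B>. (cmod (a Z * f Z))^2 <= C^2 * (cmod (f Z))^2"
  proof (rule AE_mp[OF AE0], rule AE_I2, rule impI)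
   fix Z assume "cmod (a Z) <= C0"
   then have "(cmod (a Z))^2 <= C^2" by (intro power_mono) (simp_all add: C_def)
   then show "(cmod (a Z * f Z))^2 <= C^2 * (cmod (f Z))^2"
    unfolding norm_mult power_mult_distrib by (intro mult_right_mono) simp_all
  qed
  have int: "integrable \<B> (%Z. (cmod (a Z * f Z))^2)"
  proof (rule Bochner_Integration.integrable_bound[OF int0])
   show "(%Z. (cmod (a Z * f Z))^2) : borel_measurable \<B>" using m by measurable
   show "AE Z in \<B>. norm ((cmod (a Z * f Z))^2) <= norm (C^2 * (cmod (f Z))^2)" using AE1 by simp
  qed
  have "(nrm \<B> (%Z. a Z * f Z))^2 <= (LINT Z|\<B>. C^2 * (cmod (f Z))^2)"
   unfolding nrm_square by (rule integral_mono_AE[OF int int0 AE1])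
  also have "... = (C * nrm \<B> f)^2" by (simp add: power_mult_distrib nrm_square)
  finally have "nrm \<B> (%Z. a Z * f Z) <= C * nrm \<B> f"
   by (rule power2_le_imp_le) (simp add: C nrm_nonneg)
  then show ?thesis using m int by (simp add: sq_int_def)
 qed
 then show ?thesis using C by blast
qed

lemma symbol_sq_int: "a : Linf_fun ==> f : sq_int \<B> ==> (%Z. a Z * f Z) : sq_int \<B>"
 using bounded_symbol by blast

definition form :: "('n cmat => complex) => ('n cmat => complex) => ('n cmat => complex) => complex" where
 "form a p q = ip \<B> (%Z. a Z * zero_ext p Z) (zero_ext q)"

lemma form_one: "form (%_. 1) p q = ip \<B> (zero_ext p) (zero_ext q)"
 by (simp add: form_def)

lemma one_invariant: "(%_. 1) : (invariant_symbols :: ('n cmat => complex) set)"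
 by (auto simp: invariant_symbols_def Linf_fun_def intro!: exI[of _ 1])

lemma invariant_Linf: "a : invariant_symbols ==> a : Linf_fun"
 by (simp add: invariant_symbols_def)

lemma ext_sq_int: "polynomial_fun p ==> zero_ext p : sq_int \<B>"
 by (rule bergmanD(1)[OF zero_ext_polynomial])

lemma form_linear:
 assumes "a : Linf_fun" "polynomial_fun p" "polynomial_fun p'" "polynomial_fun q"
 shows "form a (%Z. p Z + p' Z) q = form a p q + form a p' q" "form a (%Z. c * p Z) q = c * form a p q"
  "form a q (%Z. p Z + p' Z) = form a q p + form a q p'" "form a q (%Z. c * p Z) = cnj c * form a q p"
proof -
 note S = ext_sq_int[OF assms(2)] ext_sq_int[OF assms(3)] ext_sq_int[OF assms(4)]
 note aS = symbol_sq_int[OF assms(1) S(1)] symbol_sq_int[OF assms(1) S(2)] symbol_sq_int[OF assms(1) S(3)]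
 show "form a (%Z. p Z + p' Z) q = form a p q + form a p' q"
  using ip_linear(1)[OF aS(1,2) S(3)] by (simp add: form_def zero_ext_add distrib_left)
 show "form a (%Z. c * p Z) q = c * form a p q"
  using ip_linear(3)[OF aS(1,1) S(3), of c] by (simp add: form_def zero_ext_cmult mult.left_commute)
 show "form a q (%Z. p Z + p' Z) = form a q p + form a q p'"
  using ip_linear_right(1)[OF S(1,2) aS(3)] by (simp add: form_def zero_ext_add)
 show "form a q (%Z. c * p Z) = cnj c * form a q p"
  using ip_linear_right(3)[OF S(1,1) aS(3), of c] by (simp add: form_def zero_ext_cmult)
qed

lemma form_translate:
 assumes a: "a : invariant_symbols" and A: "A : unitary_group" and B: "B : unitary_group"
  and p: "polynomial_fun p" and q: "polynomial_fun q"
 shows "form a (%Z. p (A ** Z ** B)) (%Z. q (A ** Z ** B)) = form a p q"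
proof -
 define T where "T Z = A ** Z ** B" for Z :: "'n cmat"
 have iso: "norm (T Z) = norm Z" for Z by (simp add: T_def norm_unitary_left[OF A] norm_unitary_right[OF B])
 have dom: "T Z : cartan_domain \<longleftrightarrow> Z : cartan_domain" for Z unfolding T_def by (rule cartan_domain_unitary[OF A B])
 have w: "weight_density lam (T Z) = weight_density lam Z" for Z unfolding T_def by (rule weight_density_unitary[OF A B])
 have "linear T" unfolding T_def[abs_def] by (rule linear_two_sided)
 note inv = bergman_measure_invariant[OF this iso dom w]
 have m: "(%Z. a Z * zero_ext p Z * cnj (zero_ext q Z)) : borel_measurable \<B>"
  using sq_int_product_integrable[OF symbol_sq_int[OF invariant_Linf[OF a] ext_sq_int[OF p]] ext_sq_int[OF q]]
  by (rule borel_measurable_integrable)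
 have m2: "(%Z. a Z * zero_ext (%Z. p (T Z)) Z * cnj (zero_ext (%Z. q (T Z)) Z)) : borel_measurable \<B>"
  unfolding T_def using sq_int_product_integrable[OF symbol_sq_int[OF invariant_Linf[OF a]
   ext_sq_int[OF polynomial_fun_two_sided[OF p]]] ext_sq_int[OF polynomial_fun_two_sided[OF q]]]
  by (rule borel_measurable_integrable)
 have inv_A: "matrix_inv (conj_transpose A) = A"
  using unitary_groupD(4)[OF unitary_groupD(5)[OF A]] by simp
 have "AE Z in (domain_lebesgue :: 'n cmat measure). a (matrix_inv (conj_transpose A) ** Z ** B) = a Z"
  using a unitary_groupD(5)[OF A] B unfolding invariant_symbols_def by blast
 then have AE: "AE Z in \<B>. a (T Z) = a Z" unfolding AE_bergman_iff T_def inv_A .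
 have ext: "zero_ext r (T Z) = zero_ext (%Z. r (T Z)) Z" for r Z by (simp add: zero_ext_def dom)
 have "form a p q = (LINT Z|distr \<B> \<B> T. a Z * zero_ext p Z * cnj (zero_ext q Z))"
  unfolding inv(2) by (simp add: form_def ip_def)
 also have "... = (LINT Z|\<B>. a (T Z) * zero_ext p (T Z) * cnj (zero_ext q (T Z)))"
  by (rule integral_distr[OF inv(1) m])
 also have "... = (LINT Z|\<B>. a Z * zero_ext (%Z. p (T Z)) Z * cnj (zero_ext (%Z. q (T Z)) Z))"
 proof (rule integral_cong_AE)
  show "(%Z. a (T Z) * zero_ext p (T Z) * cnj (zero_ext q (T Z))) : borel_measurable \<B>"
   using measurable_compose[OF inv(1) m] .
  show "AE Z in \<B>. a (T Z) * zero_ext p (T Z) * cnj (zero_ext q (T Z))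
   = a Z * zero_ext (%Z. p (T Z)) Z * cnj (zero_ext (%Z. q (T Z)) Z)"
   by (rule AE_mp[OF AE], rule AE_I2, rule impI) (simp only: ext)
 qed (rule m2)
 finally show ?thesis by (simp add: form_def ip_def T_def)
qed

text \<open>
  For unitary \<open>A\<close> this is invariance of the measure and of the symbol; both sides are polynomials in the
  entries of \<open>A\<close>.
\<close>

lemma form_left:
 assumes a: "a : invariant_symbols" and p: "polynomial_fun p" and q: "polynomial_fun q"
 shows "form a (%Z. p (A ** Z)) q = form a p (%Z. q (conj_transpose A ** Z))"
proof -
 note aL = invariant_Linf[OF a]
 have 1: "polynomial_fun (%A. form a (%Z. p (A ** Z)) q)"
  by (rule separable_functional[OF separable_mult_left[OF p], of "%p. form a p q"])
   (simp_all add: form_linear[OF aL _ _ q])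
 have "polynomial_fun (%A. cnj (form a p (%Z. q (A ** Z))))"
  by (rule separable_functional[OF separable_mult_left[OF q], of "%q. cnj (form a p q)"])
   (simp_all add: form_linear[OF aL _ _ p])
 from cnj_polynomial_fun_conj_transpose[OF this]
 have 2: "polynomial_fun (%A. form a p (%Z. q (conj_transpose A ** Z)))" by simp
 have "form a (%Z. p (A ** Z)) q - form a p (%Z. q (conj_transpose A ** Z)) = 0"
 proof (rule polynomial_fun_0_on_unitary[OF polynomial_fun_diff[OF 1 2]])
  fix A :: "'n cmat" assume A: "A : unitary_group"
  have "mat 1 : (unitary_group :: 'n cmat set)" by (simp add: unitary_group_def)
  from form_translate[OF a A this p polynomial_fun_left[OF q, of "conj_transpose A"]]
  show "form a (%Z. p (A ** Z)) q - form a p (%Z. q (conj_transpose A ** Z)) = 0"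
   by (simp add: matrix_mul_assoc unitary_groupD(1)[OF A])
 qed
 then show ?thesis by simp
qed

lemma form_right:
 assumes a: "a : invariant_symbols" and p: "polynomial_fun p" and q: "polynomial_fun q"
 shows "form a (%Z. p (Z ** B)) q = form a p (%Z. q (Z ** conj_transpose B))"
proof -
 note aL = invariant_Linf[OF a]
 have 1: "polynomial_fun (%B. form a (%Z. p (Z ** B)) q)"
  by (rule separable_functional[OF separable_mult_right[OF p], of "%p. form a p q"])
   (simp_all add: form_linear[OF aL _ _ q])
 have "polynomial_fun (%B. cnj (form a p (%Z. q (Z ** B))))"
  by (rule separable_functional[OF separable_mult_right[OF q], of "%q. cnj (form a p q)"])
   (simp_all add: form_linear[OF aL _ _ p])
 from cnj_polynomial_fun_conj_transpose[OF this]
 have 2: "polynomial_fun (%B. form a p (%Z. q (Z ** conj_transpose B)))" by simp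
 have "form a (%Z. p (Z ** B)) q - form a p (%Z. q (Z ** conj_transpose B)) = 0"
 proof (rule polynomial_fun_0_on_unitary[OF polynomial_fun_diff[OF 1 2]])
  fix B :: "'n cmat" assume B: "B : unitary_group"
  have "mat 1 : (unitary_group :: 'n cmat set)" by (simp add: unitary_group_def)
  from form_translate[OF a this B p polynomial_fun_right[OF q, of "conj_transpose B"]]
  show "form a (%Z. p (Z ** B)) q - form a p (%Z. q (Z ** conj_transpose B)) = 0"
   by (simp add: matrix_mul_assoc[symmetric] unitary_groupD(2)[OF B])
 qed
 then show ?thesis by simp
qed

lemma form_two_sided:
 assumes a: "a : invariant_symbols" and p: "polynomial_fun p" and q: "polynomial_fun q"
 shows "form a (%Z. p (A ** Z ** B)) q = form a p (%Z. q (conj_transpose A ** Z ** conj_transpose B))"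
 using form_left[OF a polynomial_fun_right[OF p, of B] q, of A]
  form_right[OF a p polynomial_fun_left[OF q, of "conj_transpose A"], of B]
 by (simp add: matrix_mul_assoc)

text \<open>
  The outer triangular factors are absorbed by \<open>\<Delta>\<close>, and the inner ones move to \<open>\<Delta>'\<close>, where taking
  adjoints has made them act by characters.
\<close>

lemma form_highest_weight:
 assumes a: "a : invariant_symbols" and \<Delta>: "hw_poly \<mu> \<Delta>" and \<Delta>': "hw_poly \<nu> \<Delta>'"
  and tri: "lower_tri L" "upper_tri U" "lower_tri L'" "upper_tri U'"
 shows "form a (%Z. \<Delta> ((L ** U) ** Z ** (L' ** U'))) \<Delta>'
  = tri_char \<mu> L * tri_char \<mu> U' * cnj (tri_char \<nu> (conj_transpose U) * tri_char \<nu> (conj_transpose L')) * form a \<Delta> \<Delta>'"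
proof -
 note aL = invariant_Linf[OF a] and P = hw_polyD(1)[OF \<Delta>] and P' = hw_polyD(1)[OF \<Delta>']
 have 1: "(%Z. \<Delta> ((L ** U) ** Z ** (L' ** U'))) = (%Z. (tri_char \<mu> L * tri_char \<mu> U') * \<Delta> (U ** Z ** L'))"
 proof
  fix Z
  have "(L ** U) ** Z ** (L' ** U') = L ** ((U ** Z ** L') ** U')" by (simp only: matrix_mul_assoc)
  then show "\<Delta> ((L ** U) ** Z ** (L' ** U')) = (tri_char \<mu> L * tri_char \<mu> U') * \<Delta> (U ** Z ** L')"
   by (simp only: hw_polyD(3)[OF \<Delta> tri(1)] hw_polyD(4)[OF \<Delta> tri(4)] mult.assoc)
 qed
 have 2: "(%Z. \<Delta>' (conj_transpose U ** Z ** conj_transpose L'))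
  = (%Z. (tri_char \<nu> (conj_transpose U) * tri_char \<nu> (conj_transpose L')) * \<Delta>' Z)"
  unfolding hw_polyD(4)[OF \<Delta>' upper_tri_conj_transpose[OF tri(3)]]
   hw_polyD(3)[OF \<Delta>' lower_tri_conj_transpose[OF tri(2)]] by (simp add: mult_ac)
 show ?thesis
  unfolding 1 form_linear(2)[OF aL polynomial_fun_two_sided[OF P] P P'] form_two_sided[OF a P P'] 2
   form_linear(4)[OF aL P' P' P] by (simp add: mult_ac)
qed

text \<open>A relation between two invariant forms propagates from the highest weight vectors.\<close>

lemma form_bi_module:
 assumes a: "a : invariant_symbols" and b: "b : invariant_symbols"
  and \<Delta>: "hw_poly \<mu> \<Delta>" and \<Delta>': "hw_poly \<nu> \<Delta>'"
  and base: "form a \<Delta> \<Delta>' = \<gamma> * form b \<Delta> \<Delta>'"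
  and pq: "p : hw_module.bi_module \<Delta>" "q : hw_module.bi_module \<Delta>'"
 shows "form a p q = \<gamma> * form b p q"
proof -
 interpret H: hw_module \<mu> \<Delta> by unfold_locales (rule \<Delta>)
 interpret H': hw_module \<nu> \<Delta>' by unfold_locales (rule \<Delta>')
 note aL = invariant_Linf[OF a] and bL = invariant_Linf[OF b]
 note P = hw_polyD(1)[OF \<Delta>] and P' = hw_polyD(1)[OF \<Delta>']
 define d where "d p q = form a p q - \<gamma> * form b p q" for p q
 have d_lin: "d (%Z. p Z + p' Z) q = d p q + d p' q" "d (%Z. c * p Z) q = c * d p q"
  "d q (%Z. p Z + p' Z) = d q p + d q p'" "d q (%Z. c * p Z) = cnj c * d q p"
  if "polynomial_fun p" "polynomial_fun p'" "polynomial_fun q" for p p' q c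
  unfolding d_def form_linear[OF aL that] form_linear[OF bL that] by (simp_all add: algebra_simps)
 have LU: "d (%Z. \<Delta> ((L ** U) ** Z ** (L' ** U'))) \<Delta>' = 0"
  if "lower_tri L" "upper_tri U" "lower_tri L'" "upper_tri U'" for L U L' U'
  unfolding d_def form_highest_weight[OF a \<Delta> \<Delta>' that] form_highest_weight[OF b \<Delta> \<Delta>' that] base by simp
 have poly_A: "polynomial_fun (%A. d (%Z. \<Delta> (A ** Z ** B)) \<Delta>')" for B
  by (rule separable_functional[OF separable_mult_left[OF polynomial_fun_right[OF P, of B]], of "%p. d p \<Delta>'"])
   (simp_all add: d_lin P')
 have poly_B: "polynomial_fun (%B. d (%Z. \<Delta> (A ** Z ** B)) \<Delta>')" for A
  unfolding matrix_mul_assoc[symmetric]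
  by (rule separable_functional[OF separable_mult_right[OF polynomial_fun_left[OF P, of A]], of "%p. d p \<Delta>'"])
   (simp_all add: d_lin P')
 have z1: "d (%Z. \<Delta> (A ** Z ** (L' ** U'))) \<Delta>' = 0" if "lower_tri L'" "upper_tri U'" for A L' U'
 proof -
  have "(%A. d (%Z. \<Delta> (A ** Z ** (L' ** U'))) \<Delta>') = (%_. 0)"
   by (rule polynomial_fun_eq_on_LU[OF poly_A polynomial_fun.const]) (rule LU; use that in simp)
  then show ?thesis by (rule fun_cong)
 qed
 have z2: "d (%Z. \<Delta> (A ** Z ** B)) \<Delta>' = 0" for A B
 proof -
  have "(%B. d (%Z. \<Delta> (A ** Z ** B)) \<Delta>') = (%_. 0)"
   by (rule polynomial_fun_eq_on_LU[OF poly_B polynomial_fun.const]) (rule z1)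
  then show ?thesis by (rule fun_cong)
 qed
 have z3: "d (%Z. \<Delta> (A ** Z ** B)) (%Z. \<Delta>' (C ** Z ** D)) = 0" for A B C D
 proof -
  let ?p = "%Z. \<Delta> (A ** Z ** B)"
  note pp = polynomial_fun_two_sided[OF P, of A B]
  have "d ?p (%Z. \<Delta>' (C ** Z ** D)) = d (%Z. ?p (conj_transpose C ** Z ** conj_transpose D)) \<Delta>'"
   using form_two_sided[OF a pp P', of "conj_transpose C" "conj_transpose D"]
    form_two_sided[OF b pp P', of "conj_transpose C" "conj_transpose D"] by (simp add: d_def)
  also have "(%Z. ?p (conj_transpose C ** Z ** conj_transpose D))
   = (%Z. \<Delta> ((A ** conj_transpose C) ** Z ** (conj_transpose D ** B)))" by (simp only: matrix_mul_assoc)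
  also have "d ... \<Delta>' = 0" by (rule z2)
  finally show ?thesis .
 qed
 let ?V = "{p. polynomial_fun p & (ALL C D. d p (%Z. \<Delta>' (C ** Z ** D)) = 0)}"
 have "fun_subspace ?V"
  unfolding fun_subspace_def
  using d_lin(1,2)[OF _ _ polynomial_fun_two_sided[OF P']] d_lin(2)[OF P P polynomial_fun_two_sided[OF P'], of 0]
  by (auto intro: polynomial_fun.const polynomial_fun.add polynomial_fun_cmult)
 from H.bi_module_le[OF this] z3 have V: "H.bi_module <= ?V" by (auto intro: polynomial_fun_two_sided[OF P])
 let ?W = "{q. polynomial_fun q & d p q = 0}"
 have pp: "polynomial_fun p" by (rule H.bi_module_polynomial[OF pq(1)])
 have "fun_subspace ?W"
  unfolding fun_subspace_def
  using d_lin(3,4)[OF _ _ pp] d_lin(4)[OF P P pp, of 0]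
  by (auto intro: polynomial_fun.const polynomial_fun.add polynomial_fun_cmult)
 from H'.bi_module_le[OF this] V pq(1) have "H'.bi_module <= ?W" by (auto intro: polynomial_fun_two_sided[OF P'])
 then show ?thesis using pq(2) by (auto simp: d_def)
qed

text \<open>
  A diagonal matrix is both lower and upper triangular, so it acts by both characters.
\<close>

lemma form_highest_weight_zero:
 assumes a: "a : invariant_symbols" and \<Delta>: "hw_poly \<mu> \<Delta>" and \<Delta>': "hw_poly \<nu> \<Delta>'" and ne: "\<mu> ~= \<nu>"
 shows "form a \<Delta> \<Delta>' = 0"
proof -
 obtain i where i: "\<mu> i ~= \<nu> i" using ne by auto
 define t :: "'n cmat" where "t = dmat (%j. if j = i then 2 else 1)"
 have tri: "lower_tri t" "upper_tri t" "lower_tri (mat 1 :: 'n cmat)" "upper_tri (mat 1 :: 'n cmat)"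
  by (auto simp: t_def dmat_def lower_tri_def upper_tri_def cmat_def)
 have ct: "conj_transpose t = t" by (simp add: t_def dmat_def conj_transpose_def cvec_eq_iff)
 have ch: "tri_char \<alpha> t = 2 ^ \<alpha> i" for \<alpha>
  by (simp add: tri_char_def t_def dmat_def if_distrib[of "%x. x ^ _"] prod.delta cong: if_cong)
 have "tri_char \<mu> t * form a \<Delta> \<Delta>' = cnj (tri_char \<nu> t) * form a \<Delta> \<Delta>'"
  using form_highest_weight[OF a \<Delta> \<Delta>' tri(1,4,3,4)] form_highest_weight[OF a \<Delta> \<Delta>' tri(3,2,3,4)]
  by (simp add: ct)
 moreover have "cmod (2 ^ \<mu> i) ~= cmod (2 ^ \<nu> i)" using i by (simp add: norm_power)
 then have "(2 :: complex) ^ \<mu> i ~= 2 ^ \<nu> i" by metis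
 ultimately show ?thesis by (simp add: ch)
qed

end

section \<open>The isotypic components of the Bergman space\<close>

lemma scalar_mat_commute: "A ** (mat c ** (Z :: complex^'n^'m)) = mat c ** (A ** Z)"
 unfolding matrix_mult_scalar
 by (simp add: cvec_eq_iff matrix_matrix_mult_def sum_distrib_left mult.left_commute)

lemma scalar_mat_unitary:
 assumes "cmod c = 1"
 shows "(mat c :: ('n::finite) cmat) : unitary_group"
proof -
 have "cnj c * c = 1" using assms by (simp add: mult.commute complex_norm_square[symmetric])
 moreover have "conj_transpose (mat c :: 'n cmat) = mat (cnj c)"
  by (simp add: conj_transpose_def cmat_def cvec_eq_iff)
 ultimately show ?thesis
  unfolding unitary_group_def using scalar_mat_mult[of "cnj c" c "mat 1 :: 'n cmat"] by simp
qed

lemma hw_poly_scalar: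
 assumes "hw_poly \<mu> \<Delta>"
 shows "\<Delta> (mat c ** Z) = c ^ (\<Sum>i\<in>UNIV. \<mu> i) * \<Delta> Z"
proof -
 have "lower_tri (mat c)" by (auto simp: lower_tri_def cmat_def)
 from hw_polyD(3)[OF assms this] show ?thesis by (simp add: tri_char_def cmat_def power_sum)
qed

definition weight_degree :: "int^('n::finite) => nat" where
 "weight_degree m = (\<Sum>i\<in>UNIV. nat (m $ i))"

lemma component_generated:
 fixes m :: "int^('n::{finite,linorder})"
 assumes "m : dominant_weights"
 shows "\<exists>\<Delta>. hw_poly (%i. nat (m $ i)) \<Delta> & poly_component m = hw_module.bi_module \<Delta>"
 using hw_poly_dominant_weight[OF assms] poly_component_eq[OF assms] by blast

lemma component_polynomial:
 fixes m :: "int^('n::{finite,linorder})"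
 assumes m: "m : dominant_weights" and p: "p : poly_component m"
 shows "polynomial_fun p" "p (mat c ** Z) = c ^ weight_degree m * p Z"
  "invertible A ==> invertible B ==> (%Z. p (A ** Z ** B)) : poly_component m"
proof -
 from component_generated[OF m] obtain \<Delta>
  where \<Delta>: "hw_poly (%i. nat (m $ i)) \<Delta>" and eq: "poly_component m = hw_module.bi_module \<Delta>" by blast
 interpret hw_module "%i. nat (m $ i)" \<Delta> by unfold_locales (rule \<Delta>)
 have p': "p : bi_module" using p eq by simp
 show "polynomial_fun p" by (rule bi_module_polynomial[OF p'])
 show "(%Z. p (A ** Z ** B)) : poly_component m" if "invertible A" "invertible B"
  unfolding eq by (rule bi_module_invariant[OF that p'])
 let ?V = "{p. ALL c Z. p (mat c ** Z) = c ^ weight_degree m * p Z}"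
 have "fun_subspace ?V" by (simp add: fun_subspace_def distrib_left mult.left_commute)
 moreover have "(%Z. \<Delta> (A ** Z ** B)) : ?V" for A B
 proof -
  have "A ** (mat c ** Z) ** B = mat c ** (A ** Z ** B)" for c Z
   unfolding scalar_mat_commute by (simp only: matrix_mul_assoc)
  then show ?thesis by (simp add: hw_poly_scalar[OF \<Delta>] weight_degree_def)
 qed
 ultimately have "bi_module <= ?V" by (intro bi_module_le)
 then show "p (mat c ** Z) = c ^ weight_degree m * p Z" using p' by blast
qed

lemma component_subspace:
 fixes m :: "int^('n::{finite,linorder})"
 assumes m: "m : dominant_weights"
 shows "fun_subspace (poly_component m)"
proof -
 from component_generated[OF m] obtain \<Delta>
  where \<Delta>: "hw_poly (%i. nat (m $ i)) \<Delta>" and eq: "poly_component m = hw_module.bi_module \<Delta>" by blast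
 interpret hw_module "%i. nat (m $ i)" \<Delta> by unfold_locales (rule \<Delta>)
 show ?thesis unfolding eq by (rule fun_subspace_bi_module)
qed

lemma component_finite_dim:
 fixes m :: "int^('n::{finite,linorder})"
 assumes m: "m : dominant_weights"
 shows "EX T. finite T & poly_component m = cfun.span T"
proof -
 from component_generated[OF m] obtain \<Delta>
  where \<Delta>: "hw_poly (%i. nat (m $ i)) \<Delta>" and eq: "poly_component m = hw_module.bi_module \<Delta>" by blast
 interpret hw_module "%i. nat (m $ i)" \<Delta> by unfold_locales (rule \<Delta>)
 from translates_finite_span[OF hw_polyD(1)[OF \<Delta>]] obtain T
  where T: "finite T" "ALL A B. (%Z::'n cmat. \<Delta> (A ** Z ** B)) : cfun.span T" by blast
 have sub: "bi_module <= cfun.span T" using T(2) by (intro bi_module_le fun_subspace_span) blast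
 obtain B where B: "B <= bi_module" "cfun.independent B" "bi_module <= cfun.span B"
  using cfun.maximal_independent_subset[of bi_module] by blast
 have "finite B" using cfun.independent_span_bound[OF T(1) B(2)] B(1) sub by blast
 moreover have "cfun.span B <= bi_module" by (rule span_le_fun_subspace[OF B(1) fun_subspace_bi_module])
 ultimately show ?thesis using B(3) eq by (intro exI[of _ B]) auto
qed

context weighted_bergman begin

abbreviation dominant :: "(int^('n::{finite,linorder})) set" where "dominant \<equiv> dominant_weights"

lemma hw_nrm_nonzero:
 assumes \<Delta>: "hw_poly \<mu> (\<Delta> :: 'n cmat => complex)"
 shows "nrm \<B> (zero_ext \<Delta>) ~= 0"
proof
 assume "nrm \<B> (zero_ext \<Delta>) = 0"
 from nrm_zero_imp_zero[OF zero_ext_polynomial[OF hw_polyD(1)[OF \<Delta>]] this]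
 have 0: "zero_ext \<Delta> Z = 0" for Z by simp
 (* The identity itself lies on the boundary of the domain. *)
 define Z :: "'n cmat" where "Z = mat (1/2) ** mat 1"
 have "Z : cartan_domain"
  unfolding cartan_domain_iff Z_def scalar_mat_vec by (simp add: norm_scale_vec)
 then have "\<Delta> Z = 0" using 0[of Z] by (simp add: zero_ext_def)
 then show False unfolding Z_def hw_poly_scalar[OF \<Delta>] hw_polyD(2)[OF \<Delta>] by simp
qed

lemma component_form_orthogonal:
 assumes a: "a : invariant_symbols" and m: "m : dominant" "m' : dominant" "m ~= m'"
  and pq: "p : poly_component m" "q : poly_component m'"
 shows "form a p q = 0"
proof -
 from component_generated[OF m(1)] obtain \<Delta>
  where \<Delta>: "hw_poly (%i. nat (m $ i)) \<Delta>" and eq: "poly_component m = hw_module.bi_module \<Delta>" by blast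
 from component_generated[OF m(2)] obtain \<Delta>'
  where \<Delta>': "hw_poly (%i. nat (m' $ i)) \<Delta>'" and eq': "poly_component m' = hw_module.bi_module \<Delta>'" by blast
 have "(%i. nat (m $ i)) ~= (%i. nat (m' $ i))"
 proof
  assume "(%i. nat (m $ i)) = (%i. nat (m' $ i))"
  then have "nat (m $ i) = nat (m' $ i)" for i by (rule fun_cong)
  then have "m $ i = m' $ i" for i using m(1,2) unfolding dominant_weights_def by (metis (mono_tags) mem_Collect_eq nat_0_le)
  then show False using m(3) by (simp add: cvec_eq_iff)
 qed
 from form_highest_weight_zero[OF a \<Delta> \<Delta>' this]
 have "form a \<Delta> \<Delta>' = 0 * form a \<Delta> \<Delta>'" by simp
 from form_bi_module[OF a a \<Delta> \<Delta>' this pq[unfolded eq eq']] show ?thesis by simp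
qed

lemma component_form_scalar:
 assumes a: "a : invariant_symbols" and m: "m : dominant"
 shows "EX \<gamma>. ALL p:poly_component m. ALL q:poly_component m. form a p q = \<gamma> * ip \<B> (zero_ext p) (zero_ext q)"
proof -
 from component_generated[OF m] obtain \<Delta>
  where \<Delta>: "hw_poly (%i. nat (m $ i)) \<Delta>" and eq: "poly_component m = hw_module.bi_module \<Delta>" by blast
 define \<gamma> where "\<gamma> = form a \<Delta> \<Delta> / form (%_. 1) \<Delta> \<Delta>"
 have "form (%_. 1) \<Delta> \<Delta> ~= 0" using hw_nrm_nonzero[OF \<Delta>] by (simp add: form_one ip_self)
 then have "form a \<Delta> \<Delta> = \<gamma> * form (%_. 1) \<Delta> \<Delta>" by (simp add: \<gamma>_def)
 from form_bi_module[OF a one_invariant \<Delta> \<Delta> this] show ?thesis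
  unfolding eq form_one by blast
qed

text \<open>
  Pairing with a homogeneous function of degree \<open>k\<close> only sees the Fourier coefficient of index \<open>k\<close> under rotations.
\<close>

lemma ip_taylor_part:
 assumes f: "f : \<A>" and h: "polynomial_fun h" and hom: "ALL c Z. h (mat c ** Z) = c ^ k * h Z"
 shows "ip \<B> f (zero_ext h) = form (%_. 1) (taylor_part k f) h"
proof -
 have "(LINT Z|\<B>. f Z * cnj (zero_ext h Z)) = (LINT Z|\<B>. zero_ext (taylor_part k f) Z * cnj (zero_ext h Z))"
 proof (rule rotation_average[OF finite_measure_bergman _ bergman_borel[OF f], where k=k])
  show "(%Z. Z) : measurable \<B> borel"
   unfolding measurable_bergman_iff by (intro measurable_restrict_space1) simp
  show "zero_ext h : borel_measurable \<B>" by (rule sq_int_measurable[OF ext_sq_int[OF h]])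
  show "integrable \<B> (%Z. f Z * cnj (zero_ext h Z))"
   by (rule sq_int_product_integrable[OF bergmanD(1)[OF f] ext_sq_int[OF h]])
  have U: "(mat (turn \<theta>) :: 'n cmat) : unitary_group" "(mat 1 :: 'n cmat) : unitary_group" for \<theta>
   by (simp_all add: scalar_mat_unitary)
  have inv: "(%Z. mat (turn \<theta>) ** Z ** mat 1) : measurable \<B> \<B> & distr \<B> \<B> (%Z. mat (turn \<theta>) ** Z ** mat 1) = \<B>" for \<theta>
   using bergman_measure_invariant[OF linear_two_sided[of "mat (turn \<theta>)" "mat 1"], OF _
     cartan_domain_unitary[OF U] weight_density_unitary[OF U]]
   by (simp add: norm_unitary_left[OF U(1)])
  show "ALL \<theta>. (%Z. mat (turn \<theta>) ** Z) : measurable \<B> \<B>" "ALL \<theta>. distr \<B> \<B> (%Z. mat (turn \<theta>) ** Z) = \<B>"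
   using inv by simp_all
  show "ALL \<theta>. ALL Z:space \<B>. zero_ext h (mat (turn \<theta>) ** Z) = turn \<theta> ^ k * zero_ext h Z"
   using hom by (simp add: zero_ext_def cartan_domain_balanced)
  show "ALL Z:space \<B>. (LINT \<theta>|circle. f (mat (turn \<theta>) ** Z) * cnj (turn \<theta>) ^ k) = zero_ext (taylor_part k f) Z"
  proof
   fix Z assume "Z : space \<B>"
   then have Z: "Z : cartan_domain" by simp
   let ?g = "%t. f (mat t ** Z)"
   have hg: "?g holomorphic_on cball 0 1"
    by (rule disc_holomorphic[OF bergmanD(2)[OF f]]) (simp add: cartan_domain_balanced[OF Z])
   have c: "continuous_on (cball 0 1) ?g" using hg by (rule holomorphic_on_imp_continuous_on)
   have "?g holomorphic_on ball 0 1" using hg by (rule holomorphic_on_subset) auto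
   from Taylor_coefficient_circle_average[OF c this, of k]
   have "((%\<theta>. ?g (turn \<theta>) * cnj (turn \<theta>) ^ k) has_integral taylor_part k f Z) {0..1}"
    by (simp only: taylor_part_def)
   moreover have "continuous_on {0..1} (%\<theta>. ?g (turn \<theta>) * cnj (turn \<theta>) ^ k)"
    by (intro continuous_intros continuous_on_turn continuous_on_compose2[OF c continuous_on_turn]) (simp add: image_subset_iff)
   ultimately have "(LINT \<theta>|circle. ?g (turn \<theta>) * cnj (turn \<theta>) ^ k) = taylor_part k f Z"
    by (rule circle_integral[rotated])
   then show "(LINT \<theta>|circle. f (mat (turn \<theta>) ** Z) * cnj (turn \<theta>) ^ k) = zero_ext (taylor_part k f) Z"
    using Z by (simp add: zero_ext_def)
  qed
 qed
 then show ?thesis by (simp add: form_one ip_def)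
qed

text \<open>
  The polynomials orthogonal to all components form a bi-invariant space; it would contain a
  highest weight vector if it were not zero.
\<close>

theorem orthogonal_to_components_imp_zero:
 assumes f: "f : \<A>" and orth: "ALL m:dominant. ALL q:poly_component m. ip \<B> f (zero_ext q) = 0"
 shows "f = (%_. 0)"
proof -
 note hol = bergmanD(2)[OF f]
 note I1 = one_invariant and L1 = invariant_Linf[OF one_invariant]
 let ?W = "{p. polynomial_fun p & (ALL m:dominant. ALL q:poly_component m. form (%_. 1) p q = 0)}"
 have taylor_W: "taylor_part k f : ?W" for k
 proof -
  note P = taylor_part_polynomial[OF hol, of k]
  have "form (%_. 1) (taylor_part k f) q = 0" if m: "m : dominant" and q: "q : poly_component m" for m q
  proof (cases "weight_degree m = k")
   case True
   then have "form (%_. 1) (taylor_part k f) q = ip \<B> f (zero_ext q)"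
    using ip_taylor_part[OF f component_polynomial(1)[OF m q], of k] component_polynomial(2)[OF m q] by simp
   then show ?thesis using orth m q by simp
  next
   case False
   note Q = component_polynomial(1)[OF m q]
   have ct: "conj_transpose (mat 2 :: 'n cmat) = mat 2"
    by (simp add: conj_transpose_def cmat_def cvec_eq_iff)
   have "2 ^ k * form (%_. 1) (taylor_part k f) q = form (%_. 1) (%Z. taylor_part k f (mat 2 ** Z)) q"
    unfolding taylor_part_scalar[OF hol] form_linear(2)[OF L1 P P Q] ..
   also have "... = form (%_. 1) (taylor_part k f) (%Z. q (mat 2 ** Z))"
    using form_left[OF I1 P Q, of "mat 2"] by (simp add: ct)
   also have "... = 2 ^ weight_degree m * form (%_. 1) (taylor_part k f) q"
    unfolding component_polynomial(2)[OF m q] form_linear(4)[OF L1 Q Q P] by simp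
   finally have "(2 ^ k - 2 ^ weight_degree m) * form (%_. 1) (taylor_part k f) q = 0"
    by (simp add: left_diff_distrib)
   moreover have "cmod (2 ^ k) ~= cmod (2 ^ weight_degree m)" using False by (simp add: norm_power)
   then have "(2 :: complex) ^ k ~= 2 ^ weight_degree m" by metis
   ultimately show ?thesis by simp
  qed
  then show ?thesis using P by simp
 qed
 have W_sub: "fun_subspace ?W"
  unfolding fun_subspace_def
  using form_linear(1,2)[OF L1 _ _ component_polynomial(1)]
   form_linear(2)[OF L1 polynomial_fun.const polynomial_fun.const component_polynomial(1), of _ _ 0 0]
  by (auto intro: polynomial_fun.const polynomial_fun.add polynomial_fun_cmult)
 have inv_id: "invertible (mat 1 :: 'n cmat)" unfolding invertible_def by (rule exI[of _ "mat 1"]) simp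
 have W_right: "(%Z. p (Z ** B)) : ?W" if p: "p : ?W" and B: "invertible B" for p B
 proof -
  have "form (%_. 1) (%Z. p (Z ** B)) q = 0" if m: "m : dominant" and q: "q : poly_component m" for m q
  proof -
   have "(%Z. q (mat 1 ** Z ** conj_transpose B)) : poly_component m"
    using B by (intro component_polynomial(3)[OF m q inv_id]) (simp add: invertible_conj_transpose)
   then show ?thesis using p m form_right[OF I1 _ component_polynomial(1)[OF m q], of p B] by simp
  qed
  then show ?thesis using p by (simp add: polynomial_fun_right)
 qed
 have W_left: "(%Z. p (A ** Z)) : ?W" if p: "p : ?W" and A: "invertible A" for p A
 proof -
  have "form (%_. 1) (%Z. p (A ** Z)) q = 0" if m: "m : dominant" and q: "q : poly_component m" for m q
  proof -
   have "(%Z. q (conj_transpose A ** Z ** mat 1)) : poly_component m"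
    using A by (intro component_polynomial(3)[OF m q _ inv_id]) (simp add: invertible_conj_transpose)
   then show ?thesis using p m form_left[OF I1 _ component_polynomial(1)[OF m q], of p A] by simp
  qed
  then show ?thesis using p by (simp add: polynomial_fun_left)
 qed
 have "taylor_part k f Z = 0" for k Z
 proof (rule ccontr)
  assume "taylor_part k f Z ~= 0"
  from biinvariant_subspace_contains_hw_poly[OF W_sub _ W_right W_left taylor_W this]
  obtain \<alpha> \<Delta> where \<alpha>: "antimono \<alpha>" and \<Delta>: "hw_poly \<alpha> \<Delta>" and \<Delta>W: "\<Delta> : ?W" by blast
  define m :: "int^('n::{finite,linorder})" where "m = (\<chi> i. int (\<alpha> i))"
  have m: "m : dominant" using \<alpha> by (auto simp: m_def dominant_weights_def antimono_def)
  have hm: "hw_poly (%i. nat (m $ i)) \<Delta>" using \<Delta> by (simp add: m_def)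
  interpret hw_module "%i. nat (m $ i)" \<Delta> by unfold_locales (rule hm)
  have "\<Delta> : poly_component m" unfolding poly_component_eq[OF m hm] by (rule hw_in_bi_module)
  then have "form (%_. 1) \<Delta> \<Delta> = 0" using \<Delta>W m by blast
  then show False using hw_nrm_nonzero[OF \<Delta>] by (simp add: form_one ip_self)
 qed
 then have on_D: "f Z = 0" if "Z : cartan_domain" for Z
  using zero_if_taylor_parts_zero[OF hol _ that] by blast
 show ?thesis
 proof
  fix Z show "f Z = 0" using on_D[of Z] bergmanD(3)[OF f, of Z] by blast
 qed
qed

section \<open>The Hilbert direct sum\<close>

lemma bergman_component_subspace:
 assumes "m : dominant"
 shows "fun_subspace (bergman_component m)"
proof -
 note SD = fun_subspaceD[OF component_subspace[OF assms]]
 have z: "zero_ext (%_ :: 'n cmat. 0) = (%_. 0)" by (simp add: zero_ext_def fun_eq_iff)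
 show ?thesis
  unfolding fun_subspace_def
 proof (intro conjI ballI allI)
  show "(%_. 0) : bergman_component m"
   using imageI[OF SD(1), of zero_ext] unfolding bergman_component_def z .
  fix f assume "f : bergman_component m"
  then obtain p where p: "f = zero_ext p" "p : poly_component m" unfolding bergman_component_def by blast
  show "(%x. c * f x) : bergman_component m" for c
   using imageI[OF SD(3)[OF p(2)], of zero_ext] unfolding bergman_component_def p(1) zero_ext_cmult .
  fix g assume "g : bergman_component m"
  then obtain q where q: "g = zero_ext q" "q : poly_component m" unfolding bergman_component_def by blast
  show "(%x. f x + g x) : bergman_component m"
   using imageI[OF SD(2)[OF p(2) q(2)], of zero_ext] unfolding bergman_component_def p(1) q(1) zero_ext_add .
 qed
qed

lemma bergman_component_sub: "m : dominant ==> bergman_component m <= \<A>"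
 unfolding bergman_component_def using component_polynomial(1) zero_ext_polynomial by blast

lemma bergman_component_orthogonal:
 assumes "m : dominant" "m' : dominant" "m ~= m'" "f : bergman_component m" "g : bergman_component m'"
 shows "ip \<B> f g = 0"
 using component_form_orthogonal[OF one_invariant assms(1-3)] assms(4,5)
 unfolding bergman_component_def form_one by blast

lemma orthogonal_imp_zero:
 assumes "f : \<A>" "ALL m:dominant. ALL g:bergman_component m. ip \<B> f g = 0"
 shows "f = (%_. 0)"
 using orthogonal_to_components_imp_zero[OF assms(1)] assms(2) unfolding bergman_component_def by blast

lemma bergman_component_finite_span:
 assumes m: "m : dominant"
 shows "EX T. finite T & bergman_component m = cfun.span T"
proof -
 obtain T where T: "finite T" "poly_component m = cfun.span T" using component_finite_dim[OF m] by blast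
 have "bergman_component m = cfun.span (zero_ext ` T)"
 proof
  have "T <= poly_component m" unfolding T(2) by (rule cfun.span_superset)
  then have "zero_ext ` T <= bergman_component m" unfolding bergman_component_def by blast
  then show "cfun.span (zero_ext ` T) <= bergman_component m"
   by (rule span_le_fun_subspace[OF _ bergman_component_subspace[OF m]])
  note SD = fun_subspaceD[OF fun_subspace_span[of "zero_ext ` T"]]
  let ?V = "{p. zero_ext p : cfun.span (zero_ext ` T)}"
  have "zero_ext (%_ :: 'n cmat. 0) = (%_. 0)" by (simp add: zero_ext_def fun_eq_iff)
  then have "zero_ext (%_ :: 'n cmat. 0) : cfun.span (zero_ext ` T)" using SD(1) by (simp only:)
  then have "fun_subspace ?V" unfolding fun_subspace_def using SD(2,3) by (simp add: zero_ext_add zero_ext_cmult)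
  moreover have "T <= ?V" by (rule subsetI, rule CollectI, rule cfun.span_base, rule imageI)
  ultimately have "cfun.span T <= ?V" by (intro span_le_fun_subspace)
  then show "bergman_component m <= cfun.span (zero_ext ` T)" unfolding bergman_component_def T(2) by blast
 qed
 then show ?thesis using T(1) by blast
qed

lemma fun_subspace_orthogonal: "u : sq_int \<B> ==> fun_subspace {h : sq_int \<B>. ip \<B> u h = 0}"
 unfolding fun_subspace_def
 using ip_linear_right(1)[of _ \<B> _ u] ip_linear_right(3)[of _ \<B> _ u] sq_int_add[of _ \<B>] sq_int_scale[of _ \<B>]
 by (auto simp: sq_int_zero ip_def)

definition partial_span :: "(int^('n::{finite,linorder})) set => ('n cmat => complex) set" where
 "partial_span F = cfun.span (\<Union>m\<in>F. bergman_component m)"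

lemma partial_span_le:
 assumes "fun_subspace V" "!!m. m : F ==> bergman_component m <= V"
 shows "partial_span F <= V"
 unfolding partial_span_def using assms by (intro span_le_fun_subspace) auto

lemma partial_span_sub: "F <= dominant ==> partial_span F <= \<A>"
 using bergman_component_sub by (intro partial_span_le fun_subspace_bergman) blast

lemma component_in_partial_span: "m : F ==> bergman_component m <= partial_span F"
 unfolding partial_span_def by (rule subsetI, rule cfun.span_base) blast

lemma partial_span_mono: "F <= G ==> partial_span F <= partial_span G"
 unfolding partial_span_def by (rule cfun.span_mono) blast

lemma fun_subspace_partial_span: "fun_subspace (partial_span F)"
 unfolding partial_span_def by (rule fun_subspace_span)

lemma partial_span_finite:
 assumes "w : partial_span dominant"
 shows "EX F. finite F & F <= dominant & w : partial_span F"
proof -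
 let ?V = "{w. EX F. finite F & F <= dominant & w : partial_span F}"
 have "fun_subspace ?V"
  unfolding fun_subspace_def
 proof (intro conjI ballI allI)
  show "(%_. 0) : ?V"
   by (intro CollectI exI[of _ "{}"] conjI fun_subspaceD(1)[OF fun_subspace_partial_span]) simp_all
  show "(%x. c * f x) : ?V" if fV: "f : ?V" for c f
  proof -
   obtain F where F: "finite F" "F <= dominant" "f : partial_span F" using fV by blast
   show ?thesis
    by (intro CollectI exI[of _ F] conjI F(1,2) fun_subspaceD(3)[OF fun_subspace_partial_span F(3)])
  qed
  show "(%x. f x + g x) : ?V" if "f : ?V" "g : ?V" for f g
  proof -
   obtain F G where F: "finite F" "F <= dominant" "f : partial_span F"
    and G: "finite G" "G <= dominant" "g : partial_span G" using \<open>f : ?V\<close> \<open>g : ?V\<close> by blast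
   have "f : partial_span (F \<union> G)" "g : partial_span (F \<union> G)"
    using F(3) G(3) partial_span_mono[of F "F \<union> G"] partial_span_mono[of G "F \<union> G"] by auto
   note sum = fun_subspaceD(2)[OF fun_subspace_partial_span this]
   have "finite (F \<union> G)" "F \<union> G <= dominant" using F G by auto
   then show ?thesis by (intro CollectI exI[of _ "F \<union> G"] conjI sum)
  qed
 qed
 moreover have "bergman_component m <= ?V" if "m : dominant" for m
  using component_in_partial_span[of m "{m}"] that by blast
 ultimately have "partial_span dominant <= ?V" by (intro partial_span_le)
 then show ?thesis using assms by blast
qed

text \<open>
  Project onto the algebraic sum of the components: the remainder is orthogonal to all of them.
\<close>

theorem components_dense:
 assumes f: "f : \<A>" and e: "0 < e"
 shows "EX w:partial_span dominant. nrm \<B> (%Z. f Z - w Z) < e"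
proof -
 have sub: "partial_span dominant <= \<A>" by (rule partial_span_sub) simp
 have "EX l:\<A>. (EX g. (ALL n. g n : partial_span dominant) & (%n. nrm \<B> (%x. g n x - l x)) \<longlonglongrightarrow> 0) \<and>
  (ALL h:partial_span dominant. ip \<B> (%x. f x - l x) h = 0)"
 proof (rule orthogonal_projection_exists[OF fun_subspace_partial_span])
  show "partial_span dominant <= sq_int \<B>" using sub bergman_sub by blast
  show "f : sq_int \<B>" by (rule bergmanD(1)[OF f])
  fix g :: "nat => 'n cmat => complex"
  assume g: "!!n. g n : partial_span dominant" and
   c: "ALL e>0. EX N. ALL m>=N. ALL n>=N. nrm \<B> (%x. g m x - g n x) < e"
  show "EX l:\<A>. (%n. nrm \<B> (%x. g n x - l x)) \<longlonglongrightarrow> 0"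
   by (rule bergman_complete[OF subsetD[OF sub g] c])
 qed (rule bergman_sub)
 then obtain l g where l: "l : \<A>" and g: "ALL n. g n : partial_span dominant"
  and lim: "(%n. nrm \<B> (%x. g n x - l x)) \<longlonglongrightarrow> 0"
  and orth: "ALL h:partial_span dominant. ip \<B> (%x. f x - l x) h = 0" by blast
 have "(%x. f x - l x) = (%_. 0)"
  using orth component_in_partial_span[of _ dominant]
  by (intro orthogonal_imp_zero bergman_diff[OF f l]) blast
 then have fl: "l = f" by (simp add: fun_eq_iff)
 from LIMSEQ_D[OF lim e] obtain n where "norm (nrm \<B> (%x. g n x - l x) - 0) < e" by blast
 then have "nrm \<B> (%Z. f Z - g n Z) < e"
  unfolding nrm_diff_commute[of \<B> f "g n"] fl by simp
 then show ?thesis by (rule bexI[OF _ spec[OF g]])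
qed

text \<open>
  Partial sums of the orthogonal projections are best approximations from finitely many components, so
  density yields convergence.
\<close>

theorem bergman_hilbert_direct_sum: "hilbert_direct_sum lam dominant bergman_component"
 unfolding hilbert_direct_sum_def L2_eqs
proof (intro conjI ballI impI)
 fix f assume f: "f : \<A>"
 note fS = bergmanD(1)[OF f]
 have "ALL m. EX g. m : dominant --> g : bergman_component m & (ALL h:bergman_component m. ip \<B> (%x. f x - g x) h = 0)"
 proof (rule allI, rule exI, rule impI)
  fix m assume m: "m : dominant"
  obtain T where T: "finite T" "bergman_component m = cfun.span T" using bergman_component_finite_span[OF m] by blast
  have "T <= bergman_component m" unfolding T(2) by (rule cfun.span_superset)
  then have "T <= sq_int \<B>" using bergman_component_sub[OF m] bergman_sub by blast
  from finite_span_projection[OF T(1) this fS]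
  have ex: "EX g. g : bergman_component m & (ALL h:bergman_component m. ip \<B> (%x. f x - g x) h = 0)"
   unfolding T(2)[symmetric] by blast
  show "(SOME g. g : bergman_component m & (ALL h:bergman_component m. ip \<B> (%x. f x - g x) h = 0)) : bergman_component m \<and>
   (ALL h:bergman_component m. ip \<B> (%x. f x - (SOME g. g : bergman_component m & (ALL h:bergman_component m. ip \<B> (%x. f x - g x) h = 0)) x) h = 0)"
   by (rule someI_ex[OF ex])
 qed
 from choice[OF this] obtain g where g0: "ALL m. m : dominant --> g m : bergman_component m \<and>
   (ALL h:bergman_component m. ip \<B> (%x. f x - g m x) h = 0)" ..
 then have gV: "g m : bergman_component m" if "m : dominant" for m using that by blast
 have gS: "g m : sq_int \<B>" if "m : dominant" for m
  using gV[OF that] bergman_component_sub[OF that] bergman_sub by blast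
 define s where "s F Z = (\<Sum>m\<in>F. g m Z)" for F Z
 have s_span: "s F : partial_span F" if "finite F" "F <= dominant" for F
  using that
 proof (induction F rule: finite_induct)
  case empty
  then show ?case unfolding s_def[abs_def] using fun_subspaceD(1)[OF fun_subspace_partial_span] by simp
 next
  case (insert m F)
  have "g m : partial_span (insert m F)" using gV insert.prems component_in_partial_span[of m "insert m F"] by blast
  moreover have "s F : partial_span (insert m F)" using insert partial_span_mono[of F "insert m F"] by blast
  moreover have "s (insert m F) = (%Z. g m Z + s F Z)" unfolding s_def[abs_def] using insert.hyps by simp
  ultimately show ?case using fun_subspaceD(2)[OF fun_subspace_partial_span] by simp
 qed
 have sS: "s F : sq_int \<B>" if "finite F" "F <= dominant" for F
  using s_span[OF that] partial_span_sub[OF that(2)] bergman_sub by blast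
 have ip_s: "ip \<B> (s F) h = ip \<B> (g n) h"
  if "finite F" "F <= dominant" "n : F" "h : bergman_component n" for F n h
 proof -
  have hS: "h : sq_int \<B>" using that bergman_component_sub bergman_sub by blast
  have "ip \<B> (s F) h = (\<Sum>m\<in>F. ip \<B> (g m) h)" using that(1,2)
  proof (induction F rule: finite_induct)
   case empty then show ?case by (simp add: s_def ip_def)
  next
   case (insert m F)
   have "s (insert m F) = (%Z. g m Z + s F Z)" unfolding s_def[abs_def] using insert.hyps by simp
   then show ?case using insert ip_linear(1)[OF gS[of m] sS[of F] hS] by simp
  qed
  also have "... = (\<Sum>m\<in>F. if m = n then ip \<B> (g n) h else 0)"
  proof (rule sum.cong[OF refl])
   fix m assume "m : F"
   then have "m : dominant" "n : dominant" using that(2,3) by auto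
   then show "ip \<B> (g m) h = (if m = n then ip \<B> (g n) h else 0)"
    using bergman_component_orthogonal[of m n "g m" h] gV[of m] that(4) by simp
  qed
  also have "... = ip \<B> (g n) h" using that by simp
  finally show ?thesis .
 qed
 have best: "nrm \<B> (%Z. f Z - s F Z) <= nrm \<B> (%Z. f Z - w Z)"
  if F: "finite F" "F <= dominant" and w: "w : partial_span F" for F w
 proof -
  define u where "u Z = f Z - s F Z" for Z
  have uS: "u : sq_int \<B>" unfolding u_def[abs_def] by (rule sq_int_diff[OF fS sS[OF F]])
  have "ip \<B> u h = 0" if n: "n : F" and h: "h : bergman_component n" for n h
  proof -
   have nd: "n : dominant" using n F by blast
   have hS: "h : sq_int \<B>" using h bergman_component_sub[OF nd] bergman_sub by blast
   have "ip \<B> u h = ip \<B> f h - ip \<B> (g n) h"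
    unfolding u_def[abs_def] ip_linear(2)[OF fS sS[OF F] hS] ip_s[OF F n h] ..
   also have "... = ip \<B> (%x. f x - g n x) h" by (rule ip_linear(2)[OF fS gS[OF nd] hS, symmetric])
   also have "... = 0" using g0 nd h by blast
   finally show ?thesis .
  qed
  moreover have "bergman_component n <= sq_int \<B>" if "n : F" for n
   using that F bergman_component_sub[of n] bergman_sub by blast
  ultimately have O: "partial_span F <= {h : sq_int \<B>. ip \<B> u h = 0}"
   by (intro partial_span_le fun_subspace_orthogonal[OF uS]) blast
  define v where "v Z = w Z - s F Z" for Z
  have "(%Z. w Z + (-1) * s F Z) : partial_span F"
   by (rule fun_subspaceD(2)[OF fun_subspace_partial_span w fun_subspaceD(3)[OF fun_subspace_partial_span s_span[OF F]]])
  then have "v : partial_span F" by (simp add: v_def[abs_def])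
  then have v: "v : sq_int \<B>" "ip \<B> u v = 0" using O by auto
  have "(nrm \<B> (%Z. u Z - 1 * v Z))^2 = (nrm \<B> u)^2 + (nrm \<B> v)^2"
   unfolding nrm_square_diff[OF uS v(1)] v(2) by simp
  then have "(nrm \<B> u)^2 <= (nrm \<B> (%Z. f Z - w Z))^2" by (simp add: u_def v_def)
  then have "nrm \<B> u <= nrm \<B> (%Z. f Z - w Z)" by (rule power2_le_imp_le) (rule nrm_nonneg)
  then show ?thesis by (simp add: u_def[abs_def])
 qed
 have "((%F. nrm \<B> (%Z. f Z - s F Z)) \<longlongrightarrow> 0) (finite_subsets_at_top dominant)"
 proof (rule tendstoI)
  fix e :: real assume e: "0 < e"
  from components_dense[OF f e] obtain w where w: "w : partial_span dominant" "nrm \<B> (%Z. f Z - w Z) < e" by blast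
  from partial_span_finite[OF w(1)] obtain F0 where F0: "finite F0" "F0 <= dominant" "w : partial_span F0" by blast
  have "dist (nrm \<B> (%Z. f Z - s F Z)) 0 < e" if F: "finite F" "F0 <= F" "F <= dominant" for F
  proof -
   have "w : partial_span F" using F0(3) partial_span_mono[OF F(2)] by blast
   from best[OF F(1,3) this] w(2) show ?thesis using nrm_nonneg[of \<B> "%Z. f Z - s F Z"] by simp
  qed
  then show "\<forall>\<^sub>F F in finite_subsets_at_top dominant. dist (nrm \<B> (%Z. f Z - s F Z)) 0 < e"
   unfolding eventually_finite_subsets_at_top using F0(1,2) by blast
 qed
 then show "EX g. (ALL \<mu>:dominant. g \<mu> : bergman_component \<mu>) \<and>
  ((%F. nrm \<B> (%Z. f Z - (\<Sum>\<mu>\<in>F. g \<mu> Z))) \<longlongrightarrow> 0) (finite_subsets_at_top dominant)"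
  unfolding s_def using gV by blast
next
 fix \<mu> assume \<mu>: "\<mu> : dominant"
 show "fun_subspace (bergman_component \<mu>)" by (rule bergman_component_subspace[OF \<mu>])
 show "bergman_component \<mu> <= \<A>" by (rule bergman_component_sub[OF \<mu>])
 fix \<nu> f g assume "\<nu> : dominant" "\<mu> ~= \<nu>" "f : bergman_component \<mu>" "g : bergman_component \<nu>"
 then show "ip \<B> f g = 0" by (rule bergman_component_orthogonal[OF \<mu>])
qed

end

section \<open>Toeplitz operators with invariant symbols\<close>

context weighted_bergman begin

lemma bergman_proj_eqI:
 assumes u: "u : sq_int \<B>" and g: "g : \<A>" and eq: "ALL h:\<A>. ip \<B> g h = ip \<B> u h"
 shows "bergman_proj lam u = g"
 unfolding bergman_proj_def L2_eqs
proof (rule the_equality)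
 show "g : \<A> & (ALL h:\<A>. ip \<B> (%Z. u Z - g Z) h = 0)"
  using ip_linear(2)[OF u bergmanD(1)[OF g]] bergmanD(1) eq g by simp
 fix k assume k: "k : \<A> & (ALL h:\<A>. ip \<B> (%Z. u Z - k Z) h = 0)"
 then have kA: "k : \<A>" by blast
 note d = bergman_diff[OF kA g]
 note dS = bergmanD(1)[OF d] and kS = bergmanD(1)[OF kA] and gS = bergmanD(1)[OF g]
 have "ip \<B> u (%Z. k Z - g Z) - ip \<B> k (%Z. k Z - g Z) = 0"
  using k d ip_linear(2)[OF u kS dS] by simp
 moreover have "ip \<B> g (%Z. k Z - g Z) = ip \<B> u (%Z. k Z - g Z)" using eq d by blast
 ultimately have "ip \<B> (%Z. k Z - g Z) (%Z. k Z - g Z) = 0"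
  unfolding ip_linear(2)[OF kS gS dS] by simp
 then have "nrm \<B> (%Z. k Z - g Z) = 0" by (simp add: ip_self)
 from fun_cong[OF nrm_zero_imp_zero[OF d this]] show "k = g" by (simp add: fun_eq_iff)
qed

lemma bergman_proj:
 assumes u: "u : sq_int \<B>"
 shows "bergman_proj lam u : \<A>" "h : \<A> ==> ip \<B> (bergman_proj lam u) h = ip \<B> u h"
proof -
 have "EX l:\<A>. (EX g. (ALL n. g n : \<A>) & (%n. nrm \<B> (%x. g n x - l x)) \<longlonglongrightarrow> 0) \<and>
  (ALL h:\<A>. ip \<B> (%x. u x - l x) h = 0)"
  by (rule orthogonal_projection_exists[OF fun_subspace_bergman bergman_sub bergman_sub u bergman_complete])
 then obtain l where l: "l : \<A>" "ALL h:\<A>. ip \<B> (%x. u x - l x) h = 0" by blast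
 have eq: "ALL h:\<A>. ip \<B> l h = ip \<B> u h"
 proof
  fix h assume h: "h : \<A>"
  have "ip \<B> u h - ip \<B> l h = 0"
   using l(2) h ip_linear(2)[OF u bergmanD(1)[OF l(1)] bergmanD(1)[OF h]] by simp
  then show "ip \<B> l h = ip \<B> u h" by simp
 qed
 have pl: "bergman_proj lam u = l" by (rule bergman_proj_eqI[OF u l(1) eq])
 show "bergman_proj lam u : \<A>" using l(1) pl by simp
 show "h : \<A> ==> ip \<B> (bergman_proj lam u) h = ip \<B> u h" using eq pl by simp
qed

lemma bergman_eqI:
 assumes f: "f : \<A>" and g: "g : \<A>" and eq: "!!h. h : \<A> ==> ip \<B> f h = ip \<B> g h"
 shows "f = g"
proof -
 note d = bergman_diff[OF f g]
 have "ip \<B> (%Z. f Z - g Z) (%Z. f Z - g Z) = 0"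
  using ip_linear(2)[OF bergmanD(1)[OF f] bergmanD(1)[OF g] bergmanD(1)[OF d]] eq[OF d] by simp
 then have "nrm \<B> (%Z. f Z - g Z) = 0" by (simp add: ip_self)
 from fun_cong[OF nrm_zero_imp_zero[OF d this]] show "f = g" by (simp add: fun_eq_iff)
qed

lemma bounded_opD:
 assumes X: "bounded_op lam (X :: 'n fun_op)"
 shows "f : \<A> ==> X f : \<A>" "f : \<A> ==> g : \<A> ==> X (%Z. f Z + g Z) = (%Z. X f Z + X g Z)"
  "f : \<A> ==> X (%Z. c * f Z) = (%Z. c * X f Z)"
 using X unfolding bounded_op_def by blast+

lemma bounded_op_bound:
 assumes X: "bounded_op lam (X :: 'n fun_op)"
 shows "EX C>=0. ALL f:\<A>. nrm \<B> (X f) <= C * nrm \<B> f"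
proof -
 obtain C where C: "ALL f:\<A>. nrm \<B> (X f) <= C * nrm \<B> f" using X unfolding bounded_op_def L2_eqs by blast
 have "ALL f:\<A>. nrm \<B> (X f) <= max C 0 * nrm \<B> f"
 proof
  fix f assume "f : \<A>"
  then have "nrm \<B> (X f) <= C * nrm \<B> f" using C by blast
  also have "... <= max C 0 * nrm \<B> f" by (intro mult_right_mono nrm_nonneg) simp
  finally show "nrm \<B> (X f) <= max C 0 * nrm \<B> f" .
 qed
 then show ?thesis by (intro exI[of _ "max C 0"]) simp
qed

lemma bounded_opI:
 fixes X :: "'n fun_op"
 assumes "!!f. f : \<A> ==> X f : \<A>" "!!f g. f : \<A> ==> g : \<A> ==> X (%Z. f Z + g Z) = (%Z. X f Z + X g Z)"
  "!!c f. f : \<A> ==> X (%Z. c * f Z) = (%Z. c * X f Z)" "!!f. f : \<A> ==> nrm \<B> (X f) <= C * nrm \<B> f"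
 shows "bounded_op lam X"
 unfolding bounded_op_def L2_eqs using assms by blast

lemma toeplitz_props:
 assumes a: "a : Linf_fun" and f: "f : \<A>"
 shows "toeplitz lam a f : \<A>" "h : \<A> ==> ip \<B> (toeplitz lam a f) h = ip \<B> (%Z. a Z * f Z) h"
 unfolding toeplitz_def by (rule bergman_proj[OF symbol_sq_int[OF a bergmanD(1)[OF f]]]; assumption)+

lemma toeplitz_bounded:
 assumes a: "a : Linf_fun"
 shows "bounded_op lam (toeplitz lam a :: 'n fun_op)"
proof -
 obtain C where C: "0 <= C" "ALL f:sq_int \<B>. (%Z. a Z * f Z) : sq_int \<B> & nrm \<B> (%Z. a Z * f Z) <= C * nrm \<B> f"
  using bounded_symbol[OF a] by blast
 note T = toeplitz_props[OF a]
 note VD = fun_subspaceD[OF fun_subspace_bergman]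
 note aS = symbol_sq_int[OF a bergmanD(1)]
 show ?thesis
 proof (rule bounded_opI)
  fix f assume f: "f : \<A>"
  show "toeplitz lam a f : \<A>" by (rule T(1)[OF f])
  note TS = bergmanD(1)[OF T(1)[OF f]]
  show "toeplitz lam a (%Z. c * f Z) = (%Z. c * toeplitz lam a f Z)" for c
  proof (rule bergman_eqI[OF T(1)[OF VD(3)[OF f]] VD(3)[OF T(1)[OF f]]])
   fix h assume h: "h : \<A>"
   note hS = bergmanD(1)[OF h]
   show "ip \<B> (toeplitz lam a (%Z. c * f Z)) h = ip \<B> (%Z. c * toeplitz lam a f Z) h"
    unfolding T(2)[OF VD(3)[OF f] h] ip_linear(3)[OF TS TS hS] T(2)[OF f h] ip_linear(3)[OF aS[OF f] aS[OF f] hS, symmetric]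
    by (simp add: mult.left_commute)
  qed
  show "toeplitz lam a (%Z. f Z + g Z) = (%Z. toeplitz lam a f Z + toeplitz lam a g Z)" if g: "g : \<A>" for g
  proof (rule bergman_eqI[OF T(1)[OF VD(2)[OF f g]] VD(2)[OF T(1)[OF f] T(1)[OF g]]])
   fix h assume h: "h : \<A>"
   note hS = bergmanD(1)[OF h]
   show "ip \<B> (toeplitz lam a (%Z. f Z + g Z)) h = ip \<B> (%Z. toeplitz lam a f Z + toeplitz lam a g Z) h"
    unfolding T(2)[OF VD(2)[OF f g] h] ip_linear(1)[OF TS bergmanD(1)[OF T(1)[OF g]] hS] T(2)[OF f h] T(2)[OF g h]
     ip_linear(1)[OF aS[OF f] aS[OF g] hS, symmetric]
    by (simp add: distrib_left)
  qed
  show "nrm \<B> (toeplitz lam a f) <= C * nrm \<B> f"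
  proof (cases "nrm \<B> (toeplitz lam a f) = 0")
   case True
   then show ?thesis using C(1) nrm_nonneg[of \<B> f] by simp
  next
   case False
   let ?t = "toeplitz lam a f"
   have pos: "0 < nrm \<B> ?t" using False nrm_nonneg[of \<B> ?t] by simp
   have "of_real ((nrm \<B> ?t)^2) = ip \<B> (%Z. a Z * f Z) ?t"
    unfolding ip_self[symmetric] by (rule T(2)[OF f T(1)[OF f]])
   then have "cmod (of_real ((nrm \<B> ?t)^2)) <= nrm \<B> (%Z. a Z * f Z) * nrm \<B> ?t"
    using ip_Cauchy_Schwarz[OF aS[OF f] TS] by simp
   then have "(nrm \<B> ?t)^2 <= nrm \<B> (%Z. a Z * f Z) * nrm \<B> ?t" unfolding norm_of_real by simp
   then have "nrm \<B> ?t <= nrm \<B> (%Z. a Z * f Z)" using pos by (simp add: power2_eq_square)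
   also have "... <= C * nrm \<B> f" using C(2) bergmanD(1)[OF f] by blast
   finally show ?thesis .
  qed
 qed
qed

lemma component_bergman:
 assumes "m : dominant" "f : bergman_component m" shows "f : \<A>"
 using bergman_component_sub[OF assms(1)] assms(2) by blast

text \<open>Schur's lemma for the invariant form of the symbol.\<close>

lemma toeplitz_component:
 assumes a: "a : invariant_symbols" and m: "m : dominant"
 shows "EX c. ALL f:bergman_component m. toeplitz lam a f = (%Z. c * f Z)"
proof -
 note aL = invariant_Linf[OF a]
 obtain \<gamma> where \<gamma>: "ALL p:poly_component m. ALL q:poly_component m. form a p q = \<gamma> * ip \<B> (zero_ext p) (zero_ext q)"
  using component_form_scalar[OF a m] by blast
 have "toeplitz lam a f = (%Z. \<gamma> * f Z)" if fV: "f : bergman_component m" for f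
 proof -
  obtain p where p: "f = zero_ext p" "p : poly_component m" using fV unfolding bergman_component_def by blast
  have f: "f : \<A>" by (rule component_bergman[OF m fV])
  note T = toeplitz_props[OF aL f] and fS = bergmanD(1)[OF f]
  note gf = fun_subspaceD(3)[OF fun_subspace_bergman f, of \<gamma>]
  note d = bergman_diff[OF T(1) gf]
  have "(%Z. toeplitz lam a f Z - \<gamma> * f Z) = (%_. 0)"
  proof (rule orthogonal_imp_zero[OF d], intro ballI)
   fix m' g assume m': "m' : dominant" and gV: "g : bergman_component m'"
   obtain q where q: "g = zero_ext q" "q : poly_component m'" using gV unfolding bergman_component_def by blast
   have g: "g : \<A>" by (rule component_bergman[OF m' gV])
   note gS = bergmanD(1)[OF g]
   have form_eq: "form a p q = \<gamma> * ip \<B> f g"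
   proof (cases "m = m'")
    case True
    then show ?thesis using \<gamma> p q by blast
   next
    case False
    then show ?thesis
     using component_form_orthogonal[OF a m m' False p(2) q(2)]
      bergman_component_orthogonal[OF m m' False fV gV] by simp
   qed
   have "ip \<B> (%Z. toeplitz lam a f Z - \<gamma> * f Z) g = ip \<B> (toeplitz lam a f) g - ip \<B> (%Z. \<gamma> * f Z) g"
    by (rule ip_linear(2)[OF bergmanD(1)[OF T(1)] bergmanD(1)[OF gf] gS])
   also have "ip \<B> (toeplitz lam a f) g = form a p q" using T(2)[OF g] by (simp only: form_def p(1) q(1))
   also have "ip \<B> (%Z. \<gamma> * f Z) g = \<gamma> * ip \<B> f g" by (rule ip_linear(3)[OF fS fS gS])
   finally show "ip \<B> (%Z. toeplitz lam a f Z - \<gamma> * f Z) g = 0" using form_eq by simp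
  qed
  then show ?thesis by (simp add: fun_eq_iff)
 qed
 then show ?thesis by blast
qed

lemma cnj_invariant:
 assumes a: "a : (invariant_symbols :: ('n cmat => complex) set)"
 shows "(%Z. cnj (a Z)) : invariant_symbols"
proof -
 have "cnj : borel_measurable borel" by (intro borel_measurable_continuous_onI continuous_intros)
 from measurable_compose[OF _ this, of a "domain_lebesgue :: 'n cmat measure"]
 show ?thesis using a by (simp add: invariant_symbols_def Linf_fun_def)
qed

section \<open>Operators that are scalar on every component\<close>

definition diagonal_ops :: "'n fun_op set" where
 "diagonal_ops = {X. bounded_op lam X & (ALL m:dominant. EX c. ALL f:bergman_component m. X f = (%Z. c * f Z))}"

definition has_adjoint :: "'n fun_op => 'n fun_op => bool" where
 "has_adjoint X Y \<longleftrightarrow> (ALL f:\<A>. ALL g:\<A>. ip \<B> (X f) g = ip \<B> f (Y g))"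

lemma id_bounded: "bounded_op lam (id :: 'n fun_op)"
 by (rule bounded_opI[where C=1]) simp_all

lemma add_bounded:
 assumes X: "bounded_op lam (X :: 'n fun_op)" and Y: "bounded_op lam Y"
 shows "bounded_op lam (%f Z. X f Z + Y f Z)"
proof -
 note VD = fun_subspaceD[OF fun_subspace_bergman]
 from bounded_op_bound[OF X] obtain C where C: "ALL f:\<A>. nrm \<B> (X f) <= C * nrm \<B> f" by blast
 from bounded_op_bound[OF Y] obtain D where D: "ALL f:\<A>. nrm \<B> (Y f) <= D * nrm \<B> f" by blast
 show ?thesis
 proof (rule bounded_opI[where C="C + D"])
  fix f assume f: "f : \<A>"
  note XY = bounded_opD(1)[OF X f] bounded_opD(1)[OF Y f]
  show "(%Z. X f Z + Y f Z) : \<A>" by (rule VD(2)[OF XY])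
  show "(%Z. X (%Z. c * f Z) Z + Y (%Z. c * f Z) Z) = (%Z. c * (X f Z + Y f Z))" for c
   by (simp add: bounded_opD(3)[OF X f] bounded_opD(3)[OF Y f] distrib_left)
  show "(%Z. X (%Z. f Z + g Z) Z + Y (%Z. f Z + g Z) Z) = (%Z. X f Z + Y f Z + (X g Z + Y g Z))" if "g : \<A>" for g
   by (simp add: bounded_opD(2)[OF X f that] bounded_opD(2)[OF Y f that] add_ac)
  have "nrm \<B> (%Z. X f Z + Y f Z) <= nrm \<B> (X f) + nrm \<B> (Y f)"
   by (rule nrm_triangle[OF bergmanD(1)[OF XY(1)] bergmanD(1)[OF XY(2)]])
  also have "... <= C * nrm \<B> f + D * nrm \<B> f" by (rule add_mono[OF bspec[OF C f] bspec[OF D f]])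
  finally show "nrm \<B> (%Z. X f Z + Y f Z) <= (C + D) * nrm \<B> f" by (simp add: distrib_right)
 qed
qed

lemma scale_bounded:
 assumes X: "bounded_op lam (X :: 'n fun_op)"
 shows "bounded_op lam (%f Z. k * X f Z)"
proof -
 note VD = fun_subspaceD[OF fun_subspace_bergman]
 from bounded_op_bound[OF X] obtain C where C: "ALL f:\<A>. nrm \<B> (X f) <= C * nrm \<B> f" by blast
 show ?thesis
 proof (rule bounded_opI[where C="cmod k * C"])
  fix f assume f: "f : \<A>"
  show "(%Z. k * X f Z) : \<A>" by (rule VD(3)[OF bounded_opD(1)[OF X f]])
  show "(%Z. k * X (%Z. c * f Z) Z) = (%Z. c * (k * X f Z))" for c
   by (simp add: bounded_opD(3)[OF X f] mult.left_commute)
  show "(%Z. k * X (%Z. f Z + g Z) Z) = (%Z. k * X f Z + k * X g Z)" if "g : \<A>" for g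
   by (simp add: bounded_opD(2)[OF X f that] distrib_left)
  have "cmod k * nrm \<B> (X f) <= cmod k * (C * nrm \<B> f)" by (rule mult_left_mono[OF bspec[OF C f]]) simp
  then show "nrm \<B> (%Z. k * X f Z) <= cmod k * C * nrm \<B> f" by (simp add: nrm_scale mult.assoc)
 qed
qed

lemma comp_bounded:
 assumes X: "bounded_op lam (X :: 'n fun_op)" and Y: "bounded_op lam Y"
 shows "bounded_op lam (X \<circ> Y)"
proof -
 from bounded_op_bound[OF X] obtain C where C: "0 <= C" "ALL f:\<A>. nrm \<B> (X f) <= C * nrm \<B> f" by blast
 from bounded_op_bound[OF Y] obtain D where D: "ALL f:\<A>. nrm \<B> (Y f) <= D * nrm \<B> f" by blast
 show ?thesis
 proof (rule bounded_opI[where C="C * D"])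
  fix f assume f: "f : \<A>"
  note Yf = bounded_opD(1)[OF Y f]
  show "(X \<circ> Y) f : \<A>" using bounded_opD(1)[OF X Yf] by simp
  show "(X \<circ> Y) (%Z. c * f Z) = (%Z. c * (X \<circ> Y) f Z)" for c
   by (simp add: bounded_opD(3)[OF Y f] bounded_opD(3)[OF X Yf])
  show "(X \<circ> Y) (%Z. f Z + g Z) = (%Z. (X \<circ> Y) f Z + (X \<circ> Y) g Z)" if g: "g : \<A>" for g
   by (simp add: bounded_opD(2)[OF Y f g] bounded_opD(2)[OF X Yf bounded_opD(1)[OF Y g]])
  have "nrm \<B> (X (Y f)) <= C * nrm \<B> (Y f)" by (rule bspec[OF C(2) Yf])
  also have "... <= C * (D * nrm \<B> f)" by (rule mult_left_mono[OF bspec[OF D f] C(1)])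
  finally show "nrm \<B> ((X \<circ> Y) f) <= C * D * nrm \<B> f" by (simp add: mult.assoc)
 qed
qed

lemma hw_component_element:
 assumes m: "m : dominant"
 shows "EX f:bergman_component m. nrm \<B> f ~= 0"
proof -
 obtain \<Delta> where \<Delta>: "hw_poly (%i. nat (m $ i)) \<Delta>" using hw_poly_dominant_weight[OF m] by blast
 interpret hw_module "%i. nat (m $ i)" \<Delta> by unfold_locales (rule \<Delta>)
 have "\<Delta> : poly_component m" unfolding poly_component_eq[OF m \<Delta>] by (rule hw_in_bi_module)
 then show ?thesis using hw_nrm_nonzero[OF \<Delta>] unfolding bergman_component_def by blast
qed

text \<open>
  The eigenvalue of the limit can be read off from a fixed nonzero vector of the component, which controls the
  eigenvalues of the approximating operators.
\<close>

lemma diagonal_limit: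
 assumes X: "bounded_op lam (X :: 'n fun_op)" and m: "m : dominant"
  and appr: "ALL e>0. EX Y:diagonal_ops. ALL f:\<A>. nrm \<B> (%Z. X f Z - Y f Z) <= e * nrm \<B> f"
 shows "EX c. ALL f:bergman_component m. X f = (%Z. c * f Z)"
proof -
 obtain f0 where f0V: "f0 : bergman_component m" and n0: "nrm \<B> f0 ~= 0" using hw_component_element[OF m] by blast
 note f0 = component_bergman[OF m f0V]
 note f0S = bergmanD(1)[OF f0] and Xf0 = bounded_opD(1)[OF X f0]
 note VD = fun_subspaceD[OF fun_subspace_bergman]
 define c where "c = ip \<B> (X f0) f0 / ip \<B> f0 f0"
 have pos: "0 < nrm \<B> f0" using n0 nrm_nonneg[of \<B> f0] by simp
 have "X f = (%Z. c * f Z)" if fV: "f : bergman_component m" for f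
 proof -
  note f = component_bergman[OF m fV]
  note Xf = bounded_opD(1)[OF X f] and cf = VD(3)[OF f]
  have bound: "nrm \<B> (%Z. X f Z - c * f Z) <= 2 * e * nrm \<B> f" if e: "0 < e" for e
  proof -
   obtain Y where Y: "Y : diagonal_ops" "ALL f:\<A>. nrm \<B> (%Z. X f Z - Y f Z) <= e * nrm \<B> f" using appr e by blast
   then obtain y where y: "ALL f:bergman_component m. Y f = (%Z. y * f Z)" using m unfolding diagonal_ops_def by blast
   have near: "nrm \<B> (%Z. X f Z - y * f Z) <= e * nrm \<B> f" using Y(2) f y fV by fastforce
   have near0: "nrm \<B> (%Z. X f0 Z - y * f0 Z) <= e * nrm \<B> f0" using Y(2) f0 y f0V by fastforce
   have d0: "(%Z. X f0 Z - y * f0 Z) : sq_int \<B>" by (rule bergmanD(1)[OF bergman_diff[OF Xf0 VD(3)[OF f0]]])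
   have "ip \<B> (%Z. X f0 Z - y * f0 Z) f0 = ip \<B> (X f0) f0 - y * ip \<B> f0 f0"
    unfolding ip_linear(2)[OF bergmanD(1)[OF Xf0] bergmanD(1)[OF VD(3)[OF f0]] f0S] ip_linear(3)[OF f0S f0S f0S] ..
   also have "... = (c - y) * ip \<B> f0 f0" using n0 by (simp add: c_def ip_self left_diff_distrib)
   finally have "cmod ((c - y) * ip \<B> f0 f0) <= e * nrm \<B> f0 * nrm \<B> f0"
    using ip_Cauchy_Schwarz[OF d0 f0S] mult_right_mono[OF near0 nrm_nonneg[of \<B> f0]] by simp
   then have "cmod (c - y) * (nrm \<B> f0)^2 <= e * (nrm \<B> f0)^2"
    by (simp add: norm_mult ip_self norm_power power2_eq_square nrm_nonneg mult.assoc)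
   then have cy: "cmod (y - c) <= e" using pos by (simp add: norm_minus_commute)
   have "nrm \<B> (%Z. X f Z - c * f Z) <= nrm \<B> (%Z. X f Z - y * f Z) + nrm \<B> (%Z. y * f Z - c * f Z)"
    by (rule nrm_triangle_diff[OF bergmanD(1)[OF Xf] bergmanD(1)[OF cf] bergmanD(1)[OF cf]])
   also have "nrm \<B> (%Z. y * f Z - c * f Z) = cmod (y - c) * nrm \<B> f"
    unfolding left_diff_distrib[symmetric] by (rule nrm_scale)
   also have "... <= e * nrm \<B> f" by (rule mult_right_mono[OF cy nrm_nonneg])
   finally show ?thesis using near by simp
  qed
  have "nrm \<B> (%Z. X f Z - c * f Z) <= 0"
  proof (rule field_le_epsilon)
   fix e :: real assume e: "0 < e"
   have p: "0 < 2 * (nrm \<B> f + 1)" using nrm_nonneg[of \<B> f] by simp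
   have "nrm \<B> (%Z. X f Z - c * f Z) <= 2 * (e / (2 * (nrm \<B> f + 1))) * nrm \<B> f"
    by (rule bound[OF divide_pos_pos[OF e p]])
   also have "... = e * (nrm \<B> f / (nrm \<B> f + 1))" by (simp add: divide_simps)
   also have "... <= e * 1" using e nrm_nonneg[of \<B> f] by (intro mult_left_mono) (auto simp: divide_le_eq)
   finally show "nrm \<B> (%Z. X f Z - c * f Z) <= 0 + e" by simp
  qed
  then have "nrm \<B> (%Z. X f Z - c * f Z) = 0" using nrm_nonneg[of \<B> "%Z. X f Z - c * f Z"] by simp
  from fun_cong[OF nrm_zero_imp_zero[OF bergman_diff[OF Xf cf] this]]
  show ?thesis by (simp add: fun_eq_iff)
 qed
 then show ?thesis by blast
qed

lemma diagonal_opsD: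
 assumes "X : diagonal_ops"
 shows "bounded_op lam X" "m : dominant ==> EX c. ALL f:bergman_component m. X f = (%Z. c * f Z)"
 using assms by (auto simp: diagonal_ops_def)

theorem diagonal_ops_algebra: "closed_unital_algebra lam diagonal_ops"
 unfolding closed_unital_algebra_def L2_eqs
proof (intro conjI ballI allI impI)
 show "bounded_op lam X" if "X : diagonal_ops" for X by (rule diagonal_opsD(1)[OF that])
 show "id : diagonal_ops"
  unfolding diagonal_ops_def by (auto simp: id_bounded intro!: exI[of _ 1])
 fix X :: "'n fun_op"
 show "X : diagonal_ops" if h: "bounded_op lam X \<and>
   (ALL e>0. EX Y:diagonal_ops. ALL f:\<A>. nrm \<B> (%Z. X f Z - Y f Z) <= e * nrm \<B> f)"
  unfolding diagonal_ops_def using h diagonal_limit[of X] by blast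
 assume X: "X : diagonal_ops"
 note Xb = diagonal_opsD(1)[OF X]
 show "(%f Z. c * X f Z) : diagonal_ops" for c
  unfolding diagonal_ops_def
 proof (intro CollectI conjI ballI)
  fix m assume m: "m : dominant"
  then obtain x where x: "ALL f:bergman_component m. X f = (%Z. x * f Z)" using diagonal_opsD(2)[OF X] by blast
  have "(%Z. c * X f Z) = (%Z. (c * x) * f Z)" if f: "f : bergman_component m" for f
   unfolding bspec[OF x f] by (simp only: mult.assoc)
  then show "EX x. ALL f:bergman_component m. (%Z. c * X f Z) = (%Z. x * f Z)"
   by (intro exI[of _ "c * x"] ballI)
 qed (rule scale_bounded[OF Xb])
 fix Y :: "'n fun_op" assume Y: "Y : diagonal_ops"
 note Yb = diagonal_opsD(1)[OF Y]
 show "(%f Z. X f Z + Y f Z) : diagonal_ops"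
  unfolding diagonal_ops_def
 proof (intro CollectI conjI ballI)
  fix m assume m: "m : dominant"
  obtain x where x: "ALL f:bergman_component m. X f = (%Z. x * f Z)" using diagonal_opsD(2)[OF X m] by blast
  obtain y where y: "ALL f:bergman_component m. Y f = (%Z. y * f Z)" using diagonal_opsD(2)[OF Y m] by blast
  have "(%Z. X f Z + Y f Z) = (%Z. (x + y) * f Z)" if f: "f : bergman_component m" for f
   unfolding bspec[OF x f] bspec[OF y f] by (simp only: distrib_right)
  then show "EX x. ALL f:bergman_component m. (%Z. X f Z + Y f Z) = (%Z. x * f Z)"
   by (intro exI[of _ "x + y"] ballI)
 qed (rule add_bounded[OF Xb Yb])
 show "X \<circ> Y : diagonal_ops"
  unfolding diagonal_ops_def
 proof (intro CollectI conjI ballI)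
  fix m assume m: "m : dominant"
  obtain x where x: "ALL f:bergman_component m. X f = (%Z. x * f Z)" using diagonal_opsD(2)[OF X m] by blast
  obtain y where y: "ALL f:bergman_component m. Y f = (%Z. y * f Z)" using diagonal_opsD(2)[OF Y m] by blast
  have "(X \<circ> Y) f = (%Z. (y * x) * f Z)" if f: "f : bergman_component m" for f
   unfolding o_apply bspec[OF y f] bounded_opD(3)[OF Xb component_bergman[OF m f], of y] bspec[OF x f] by (simp only: mult.assoc)
  then show "EX x. ALL f:bergman_component m. (X \<circ> Y) f = (%Z. x * f Z)" by (intro exI[of _ "y * x"] ballI)
 qed (rule comp_bounded[OF Xb Yb])
qed

lemma toeplitz_diagonal: "toeplitz lam ` invariant_symbols <= diagonal_ops"
proof
 fix X assume "X : toeplitz lam ` (invariant_symbols :: ('n cmat => complex) set)"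
 then obtain a :: "'n cmat => complex" where a: "a : invariant_symbols" "X = toeplitz lam a" by blast
 show "X : diagonal_ops"
  unfolding diagonal_ops_def a(2)
  by (intro CollectI conjI ballI toeplitz_bounded[OF invariant_Linf[OF a(1)]] toeplitz_component[OF a(1)])
qed

abbreviation "Talg \<equiv> toeplitz_algebra lam (invariant_symbols :: ('n cmat => complex) set)"

lemma Talg_diagonal: "Talg <= diagonal_ops"
 unfolding toeplitz_algebra_def
 by (rule Inter_lower, intro CollectI conjI diagonal_ops_algebra toeplitz_diagonal)

lemma Talg_least: "closed_unital_algebra lam \<X> ==> toeplitz lam ` invariant_symbols <= \<X> ==> Talg <= \<X>"
 unfolding toeplitz_algebra_def by (rule Inter_lower, intro CollectI conjI)

text \<open>
  The vectors with this property form a subspace that contains every component, so the claim follows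
  by continuity.
\<close>

lemma diagonal_ip:
 assumes X: "X : diagonal_ops" and m: "m : dominant"
  and c: "ALL f:bergman_component m. X f = (%Z. c * f Z)"
  and f: "f : \<A>" and q: "q : bergman_component m"
 shows "ip \<B> (X f) q = c * ip \<B> f q"
proof -
 note Xb = diagonal_opsD(1)[OF X] and qA = component_bergman[OF m q]
 note qS = bergmanD(1)[OF qA] and VD = fun_subspaceD[OF fun_subspace_bergman]
 obtain C where C: "0 <= C" "ALL f:\<A>. nrm \<B> (X f) <= C * nrm \<B> f" using bounded_op_bound[OF Xb] by blast
 let ?V = "{w : \<A>. ip \<B> (X w) q = c * ip \<B> w q}"
 have XS: "X w : sq_int \<B>" if "w : \<A>" for w by (rule bergmanD(1)[OF bounded_opD(1)[OF Xb that]])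
 have scale: "(%x. k * w x) : ?V" if w: "w : ?V" for k w
 proof -
  have wA: "w : \<A>" using w by blast
  show ?thesis
   using w VD(3)[OF wA] ip_linear(3)[OF XS[OF wA] XS[OF wA] qS] ip_linear(3)[OF bergmanD(1)[OF wA] bergmanD(1)[OF wA] qS]
   by (simp add: bounded_opD(3)[OF Xb wA])
 qed
 have "fun_subspace ?V"
  unfolding fun_subspace_def
 proof (intro conjI ballI allI)
  show "(%x. k * w x) : ?V" if w: "w : ?V" for k w by (rule scale[OF w])
  have "(%x. 0 * q x) : ?V"
   using VD(3)[OF qA, of 0] bounded_opD(3)[OF Xb qA, of 0] by (simp add: ip_def)
  then show "(%_. 0) : ?V" by simp
  show "(%x. v x + w x) : ?V" if v: "v : ?V" and w: "w : ?V" for v w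
  proof -
   have vA: "v : \<A>" and wA: "w : \<A>" using v w by blast+
   show ?thesis
    using v w VD(2)[OF vA wA] ip_linear(1)[OF XS[OF vA] XS[OF wA] qS] ip_linear(1)[OF bergmanD(1)[OF vA] bergmanD(1)[OF wA] qS]
    by (simp add: bounded_opD(2)[OF Xb vA wA] distrib_left)
  qed
 qed
 moreover have "bergman_component n <= ?V" if n: "n : dominant" for n
 proof
  fix w assume wV: "w : bergman_component n"
  note wA = component_bergman[OF n wV]
  note wS = bergmanD(1)[OF wA]
  obtain y where "ALL f:bergman_component n. X f = (%Z. y * f Z)" using diagonal_opsD(2)[OF X n] by blast
  then have Xw: "X w = (%Z. y * w Z)" using wV by blast
  show "w : ?V"
  proof (cases "n = m")
   case True
   then have "X w = (%Z. c * w Z)" using c wV by blast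
   then show ?thesis using wA ip_linear(3)[OF wS wS qS] by simp
  next
   case False
   from bergman_component_orthogonal[OF n m False wV q]
   show ?thesis using wA ip_linear(3)[OF wS wS qS] by (simp add: Xw)
  qed
 qed
 ultimately have W: "partial_span dominant <= ?V" by (intro partial_span_le)
 have "cmod (ip \<B> (X f) q - c * ip \<B> f q) <= 0"
 proof (rule field_le_epsilon)
  fix e :: real assume e: "0 < e"
  define K where "K = (C + cmod c) * nrm \<B> q + 1"
  have K: "0 < K" using C(1) nrm_nonneg[of \<B> q] by (simp add: K_def add_nonneg_pos)
  obtain w where w: "w : partial_span dominant" "nrm \<B> (%Z. f Z - w Z) < e / K"
   using components_dense[OF f divide_pos_pos[OF e K]] by blast
  have wA: "w : \<A>" and wq: "ip \<B> (X w) q = c * ip \<B> w q" using W w(1) by blast+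
  define u where "u Z = f Z - w Z" for Z
  have uA: "u : \<A>" unfolding u_def[abs_def] by (rule bergman_diff[OF f wA])
  have fu: "f = (%Z. u Z + w Z)" by (simp add: u_def fun_eq_iff)
  have Xf: "X f = (%Z. X u Z + X w Z)" using bounded_opD(2)[OF Xb uA wA] fu by simp
  have "ip \<B> (X f) q - c * ip \<B> f q = ip \<B> (X u) q - c * ip \<B> u q"
   unfolding Xf ip_linear(1)[OF XS[OF uA] XS[OF wA] qS]
   by (subst fu, subst ip_linear(1)[OF bergmanD(1)[OF uA] bergmanD(1)[OF wA] qS]) (simp add: wq distrib_left)
  also have "cmod ... <= cmod (ip \<B> (X u) q) + cmod (c * ip \<B> u q)" by (rule norm_triangle_ineq4)
  also have "... <= C * nrm \<B> u * nrm \<B> q + cmod c * (nrm \<B> u * nrm \<B> q)"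
   unfolding norm_mult
   by (intro add_mono mult_left_mono order_trans[OF ip_Cauchy_Schwarz[OF XS[OF uA] qS]] mult_right_mono
     bspec[OF C(2) uA] nrm_nonneg ip_Cauchy_Schwarz[OF bergmanD(1)[OF uA] qS]) simp_all
  also have "... = nrm \<B> u * ((C + cmod c) * nrm \<B> q)" by (simp add: algebra_simps)
  also have "... <= nrm \<B> u * K" by (intro mult_left_mono nrm_nonneg) (simp add: K_def)
  also have "... <= e / K * K" using w(2) K by (intro mult_right_mono) (simp_all add: u_def[abs_def])
  also have "... = e" using K by simp
  finally show "cmod (ip \<B> (X f) q - c * ip \<B> f q) <= 0 + e" by simp
 qed
 then show ?thesis by simp
qed

text \<open>
  Both orders have the same inner products with all components.
\<close>

theorem diagonal_ops_commute:
 assumes X: "X : diagonal_ops" and Y: "Y : diagonal_ops" and f: "f : \<A>"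
 shows "X (Y f) = Y (X f)"
proof -
 note Xb = diagonal_opsD(1)[OF X] and Yb = diagonal_opsD(1)[OF Y]
 note Xf = bounded_opD(1)[OF Xb f] and Yf = bounded_opD(1)[OF Yb f]
 note XY = bounded_opD(1)[OF Xb Yf] and YX = bounded_opD(1)[OF Yb Xf]
 have "(%Z. X (Y f) Z - Y (X f) Z) = (%_. 0)"
 proof (rule orthogonal_imp_zero[OF bergman_diff[OF XY YX]], intro ballI)
  fix m q assume m: "m : dominant" and q: "q : bergman_component m"
  obtain x where x: "ALL f:bergman_component m. X f = (%Z. x * f Z)" using diagonal_opsD(2)[OF X m] by blast
  obtain y where y: "ALL f:bergman_component m. Y f = (%Z. y * f Z)" using diagonal_opsD(2)[OF Y m] by blast
  note qS = bergmanD(1)[OF component_bergman[OF m q]]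
  show "ip \<B> (%Z. X (Y f) Z - Y (X f) Z) q = 0"
   unfolding ip_linear(2)[OF bergmanD(1)[OF XY] bergmanD(1)[OF YX] qS]
    diagonal_ip[OF X m x Yf q] diagonal_ip[OF Y m y f q] diagonal_ip[OF Y m y Xf q] diagonal_ip[OF X m x f q] by simp
 qed
 then show ?thesis by (simp add: fun_eq_iff)
qed

end

section \<open>Adjoints\<close>

context weighted_bergman begin

lemma closed_unital_algebraD:
 assumes "closed_unital_algebra lam (\<X> :: 'n fun_op set)"
 shows "X : \<X> ==> bounded_op lam X" "id : \<X>" "X : \<X> ==> Y : \<X> ==> (%f Z. X f Z + Y f Z) : \<X>"
  "X : \<X> ==> (%f Z. c * X f Z) : \<X>" "X : \<X> ==> Y : \<X> ==> X \<circ> Y : \<X>"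
  "bounded_op lam X ==> ALL e>0. EX Y:\<X>. ALL f:\<A>. nrm \<B> (%Z. X f Z - Y f Z) <= e * nrm \<B> f ==> X : \<X>"
 using assms unfolding closed_unital_algebra_def L2_eqs by (simp_all only: Ball_def)

lemma TalgI:
 assumes "!!\<X>. closed_unital_algebra lam \<X> ==> toeplitz lam ` invariant_symbols <= \<X> ==> X : \<X>"
 shows "X : Talg"
 unfolding toeplitz_algebra_def by (rule InterI) (use assms in simp)

lemma Talg_sub: "X : Talg ==> closed_unital_algebra lam \<X> ==> toeplitz lam ` invariant_symbols <= \<X> ==> X : \<X>"
 unfolding toeplitz_algebra_def by (erule InterD) simp

lemma Talg_generators: "a : invariant_symbols ==> toeplitz lam a : Talg"
 by (rule TalgI, erule subsetD, rule imageI)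

lemma Talg_algebra: "closed_unital_algebra lam Talg"
 unfolding closed_unital_algebra_def L2_eqs
proof (intro conjI ballI allI impI)
 show "bounded_op lam X" if "X : Talg" for X
  by (rule diagonal_opsD(1)[OF subsetD[OF Talg_diagonal that]])
 show "id : Talg" by (rule TalgI) (rule closed_unital_algebraD(2))
 show "(%f Z. X f Z + Y f Z) : Talg" if "X : Talg" "Y : Talg" for X Y
  by (rule TalgI, rule closed_unital_algebraD(3), assumption) (rule Talg_sub[OF that(1)] Talg_sub[OF that(2)]; assumption)+
 show "(%f Z. c * X f Z) : Talg" if "X : Talg" for c X
  by (rule TalgI, rule closed_unital_algebraD(4), assumption) (rule Talg_sub[OF that]; assumption)
 show "X \<circ> Y : Talg" if "X : Talg" "Y : Talg" for X Y
  by (rule TalgI, rule closed_unital_algebraD(5), assumption) (rule Talg_sub[OF that(1)] Talg_sub[OF that(2)]; assumption)+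
 fix X :: "'n fun_op"
 assume X: "bounded_op lam X & (ALL e>0. EX Y:Talg. ALL f:\<A>. nrm \<B> (%Z. X f Z - Y f Z) <= e * nrm \<B> f)"
 show "X : Talg"
 proof (rule TalgI)
  fix \<X> :: "'n fun_op set"
  assume A: "closed_unital_algebra lam \<X>" "toeplitz lam ` invariant_symbols <= \<X>"
  have "ALL e>0. EX Y:\<X>. ALL f:\<A>. nrm \<B> (%Z. X f Z - Y f Z) <= e * nrm \<B> f"
  proof (intro allI impI)
   fix e :: real assume "0 < e"
   then obtain Y where Y: "Y : Talg" "ALL f:\<A>. nrm \<B> (%Z. X f Z - Y f Z) <= e * nrm \<B> f" using X by blast
   show "EX Y:\<X>. ALL f:\<A>. nrm \<B> (%Z. X f Z - Y f Z) <= e * nrm \<B> f"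
   proof (rule bexI[where x=Y])
    show "ALL f:\<A>. nrm \<B> (%Z. X f Z - Y f Z) <= e * nrm \<B> f" by (rule Y(2))
    show "Y : \<X>" by (rule Talg_sub[OF Y(1) A])
   qed
  qed
  then show "X : \<X>" using X by (intro closed_unital_algebraD(6)[OF A(1)]) blast+
 qed
qed

lemma has_adjointD: "has_adjoint X Y ==> f : \<A> ==> g : \<A> ==> ip \<B> (X f) g = ip \<B> f (Y g)"
 unfolding has_adjoint_def by blast

lemma adjoint_bound:
 assumes adj: "has_adjoint X Y" and X: "!!f. f : \<A> ==> X f : \<A>" and Y: "!!g. g : \<A> ==> Y g : \<A>"
  and C: "!!f. f : \<A> ==> nrm \<B> (X f) <= C * nrm \<B> f" "0 <= C" and g: "g : \<A>"
 shows "nrm \<B> (Y g) <= C * nrm \<B> g"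
proof (cases "nrm \<B> (Y g) = 0")
 case True
 then show ?thesis using C(2) nrm_nonneg[of \<B> g] by simp
next
 case False
 then have pos: "0 < nrm \<B> (Y g)" using nrm_nonneg[of \<B> "Y g"] by simp
 note YA = Y[OF g]
 have "of_real ((nrm \<B> (Y g))^2) = ip \<B> (X (Y g)) g"
  unfolding ip_self[symmetric] by (rule has_adjointD[OF adj YA g, symmetric])
 then have "cmod (of_real ((nrm \<B> (Y g))^2)) <= nrm \<B> (X (Y g)) * nrm \<B> g"
  using ip_Cauchy_Schwarz[OF bergmanD(1)[OF X[OF YA]] bergmanD(1)[OF g]] by simp
 also have "... <= C * nrm \<B> (Y g) * nrm \<B> g" by (rule mult_right_mono[OF C(1)[OF YA] nrm_nonneg])
 finally have "(nrm \<B> (Y g))^2 <= (C * nrm \<B> g) * nrm \<B> (Y g)" unfolding norm_of_real by (simp add: mult_ac)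
 then show ?thesis using pos by (simp add: power2_eq_square)
qed

lemma has_adjoint_diff:
 assumes "has_adjoint X Y" "has_adjoint X' Y'"
  and X: "!!f. f : \<A> ==> X f : \<A>" "!!f. f : \<A> ==> X' f : \<A>"
  and Y: "!!f. f : \<A> ==> Y f : \<A>" "!!f. f : \<A> ==> Y' f : \<A>"
 shows "has_adjoint (%f Z. X f Z - X' f Z) (%g Z. Y g Z - Y' g Z)"
 unfolding has_adjoint_def
proof (intro ballI)
 fix f g assume f: "f : \<A>" and g: "g : \<A>"
 show "ip \<B> (%Z. X f Z - X' f Z) g = ip \<B> f (%Z. Y g Z - Y' g Z)"
  unfolding ip_linear(2)[OF bergmanD(1)[OF X(1)[OF f]] bergmanD(1)[OF X(2)[OF f]] bergmanD(1)[OF g]]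
   ip_linear_right(2)[OF bergmanD(1)[OF Y(1)[OF g]] bergmanD(1)[OF Y(2)[OF g]] bergmanD(1)[OF f]]
   has_adjointD[OF assms(1) f g] has_adjointD[OF assms(2) f g] ..
qed

lemma bergman_eqI_right:
 assumes "f : \<A>" "g : \<A>" "!!h. h : \<A> ==> ip \<B> h f = ip \<B> h g"
 shows "f = g"
proof (rule bergman_eqI[OF assms(1,2)])
 fix h assume "h : \<A>"
 then show "ip \<B> f h = ip \<B> g h" using assms(3)[of h] ip_cnj[of \<B> h f] ip_cnj[of \<B> h g] by simp
qed

lemma adjoint_bounded:
 assumes adj: "has_adjoint X Y" and X: "bounded_op lam (X :: 'n fun_op)" and Y: "!!g. g : \<A> ==> Y g : \<A>"
 shows "bounded_op lam Y"
proof -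
 note VD = fun_subspaceD[OF fun_subspace_bergman]
 obtain C where C: "0 <= C" "ALL f:\<A>. nrm \<B> (X f) <= C * nrm \<B> f" using bounded_op_bound[OF X] by blast
 show ?thesis
 proof (rule bounded_opI[where C=C])
  fix f assume f: "f : \<A>"
  show "Y f : \<A>" by (rule Y[OF f])
  show "Y (%Z. c * f Z) = (%Z. c * Y f Z)" for c
  proof (rule bergman_eqI_right[OF Y[OF VD(3)[OF f]] VD(3)[OF Y[OF f]]])
   fix h assume h: "h : \<A>"
   note fS = bergmanD(1)[OF f] and YS = bergmanD(1)[OF Y[OF f]]
   show "ip \<B> h (Y (%Z. c * f Z)) = ip \<B> h (%Z. c * Y f Z)"
    unfolding has_adjointD[OF adj h VD(3)[OF f], symmetric] ip_linear_right(3)[OF YS YS bergmanD(1)[OF h]]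
     ip_linear_right(3)[OF fS fS bergmanD(1)[OF bounded_opD(1)[OF X h]]] has_adjointD[OF adj h f] ..
  qed
  show "Y (%Z. f Z + g Z) = (%Z. Y f Z + Y g Z)" if g: "g : \<A>" for g
  proof (rule bergman_eqI_right[OF Y[OF VD(2)[OF f g]] VD(2)[OF Y[OF f] Y[OF g]]])
   fix h assume h: "h : \<A>"
   show "ip \<B> h (Y (%Z. f Z + g Z)) = ip \<B> h (%Z. Y f Z + Y g Z)"
    unfolding has_adjointD[OF adj h VD(2)[OF f g], symmetric]
     ip_linear_right(1)[OF bergmanD(1)[OF Y[OF f]] bergmanD(1)[OF Y[OF g]] bergmanD(1)[OF h]]
     ip_linear_right(1)[OF bergmanD(1)[OF f] bergmanD(1)[OF g] bergmanD(1)[OF bounded_opD(1)[OF X h]]]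
     has_adjointD[OF adj h f] has_adjointD[OF adj h g] ..
  qed
  show "nrm \<B> (Y f) <= C * nrm \<B> f"
   by (rule adjoint_bound[OF adj bounded_opD(1)[OF X] Y _ C(1) f]) (assumption | rule bspec[OF C(2)])+
 qed
qed

text \<open>The adjoints of a norm convergent sequence converge, with the same error bounds.\<close>

lemma adjoint_limit:
 assumes X: "bounded_op lam (X :: 'n fun_op)"
  and appr: "ALL e>0. EX S:Talg. (EX R:Talg. has_adjoint S R) & (ALL f:\<A>. nrm \<B> (%Z. X f Z - S f Z) <= e * nrm \<B> f)"
 shows "EX Y:Talg. has_adjoint X Y"
proof -
 define e where "e n = inverse (real (Suc n))" for n
 have e_pos: "0 < e n" for n by (simp add: e_def)
 have e_lim: "e \<longlonglongrightarrow> 0" unfolding e_def[abs_def] by (rule LIMSEQ_inverse_real_of_nat)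
 note VD = fun_subspaceD[OF fun_subspace_bergman]
 have "ALL n. EX SR. fst SR : Talg & snd SR : Talg & has_adjoint (fst SR) (snd SR) \<and>
   (ALL f:\<A>. nrm \<B> (%Z. X f Z - fst SR f Z) <= e n * nrm \<B> f)"
 proof
  fix n
  from mp[OF spec[OF appr, of "e n"] e_pos] obtain S R where "S : Talg" "R : Talg" "has_adjoint S R"
   "ALL f:\<A>. nrm \<B> (%Z. X f Z - S f Z) <= e n * nrm \<B> f" by blast
  then show "EX SR. fst SR : Talg & snd SR : Talg & has_adjoint (fst SR) (snd SR) \<and>
   (ALL f:\<A>. nrm \<B> (%Z. X f Z - fst SR f Z) <= e n * nrm \<B> f)" by (intro exI[of _ "(S, R)"]) simp
 qed
 from choice[OF this] obtain SR where SR: "ALL n. fst (SR n) : Talg & snd (SR n) : Talg & has_adjoint (fst (SR n)) (snd (SR n)) \<and>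
   (ALL f:\<A>. nrm \<B> (%Z. X f Z - fst (SR n) f Z) <= e n * nrm \<B> f)" ..
 define S where "S n = fst (SR n)" for n
 define R where "R n = snd (SR n)" for n
 have RT: "R n : Talg" for n using SR by (simp add: R_def)
 have adj: "has_adjoint (S n) (R n)" for n using SR by (simp add: S_def R_def)
 have close: "nrm \<B> (%Z. X f Z - S n f Z) <= e n * nrm \<B> f" if "f : \<A>" for f n
  using SR that by (simp add: S_def)
 have bd: "bounded_op lam (S n)" "bounded_op lam (R n)" for n
  using SR closed_unital_algebraD(1)[OF Talg_algebra] by (simp_all add: S_def R_def)
 note XA = bounded_opD(1)[OF X] and SA = bounded_opD(1)[OF bd(1)] and RA = bounded_opD(1)[OF bd(2)]
 have close2: "nrm \<B> (%Z. S m f Z - S n f Z) <= (e m + e n) * nrm \<B> f" if f: "f : \<A>" for f m n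
 proof -
  have "nrm \<B> (%Z. S m f Z - S n f Z) <= nrm \<B> (%Z. S m f Z - X f Z) + nrm \<B> (%Z. X f Z - S n f Z)"
   by (rule nrm_triangle_diff[OF bergmanD(1)[OF SA[OF f]] bergmanD(1)[OF XA[OF f]] bergmanD(1)[OF SA[OF f]]])
  also have "... <= e m * nrm \<B> f + e n * nrm \<B> f"
   unfolding nrm_diff_commute[of \<B> "S m f"] by (rule add_mono[OF close[OF f] close[OF f]])
  finally show ?thesis by (simp add: distrib_right)
 qed
 have R_close: "nrm \<B> (%Z. R m g Z - R n g Z) <= (e m + e n) * nrm \<B> g" if g: "g : \<A>" for g m n
 proof (rule adjoint_bound[OF has_adjoint_diff[OF adj adj]])
  show "0 <= e m + e n" using e_pos[of m] e_pos[of n] by simp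
 qed (simp_all add: SA RA bergman_diff g close2)
 have ex: "EX l. l : \<A> & (%n. nrm \<B> (%x. R n g x - l x)) \<longlonglongrightarrow> 0" if g: "g : \<A>" for g
 proof -
  have "EX l:\<A>. (%n. nrm \<B> (%x. R n g x - l x)) \<longlonglongrightarrow> 0"
  proof (rule bergman_complete[OF RA[OF g]], intro allI impI)
   fix d :: real assume d: "0 < d"
   define K where "K = 2 * (nrm \<B> g + 1)"
   have K: "0 < K" using nrm_nonneg[of \<B> g] by (simp add: K_def)
   from order_tendstoD(2)[OF e_lim divide_pos_pos[OF d K]]
   obtain N where N: "ALL n>=N. e n < d / K" unfolding eventually_sequentially by blast
   have "nrm \<B> (%x. R m g x - R n g x) < d" if "N <= m" "N <= n" for m n
   proof -
    have "nrm \<B> (%x. R m g x - R n g x) <= (e m + e n) * nrm \<B> g" by (rule R_close[OF g])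
    also have "... <= (d / K + d / K) * nrm \<B> g"
     using N that by (intro mult_right_mono add_mono nrm_nonneg) (simp_all add: less_imp_le)
    also have "... < (d / K + d / K) * (nrm \<B> g + 1)" using d K by (intro mult_strict_left_mono) simp_all
    also have "... = d / K * (2 * (nrm \<B> g + 1))" by (simp only: mult_2 distrib_left distrib_right)
    also have "... = d / K * K" by (simp only: K_def)
    also have "... = d" using K by simp
    finally show ?thesis .
   qed
   then show "EX N. ALL m>=N. ALL n>=N. nrm \<B> (%x. R m g x - R n g x) < d" by (intro exI[of _ N]) simp
  qed
  then show ?thesis by blast
 qed
 define Y where "Y g = (SOME l. l : \<A> & (%n. nrm \<B> (%x. R n g x - l x)) \<longlonglongrightarrow> 0)" for g
 have YP: "Y g : \<A> & (%n. nrm \<B> (%x. R n g x - Y g x)) \<longlonglongrightarrow> 0" if g: "g : \<A>" for g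
  using someI_ex[OF ex[OF g]] unfolding Y_def .
 then have YA: "Y g : \<A>" if "g : \<A>" for g using that by blast
 have adjY: "has_adjoint X Y"
  unfolding has_adjoint_def
 proof (intro ballI)
  fix f g assume f: "f : \<A>" and g: "g : \<A>"
  note fS = bergmanD(1)[OF f] and gS = bergmanD(1)[OF g]
  have bound: "cmod (ip \<B> (X f) g - ip \<B> f (Y g))
   <= e n * nrm \<B> f * nrm \<B> g + nrm \<B> f * nrm \<B> (%x. R n g x - Y g x)" for n
  proof -
   note d1 = bergmanD(1)[OF bergman_diff[OF XA[OF f] SA[OF f, of n]]]
   note d2 = bergmanD(1)[OF bergman_diff[OF RA[OF g, of n] YA[OF g]]]
   have "ip \<B> (X f) g - ip \<B> f (Y g) = ip \<B> (%x. X f x - S n f x) g + ip \<B> f (%x. R n g x - Y g x)"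
    unfolding ip_linear(2)[OF bergmanD(1)[OF XA[OF f]] bergmanD(1)[OF SA[OF f]] gS]
     ip_linear_right(2)[OF bergmanD(1)[OF RA[OF g]] bergmanD(1)[OF YA[OF g]] fS] has_adjointD[OF adj f g] by simp
   also have "cmod ... <= cmod (ip \<B> (%x. X f x - S n f x) g) + cmod (ip \<B> f (%x. R n g x - Y g x))"
    by (rule norm_triangle_ineq)
   also have "... <= e n * nrm \<B> f * nrm \<B> g + nrm \<B> f * nrm \<B> (%x. R n g x - Y g x)"
    by (intro add_mono ip_Cauchy_Schwarz[OF fS d2] order_trans[OF ip_Cauchy_Schwarz[OF d1 gS]]
      mult_right_mono[OF close[OF f] nrm_nonneg])
   finally show ?thesis .
  qed
  have "(%n. e n * nrm \<B> f * nrm \<B> g + nrm \<B> f * nrm \<B> (%x. R n g x - Y g x)) \<longlonglongrightarrow> 0 * nrm \<B> f * nrm \<B> g + nrm \<B> f * 0"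
   using YP[OF g] by (intro tendsto_intros e_lim) blast
  then have "cmod (ip \<B> (X f) g - ip \<B> f (Y g)) <= 0 * nrm \<B> f * nrm \<B> g + nrm \<B> f * 0"
   by (rule LIMSEQ_le_const) (intro exI[of _ 0] allI impI bound)
  then show "ip \<B> (X f) g = ip \<B> f (Y g)" by simp
 qed
 have Y_close: "nrm \<B> (%Z. Y g Z - R n g Z) <= e n * nrm \<B> g" if g: "g : \<A>" for g n
 proof (rule adjoint_bound[OF has_adjoint_diff[OF adjY adj]])
  show "0 <= e n" using e_pos[of n] by simp
 qed (simp_all add: XA SA YA RA bergman_diff g close)
 have "Y : Talg"
 proof (rule closed_unital_algebraD(6)[OF Talg_algebra adjoint_bounded[OF adjY X YA]], assumption, intro allI impI)
  fix d :: real assume d: "0 < d"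
  from order_tendstoD(2)[OF e_lim d] obtain n where n: "e n < d" unfolding eventually_sequentially by blast
  have "ALL g:\<A>. nrm \<B> (%Z. Y g Z - R n g Z) <= d * nrm \<B> g"
  proof
   fix g assume g: "g : \<A>"
   have "e n * nrm \<B> g <= d * nrm \<B> g" using n by (intro mult_right_mono nrm_nonneg) simp
   then show "nrm \<B> (%Z. Y g Z - R n g Z) <= d * nrm \<B> g" using Y_close[OF g, of n] by (rule order_trans[rotated])
  qed
  then show "EX R:Talg. ALL g:\<A>. nrm \<B> (%Z. Y g Z - R g Z) <= d * nrm \<B> g" by (rule bexI[OF _ RT])
 qed
 then show ?thesis using adjY by blast
qed

lemma toeplitz_adjoint:
 assumes a: "a : (invariant_symbols :: ('n cmat => complex) set)"
 shows "has_adjoint (toeplitz lam a) (toeplitz lam (%Z. cnj (a Z)))"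
 unfolding has_adjoint_def
proof (intro ballI)
 fix f g assume f: "f : \<A>" and g: "g : \<A>"
 let ?b = "%Z. cnj (a Z)"
 have "ip \<B> (toeplitz lam a f) g = ip \<B> (%Z. a Z * f Z) g" by (rule toeplitz_props(2)[OF invariant_Linf[OF a] f g])
 also have "... = cnj (ip \<B> (%Z. ?b Z * g Z) f)" unfolding ip_cnj by (simp add: ip_def mult_ac)
 also have "ip \<B> (%Z. ?b Z * g Z) f = ip \<B> (toeplitz lam ?b g) f"
  by (rule toeplitz_props(2)[OF invariant_Linf[OF cnj_invariant[OF a]] g f, symmetric])
 also have "cnj ... = ip \<B> f (toeplitz lam ?b g)" by (rule ip_cnj)
 finally show "ip \<B> (toeplitz lam a f) g = ip \<B> f (toeplitz lam ?b g)" .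
qed

text \<open>
  The operators of the algebra whose adjoint also belongs to it form a closed unital algebra that
  contains the generators.
\<close>

theorem Talg_adjoint:
 assumes "X : Talg"
 shows "EX Y:Talg. has_adjoint X Y"
proof -
 note TD = closed_unital_algebraD[OF Talg_algebra]
 define E where "E = {X : Talg. EX Y:Talg. has_adjoint X Y}"
 have "closed_unital_algebra lam E"
  unfolding closed_unital_algebra_def L2_eqs
 proof (intro conjI ballI allI impI)
  show "bounded_op lam X" if "X : E" for X using that TD(1) by (simp add: E_def)
  have "has_adjoint id id" by (simp add: has_adjoint_def)
  then show "id : E" using TD(2) unfolding E_def by blast
  fix X :: "'n fun_op"
  show "X : E" if h: "bounded_op lam X & (ALL e>0. EX S:E. ALL f:\<A>. nrm \<B> (%Z. X f Z - S f Z) <= e * nrm \<B> f)"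
  proof -
   have 1: "ALL e>0. EX S:Talg. (EX R:Talg. has_adjoint S R) & (ALL f:\<A>. nrm \<B> (%Z. X f Z - S f Z) <= e * nrm \<B> f)"
    using h unfolding E_def by blast
   then have 2: "ALL e>0. EX S:Talg. ALL f:\<A>. nrm \<B> (%Z. X f Z - S f Z) <= e * nrm \<B> f" by blast
   have b: "bounded_op lam X" using h by blast
   show ?thesis using adjoint_limit[OF b 1] TD(6)[OF b 2] by (simp add: E_def)
  qed
  assume X: "X : E"
  then obtain X' where XT: "X : Talg" and X': "X' : Talg" "has_adjoint X X'" unfolding E_def by blast
  note XA = bounded_opD(1)[OF TD(1)[OF XT]] and XA' = bounded_opD(1)[OF TD(1)[OF X'(1)]]
  show "(%f Z. c * X f Z) : E" for c
  proof -
   have "has_adjoint (%f Z. c * X f Z) (%f Z. cnj c * X' f Z)"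
    unfolding has_adjoint_def
   proof (intro ballI)
    fix f g assume f: "f : \<A>" and g: "g : \<A>"
    note S = bergmanD(1)[OF XA[OF f]] bergmanD(1)[OF XA'[OF g]]
    show "ip \<B> (%Z. c * X f Z) g = ip \<B> f (%Z. cnj c * X' g Z)"
     unfolding ip_linear(3)[OF S(1) S(1) bergmanD(1)[OF g]] ip_linear_right(3)[OF S(2) S(2) bergmanD(1)[OF f]]
      has_adjointD[OF X'(2) f g] by simp
   qed
   then show ?thesis using TD(4)[OF XT] TD(4)[OF X'(1)] unfolding E_def by blast
  qed
  fix Y :: "'n fun_op" assume Y: "Y : E"
  then obtain Y' where YT: "Y : Talg" and Y': "Y' : Talg" "has_adjoint Y Y'" unfolding E_def by blast
  note YA = bounded_opD(1)[OF TD(1)[OF YT]] and YA' = bounded_opD(1)[OF TD(1)[OF Y'(1)]]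
  have "has_adjoint (%f Z. X f Z + Y f Z) (%f Z. X' f Z + Y' f Z)"
   unfolding has_adjoint_def
  proof (intro ballI)
   fix f g assume f: "f : \<A>" and g: "g : \<A>"
   show "ip \<B> (%Z. X f Z + Y f Z) g = ip \<B> f (%Z. X' g Z + Y' g Z)"
    unfolding ip_linear(1)[OF bergmanD(1)[OF XA[OF f]] bergmanD(1)[OF YA[OF f]] bergmanD(1)[OF g]]
     ip_linear_right(1)[OF bergmanD(1)[OF XA'[OF g]] bergmanD(1)[OF YA'[OF g]] bergmanD(1)[OF f]]
     has_adjointD[OF X'(2) f g] has_adjointD[OF Y'(2) f g] ..
  qed
  then show "(%f Z. X f Z + Y f Z) : E" using TD(3)[OF XT YT] TD(3)[OF X'(1) Y'(1)] unfolding E_def by blast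
  have "has_adjoint (X \<circ> Y) (Y' \<circ> X')"
   unfolding has_adjoint_def
  proof (intro ballI)
   fix f g assume f: "f : \<A>" and g: "g : \<A>"
   show "ip \<B> ((X \<circ> Y) f) g = ip \<B> f ((Y' \<circ> X') g)"
    unfolding o_apply has_adjointD[OF X'(2) YA[OF f] g] has_adjointD[OF Y'(2) f XA'[OF g]] ..
  qed
  then show "X \<circ> Y : E" using TD(5)[OF XT YT] TD(5)[OF Y'(1) X'(1)] unfolding E_def by blast
 qed
 moreover have "toeplitz lam ` invariant_symbols <= E"
 proof
  fix X assume "X : toeplitz lam ` (invariant_symbols :: ('n cmat => complex) set)"
  then obtain a :: "'n cmat => complex" where a: "a : invariant_symbols" "X = toeplitz lam a" by blast
  show "X : E"
   unfolding E_def a(2)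
   using Talg_generators[OF a(1)] Talg_generators[OF cnj_invariant[OF a(1)]] toeplitz_adjoint[OF a(1)] by blast
 qed
 ultimately have "Talg <= E" by (rule Talg_least)
 then show ?thesis using assms unfolding E_def by blast
qed

end

section \<open>Commutativity and the spectral decomposition\<close>

theorem theorem4p11:
  fixes lam :: real
    and \<T> :: "'n::{finite,linorder} fun_op set"
  assumes "lam > 2 * real CARD('n) - 1"
    and "\<T> = toeplitz_algebra lam invariant_symbols"
  shows
    \<comment> \<open>a C*-algebra: the norm-closed algebra contains the adjoints of its elements\<close>
    "(\<forall>X\<in>\<T>. \<exists>Y\<in>\<T>. \<forall>f\<in>bergman_space lam. \<forall>g\<in>bergman_space lam.
        L2_inner lam (X f) g = L2_inner lam f (Y g))
     \<and> (\<forall>X\<in>\<T>. \<forall>Y\<in>\<T>. \<forall>f\<in>bergman_space lam. X (Y f) = Y (X f))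
     \<and> hilbert_direct_sum lam (dominant_weights :: (int^('n::{finite,linorder})) set) bergman_component
     \<and> (\<forall>X\<in>\<T>. \<forall>\<mu>\<in>(dominant_weights :: (int^('n::{finite,linorder})) set).
          X ` bergman_component \<mu> \<subseteq> bergman_component \<mu> \<and>
          (\<exists>c. \<forall>f\<in>bergman_component \<mu>. X f = (\<lambda>Z. c * f Z)))"
proof -
 interpret weighted_bergman "TYPE('n)" lam by unfold_locales (rule assms(1))
 note T = assms(2)
 have diag: "X : diagonal_ops" if "X : \<T>" for X
  using that Talg_diagonal unfolding T by blast
 have "EX Y:\<T>. ALL f:bergman_space lam. ALL g:bergman_space lam. L2_inner lam (X f) g = L2_inner lam f (Y g)"
  if "X : \<T>" for X
  using Talg_adjoint[of X] that unfolding T has_adjoint_def L2_eqs by blast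
 moreover have "X (Y f) = Y (X f)" if "X : \<T>" "Y : \<T>" "f : bergman_space lam" for X Y f
  by (rule diagonal_ops_commute[OF diag diag]) (rule that)+
 moreover have "X ` bergman_component \<mu> <= bergman_component \<mu> \<and>
   (EX c. ALL f:bergman_component \<mu>. X f = (%Z. c * f Z))"
  if X: "X : \<T>" and \<mu>: "\<mu> : dominant" for X \<mu>
 proof -
  obtain c where c: "ALL f:bergman_component \<mu>. X f = (%Z. c * f Z)" using diagonal_opsD(2)[OF diag[OF X] \<mu>] by blast
  have "X f : bergman_component \<mu>" if f: "f : bergman_component \<mu>" for f
   unfolding bspec[OF c f] by (rule fun_subspaceD(3)[OF bergman_component_subspace[OF \<mu>] f])
  then show ?thesis using c by blast
 qed
 ultimately show ?thesis using bergman_hilbert_direct_sum by simp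
qed

end
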